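(* Let $A$ be the algebra with generators $1_\lambda$, $E_{i,r}1_\lambda$, $F_{i,r}1_\lambda$, $P_i^{(n)}1_\lambda$, $P_i^{(1^n)}1_\lambda$, $Q_i^{(n)}1_\lambda$, $Q_i^{(1^n)}1_\lambda$ ($i\in I$, $r\in\mathbb Z$, $n\in\mathbb N$, $\lambda\in\widehat X$) and relations (R1)--(R6) given in the context. Then: (1) The relations (R1)--(R6) imply all the relations of Drinfeld's realization of the quantum affine algebra, i.e. with $e_{i,r},f_{i,r},h_{i,m},x_i^\pm(z),\psi_i^\pm(z)$ defined from the generators of $A$ as in the context, the relations (D1)--(D8) of the context hold in $A$ after multiplication by any $1_\lambda$, $\lambda \in \widehat X$. (2) When acting on an integrable representation, relation (R6) is not necessary, since it follows formally from the other relations: if $V=\bigoplus_{\lambda\in\widehat X}V(\lambda)$ is an integrable representation on which the generators act (with $1_\lambda$ acting as the projection onto $V(\lambda)$) so that (R1)--(R5) hold, then (R6) also holds on $V$.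
   Context: **Notation.** $\Bbbk$ is a field of characteristic zero, $q$ is an indeterminate, and algebras are over $\Bbbk(q^{1/2})$ (not necessarily unital). $[n]=\frac{q^n-q^{-n}}{q-q^{-1}}$. Let $I$ be the vertex set of a simply-laced Dynkin diagram of finite type, with Lie algebra $\mathfrak g$, simple roots $\alpha_i$, and $\langle i,j\rangle:=\langle\alpha_i,\alpha_j\rangle$ the Cartan matrix entry ($2$ if $i=j$, $-1$ if $i\ne j$ are joined by an edge, $0$ otherwise). $\widehat X$ is the weight lattice of the affine Lie algebra $\widehat{\mathfrak g}=\mathfrak g\otimes\Bbbk[t,t^{-1}]\oplus\Bbbk c$, with its standard pairing; $\widehat Y=Y\oplus\mathbb Z\delta$ is the affine root lattice ($Y$ the root lattice of $\mathfrak g$), with $\langle\alpha_i,\delta\rangle=0$ for $i \in I$ and $\langle\delta,\delta\rangle=0$. For $\lambda\in\widehat X$ write $\langle\lambda,i\rangle=\langle\lambda,\alpha_i\rangle$. Fix a positive integer $c$. For $f\in\mathbb N[q,q^{-1}]$, $\mathrm{Sym}^n(f)$ and $\Lambda^n(f)$ denote the graded dimensions of the $n$-th symmetric and exterior powers of a graded vector space of graded dimension $f$. Write $E_i=E_{i,0}$, $F_i=F_{i,0}$. Relations written without idempotents are understood to hold after multiplying by any $1_\lambda$. Conventions: $P_i^{(0)}=P_i^{(1^0)}=Q_i^{(0)}=Q_i^{(1^0)}=1$ (the identity on each weight), these symbols vanish for negative index, and the generating functions $\sum_{n\ge0}P_i^{(n)}z^n$ and $\sum_{n\ge0}(-1)^nP_i^{(1^n)}z^n$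 are inverse to each other; likewise for $Q$. Define, for $n\ge1$, $$Q_i^{[1^n]}=\sum_{m=0}^n(-q)^m[m]\,Q_i^{(1^{n-m})}Q_i^{(m)},\qquad P_i^{[1^n]}=\sum_{m=0}^n(-q)^{-m}[m]\,P_i^{(1^{n-m})}P_i^{(m)}.$$ **Relations.** (R1) The $1_\lambda$ are mutually orthogonal idempotents, and $E_{i,r}1_\lambda=1_\mu E_{i,r}1_\lambda=1_\mu E_{i,r}$, $F_{i,-r}1_\mu=1_\lambda F_{i,-r}1_\mu=1_\lambda F_{i,-r}$, where $\mu=\lambda+\alpha_i+rc\delta$. (R2) The $P$'s and $Q$'s satisfy $$Q_j^{(n)}P_i^{(m)}=\begin{cases}\sum_{k\ge0}\mathrm{Sym}^k([2][c])P_i^{(m-k)}Q_i^{(n-k)}& i=j\\ \sum_{k\ge0}(-1)^k\Lambda^k([c])P_i^{(m-k)}Q_j^{(n-k)}&\langle i,j\rangle=-1\\ P_i^{(m)}Q_j^{(n)}&\langle i,j\rangle=0\end{cases}$$ $$Q_j^{(1^n)}P_i^{(m)}=\begin{cases}\sum_{k\ge0}\Lambda^k([2][c])P_i^{(m-k)}Q_i^{(1^{n-k})}& i=j\\ \sum_{k\ge0}(-1)^k\mathrm{Sym}^k([c])P_i^{(m-k)}Q_j^{(1^{n-k})}&\langle i,j\rangle=-1\\ P_i^{(m)}Q_j^{(1^n)}&\langle i,j\rangle=0\end{cases}$$ and likewise with $(a)$ and $(1^a)$ exchanged everywhere. Moreover, for $\mu=\lambda+nc\delta$, $Q_i^{(n)}1_\lambda=1_\mu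 Q_i^{(n)}1_\lambda=1_\mu Q_i^{(n)}$ and $P_i^{(n)}1_\mu=1_\lambda P_i^{(n)}1_\mu=1_\lambda P_i^{(n)}$, and the same with $(1^n)$ in place of $(n)$. (R3) $$[E_{i,a},F_{i,b}]1_\lambda=\begin{cases}q^{ac}q^{\langle\lambda,i\rangle}Q_i^{[1^{a+b}]}1_\lambda&a+b>0\\ q^{bc}q^{-\langle\lambda,i\rangle}P_i^{[1^{-a-b}]}1_\lambda&a+b<0\\ [\langle\lambda,i\rangle+ac]1_\lambda&a+b=0\end{cases}$$ and $[E_{i,a},F_{j,b}]1_\lambda=0$ for $i\neq j$. (R4) For all $n\in\mathbb Z$: $E_{i,n}E_{i,n-1}1_\lambda=q^2E_{i,n-1}E_{i,n}1_\lambda$ and $F_{i,n-1}F_{i,n}1_\lambda=q^2F_{i,n}F_{i,n-1}1_\lambda$. (R5) If $\langle i,j\rangle=-1$: $$E_{i,1}E_j1_\lambda+E_{j,1}E_i1_\lambda=q^{-1}(E_jE_{i,1}1_\lambda+E_iE_{j,1}1_\lambda),$$ $$F_{i,-1}F_j1_\lambda+F_{j,-1}F_i1_\lambda=q^{-1}(F_jF_{i,-1}1_\lambda+F_iF_{j,-1}1_\lambda).$$ If $\langle i,j\rangle=0$: $E_{i,m}E_{j,n}1_\lambda=E_{j,n}E_{i,m}1_\lambda$ and $F_{i,m}F_{j,n}1_\lambda=F_{j,n}F_{i,m}1_\lambda$ for all $m,n\in\mathbb Z$. (R6) If $\langle i,j\rangle=-1$, then for all $m,n\in\mathbb Z$: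 $E_{j,n}E_{i,m}^21_\lambda+E_{i,m}^2E_{j,n}1_\lambda=[2]E_{i,m}E_{j,n}E_{i,m}1_\lambda$, and the same with all $E$'s replaced by $F$'s. **Drinfeld generators in terms of the generators $E_{i,r}1_\lambda$, $F_{i,r}1_\lambda$, $P_i^{(n)}1_\lambda$, $Q_i^{(n)}1_\lambda$ of $A$.** Put $e_{i,r}1_\lambda=(-q^{1+c/2})^{-r}E_{i,r}1_\lambda$, $f_{i,r}1_\lambda=(-q^{1+c/2})^{-r}F_{i,r}1_\lambda$, and define $h_{i,m}$ ($m\ne0$) by $$\sum_{n\ge0}Q_i^{(n)}z^n=\exp\Big(\sum_{n\ge1}\tfrac{h_{i,n}}{[n]}z^n\Big),\qquad \sum_{n\ge0}P_i^{(n)}z^n=\exp\Big(\sum_{n\ge1}\tfrac{h_{i,-n}}{[n]}z^n\Big).$$ Let $x_i^+(z)=\sum_{n\in\mathbb Z}e_{i,n}z^{-n}$, $x_i^-(z)=\sum_{n\in\mathbb Z}f_{i,n}z^{-n}$, $\delta(z)=\sum_{n\in\mathbb Z}z^n$, and $$\psi_i^\pm(z)1_\lambda=q^{\pm\langle\lambda,i\rangle}\exp\Big(\pm(q-q^{-1})\sum_{n>0}h_{i,\pm n}z^{\mp n}\Big)1_\lambda.$$ **Drinfeld relations** (in idempotent form: the generators $q^h$, $q^{d}$, $q^{c/2}$ of Drinfeld's realization are replaced by weights and the scalar $q^{c/2}$, so the relations involving only conjugation by them become (D1)): (D1) $e_{i,r}1_\lambda=1_{\lambda+\alpha_i+rc\delta}e_{i,r}1_\lambda$,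 $f_{i,r}1_\lambda=1_{\lambda-\alpha_i+rc\delta}f_{i,r}1_\lambda$, $h_{i,m}1_\lambda=1_{\lambda+mc\delta}h_{i,m}1_\lambda$. (D2) $\psi_i^\pm(z)\psi_j^\pm(w)=\psi_j^\pm(w)\psi_i^\pm(z)$. (D3) $\psi_i^-(z)\psi_j^+(w)=\frac{(z-q^{-\langle i,j\rangle}q^cw)(z-q^{\langle i,j\rangle}q^{-c}w)}{(z-q^{\langle i,j\rangle}q^cw)(z-q^{-\langle i,j\rangle}q^{-c}w)}\psi_j^+(w)\psi_i^-(z)$, with the rational function expanded in nonnegative powers of $z/w$. (D4) $(q^{\pm sc/2}z-q^{\pm\langle i,j\rangle}w)\psi_j^s(z)x_i^\pm(w)=(q^{\pm\langle i,j\rangle}q^{\pm sc/2}z-w)x_i^\pm(w)\psi_j^s(z)$ for $s=\pm$. (D5) $[x_i^+(z),x_j^-(w)]=\delta_{ij}\frac1{q-q^{-1}}\big(\delta(q^cwz^{-1})\psi_i^+(q^{c/2}w)-\delta(q^czw^{-1})\psi_i^-(q^{c/2}z)\big)$. (D6) $(z-q^{\pm2}w)x_i^\pm(z)x_i^\pm(w)=(q^{\pm2}z-w)x_i^\pm(w)x_i^\pm(z)$. (D7) If $\langle i,j\rangle=-1$: $(z-q^{\mp1}w)x_i^\pm(z)x_j^\pm(w)=(q^{\mp1}z-w)x_j^\pm(w)x_i^\pm(z)$. (D8) If $\langle i,j\rangle\le0$, $N=1-\langle i,j\rangle$: $$\sum_{\sigma\in S_N}\sum_{s=0}^N(-1)^s\begin{bmatrix}N\\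 s\end{bmatrix}x_i^\pm(z_{\sigma(1)})\cdots x_i^\pm(z_{\sigma(s)})x_j^\pm(w)x_i^\pm(z_{\sigma(s+1)})\cdots x_i^\pm(z_{\sigma(N)})=0,$$ where $\begin{bmatrix}N\\ s\end{bmatrix}$ is the quantum binomial coefficient. **Integrable representation.** A representation with weight space decomposition $V=\bigoplus_{\lambda\in\widehat X}V(\lambda)$ is integrable if for every $\lambda\in\widehat X$ and every real root $\alpha\in\widehat Y$ the weight space $V(\lambda+n\alpha)$ is zero for $n\gg0$ and for $n\ll0$. *)

theory Defs
  imports
    Complex_Main
    "HOL-Computational_Algebra.Polynomial"
    "HOL-Computational_Algebra.Fraction_Field"
    "HOL-Computational_Algebra.Formal_Power_Series"
    "HOL-Library.Poly_Mapping"
    "HOL-Library.Multiset"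
    "HOL-Library.Function_Algebras"
    "HOL-Library.Product_Plus"
    "HOL-Combinatorics.Permutations"
begin

section \<open>The ground field \<open>k(q\<^sup>1\<^sup>/\<^sup>2)\<close>, quantum integers, graded dimensions\<close>

text \<open>The indeterminate of the rational function field is \<open>q\<^sup>1\<^sup>/\<^sup>2\<close>.\<close>

definition qhalf :: "'k::field_char_0 poly fract" where
  "qhalf = Fract [:0, 1:] 1"

definition qq :: "'k::field_char_0 poly fract" where
  "qq = qhalf ^ 2"

definition qint :: "int \<Rightarrow> 'k::field_char_0 poly fract" where
  "qint n = (qq powi n - qq powi (- n)) / (qq - inverse qq)"

definition qfact :: "nat \<Rightarrow> 'k::field_char_0 poly fract" where
  "qfact n = (\<Prod>k=1..n. qint (int k))"

definition qbinom :: "nat \<Rightarrow> nat \<Rightarrow> 'k::field_char_0 poly fract" where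
  "qbinom n s = qfact n / (qfact s * qfact (n - s))"

text \<open>Elements of \<open>\<nat>[q,q\<^sup>-\<^sup>1]\<close> are finitely supported functions \<open>int \<Rightarrow>\<^sub>0 nat\<close> with the
  convolution product.  A graded space of graded dimension \<open>f\<close> has the homogeneous basis
  \<open>graded_basis f\<close>, where \<open>(d, k)\<close> has degree \<open>d\<close>; its symmetric (exterior) powers have the
  multisets (subsets) of basis vectors as bases.\<close>

definition laurent_qint :: "nat \<Rightarrow> (int \<Rightarrow>\<^sub>0 nat)" where
  "laurent_qint n = (\<Sum>k<n. Poly_Mapping.single (int n - 1 - 2 * int k) 1)"

definition graded_basis :: "(int \<Rightarrow>\<^sub>0 nat) \<Rightarrow> (int \<times> nat) set" where
  "graded_basis f = {(d, k). k < Poly_Mapping.lookup f d}"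

definition sym_gdim :: "nat \<Rightarrow> (int \<Rightarrow>\<^sub>0 nat) \<Rightarrow> 'k::field_char_0 poly fract" where
  "sym_gdim n f =
     (\<Sum>M\<in>{M. set_mset M \<subseteq> graded_basis f \<and> size M = n}. qq powi (\<Sum>b\<in>#M. fst b))"

definition ext_gdim :: "nat \<Rightarrow> (int \<Rightarrow>\<^sub>0 nat) \<Rightarrow> 'k::field_char_0 poly fract" where
  "ext_gdim n f = (\<Sum>B\<in>{B. B \<subseteq> graded_basis f \<and> card B = n}. qq powi (\<Sum>b\<in>B. fst b))"


section \<open>Dynkin diagrams and affine weights\<close>

definition cartan :: "('i \<Rightarrow> 'i \<Rightarrow> bool) \<Rightarrow> 'i \<Rightarrow> 'i \<Rightarrow> int" where
  "cartan adj i j = (if i = j then 2 else if adj i j then - 1 else 0)"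

text \<open>\<open>adj\<close> is the edge relation; finite type means that the Cartan matrix is positive definite.\<close>

definition simply_laced_finite_type :: "('i::finite \<Rightarrow> 'i \<Rightarrow> bool) \<Rightarrow> bool" where
  "simply_laced_finite_type adj \<longleftrightarrow>
     (\<forall>i. \<not> adj i i) \<and> (\<forall>i j. adj i j \<longrightarrow> adj j i) \<and>
     (\<forall>x :: 'i \<Rightarrow> real. (\<exists>i. x i \<noteq> 0) \<longrightarrow>
        (\<Sum>i\<in>UNIV. \<Sum>j\<in>UNIV. of_int (cartan adj i j) * x i * x j) > 0)"

text \<open>The affine weight lattice is \<open>X \<oplus> \<int>\<Lambda>\<^sub>0 \<oplus> \<int>\<delta>\<close>: the triple \<open>(w, l, d)\<close> is
  \<open>\<Sum>\<^sub>i w i \<cdot> \<omega>\<^sub>i + l\<Lambda>\<^sub>0 + d\<delta>\<close> with \<open>\<omega>\<^sub>i\<close> the fundamental weights, so \<open>\<langle>\<lambda>, \<alpha>\<^sub>i\<rangle> = w i\<close> and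
  \<open>\<langle>\<lambda>, \<delta>\<rangle> = l\<close>.  The affine root lattice is embedded by
  \<open>\<alpha>\<^sub>i = (\<lambda>j. \<langle>i,j\<rangle>, 0, 0)\<close> and \<open>\<delta> = (0, 0, 1)\<close>.
  Weights \<open>\<lambda>\<close> are called \<open>lam\<close> in formulas.\<close>

type_synonym 'i weight = "('i \<Rightarrow> int) \<times> int \<times> int"

definition pair_simple :: "'i weight \<Rightarrow> 'i \<Rightarrow> int" where
  "pair_simple lam i = fst lam i"

definition simple_root :: "('i \<Rightarrow> 'i \<Rightarrow> bool) \<Rightarrow> 'i \<Rightarrow> 'i weight" where
  "simple_root adj i = (\<lambda>j. cartan adj i j, 0, 0)"

definition delta_wt :: "int \<Rightarrow> 'i weight" where
  "delta_wt n = (\<lambda>_. 0, 0, n)"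

definition wt_scale :: "int \<Rightarrow> 'i weight \<Rightarrow> 'i weight" where
  "wt_scale n \<alpha> = (\<lambda>j. n * fst \<alpha> j, n * fst (snd \<alpha>), n * snd (snd \<alpha>))"

text \<open>Roots of \<open>\<gg>\<close>: the Weyl group orbits of the simple roots.\<close>

inductive_set finite_root :: "('i \<Rightarrow> 'i \<Rightarrow> bool) \<Rightarrow> 'i weight set"
  for adj :: "'i \<Rightarrow> 'i \<Rightarrow> bool" where
  simple: "simple_root adj i \<in> finite_root adj"
| reflect: "\<beta> \<in> finite_root adj \<Longrightarrow>
    \<beta> - wt_scale (pair_simple \<beta> i) (simple_root adj i) \<in> finite_root adj"

definition real_root :: "('i \<Rightarrow> 'i \<Rightarrow> bool) \<Rightarrow> 'i weight set" where
  "real_root adj = {\<beta> + delta_wt n |\<beta> n. \<beta> \<in> finite_root adj}"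


section \<open>The free algebra on the generators\<close>

text \<open>\<open>Row\<close> stands for the superscript \<open>(n)\<close> and \<open>Col\<close> for \<open>(1\<^sup>n)\<close>.  A generator carries its
  weight \<open>\<lambda>\<close>: \<open>EG i r \<lambda>\<close> is the symbol \<open>E\<^sub>i\<^sub>,\<^sub>r 1\<^sub>\<lambda>\<close>, and so on.\<close>

datatype shape = Row | Col

datatype 'i gen =
    Idem "'i weight"
  | EG 'i int "'i weight"
  | FG 'i int "'i weight"
  | PG 'i shape nat "'i weight"
  | QG 'i shape nat "'i weight"

datatype 'g word = Word (letters: "'g list")

instantiation word :: (type) monoid_add
begin

definition zero_word :: "'a word" where
  "zero_word = Word []"

definition plus_word :: "'a word \<Rightarrow> 'a word \<Rightarrow> 'a word" where
  "plus_word u w = Word (letters u @ letters w)"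

instance
  by standard (simp_all add: zero_word_def plus_word_def)

end

text \<open>The monoid algebra of the words is the free unital algebra.  All generators and relations
  below lie in its ideal of elements without constant term, which is the free non-unital algebra.
  The ideal generated by relations from there is the same in both algebras.\<close>

type_synonym ('i, 'k) free_alg = "'i gen word \<Rightarrow>\<^sub>0 'k poly fract"

definition gen :: "'i gen \<Rightarrow> ('i, 'k::field_char_0) free_alg" where
  "gen g = Poly_Mapping.single (Word [g]) 1"

definition smul :: "'k::field_char_0 poly fract \<Rightarrow> ('i, 'k) free_alg \<Rightarrow> ('i, 'k) free_alg"
    (infixr "*\<^sub>q" 75) where
  "a *\<^sub>q x = Poly_Mapping.single 0 a * x"

abbreviation idem :: "'i weight \<Rightarrow> ('i, 'k::field_char_0) free_alg" where
  "idem lam \<equiv> gen (Idem lam)"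

text \<open>A homogeneous operator \<open>x\<close> such as \<open>E\<^sub>i\<^sub>,\<^sub>r\<close> (written without idempotent) is not an element
  of the algebra; it consists of its weight and of the elements \<open>x1\<^sub>\<lambda>\<close>.  The product is
  \<open>(xy)1\<^sub>\<lambda> = x1\<^sub>\<mu> \<cdot> y1\<^sub>\<lambda>\<close> with \<open>\<mu> = \<lambda> + wt y\<close>.\<close>

datatype ('i, 'a) homog = Hop (hop_wt: "'i weight") (hop_at: "'i weight \<Rightarrow> 'a")

type_synonym ('i, 'k) hop = "('i, ('i, 'k) free_alg) homog"

notation hop_at ("(_\<one>\<^bsub>_\<^esub>)" [1000, 0] 1000)

definition hop_mult ::
    "('i, 'k::field_char_0) hop \<Rightarrow> ('i, 'k) hop \<Rightarrow> ('i, 'k) hop" (infixr "\<odot>" 80) where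
  "x \<odot> y = Hop (hop_wt x + hop_wt y) (\<lambda>lam. x\<one>\<^bsub>lam + hop_wt y\<^esub> * y\<one>\<^bsub>lam\<^esub>)"

definition hop_scale ::
    "'k::field_char_0 poly fract \<Rightarrow> ('i, 'k) hop \<Rightarrow> ('i, 'k) hop" where
  "hop_scale a x = Hop (hop_wt x) (\<lambda>lam. a *\<^sub>q x\<one>\<^bsub>lam\<^esub>)"

fun hop_prod :: "('i, 'k::field_char_0) hop list \<Rightarrow> ('i, 'k) hop" where
  "hop_prod [] = Hop 0 idem"
| "hop_prod [x] = x"
| "hop_prod (x # y # ys) = x \<odot> hop_prod (y # ys)"

definition opE ::
    "('i \<Rightarrow> 'i \<Rightarrow> bool) \<Rightarrow> nat \<Rightarrow> 'i \<Rightarrow> int \<Rightarrow> ('i, 'k::field_char_0) hop" where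
  "opE adj c i r = Hop (simple_root adj i + delta_wt (r * int c)) (\<lambda>lam. gen (EG i r lam))"

definition opF ::
    "('i \<Rightarrow> 'i \<Rightarrow> bool) \<Rightarrow> nat \<Rightarrow> 'i \<Rightarrow> int \<Rightarrow> ('i, 'k::field_char_0) hop" where
  "opF adj c i r = Hop (- simple_root adj i + delta_wt (r * int c)) (\<lambda>lam. gen (FG i r lam))"

definition opP :: "nat \<Rightarrow> 'i \<Rightarrow> shape \<Rightarrow> nat \<Rightarrow> ('i, 'k::field_char_0) hop" where
  "opP c i s n = Hop (delta_wt (- int n * int c)) (\<lambda>lam. gen (PG i s n lam))"

definition opQ :: "nat \<Rightarrow> 'i \<Rightarrow> shape \<Rightarrow> nat \<Rightarrow> ('i, 'k::field_char_0) hop" where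
  "opQ c i s n = Hop (delta_wt (int n * int c)) (\<lambda>lam. gen (QG i s n lam))"


section \<open>The relations\<close>

text \<open>An equation \<open>x = y\<close> is recorded as the element \<open>x - y\<close> of the free algebra.  \<open>rel0\<close> are the
  conventions on the symbols \<open>P\<close> and \<open>Q\<close>.\<close>

definition rel0 :: "nat \<Rightarrow> ('i, 'k::field_char_0) free_alg set" where
  "rel0 c =
     {(T i s 0)\<one>\<^bsub>lam\<^esub> - idem lam |T i s lam. T \<in> {opP c, opQ c}} \<union>
     {(\<Sum>k=0..n. ((- 1) ^ k) *\<^sub>q (T i Row (n - k) \<odot> T i Col k)\<one>\<^bsub>lam\<^esub>) |T i n lam.
        T \<in> {opP c, opQ c} \<and> n \<ge> 1} \<union>
     {(\<Sum>k=0..n. ((- 1) ^ k) *\<^sub>q (T i Col k \<odot> T i Row (n - k))\<one>\<^bsub>lam\<^esub>) |T i n lam.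
        T \<in> {opP c, opQ c} \<and> n \<ge> 1}"

text \<open>\<open>1\<^sub>\<mu>x1\<^sub>\<lambda> = x1\<^sub>\<lambda>\<close> and \<open>x1\<^sub>\<lambda>1\<^sub>\<lambda> = x1\<^sub>\<lambda>\<close> for \<open>\<mu> = \<lambda> + wt x\<close>; the symbol \<open>1\<^sub>\<mu>x\<close> denotes
  the generator \<open>x1\<^sub>\<lambda>\<close>.\<close>

definition weight_rels :: "('i, 'k::field_char_0) hop \<Rightarrow> ('i, 'k) free_alg set" where
  "weight_rels x =
     {idem (lam + hop_wt x) * x\<one>\<^bsub>lam\<^esub> - x\<one>\<^bsub>lam\<^esub> |lam. True} \<union>
     {x\<one>\<^bsub>lam\<^esub> * idem lam - x\<one>\<^bsub>lam\<^esub> |lam. True}"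

definition rel1 ::
    "('i \<Rightarrow> 'i \<Rightarrow> bool) \<Rightarrow> nat \<Rightarrow> ('i, 'k::field_char_0) free_alg set" where
  "rel1 adj c =
     {idem lam * idem \<mu> - (if lam = \<mu> then idem lam else 0) |lam \<mu>. True} \<union>
     (\<Union>i r. weight_rels (opE adj c i r)) \<union> (\<Union>i r. weight_rels (opF adj c i r))"

text \<open>The coefficient of \<open>P\<^sub>i(m-k) Q\<^sub>j(n-k)\<close> in \<open>Q\<^sub>j(n) P\<^sub>i(m)\<close>, where \<open>eq_shape\<close> says whether
  the two superscripts are of the same kind.\<close>

definition heis_coeff :: "nat \<Rightarrow> bool \<Rightarrow> int \<Rightarrow> nat \<Rightarrow> 'k::field_char_0 poly fract" where
  "heis_coeff c eq_shape a k =
     (if a = 2 then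
        (if eq_shape then sym_gdim k (laurent_qint 2 * laurent_qint c)
         else ext_gdim k (laurent_qint 2 * laurent_qint c))
      else if a = - 1 then
        (- 1) ^ k * (if eq_shape then ext_gdim k (laurent_qint c) else sym_gdim k (laurent_qint c))
      else (if k = 0 then 1 else 0))"

definition rel2 ::
    "('i \<Rightarrow> 'i \<Rightarrow> bool) \<Rightarrow> nat \<Rightarrow> ('i, 'k::field_char_0) free_alg set" where
  "rel2 adj c =
     {(opQ c j s n \<odot> opP c i t m)\<one>\<^bsub>lam\<^esub> -
        (\<Sum>k=0..min m n. heis_coeff c (s = t) (cartan adj i j) k *\<^sub>q
           (opP c i t (m - k) \<odot> opQ c j s (n - k))\<one>\<^bsub>lam\<^esub>)
      |i j s t m n lam. True} \<union>
     (\<Union>i s n. weight_rels (opP c i s n)) \<union> (\<Union>i s n. weight_rels (opQ c i s n))"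

definition opQbr :: "nat \<Rightarrow> 'i \<Rightarrow> nat \<Rightarrow> ('i, 'k::field_char_0) hop" where
  "opQbr c i n = Hop (delta_wt (int n * int c))
     (\<lambda>lam. \<Sum>m=0..n. ((- qq) ^ m * qint (int m)) *\<^sub>q (opQ c i Col (n - m) \<odot> opQ c i Row m)\<one>\<^bsub>lam\<^esub>)"

definition opPbr :: "nat \<Rightarrow> 'i \<Rightarrow> nat \<Rightarrow> ('i, 'k::field_char_0) hop" where
  "opPbr c i n = Hop (delta_wt (- int n * int c))
     (\<lambda>lam. \<Sum>m=0..n. ((- qq) powi (- int m) * qint (int m)) *\<^sub>q
            (opP c i Col (n - m) \<odot> opP c i Row m)\<one>\<^bsub>lam\<^esub>)"

definition rel3 ::
    "('i \<Rightarrow> 'i \<Rightarrow> bool) \<Rightarrow> nat \<Rightarrow> ('i, 'k::field_char_0) free_alg set" where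
  "rel3 adj c =
     {(opE adj c i a \<odot> opF adj c i b)\<one>\<^bsub>lam\<^esub> - (opF adj c i b \<odot> opE adj c i a)\<one>\<^bsub>lam\<^esub> -
        (if a + b > 0 then
           (qq powi (a * int c) * qq powi pair_simple lam i) *\<^sub>q (opQbr c i (nat (a + b)))\<one>\<^bsub>lam\<^esub>
         else if a + b < 0 then
           (qq powi (b * int c) * qq powi (- pair_simple lam i)) *\<^sub>q (opPbr c i (nat (- a - b)))\<one>\<^bsub>lam\<^esub>
         else qint (pair_simple lam i + a * int c) *\<^sub>q idem lam)
      |i a b lam. True} \<union>
     {(opE adj c i a \<odot> opF adj c j b)\<one>\<^bsub>lam\<^esub> - (opF adj c j b \<odot> opE adj c i a)\<one>\<^bsub>lam\<^esub>
      |i j a b lam. i \<noteq> j}"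

definition rel4 ::
    "('i \<Rightarrow> 'i \<Rightarrow> bool) \<Rightarrow> nat \<Rightarrow> ('i, 'k::field_char_0) free_alg set" where
  "rel4 adj c =
     {(opE adj c i n \<odot> opE adj c i (n - 1))\<one>\<^bsub>lam\<^esub> -
        qq ^ 2 *\<^sub>q (opE adj c i (n - 1) \<odot> opE adj c i n)\<one>\<^bsub>lam\<^esub> |i n lam. True} \<union>
     {(opF adj c i (n - 1) \<odot> opF adj c i n)\<one>\<^bsub>lam\<^esub> -
        qq ^ 2 *\<^sub>q (opF adj c i n \<odot> opF adj c i (n - 1))\<one>\<^bsub>lam\<^esub> |i n lam. True}"

definition rel5 ::
    "('i \<Rightarrow> 'i \<Rightarrow> bool) \<Rightarrow> nat \<Rightarrow> ('i, 'k::field_char_0) free_alg set" where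
  "rel5 adj c =
     {(opE adj c i 1 \<odot> opE adj c j 0)\<one>\<^bsub>lam\<^esub> + (opE adj c j 1 \<odot> opE adj c i 0)\<one>\<^bsub>lam\<^esub> -
        inverse qq *\<^sub>q ((opE adj c j 0 \<odot> opE adj c i 1)\<one>\<^bsub>lam\<^esub> + (opE adj c i 0 \<odot> opE adj c j 1)\<one>\<^bsub>lam\<^esub>)
      |i j lam. cartan adj i j = - 1} \<union>
     {(opF adj c i (- 1) \<odot> opF adj c j 0)\<one>\<^bsub>lam\<^esub> + (opF adj c j (- 1) \<odot> opF adj c i 0)\<one>\<^bsub>lam\<^esub> -
        inverse qq *\<^sub>q
          ((opF adj c j 0 \<odot> opF adj c i (- 1))\<one>\<^bsub>lam\<^esub> + (opF adj c i 0 \<odot> opF adj c j (- 1))\<one>\<^bsub>lam\<^esub>)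
      |i j lam. cartan adj i j = - 1} \<union>
     {(T i m \<odot> T j n)\<one>\<^bsub>lam\<^esub> - (T j n \<odot> T i m)\<one>\<^bsub>lam\<^esub>
      |T i j m n lam. T \<in> {opE adj c, opF adj c} \<and> cartan adj i j = 0}"

definition rel6 ::
    "('i \<Rightarrow> 'i \<Rightarrow> bool) \<Rightarrow> nat \<Rightarrow> ('i, 'k::field_char_0) free_alg set" where
  "rel6 adj c =
     {(T j n \<odot> T i m \<odot> T i m)\<one>\<^bsub>lam\<^esub> + (T i m \<odot> T i m \<odot> T j n)\<one>\<^bsub>lam\<^esub> -
        qint 2 *\<^sub>q (T i m \<odot> T j n \<odot> T i m)\<one>\<^bsub>lam\<^esub>
      |T i j m n lam. T \<in> {opE adj c, opF adj c} \<and> cartan adj i j = - 1}"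

definition rels0_5 ::
    "('i \<Rightarrow> 'i \<Rightarrow> bool) \<Rightarrow> nat \<Rightarrow> ('i, 'k::field_char_0) free_alg set" where
  "rels0_5 adj c =
     rel0 c \<union> rel1 adj c \<union> rel2 adj c \<union> rel3 adj c \<union> rel4 adj c \<union> rel5 adj c"

inductive_set two_sided_ideal :: "'a::ring_1 set \<Rightarrow> 'a set" for S :: "'a set" where
  base: "x \<in> S \<Longrightarrow> x \<in> two_sided_ideal S"
| zero: "0 \<in> two_sided_ideal S"
| add: "x \<in> two_sided_ideal S \<Longrightarrow> y \<in> two_sided_ideal S \<Longrightarrow> x + y \<in> two_sided_ideal S"
| left: "x \<in> two_sided_ideal S \<Longrightarrow> a * x \<in> two_sided_ideal S"
| right: "x \<in> two_sided_ideal S \<Longrightarrow> x * a \<in> two_sided_ideal S"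

text \<open>The algebra \<open>A\<close> is the quotient of the free algebra by the ideal generated by all relations;
  \<open>eq_A\<close> is equality in \<open>A\<close> of the classes of two elements.\<close>

definition eq_A ::
    "('i \<Rightarrow> 'i \<Rightarrow> bool) \<Rightarrow> nat \<Rightarrow> ('i, 'k::field_char_0) free_alg \<Rightarrow> ('i, 'k) free_alg \<Rightarrow> bool" where
  "eq_A adj c x y \<longleftrightarrow> x - y \<in> two_sided_ideal (rels0_5 adj c \<union> rel6 adj c)"


section \<open>Drinfeld generators\<close>

text \<open>\<open>exp_coeff X n \<lambda>\<close> is the coefficient of \<open>z\<^sup>n\<close> in \<open>exp (\<Sum>\<^sub>m\<^sub>\<ge>\<^sub>1 X\<^sub>m z\<^sup>m) 1\<^sub>\<lambda>\<close>, from
  \<open>exp Y = \<Sum>\<^sub>k Y\<^sup>k / k!\<close>.  The \<open>X\<^sub>m\<close> are not assumed to commute.\<close>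

definition compositions :: "nat \<Rightarrow> nat \<Rightarrow> nat list set" where
  "compositions k n = {\<nu>. length \<nu> = k \<and> sum_list \<nu> = n \<and> 0 \<notin> set \<nu>}"

definition exp_coeff ::
    "(nat \<Rightarrow> ('i, 'k::field_char_0) hop) \<Rightarrow> nat \<Rightarrow> 'i weight \<Rightarrow> ('i, 'k) free_alg" where
  "exp_coeff X n lam =
     (\<Sum>k=0..n. inverse (of_nat (fact k)) *\<^sub>q (\<Sum>\<nu>\<in>compositions k n. (hop_prod (map X \<nu>))\<one>\<^bsub>lam\<^esub>))"

text \<open>A family \<open>h i m \<lambda>\<close> of elements \<open>h\<^sub>i\<^sub>,\<^sub>m 1\<^sub>\<lambda>\<close>; \<open>h\<^sub>i\<^sub>,\<^sub>m\<close> has weight \<open>mc\<delta>\<close>.\<close>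

type_synonym ('i, 'k) hfam = "'i \<Rightarrow> int \<Rightarrow> 'i weight \<Rightarrow> ('i, 'k) free_alg"

definition oph :: "nat \<Rightarrow> ('i, 'k::field_char_0) hfam \<Rightarrow> 'i \<Rightarrow> int \<Rightarrow> ('i, 'k) hop" where
  "oph c h i m = Hop (delta_wt (m * int c)) (h i m)"

text \<open>The equations in \<open>A\<close> defining the \<open>h\<^sub>i\<^sub>,\<^sub>m\<close>, \<open>m \<noteq> 0\<close>; they have a solution
  by \<open>is_drinfeld_h_exists\<close> below.\<close>

definition is_drinfeld_h ::
    "('i \<Rightarrow> 'i \<Rightarrow> bool) \<Rightarrow> nat \<Rightarrow> ('i, 'k::field_char_0) hfam \<Rightarrow> bool" where
  "is_drinfeld_h adj c h \<longleftrightarrow> (\<forall>i n lam.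
     eq_A adj c ((opQ c i Row n)\<one>\<^bsub>lam\<^esub>)
       (exp_coeff (\<lambda>m. hop_scale (inverse (qint (int m))) (oph c h i (int m))) n lam) \<and>
     eq_A adj c ((opP c i Row n)\<one>\<^bsub>lam\<^esub>)
       (exp_coeff (\<lambda>m. hop_scale (inverse (qint (int m))) (oph c h i (- int m))) n lam))"

definition ope ::
    "('i \<Rightarrow> 'i \<Rightarrow> bool) \<Rightarrow> nat \<Rightarrow> 'i \<Rightarrow> int \<Rightarrow> ('i, 'k::field_char_0) hop" where
  "ope adj c i r = hop_scale ((- (qq * qhalf ^ c)) powi (- r)) (opE adj c i r)"

definition opf ::
    "('i \<Rightarrow> 'i \<Rightarrow> bool) \<Rightarrow> nat \<Rightarrow> 'i \<Rightarrow> int \<Rightarrow> ('i, 'k::field_char_0) hop" where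
  "opf adj c i r = hop_scale ((- (qq * qhalf ^ c)) powi (- r)) (opF adj c i r)"


section \<open>Formal distributions and the Drinfeld relations\<close>

text \<open>A formal distribution in one variable is the function sending \<open>n\<close> to the coefficient of
  \<open>z\<^sup>n\<close>; in two variables it sends \<open>a, b\<close> to the coefficient of \<open>z\<^sup>aw\<^sup>b\<close>.  The signs \<open>\<plusminus>\<close> are
  the integers \<open>1\<close> and \<open>-1\<close>.\<close>

definition cur_x ::
    "('i \<Rightarrow> 'i \<Rightarrow> bool) \<Rightarrow> nat \<Rightarrow> int \<Rightarrow> 'i \<Rightarrow> int \<Rightarrow> ('i, 'k::field_char_0) hop" where
  "cur_x adj c \<epsilon> i n = (if \<epsilon> = 1 then ope adj c i (- n) else opf adj c i (- n))"

definition cur_psi ::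
    "nat \<Rightarrow> ('i, 'k::field_char_0) hfam \<Rightarrow> int \<Rightarrow> 'i \<Rightarrow> int \<Rightarrow> ('i, 'k) hop" where
  "cur_psi c h s i n = Hop (delta_wt (- n * int c))
     (\<lambda>lam. if s * n \<le> 0 then
            qq powi (s * pair_simple lam i) *\<^sub>q
              exp_coeff (\<lambda>m. hop_scale (of_int s * (qq - inverse qq)) (oph c h i (s * int m)))
                (nat (- (s * n))) lam
          else 0)"

type_synonym ('i, 'k) dist2 = "int \<Rightarrow> int \<Rightarrow> ('i, 'k) free_alg"

definition prod_zw :: "(int \<Rightarrow> ('i, 'k::field_char_0) hop) \<Rightarrow> (int \<Rightarrow> ('i, 'k) hop) \<Rightarrow>
    'i weight \<Rightarrow> ('i, 'k) dist2"  \<comment> \<open>\<open>X(z) Y(w) 1\<^sub>\<lambda>\<close>\<close> where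
  "prod_zw X Y lam = (\<lambda>a b. (X a \<odot> Y b)\<one>\<^bsub>lam\<^esub>)"

definition prod_wz :: "(int \<Rightarrow> ('i, 'k::field_char_0) hop) \<Rightarrow> (int \<Rightarrow> ('i, 'k) hop) \<Rightarrow>
    'i weight \<Rightarrow> ('i, 'k) dist2"  \<comment> \<open>\<open>Y(w) X(z) 1\<^sub>\<lambda>\<close>\<close> where
  "prod_wz Y X lam = (\<lambda>a b. (Y b \<odot> X a)\<one>\<^bsub>lam\<^esub>)"

definition lin_mult :: "'k::field_char_0 poly fract \<Rightarrow> 'k poly fract \<Rightarrow>
    ('i, 'k) dist2 \<Rightarrow> ('i, 'k) dist2"  \<comment> \<open>\<open>(\<alpha>z - \<beta>w) T(z,w)\<close>\<close> where
  "lin_mult \<alpha> \<beta> T = (\<lambda>a b. \<alpha> *\<^sub>q T (a - 1) b - \<beta> *\<^sub>q T a (b - 1))"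

text \<open>\<open>g(z/w) T(z,w)\<close> for a power series \<open>g\<close>, where \<open>T\<close> has no negative powers of \<open>z\<close> (which
  makes the sum finite).\<close>

definition series_mult :: "'k::field_char_0 poly fract fps \<Rightarrow>
    ('i, 'k) dist2 \<Rightarrow> ('i, 'k) dist2" where
  "series_mult g T =
     (\<lambda>a b. \<Sum>k\<in>{k::nat. int k \<le> a}. fps_nth g k *\<^sub>q T (a - int k) (b + int k))"

definition delta_wz :: "'k::field_char_0 poly fract \<Rightarrow> 'k poly fract \<Rightarrow>
    (int \<Rightarrow> ('i, 'k) hop) \<Rightarrow> 'i weight \<Rightarrow> ('i, 'k) dist2"
      \<comment> \<open>\<open>\<delta>(\<kappa>wz\<^sup>-\<^sup>1) Y(\<beta>w) 1\<^sub>\<lambda> = \<Sum>\<^sub>n\<^sub>,\<^sub>m \<kappa>\<^sup>n \<beta>\<^sup>m Y\<^sub>m1\<^sub>\<lambda> z\<^sup>-\<^sup>n w\<^sup>n\<^sup>+\<^sup>m\<close>\<close> where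
  "delta_wz \<kappa> \<beta> Y lam = (\<lambda>a b. (\<kappa> powi (- a) * \<beta> powi (a + b)) *\<^sub>q (Y (a + b))\<one>\<^bsub>lam\<^esub>)"

definition delta_zw :: "'k::field_char_0 poly fract \<Rightarrow> 'k poly fract \<Rightarrow>
    (int \<Rightarrow> ('i, 'k) hop) \<Rightarrow> 'i weight \<Rightarrow> ('i, 'k) dist2"
      \<comment> \<open>\<open>\<delta>(\<kappa>zw\<^sup>-\<^sup>1) Y(\<beta>z) 1\<^sub>\<lambda>\<close>\<close> where
  "delta_zw \<kappa> \<beta> Y lam = (\<lambda>a b. (\<kappa> powi (- b) * \<beta> powi (a + b)) *\<^sub>q (Y (a + b))\<one>\<^bsub>lam\<^esub>)"

definition dist_eq_A ::
    "('i \<Rightarrow> 'i \<Rightarrow> bool) \<Rightarrow> nat \<Rightarrow> ('i, 'k::field_char_0) dist2 \<Rightarrow> ('i, 'k) dist2 \<Rightarrow> bool" where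
  "dist_eq_A adj c S T \<longleftrightarrow> (\<forall>a b. eq_A adj c (S a b) (T a b))"

definition drinfeld1 ::
    "('i \<Rightarrow> 'i \<Rightarrow> bool) \<Rightarrow> nat \<Rightarrow> ('i, 'k::field_char_0) hfam \<Rightarrow> bool" where
  "drinfeld1 adj c (h :: ('i, 'k) hfam) \<longleftrightarrow> (\<forall>i r lam.
     eq_A adj c ((ope adj c i r)\<one>\<^bsub>lam\<^esub> :: ('i, 'k) free_alg)
       (idem (lam + simple_root adj i + delta_wt (r * int c)) * (ope adj c i r)\<one>\<^bsub>lam\<^esub>) \<and>
     eq_A adj c ((opf adj c i r)\<one>\<^bsub>lam\<^esub> :: ('i, 'k) free_alg)
       (idem (lam - simple_root adj i + delta_wt (r * int c)) * (opf adj c i r)\<one>\<^bsub>lam\<^esub>) \<and>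
     (r \<noteq> 0 \<longrightarrow>
        eq_A adj c ((oph c h i r)\<one>\<^bsub>lam\<^esub>)
          (idem (lam + delta_wt (r * int c)) * (oph c h i r)\<one>\<^bsub>lam\<^esub>)))"

definition drinfeld2 ::
    "('i \<Rightarrow> 'i \<Rightarrow> bool) \<Rightarrow> nat \<Rightarrow> ('i, 'k::field_char_0) hfam \<Rightarrow> bool" where
  "drinfeld2 adj c h \<longleftrightarrow> (\<forall>i j lam. \<forall>s\<in>{1, - 1}.
     dist_eq_A adj c
       (prod_zw (cur_psi c h s i) (cur_psi c h s j) lam)
       (prod_wz (cur_psi c h s j) (cur_psi c h s i) lam))"

text \<open>With \<open>x = z/w\<close> the rational function is
  \<open>(x - q\<^sup>c\<^sup>-\<^sup>a)(x - q\<^sup>a\<^sup>-\<^sup>c) / ((x - q\<^sup>a\<^sup>+\<^sup>c)(x - q\<^sup>-\<^sup>a\<^sup>-\<^sup>c))\<close>, \<open>a = \<langle>i,j\<rangle>\<close>.\<close>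

definition d3_series :: "nat \<Rightarrow> int \<Rightarrow> 'k::field_char_0 poly fract fps" where
  "d3_series c a =
     ((fps_X - fps_const (qq powi (- a) * qq powi int c)) *
      (fps_X - fps_const (qq powi a * qq powi (- int c)))) /
     ((fps_X - fps_const (qq powi a * qq powi int c)) *
      (fps_X - fps_const (qq powi (- a) * qq powi (- int c))))"

definition drinfeld3 ::
    "('i \<Rightarrow> 'i \<Rightarrow> bool) \<Rightarrow> nat \<Rightarrow> ('i, 'k::field_char_0) hfam \<Rightarrow> bool" where
  "drinfeld3 adj c h \<longleftrightarrow> (\<forall>i j lam.
     dist_eq_A adj c
       (prod_zw (cur_psi c h (- 1) i) (cur_psi c h 1 j) lam)
       (series_mult (d3_series c (cartan adj i j))
         (prod_wz (cur_psi c h 1 j) (cur_psi c h (- 1) i) lam)))"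

definition drinfeld4 ::
    "('i \<Rightarrow> 'i \<Rightarrow> bool) \<Rightarrow> nat \<Rightarrow> ('i, 'k::field_char_0) hfam \<Rightarrow> bool" where
  "drinfeld4 adj c h \<longleftrightarrow> (\<forall>i j lam. \<forall>\<epsilon>\<in>{1, - 1}. \<forall>s\<in>{1, - 1}.
     dist_eq_A adj c
       (lin_mult (qhalf powi (\<epsilon> * s * int c)) (qq powi (\<epsilon> * cartan adj i j))
         (prod_zw (cur_psi c h s j) (cur_x adj c \<epsilon> i) lam))
       (lin_mult (qq powi (\<epsilon> * cartan adj i j) * qhalf powi (\<epsilon> * s * int c)) 1
         (prod_wz (cur_x adj c \<epsilon> i) (cur_psi c h s j) lam)))"

definition drinfeld5 ::
    "('i \<Rightarrow> 'i \<Rightarrow> bool) \<Rightarrow> nat \<Rightarrow> ('i, 'k::field_char_0) hfam \<Rightarrow> bool" where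
  "drinfeld5 adj c h \<longleftrightarrow> (\<forall>i j lam.
     dist_eq_A adj c
       (\<lambda>a b. prod_zw (cur_x adj c 1 i) (cur_x adj c (- 1) j) lam a b -
              prod_wz (cur_x adj c (- 1) j) (cur_x adj c 1 i) lam a b)
       (\<lambda>a b. if i = j then
          (1 / (qq - inverse qq)) *\<^sub>q
            (delta_wz (qq ^ c) (qhalf ^ c) (cur_psi c h 1 i) lam a b -
             delta_zw (qq ^ c) (qhalf ^ c) (cur_psi c h (- 1) i) lam a b)
        else 0))"

text \<open>The next three relations do not involve the \<open>h\<^sub>i\<^sub>,\<^sub>m\<close>; the argument \<open>h\<close> only fixes the
  ground field.\<close>

definition drinfeld6 ::
    "('i \<Rightarrow> 'i \<Rightarrow> bool) \<Rightarrow> nat \<Rightarrow> ('i, 'k::field_char_0) hfam \<Rightarrow> bool" where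
  "drinfeld6 adj c (h :: ('i, 'k) hfam) \<longleftrightarrow> (\<forall>i lam. \<forall>\<epsilon>\<in>{1, - 1}.
     dist_eq_A adj c
       (lin_mult 1 (qq powi (2 * \<epsilon>))
         (prod_zw (cur_x adj c \<epsilon> i) (cur_x adj c \<epsilon> i) lam :: ('i, 'k) dist2))
       (lin_mult (qq powi (2 * \<epsilon>)) 1
         (prod_wz (cur_x adj c \<epsilon> i) (cur_x adj c \<epsilon> i) lam)))"

definition drinfeld7 ::
    "('i \<Rightarrow> 'i \<Rightarrow> bool) \<Rightarrow> nat \<Rightarrow> ('i, 'k::field_char_0) hfam \<Rightarrow> bool" where
  "drinfeld7 adj c (h :: ('i, 'k) hfam) \<longleftrightarrow> (\<forall>i j lam. \<forall>\<epsilon>\<in>{1, - 1}. cartan adj i j = - 1 \<longrightarrow>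
     dist_eq_A adj c
       (lin_mult 1 (qq powi (- \<epsilon>))
         (prod_zw (cur_x adj c \<epsilon> i) (cur_x adj c \<epsilon> j) lam :: ('i, 'k) dist2))
       (lin_mult (qq powi (- \<epsilon>)) 1
         (prod_wz (cur_x adj c \<epsilon> j) (cur_x adj c \<epsilon> i) lam)))"

text \<open>The coefficient of \<open>z\<^sub>1\<^sup>r\<^sup>(\<^sup>1\<^sup>) \<cdots> z\<^sub>N\<^sup>r\<^sup>(\<^sup>N\<^sup>) w\<^sup>t\<close> of the quantum Serre relation.\<close>

definition drinfeld8 ::
    "('i \<Rightarrow> 'i \<Rightarrow> bool) \<Rightarrow> nat \<Rightarrow> ('i, 'k::field_char_0) hfam \<Rightarrow> bool" where
  "drinfeld8 adj c (h :: ('i, 'k) hfam) \<longleftrightarrow>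
     (\<forall>i j lam. \<forall>\<epsilon>\<in>{1, - 1}. \<forall>(r :: nat \<Rightarrow> int) t N.
        cartan adj i j \<le> 0 \<and> N = nat (1 - cartan adj i j) \<longrightarrow>
        eq_A adj c
          (\<Sum>\<sigma>\<in>{\<sigma>. \<sigma> permutes {1..N}}. \<Sum>s=0..N.
             ((- 1) ^ s * qbinom N s) *\<^sub>q
               (hop_prod
                  (map (\<lambda>k. cur_x adj c \<epsilon> i (r (\<sigma> k))) [1..<s + 1] @ [cur_x adj c \<epsilon> j t] @
                   map (\<lambda>k. cur_x adj c \<epsilon> i (r (\<sigma> k))) [s + 1..<N + 1]))\<one>\<^bsub>lam\<^esub>)
          (0 :: ('i, 'k) free_alg))"


section \<open>Representations\<close>

text \<open>\<open>\<rho>\<close> gives the action of each generator on \<open>V\<close>; \<open>alg_act\<close> extends it to the free algebra.\<close>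

definition alg_act :: "('k::field_char_0 poly fract \<Rightarrow> 'v::ab_group_add \<Rightarrow> 'v) \<Rightarrow>
    ('i gen \<Rightarrow> 'v \<Rightarrow> 'v) \<Rightarrow> ('i, 'k) free_alg \<Rightarrow> 'v \<Rightarrow> 'v" where
  "alg_act scale \<rho> x v =
     (\<Sum>w\<in>Poly_Mapping.keys x. scale (Poly_Mapping.lookup x w) (foldr \<rho> (letters w) v))"

definition rels_hold_on :: "('k::field_char_0 poly fract \<Rightarrow> 'v::ab_group_add \<Rightarrow> 'v) \<Rightarrow>
    ('i gen \<Rightarrow> 'v \<Rightarrow> 'v) \<Rightarrow> ('i, 'k) free_alg set \<Rightarrow> bool" where
  "rels_hold_on scale \<rho> R \<longleftrightarrow> (\<forall>x\<in>R. \<forall>v. alg_act scale \<rho> x v = 0)"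

text \<open>\<open>V = \<Oplus>\<^sub>\<lambda> V\<^sub>\<lambda>\<close> with \<open>1\<^sub>\<lambda>\<close> acting as the projection onto \<open>V\<^sub>\<lambda>\<close>.\<close>

definition weight_representation :: "('k::field_char_0 poly fract \<Rightarrow> 'v::ab_group_add \<Rightarrow> 'v) \<Rightarrow>
    ('i weight \<Rightarrow> 'v set) \<Rightarrow> ('i gen \<Rightarrow> 'v \<Rightarrow> 'v) \<Rightarrow> bool" where
  "weight_representation scale V \<rho> \<longleftrightarrow>
     vector_space scale \<and>
     (\<forall>g. Vector_Spaces.linear scale scale (\<rho> g)) \<and>
     (\<forall>lam. module.subspace scale (V lam)) \<and>
     (\<forall>v. \<exists>!f. (\<forall>lam. f lam \<in> V lam) \<and> finite {lam. f lam \<noteq> 0} \<and> v = (\<Sum>lam | f lam \<noteq> 0. f lam)) \<and>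
     (\<forall>lam \<mu>. \<forall>v\<in>V \<mu>. \<rho> (Idem lam) v = (if lam = \<mu> then v else 0))"

definition integrable ::
    "('i \<Rightarrow> 'i \<Rightarrow> bool) \<Rightarrow> ('i weight \<Rightarrow> 'v::ab_group_add set) \<Rightarrow> bool" where
  "integrable adj V \<longleftrightarrow>
     (\<forall>lam. \<forall>\<alpha>\<in>real_root adj. \<exists>n0. \<forall>n::int. \<bar>n\<bar> \<ge> n0 \<longrightarrow> V (lam + wt_scale n \<alpha>) = {0})"


section \<open>Existence of the elements \<open>h\<^sub>i\<^sub>,\<^sub>m\<close>\<close>

lemma qhalf_power: "(qhalf :: 'k::field_char_0 poly fract) ^ n = Fract (monom 1 n) 1"
proof (induction n)
  case 0
  show ?case by (simp add: One_fract_def monom_0 one_pCons)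
next
  case (Suc n)
  have "(qhalf :: 'k poly fract) * Fract (monom 1 n) 1 = Fract (monom 1 (Suc n)) 1"
    unfolding qhalf_def by (simp add: monom_Suc)
  with Suc show ?case by simp
qed

lemma qhalf_nonzero: "(qhalf :: 'k::field_char_0 poly fract) \<noteq> 0"
  unfolding qhalf_def Zero_fract_def by (simp add: eq_fract)

lemma qhalf_power_neq_1: "n > 0 \<Longrightarrow> (qhalf :: 'k::field_char_0 poly fract) ^ n \<noteq> 1"
proof
  assume n: "n > 0" and "(qhalf :: 'k poly fract) ^ n = 1"
  hence "monom (1::'k) n = 1"
    by (simp add: qhalf_power One_fract_def eq_fract)
  hence "degree (monom (1::'k) n) = 0" by simp
  with n show False by (simp add: degree_monom_eq)
qed

lemma qint_nonzero:
  assumes "n > 0"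
  shows "(qint (int n) :: 'k::field_char_0 poly fract) \<noteq> 0"
proof -
  have nz: "(qq :: 'k poly fract) ^ m - inverse (qq ^ m) \<noteq> 0" if "m > 0" for m
  proof
    assume "(qq :: 'k poly fract) ^ m - inverse (qq ^ m) = 0"
    hence "(qq :: 'k poly fract) ^ m = inverse (qq ^ m)" by simp
    moreover have "(qq :: 'k poly fract) ^ m \<noteq> 0" using qhalf_nonzero [where 'k = 'k] by (simp add: qq_def)
    ultimately have "(qq :: 'k poly fract) ^ m * qq ^ m = 1"
      by (metis right_inverse)
    hence "(qhalf :: 'k poly fract) ^ (4 * m) = 1"
      by (simp add: qq_def power_mult [symmetric] power_add [symmetric])
    with qhalf_power_neq_1 [of "4 * m", where 'k = 'k] that show False by simp
  qed
  from nz [OF assms] nz [of 1] show ?thesis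
    by (simp add: qint_def power_int_minus)
qed

lemma smul_smul: "a *\<^sub>q (b *\<^sub>q x) = (a * b) *\<^sub>q x"
  by (simp add: smul_def mult.assoc [symmetric] mult_single)

lemma smul_one: "1 *\<^sub>q x = x"
  by (simp add: smul_def)

lemma finite_compositions: "finite (compositions k n)"
proof (rule finite_subset)
  show "compositions k n \<subseteq> {\<nu>. set \<nu> \<subseteq> {0..n} \<and> length \<nu> = k}"
    unfolding compositions_def using member_le_sum_list by fastforce
  show "finite {\<nu>. set \<nu> \<subseteq> {0..n} \<and> length \<nu> = k}"
    by (rule finite_lists_length_eq) simp
qed

lemma compositions_1: "n > 0 \<Longrightarrow> compositions 1 n = {[n]}"
  unfolding compositions_def by (auto simp: length_Suc_conv)

lemma compositions_0: "compositions 0 n = (if n = 0 then {[]} else {})"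
  unfolding compositions_def by auto

lemma sum_list_ge_length:
  "(\<nu> :: nat list) \<noteq> [] \<Longrightarrow> 0 \<notin> set \<nu> \<Longrightarrow> m \<in> set \<nu> \<Longrightarrow> m + (length \<nu> - 1) \<le> sum_list \<nu>"
proof (induction \<nu>)
  case (Cons a \<nu>)
  have len: "0 \<notin> set xs \<Longrightarrow> length xs \<le> sum_list xs" for xs :: "nat list"
    by (induction xs) (auto simp: Suc_le_eq intro: add_mono [of 1, simplified])
  show ?case
  proof (cases "m = a")
    case True
    with Cons.prems len [of \<nu>] show ?thesis by simp
  next
    case False
    with Cons.prems have "m \<in> set \<nu>" "\<nu> \<noteq> []" by auto
    with Cons have "m + (length \<nu> - 1) \<le> sum_list \<nu>" by simp
    moreover have "a \<ge> 1" using Cons.prems by (cases a) auto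
    moreover have "length \<nu> \<ge> 1" using \<open>\<nu> \<noteq> []\<close> by (cases \<nu>) auto
    ultimately show ?thesis by simp
  qed
qed simp

lemma compositions_less:
  assumes "\<nu> \<in> compositions k n" "k \<ge> 2" "m \<in> set \<nu>"
  shows "m < n" "m > 0"
proof -
  have "\<nu> \<noteq> []" using assms by (auto simp: compositions_def)
  with assms sum_list_ge_length [of \<nu> m] show "m < n" by (auto simp: compositions_def)
  show "m > 0" using assms by (cases m) (auto simp: compositions_def)
qed

lemma exp_coeff_0: "exp_coeff X 0 lam = idem lam"
  by (simp add: exp_coeff_def compositions_0 smul_one)

text \<open>The formal exponential is onto the series with constant term \<open>1\<close>.\<close>

lemma exp_coeff_solve:
  fixes T :: "nat \<Rightarrow> 'i weight \<Rightarrow> ('i, 'k::field_char_0) free_alg" and d :: "nat \<Rightarrow> 'i weight"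
  obtains f where "\<And>n lam. n > 0 \<Longrightarrow>
     exp_coeff (\<lambda>m. hop_scale (inverse (qint (int m))) (Hop (d m) (f m))) n lam = T n lam"
proof -
  define X where "X f m = hop_scale (inverse (qint (int m))) (Hop (d m) (f m))"
    for f :: "nat \<Rightarrow> 'i weight \<Rightarrow> ('i, 'k) free_alg" and m
  define rest where "rest f n lam =
      (\<Sum>k=2..n. inverse (of_nat (fact k)) *\<^sub>q
         (\<Sum>\<nu>\<in>compositions k n. (hop_prod (map (X f) \<nu>))\<one>\<^bsub>lam\<^esub>))" for f n lam
  define G where "G f n = (\<lambda>lam. qint (int n) *\<^sub>q (T n lam - rest f n lam))" for f n
  define f where "f = wfrec less_than G"
  have rest_cong: "rest f n = rest g n" if "\<And>m. m < n \<Longrightarrow> f m = g m" for f g n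
  proof -
    have eq: "map (X f) \<nu> = map (X g) \<nu>" if "\<nu> \<in> compositions k n" "k \<ge> 2" for \<nu> k
      using compositions_less(1) [OF that] \<open>\<And>m. m < n \<Longrightarrow> f m = g m\<close>
      by (auto simp: X_def)
    have "(\<Sum>\<nu>\<in>compositions k n. (hop_prod (map (X f) \<nu>))\<one>\<^bsub>lam\<^esub>) =
          (\<Sum>\<nu>\<in>compositions k n. (hop_prod (map (X g) \<nu>))\<one>\<^bsub>lam\<^esub>)" if "k \<ge> 2" for k lam
      by (rule sum.cong) (simp_all only: eq that)
    thus ?thesis unfolding rest_def by (auto intro!: sum.cong)
  qed
  have f_rec: "f n = G f n" for n
  proof -
    have "f n = G (cut f less_than n) n"
      unfolding f_def by (rule wfrec) simp
    moreover have "rest (cut f less_than n) n = rest f n"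
      by (rule rest_cong) (simp add: cut_apply)
    ultimately show ?thesis by (simp add: G_def)
  qed
  have "exp_coeff (X f) n lam = T n lam" if n: "n > 0" for n lam
  proof -
    have split: "{0..n} = insert 0 (insert 1 {2..n})" using n by auto
    have "exp_coeff (X f) n lam = (X f n)\<one>\<^bsub>lam\<^esub> + rest f n lam"
      unfolding exp_coeff_def split rest_def
      using n compositions_1 [OF n] by (simp add: compositions_0 smul_one smul_def [of _ 0])
    also have "(X f n)\<one>\<^bsub>lam\<^esub> = T n lam - rest f n lam"
      using f_rec [of n] qint_nonzero [OF n, where 'k = 'k]
      by (simp add: X_def hop_scale_def G_def smul_smul smul_one)
    finally show ?thesis by simp
  qed
  moreover have "X f = (\<lambda>m. hop_scale (inverse (qint (int m))) (Hop (d m) (f m)))"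
    by (rule ext) (simp add: X_def)
  ultimately show ?thesis using that [of f] by simp
qed

lemma is_drinfeld_h_exists:
  "\<exists>h :: ('i, 'k::field_char_0) hfam. is_drinfeld_h adj c h"
proof -
  define Sf where "Sf i f \<longleftrightarrow> (\<forall>n lam. n > 0 \<longrightarrow>
       exp_coeff (\<lambda>m. hop_scale (inverse (qint (int m))) (Hop (delta_wt (int m * int c)) (f m))) n lam =
       ((opQ c i Row n)\<one>\<^bsub>lam\<^esub> :: ('i, 'k) free_alg))" for i f
  have "\<forall>i. \<exists>f. Sf i f"
  proof
    fix i
    show "\<exists>f. Sf i f"
      unfolding Sf_def
      by (rule exp_coeff_solve [where d = "\<lambda>m. delta_wt (int m * int c)"
            and T = "\<lambda>n lam. (opQ c i Row n)\<one>\<^bsub>lam\<^esub>"]) blast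
  qed
  then obtain f where "\<forall>i. Sf i (f i)"
    using choice by blast
  hence f: "exp_coeff (\<lambda>m. hop_scale (inverse (qint (int m))) (Hop (delta_wt (int m * int c)) (f i m))) n lam =
       ((opQ c i Row n)\<one>\<^bsub>lam\<^esub> :: ('i, 'k) free_alg)" if "n > 0" for i n lam
    using that unfolding Sf_def by blast
  define Sg where "Sg i f \<longleftrightarrow> (\<forall>n lam. n > 0 \<longrightarrow>
       exp_coeff (\<lambda>m. hop_scale (inverse (qint (int m))) (Hop (delta_wt (- int m * int c)) (f m))) n lam =
       ((opP c i Row n)\<one>\<^bsub>lam\<^esub> :: ('i, 'k) free_alg))" for i f
  have "\<forall>i. \<exists>f. Sg i f"
  proof
    fix i
    show "\<exists>f. Sg i f"
      unfolding Sg_def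
      by (rule exp_coeff_solve [where d = "\<lambda>m. delta_wt (- int m * int c)"
            and T = "\<lambda>n lam. (opP c i Row n)\<one>\<^bsub>lam\<^esub>"]) blast
  qed
  then obtain g where "\<forall>i. Sg i (g i)"
    using choice by blast
  hence g: "exp_coeff (\<lambda>m. hop_scale (inverse (qint (int m))) (Hop (delta_wt (- int m * int c)) (g i m))) n lam =
       ((opP c i Row n)\<one>\<^bsub>lam\<^esub> :: ('i, 'k) free_alg)" if "n > 0" for i n lam
    using that unfolding Sg_def by blast
  define h :: "('i, 'k) hfam" where
    "h i m = (if m > 0 then f i (nat m) else g i (nat (- m)))" for i m
  have cong: "exp_coeff X n lam = exp_coeff Y n lam" if "\<And>m. m > 0 \<Longrightarrow> X m = Y m"
    for X Y :: "nat \<Rightarrow> ('i, 'k) hop" and n lam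
  proof -
    have eq: "map X \<nu> = map Y \<nu>" if "\<nu> \<in> compositions k n" for \<nu> k
      using that \<open>\<And>m. m > 0 \<Longrightarrow> X m = Y m\<close>
      by (intro map_cong refl) (metis (mono_tags, lifting) compositions_def mem_Collect_eq neq0_conv)
    have "(\<Sum>\<nu>\<in>compositions k n. (hop_prod (map X \<nu>))\<one>\<^bsub>lam\<^esub>) =
          (\<Sum>\<nu>\<in>compositions k n. (hop_prod (map Y \<nu>))\<one>\<^bsub>lam\<^esub>)" for k
      by (rule sum.cong) (simp_all only: eq)
    thus ?thesis by (simp add: exp_coeff_def)
  qed
  have zero: "eq_A adj c ((T i Row 0)\<one>\<^bsub>lam\<^esub>) (idem lam :: ('i, 'k) free_alg)"
    if "T \<in> {opP c, opQ c}" for T i lam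
    unfolding eq_A_def rels0_5_def rel0_def
    by (rule two_sided_ideal.base) (use that in blast)
  have refl: "eq_A adj c x x" for x :: "('i, 'k) free_alg"
    by (simp add: eq_A_def two_sided_ideal.zero)
  have "is_drinfeld_h adj c h"
    unfolding is_drinfeld_h_def
  proof (intro allI conjI)
    fix i n lam
    show "eq_A adj c ((opQ c i Row n)\<one>\<^bsub>lam\<^esub>)
       (exp_coeff (\<lambda>m. hop_scale (inverse (qint (int m))) (oph c h i (int m))) n lam)"
    proof (cases "n = 0")
      case True
      thus ?thesis by (simp add: exp_coeff_0 zero)
    next
      case False
      have "exp_coeff (\<lambda>m. hop_scale (inverse (qint (int m))) (oph c h i (int m))) n lam =
          (opQ c i Row n)\<one>\<^bsub>lam\<^esub>"
        using False f [of n i lam] by (subst cong [where Y = "\<lambda>m. hop_scale (inverse (qint (int m)))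
          (Hop (delta_wt (int m * int c)) (f i m))"]) (simp_all add: oph_def h_def)
      thus ?thesis by (simp add: refl)
    qed
    show "eq_A adj c ((opP c i Row n)\<one>\<^bsub>lam\<^esub>)
       (exp_coeff (\<lambda>m. hop_scale (inverse (qint (int m))) (oph c h i (- int m))) n lam)"
    proof (cases "n = 0")
      case True
      thus ?thesis by (simp add: exp_coeff_0 zero)
    next
      case False
      have "exp_coeff (\<lambda>m. hop_scale (inverse (qint (int m))) (oph c h i (- int m))) n lam =
          (opP c i Row n)\<one>\<^bsub>lam\<^esub>"
        using False g [of n i lam] by (subst cong [where Y = "\<lambda>m. hop_scale (inverse (qint (int m)))
          (Hop (delta_wt (- int m * int c)) (g i m))"]) (simp_all add: oph_def h_def)
      thus ?thesis by (simp add: refl)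
    qed
  qed
  thus ?thesis by (rule exI [where x = h])
qed

end

theory Submission
  imports Defs
begin

text \<open>
  Homogeneous operators act on families of elements of the quotient algebra indexed by weights, which
  turns the relations into identities in a ring.  Commuting (R4) with \<open>F\<^sub>i\<^sub>,\<^sub>b\<close> by means of (R3) gives
  the exchange relations (D4) between the \<open>E\<^sub>i\<^sub>,\<^sub>n\<close> and the Cartan currents, so that the bracket with
  \<open>h\<^sub>i\<^sub>,\<^sub>\<plusminus>\<^sub>1\<close> shifts the modes of the \<open>E\<^sub>j\<^sub>,\<^sub>n\<close> and \<open>F\<^sub>j\<^sub>,\<^sub>n\<close>; these brackets carry (R4), (R5) and (R6)
  from the given modes to all modes, which gives (D6), (D7), (D4) for \<open>i \<noteq> j\<close>, and (D8).  The exchange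
  factors of \<open>\<psi>\<^sub>i\<close> with \<open>E\<^sub>j\<close> and with \<open>F\<^sub>j\<close> cancel, hence \<open>\<psi>\<^sub>i\<close> commutes with the commutators of \<open>E\<^sub>j\<close>
  and \<open>F\<^sub>j\<close>; this is (D2).  Since \<open>Q\<^sub>i(z) = exp (\<Sum> h\<^sub>n z\<^sup>n / [n])\<close>, the exponential of
  \<open>(q - q\<^sup>-\<^sup>1) \<Sum> h\<^sub>n (qz)\<^sup>n\<close> is \<open>Q\<^sub>i(z)\<^sup>-\<^sup>1 Q\<^sub>i(q\<^sup>2z)\<close>, whose coefficients are the bracketed \<open>Q\<close>'s of (R3) up to factors;
  this identifies the right hand side of (R3) with that of (D5) and reduces (D3) to the exchange
  relations (R2) of the \<open>P\<close>'s and \<open>Q\<close>'s.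

  On an integrable representation the difference \<open>S\<close> of the two sides of (R6) commutes with \<open>F\<^sub>i\<^sub>,\<^sub>-\<^sub>m\<close> and raises
  the weight for the quantum \<open>sl\<^sub>2\<close> of \<open>E\<^sub>i\<^sub>,\<^sub>m\<close>, \<open>F\<^sub>i\<^sub>,\<^sub>-\<^sub>m\<close> by \<open>3\<close>; such an operator is zero.
\<close>

section \<open>Consequences of the loop relations\<close>

text \<open>(R5) concerns the modes 0 and 1 only, and carrying it to all modes by brackets with
  \<open>H i\<close> would require \<open>H i\<close> and \<open>H j\<close> to commute, which is
  not among the relations. What (R2) provides is that \<open>H i\<close> and \<open>H' j\<close>
  commute up to a scalar. Hence the bracket of \<open>H i\<close> with \<open>E j n\<close> is at
  that stage available only for n \<le> 0, where \<open>H' j\<close> lowers n, and that of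
  \<open>H' i\<close> only for n \<ge> 1. The Serre relation (R6), commuted with a suitable
  \<open>F i b\<close>, turns each of the two brackets into the quadratic relation between E_i and
  E_j, and the two ranges together cover all modes.

  Nor do the relations say that the Q's commute with each other, so the exponential that defines the
  h's is that of a series with possibly noncommuting coefficients. Commutativity is won in the
  opposite direction: that of the \<psi>'s gives that of the bracketed Q's, from which the Q's and
  from these the h's are recovered recursively. Only this makes the usual rules for exponentials
  applicable.\<close>

locale scalar_algebra =
  fixes scl :: "'f::field_char_0 \<Rightarrow> 'r::ring_1 \<Rightarrow> 'r" (infixr "*s" 75)
  assumes scl_add_right: "c *s (x + y) = c *s x + c *s y"
    and scl_add_left: "(c + d) *s x = c *s x + d *s x"
    and scl_scl [simp]: "c *s d *s x = (c * d) *s x"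
    and scl_one [simp]: "1 *s x = x"
    and scl_mult_left [simp]: "(c *s x) * y = c *s (x * y)"
    and scl_mult_right [simp]: "x * (c *s y) = c *s (x * y)"
begin

lemma scl_zero_left [simp]: "0 *s x = 0"
  using scl_add_left [of 0 0 x] by simp

lemma scl_zero_right [simp]: "c *s 0 = 0"
  using scl_add_right [of c 0 0] by simp

lemma scl_minus_right [simp]: "c *s (- x) = - (c *s x)"
  using scl_add_right [of c x "- x"] by (simp add: eq_neg_iff_add_eq_0 add.commute)

lemma scl_minus_left [simp]: "(- c) *s x = - (c *s x)"
  using scl_add_left [of c "- c" x] by (simp add: eq_neg_iff_add_eq_0 add.commute)

lemma scl_diff_right: "c *s (x - y) = c *s x - c *s y"
  using scl_add_right [of c x "- y"] by simp

lemma scl_diff_left: "(c - d) *s x = c *s x - d *s x"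
  using scl_add_left [of c "- d" x] by simp

lemmas scl_distribs = scl_add_right scl_add_left scl_diff_right scl_diff_left

lemma scl_sum_right: "c *s (\<Sum>k\<in>S. x k) = (\<Sum>k\<in>S. c *s x k)"
  by (induction S rule: infinite_finite_induct) (simp_all add: scl_add_right)

lemma scl_sum_left: "(\<Sum>k\<in>S. c k) *s x = (\<Sum>k\<in>S. c k *s x)"
  by (induction S rule: infinite_finite_induct) (simp_all add: scl_add_left)

lemma scl_eq_0D: "c \<noteq> 0 \<Longrightarrow> c *s x = 0 \<Longrightarrow> x = 0"
  by (metis scl_scl scl_one left_inverse scl_zero_right)

lemma scl_eqD: "c *s x = c *s y \<Longrightarrow> c \<noteq> 0 \<Longrightarrow> x = y"
  by (metis scl_scl scl_one left_inverse)

lemma double_eq_0D: "x + x = 0 \<Longrightarrow> x = (0 :: 'r)"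
proof -
  assume "x + x = 0"
  hence "(1 + 1 :: 'f) *s x = 0" unfolding scl_add_left by simp
  thus "x = 0" by (rule scl_eq_0D [rotated]) simp
qed

lemma of_nat_mult_eq_scl: "of_nat n * x = of_nat n *s x"
  by (induction n) (simp_all add: scl_add_left distrib_right)

end

definition comm_br :: "'r::ring \<Rightarrow> 'r \<Rightarrow> 'r" where
  "comm_br x y = x * y - y * x"

lemma comm_br_mult_left: "comm_br (x * y) z = x * comm_br y z + comm_br x z * y"
  and comm_br_mult_right: "comm_br x (y * z) = comm_br x y * z + y * comm_br x z"
  and comm_br_add_left: "comm_br (x + y) z = comm_br x z + comm_br y z"
  and comm_br_add_right: "comm_br x (y + z) = comm_br x y + comm_br x z"
  and comm_br_diff_left: "comm_br (x - y) z = comm_br x z - comm_br y z"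
  and comm_br_diff_right: "comm_br x (y - z) = comm_br x y - comm_br x z"
  by (simp_all add: comm_br_def algebra_simps)

lemmas comm_br_simps = comm_br_mult_left comm_br_mult_right comm_br_add_left comm_br_add_right
  comm_br_diff_left comm_br_diff_right

context scalar_algebra
begin

lemma comm_br_scl_left: "comm_br (c *s x) y = c *s comm_br x y"
  and comm_br_scl_right: "comm_br x (c *s y) = c *s comm_br x y"
  by (simp_all add: comm_br_def scl_distribs)

lemmas comm_br_scl = comm_br_scl_left comm_br_scl_right

end

text \<open>\<open>e\<close> stands for the formal sum of all idempotents; it is a unit for the
  generators but not for the ring. \<open>C\<close> is q^c, and \<open>\<psi> i n\<close>,
  \<open>\<phi> i n\<close> are the modes of the Cartan currents, rescaled so that the three cases
  of (R3) become the single formula \<open>E_F\<close>. The zeroth modes are q to the power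
  \<plusminus><lambda,i> and encode the weights. Of (R2) only the scalar commutator
  \<open>heis\<close> of the first modes enters.\<close>

locale loop_relations = scalar_algebra scl
  for scl :: "'f::field_char_0 \<Rightarrow> 'r::ring_1 \<Rightarrow> 'r" (infixr "*s" 75) +
  fixes q C :: 'f and a :: "'i \<Rightarrow> 'i \<Rightarrow> int" and e :: 'r
    and E F \<psi> \<phi> :: "'i \<Rightarrow> int \<Rightarrow> 'r"
  assumes q_nz: "q \<noteq> 0" and C_nz: "C \<noteq> 0" and q_nroot: "\<And>n. n > 0 \<Longrightarrow> q ^ n \<noteq> 1"
    and a_diag: "a i i = 2" and a_off: "i \<noteq> j \<Longrightarrow> a i j = 0 \<or> a i j = - 1" and a_sym: "a i j = a j i"
    and e_E: "e * E i n = E i n" and E_e: "E i n * e = E i n"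
    and e_F: "e * F i n = F i n" and F_e: "F i n * e = F i n"
    and e_\<psi>: "e * \<psi> i n = \<psi> i n" and \<psi>_e: "\<psi> i n * e = \<psi> i n"
    and e_\<phi>: "e * \<phi> i n = \<phi> i n" and \<phi>_e: "\<phi> i n * e = \<phi> i n"
    and \<psi>_neg: "n < 0 \<Longrightarrow> \<psi> i n = 0" and \<phi>_pos: "n > 0 \<Longrightarrow> \<phi> i n = 0"
    and \<psi>0_\<phi>0: "\<psi> i 0 * \<phi> i 0 = e" and \<phi>0_\<psi>0: "\<phi> i 0 * \<psi> i 0 = e"
    and \<psi>0_E: "\<psi> i 0 * E j n = q powi a i j *s (E j n * \<psi> i 0)"
    and \<psi>0_F: "\<psi> i 0 * F j n = q powi (- a i j) *s (F j n * \<psi> i 0)"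
    and \<psi>0_\<psi>: "\<psi> i 0 * \<psi> j n = \<psi> j n * \<psi> i 0" and \<psi>0_\<phi>: "\<psi> i 0 * \<phi> j n = \<phi> j n * \<psi> i 0"
    and E_F: "E i m * F i n - F i n * E i m =
        inverse (q - inverse q) *s (C powi m *s \<psi> i (m + n) - C powi n *s \<phi> i (m + n))"
    and E_F_neq: "i \<noteq> j \<Longrightarrow> E i m * F j n = F j n * E i m"
    and E_E: "E i n * E i (n - 1) = q ^ 2 *s (E i (n - 1) * E i n)"
    and F_F: "F i (n - 1) * F i n = q ^ 2 *s (F i n * F i (n - 1))"
    and E_E_adj: "a i j = - 1 \<Longrightarrow>
        E i 1 * E j 0 + E j 1 * E i 0 = inverse q *s (E j 0 * E i 1 + E i 0 * E j 1)"
    and F_F_adj: "a i j = - 1 \<Longrightarrow>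
        F i (- 1) * F j 0 + F j (- 1) * F i 0 = inverse q *s (F j 0 * F i (- 1) + F i 0 * F j (- 1))"
    and E_E_0: "a i j = 0 \<Longrightarrow> E i m * E j n = E j n * E i m"
    and F_F_0: "a i j = 0 \<Longrightarrow> F i m * F j n = F j n * F i m"
    and E_serre: "a i j = - 1 \<Longrightarrow> E j n * E i m * E i m + E i m * E i m * E j n =
        (q + inverse q) *s (E i m * E j n * E i m)"
    and F_serre: "a i j = - 1 \<Longrightarrow> F j n * F i m * F i m + F i m * F i m * F j n =
        (q + inverse q) *s (F i m * F j n * F i m)"
    and heis: "\<exists>x. comm_br (\<psi> i 1 * \<phi> i 0) (\<phi> j (- 1) * \<psi> j 0) = x *s e"
begin

lemma inverse_q_neq: "q - inverse q \<noteq> 0"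
proof
  assume "q - inverse q = 0"
  hence "q ^ 2 = 1" using q_nz by (simp add: field_simps power2_eq_square)
  with q_nroot [of 2] show False by simp
qed

lemma \<phi>0_comm_scaled:
  assumes "\<psi> i 0 * X = q powi b *s (X * \<psi> i 0)" "e * X = X" "X * e = X"
  shows "\<phi> i 0 * X = q powi (- b) *s (X * \<phi> i 0)"
proof -
  have "X * \<phi> i 0 = \<phi> i 0 * (\<psi> i 0 * X) * \<phi> i 0"
    using assms(2) by (simp add: mult.assoc [symmetric] \<phi>0_\<psi>0)
  also have "\<dots> = q powi b *s (\<phi> i 0 * (X * (\<psi> i 0 * \<phi> i 0)))"
    unfolding assms(1) by (simp add: mult.assoc)
  also have "\<dots> = q powi b *s (\<phi> i 0 * X)"
    by (simp add: \<psi>0_\<phi>0 assms(3))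
  finally show ?thesis using q_nz by (simp add: power_int_minus)
qed

lemma \<phi>0_E: "\<phi> i 0 * E j n = q powi (- a i j) *s (E j n * \<phi> i 0)"
  by (rule \<phi>0_comm_scaled) (simp_all add: \<psi>0_E e_E E_e)

lemma \<phi>0_F: "\<phi> i 0 * F j n = q powi (a i j) *s (F j n * \<phi> i 0)"
  using \<phi>0_comm_scaled [of i "F j n" "- a i j"] by (simp add: \<psi>0_F e_F F_e)

lemma \<phi>0_comm: "\<psi> i 0 * X = X * \<psi> i 0 \<Longrightarrow> e * X = X \<Longrightarrow> X * e = X \<Longrightarrow> \<phi> i 0 * X = X * \<phi> i 0"
  using \<phi>0_comm_scaled [of i X 0] by simp

text \<open>The symmetry through which every result on \<open>E\<close> yields one on
  \<open>F\<close>. Interchanging \<open>\<psi>\<close> and \<open>\<phi>\<close> absorbs the sign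
  from reversing the commutator of E and F, and negating the modes inverts \<open>C\<close>.\<close>

lemma swap:
  "loop_relations scl q (inverse C) a e (\<lambda>i n. F i (- n)) (\<lambda>i n. E i (- n))
     (\<lambda>i n. \<phi> i (- n)) (\<lambda>i n. \<psi> i (- n))"
proof unfold_locales
  show "\<phi> i (- 0) * F j (- n) = q powi a i j *s (F j (- n) * \<phi> i (- 0))" for i j n
    by (simp add: \<phi>0_F)
  show "\<phi> i (- 0) * E j (- n) = q powi (- a i j) *s (E j (- n) * \<phi> i (- 0))" for i j n
    by (simp add: \<phi>0_E)
  show "\<phi> i (- 0) * \<phi> j (- n) = \<phi> j (- n) * \<phi> i (- 0)"
    "\<phi> i (- 0) * \<psi> j (- n) = \<psi> j (- n) * \<phi> i (- 0)" for i j n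
    by (simp_all add: \<phi>0_comm \<psi>0_\<psi> \<psi>0_\<phi> e_\<psi> \<psi>_e e_\<phi> \<phi>_e)
  show "F i (- m) * E i (- n) - E i (- n) * F i (- m) =
       inverse (q - inverse q) *s
         (inverse C powi m *s \<phi> i (- (m + n)) - inverse C powi n *s \<psi> i (- (m + n)))" for i m n
    using E_F [of i "- n" "- m"]
    by (simp add: scl_diff_right power_int_minus power_int_inverse algebra_simps)
  show "\<exists>x. comm_br (\<phi> i (- 1) * \<psi> i (- 0)) (\<psi> j (- (- 1)) * \<phi> j (- 0)) = x *s e" for i j
  proof -
    obtain x where "comm_br (\<psi> j 1 * \<phi> j 0) (\<phi> i (- 1) * \<psi> i 0) = x *s e" using heis by blast
    hence "comm_br (\<phi> i (- 1) * \<psi> i 0) (\<psi> j 1 * \<phi> j 0) = (- x) *s e"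
      by (simp add: comm_br_def algebra_simps)
    thus ?thesis by (intro exI [of _ "- x"]) simp
  qed
  show "F i (- n) * F i (- (n - 1)) = q\<^sup>2 *s (F i (- (n - 1)) * F i (- n))" for i n
    using F_F [of i "1 - n"] by simp
  show "E i (- (n - 1)) * E i (- n) = q\<^sup>2 *s (E i (- n) * E i (- (n - 1)))" for i n
    using E_E [of i "1 - n"] by simp
  show "i \<noteq> j \<Longrightarrow> a i j = 0 \<or> a i j = - 1" "a i j = a j i" for i j
    by (fact a_off, fact a_sym)
  show "n > 0 \<Longrightarrow> q ^ n \<noteq> 1" for n
    by (fact q_nroot)
  show "n < 0 \<Longrightarrow> \<phi> i (- n) = 0" "n > 0 \<Longrightarrow> \<psi> i (- n) = 0" for i n
    by (simp_all add: \<phi>_pos \<psi>_neg)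
  show "i \<noteq> j \<Longrightarrow> F i (- m) * E j (- n) = E j (- n) * F i (- m)" for i j m n
    using E_F_neq [of j i] by metis
  show "a i j = - 1 \<Longrightarrow> F i (- 1) * F j (- 0) + F j (- 1) * F i (- 0) =
      inverse q *s (F j (- 0) * F i (- 1) + F i (- 0) * F j (- 1))" for i j
    using F_F_adj by simp
  show "a i j = - 1 \<Longrightarrow> E i (- (- 1)) * E j (- 0) + E j (- (- 1)) * E i (- 0) =
      inverse q *s (E j (- 0) * E i (- (- 1)) + E i (- 0) * E j (- (- 1)))" for i j
    using E_E_adj by simp
  show "a i j = 0 \<Longrightarrow> E i (- m) * E j (- n) = E j (- n) * E i (- m)"
    "a i j = 0 \<Longrightarrow> F i (- m) * F j (- n) = F j (- n) * F i (- m)" for i j m n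
    by (fact E_E_0, fact F_F_0)
  show "a i j = - 1 \<Longrightarrow> F j (- n) * F i (- m) * F i (- m) + F i (- m) * F i (- m) * F j (- n) =
        (q + inverse q) *s (F i (- m) * F j (- n) * F i (- m))"
    "a i j = - 1 \<Longrightarrow> E j (- n) * E i (- m) * E i (- m) + E i (- m) * E i (- m) * E j (- n) =
        (q + inverse q) *s (E i (- m) * E j (- n) * E i (- m))" for i j m n
    by (fact F_serre, fact E_serre)
qed (simp_all add: q_nz C_nz a_diag e_E E_e e_F F_e e_\<psi> \<psi>_e e_\<phi> \<phi>_e \<psi>0_\<phi>0 \<phi>0_\<psi>0)

section \<open>Exchange of the Cartan currents with E\<close>

definition XP :: "'i \<Rightarrow> 'i \<Rightarrow> int \<Rightarrow> int \<Rightarrow> 'r" where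
  "XP i j k n = C *s (\<psi> i (k + 1) * E j n) - q powi a i j *s (\<psi> i k * E j (n + 1)) -
     (q powi a i j * C) *s (E j n * \<psi> i (k + 1)) + E j (n + 1) * \<psi> i k"

text \<open>\<open>XP\<close> and \<open>XM\<close> are the differences of the two sides of (D4) in
  the modes k and n, for E with \<open>\<psi>\<close> and with \<open>\<phi>\<close>, up to the
  rescaling of the modes.\<close>

definition XM :: "'i \<Rightarrow> 'i \<Rightarrow> int \<Rightarrow> int \<Rightarrow> 'r" where
  "XM i j k n = \<phi> i (k + 1) * E j n - q powi a i j *s (\<phi> i k * E j (n + 1)) -
     q powi a i j *s (E j n * \<phi> i (k + 1)) + E j (n + 1) * \<phi> i k"

definition EFbr :: "'i \<Rightarrow> int \<Rightarrow> int \<Rightarrow> 'r" where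
  "EFbr i m b = C powi m *s \<psi> i (m + b) - C powi b *s \<phi> i (m + b)"

lemma comm_E_F: "comm_br (E i m) (F j b) =
    (if i = j then inverse (q - inverse q) *s EFbr i m b else 0)"
  by (simp add: comm_br_def E_F E_F_neq EFbr_def)

text \<open>The hypothesis mixes \<open>\<psi>\<close> and \<open>\<phi>\<close>, but these live in
  nonnegative and in nonpositive modes. For k \<ge> 0 \<open>XM\<close> vanishes by itself, for k <
  0 \<open>XP\<close> does, and the hypothesis at b = k - m says that nonzero multiples of the two
  are equal.\<close>

lemma XP_XM_eq_0:
  assumes H: "\<And>b. EFbr i (m + 1) b * E j n - q powi a i j *s (EFbr i m b * E j (n + 1)) =
     q powi a i j *s (E j n * EFbr i (m + 1) b) - E j (n + 1) * EFbr i m b"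
  shows "XP i j k n = 0" "XM i j k n = 0"
proof -
  have eq: "C powi m *s XP i j k n = C powi (k - m) *s XM i j k n"
  proof -
    have "C powi m *s XP i j k n - C powi (k - m) *s XM i j k n =
       EFbr i (m + 1) (k - m) * E j n - q powi a i j *s (EFbr i m (k - m) * E j (n + 1)) -
       (q powi a i j *s (E j n * EFbr i (m + 1) (k - m)) - E j (n + 1) * EFbr i m (k - m))"
      using C_nz by (simp add: XP_def XM_def EFbr_def scl_distribs power_int_add algebra_simps)
    with H [of "k - m"] show ?thesis by simp
  qed
  have "XP i j k n = 0 \<and> XM i j k n = 0"
  proof (cases "k \<ge> 0")
    case True
    have "XM i j k n = 0"
    proof (cases "k = 0")
      case True
      thus ?thesis using q_nz by (simp add: XM_def \<phi>_pos \<phi>0_E power_int_minus)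
    next
      case False
      with True show ?thesis by (simp add: XM_def \<phi>_pos)
    qed
    with eq C_nz scl_eq_0D [of "C powi m"] show ?thesis by simp
  next
    case False
    have "XP i j k n = 0"
    proof (cases "k = - 1")
      case True
      thus ?thesis by (simp add: XP_def \<psi>_neg \<psi>0_E mult.commute)
    next
      case False
      with \<open>\<not> k \<ge> 0\<close> show ?thesis by (simp add: XP_def \<psi>_neg)
    qed
    with eq C_nz scl_eq_0D [of "C powi (k - m)" "XM i j k n"] show ?thesis by simp
  qed
  thus "XP i j k n = 0" "XM i j k n = 0" by auto
qed

lemma XP_XM_diag: "XP i i k n = 0" "XM i i k n = 0"
proof -
  have H: "EFbr i (n + 1) b * E i n - q powi a i i *s (EFbr i n b * E i (n + 1)) =
     q powi a i i *s (E i n * EFbr i (n + 1) b) - E i (n + 1) * EFbr i n b" for b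
  proof -
    let ?c = "inverse (q - inverse q)"
    have "comm_br (E i (n + 1) * E i n) (F i b) = comm_br (q ^ 2 *s (E i n * E i (n + 1))) (F i b)"
      using E_E [of i "n + 1"] by simp
    hence "?c *s (E i (n + 1) * EFbr i n b + EFbr i (n + 1) b * E i n) =
      ?c *s (q ^ 2 *s (E i n * EFbr i (n + 1) b + EFbr i n b * E i (n + 1)))"
      by (simp add: comm_br_mult_left comm_br_scl comm_E_F scl_add_right mult.commute)
    hence "E i (n + 1) * EFbr i n b + EFbr i (n + 1) b * E i n =
      q ^ 2 *s (E i n * EFbr i (n + 1) b + EFbr i n b * E i (n + 1))"
      by (rule scl_eqD) (use inverse_q_neq in simp)
    thus ?thesis by (simp add: a_diag scl_add_right algebra_simps)
  qed
  show "XP i i k n = 0" "XM i i k n = 0" by (rule XP_XM_eq_0, rule H)+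
qed

text \<open>The difference of the two sides of (D6), for i = j, or of (D7), for adjacent nodes, in
  the modes m and n up to rescaling. For nonadjacent nodes its vanishing follows from the
  commutation in (R5).\<close>

definition RE :: "'i \<Rightarrow> 'i \<Rightarrow> int \<Rightarrow> int \<Rightarrow> 'r" where
  "RE i j m n = E i (m + 1) * E j n - q powi a i j *s (E i m * E j (n + 1)) -
     q powi a i j *s (E j n * E i (m + 1)) + E j (n + 1) * E i m"

text \<open>A single m is enough for all k: commuting with F_{i,b} leaves E_j untouched, b is
  arbitrary, and the conclusion does not involve m. So (R5), which has m = 0 only, already
  determines how the currents of i pass E_{j,0}.\<close>

lemma XP_XM_neq:
  assumes "i \<noteq> j" "RE i j m n = 0"
  shows "XP i j k n = 0" "XM i j k n = 0"
proof -
  have H: "EFbr i (m + 1) b * E j n - q powi a i j *s (EFbr i m b * E j (n + 1)) =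
     q powi a i j *s (E j n * EFbr i (m + 1) b) - E j (n + 1) * EFbr i m b" for b
  proof -
    let ?c = "inverse (q - inverse q)"
    have "comm_br (RE i j m n) (F i b) = 0"
      by (simp add: assms comm_br_def)
    hence "?c *s (EFbr i (m + 1) b * E j n - q powi a i j *s (EFbr i m b * E j (n + 1)) -
        q powi a i j *s (E j n * EFbr i (m + 1) b) + E j (n + 1) * EFbr i m b) = 0"
      using assms(1)
      by (simp add: RE_def comm_br_simps comm_br_scl comm_E_F scl_distribs mult.commute)
    hence "EFbr i (m + 1) b * E j n - q powi a i j *s (EFbr i m b * E j (n + 1)) -
        q powi a i j *s (E j n * EFbr i (m + 1) b) + E j (n + 1) * EFbr i m b = 0"
      by (rule scl_eq_0D [rotated]) (use inverse_q_neq in simp)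
    thus ?thesis by (simp add: algebra_simps)
  qed
  show "XP i j k n = 0" "XM i j k n = 0" by (rule XP_XM_eq_0, rule H)+
qed

lemma RE_0: "a i j = 0 \<Longrightarrow> RE i j m n = 0"
  using E_E_0 [of i j m "n + 1"] E_E_0 [of i j "m + 1" n] by (simp add: RE_def)

lemma RE_adj_00: "a i j = - 1 \<Longrightarrow> RE i j 0 0 = 0"
  using E_E_adj [of i j] by (simp add: RE_def scl_add_right power_int_minus algebra_simps)

section \<open>The operators that shift the modes\<close>

definition H :: "'i \<Rightarrow> 'r" where "H i = \<psi> i 1 * \<phi> i 0"
text \<open>Up to nonzero scalars \<open>H i\<close> is h_{i,1} and \<open>H' i\<close> is h_{i,-1}:
  the first modes of the currents divided by the zeroth ones.\<close>

definition H' :: "'i \<Rightarrow> 'r" where "H' i = \<phi> i (- 1) * \<psi> i 0"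

lemma \<psi>1_eq: "\<psi> i 1 = H i * \<psi> i 0"
  by (simp add: H_def mult.assoc \<phi>0_\<psi>0 \<psi>_e)

lemma \<phi>1_eq: "\<phi> i (- 1) = H' i * \<phi> i 0"
  by (simp add: H'_def mult.assoc \<psi>0_\<phi>0 \<phi>_e)

text \<open>In \<open>XP\<close> at k = 0 the zeroth mode \<open>\<psi> i 0\<close> passes E_j at
  the cost of a power of q and is then cancelled by \<open>\<phi> i 0\<close> from the right. What
  remains is the bracket with h_{i,1}, which raises the mode; its factor is zero exactly for
  nonadjacent i and j.\<close>

lemma H_E:
  assumes "XP i j 0 n = 0"
  shows "comm_br (H i) (E j n) = (inverse C * (q powi a i j - q powi (- a i j))) *s E j (n + 1)"
proof -
  let ?b = "q powi a i j"
  have b: "?b \<noteq> 0" using q_nz by simp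
  have "C *s (H i * (?b *s (E j n * \<psi> i 0))) - ?b *s (?b *s (E j (n + 1) * \<psi> i 0)) -
     (?b * C) *s (E j n * (H i * \<psi> i 0)) + E j (n + 1) * \<psi> i 0 = 0"
    using assms by (simp add: XP_def \<psi>1_eq \<psi>0_E mult.assoc)
  hence "((?b * C) *s comm_br (H i) (E j n) - (?b * ?b - 1) *s E j (n + 1)) * \<psi> i 0 * \<phi> i 0 = 0"
    by (simp add: comm_br_def scl_distribs algebra_simps)
  hence "(?b * C) *s comm_br (H i) (E j n) - (?b * ?b - 1) *s E j (n + 1) = 0"
    by (simp add: mult.assoc \<psi>0_\<phi>0 comm_br_def H_def algebra_simps E_e \<phi>_e)
  moreover have "?b * ?b - 1 = ?b * C * (inverse C * (?b - inverse ?b))"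
    using b C_nz by (simp add: field_simps)
  ultimately have "(?b * C) *s comm_br (H i) (E j n) =
      (?b * C) *s (inverse C * (?b - inverse ?b)) *s E j (n + 1)"
    by simp
  thus ?thesis using b C_nz scl_eqD [of "?b * C"] by (simp add: power_int_minus)
qed

lemma H'_E:
  assumes "XM i j (- 1) n = 0"
  shows "comm_br (H' i) (E j (n + 1)) = (- (q powi a i j - q powi (- a i j))) *s E j n"
proof -
  let ?b = "q powi a i j"
  have b: "?b \<noteq> 0" using q_nz by simp
  have "inverse ?b *s (E j n * \<phi> i 0) - ?b *s (H' i * (inverse ?b *s (E j (n + 1) * \<phi> i 0))) -
     ?b *s (E j n * \<phi> i 0) + E j (n + 1) * (H' i * \<phi> i 0) = 0"
    using assms by (simp add: XM_def \<phi>1_eq \<phi>0_E mult.assoc power_int_minus)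
  hence "(comm_br (H' i) (E j (n + 1)) + (?b - inverse ?b) *s E j n) * \<phi> i 0 * \<psi> i 0 = 0"
    using b by (simp add: comm_br_def scl_distribs algebra_simps)
  hence "comm_br (H' i) (E j (n + 1)) + (?b - inverse ?b) *s E j n = 0"
    by (simp add: mult.assoc \<phi>0_\<psi>0 comm_br_def H'_def algebra_simps E_e \<psi>_e)
  thus ?thesis by (simp only: scl_minus_left eq_neg_iff_add_eq_0 power_int_minus)
qed

text \<open>The Jacobi identity: the two adjoint actions differ by the bracket with a multiple of
  \<open>e\<close>, and \<open>e\<close> is a unit for x.\<close>

lemma comm_H_H':
  assumes "e * x = x" "x * e = x"
  shows "comm_br (H i) (comm_br (H' j) x) = comm_br (H' j) (comm_br (H i) x)"
proof -
  obtain s where "comm_br (H i) (H' j) = s *s e"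
    using heis by (auto simp: H_def H'_def)
  hence "comm_br (comm_br (H i) (H' j)) x = 0"
    using assms by (simp add: comm_br_def)
  thus ?thesis by (simp add: comm_br_def algebra_simps)
qed

text \<open>The factor by which \<open>H i\<close> and \<open>H' i\<close> shift the modes of their
  own E_i; being nonzero, it can be divided out when a bracket is carried to a neighbouring
  mode.\<close>

lemma q2_neq: "q powi 2 - q powi (- 2) \<noteq> 0"
proof
  assume "q powi 2 - q powi (- 2) = 0"
  hence "q ^ 4 = 1" using q_nz by (simp add: power_int_minus field_simps)
  with q_nroot [of 4] show False by simp
qed

text \<open>(R5) covers n = 0. In the descending induction E_{j,n-1} is written as a bracket of
  E_{j,n} with \<open>H' j\<close>, which the diagonal case permits, and the two adjoint actions are
  interchanged.\<close>

lemma H_E_le: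
  assumes ij: "a i j = - 1" and n: "n \<le> 0"
  shows "comm_br (H i) (E j n) = (inverse C * (q powi a i j - q powi (- a i j))) *s E j (n + 1)"
  using n
proof (induction n rule: int_le_induct)
  case base
  have "i \<noteq> j" using ij a_diag by auto
  from XP_XM_neq(1) [OF this RE_adj_00 [OF ij]] show ?case by (rule H_E)
next
  case (step n)
  let ?g = "inverse C * (q powi a i j - q powi (- a i j))" and ?d = "- (q powi 2 - q powi (- 2))"
  have d: "comm_br (H' j) (E j (m + 1)) = ?d *s E j m" for m
    using H'_E [OF XP_XM_diag(2)] by (simp add: a_diag)
  have "?d *s comm_br (H i) (E j (n - 1)) = comm_br (H i) (comm_br (H' j) (E j n))"
    using d [of "n - 1"] by (simp add: comm_br_scl)
  also have "\<dots> = comm_br (H' j) (?g *s E j (n + 1))"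
    by (simp add: comm_H_H' e_E E_e step.IH)
  also have "\<dots> = ?d *s ?g *s E j (n - 1 + 1)"
    unfolding comm_br_scl d by (simp add: mult.commute)
  finally show ?case by (rule scl_eqD) (use q2_neq in simp)
qed

lemma H'_E_ge:
  assumes ij: "a i j = - 1" and n: "n \<ge> 1"
  shows "comm_br (H' i) (E j n) = (- (q powi a i j - q powi (- a i j))) *s E j (n - 1)"
  using n
proof (induction n rule: int_ge_induct)
  case base
  have "i \<noteq> j" using ij a_diag by auto
  \<comment> \<open>\<open>XM\<close> at n = 0 is the mode pair of (R5) again: it lowers E_{j,1} to
    E_{j,0}, so the induction starts at 1.\<close>
  from XP_XM_neq(2) [OF this RE_adj_00 [OF ij]] H'_E [of i j 0] show ?case by simp
next
  case (step n)
  let ?d = "- (q powi a i j - q powi (- a i j))" and ?g = "inverse C * (q powi 2 - q powi (- 2))"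
  have g: "comm_br (H j) (E j m) = ?g *s E j (m + 1)" for m
    using H_E [OF XP_XM_diag(1)] by (simp add: a_diag)
  have "?g *s comm_br (H' i) (E j (n + 1)) = comm_br (H' i) (comm_br (H j) (E j n))"
    unfolding g comm_br_scl ..
  also have "\<dots> = comm_br (H j) (?d *s E j (n - 1))"
    by (simp add: comm_H_H' [symmetric] e_E E_e step.IH)
  also have "\<dots> = ?g *s ?d *s E j (n + 1 - 1)"
    unfolding comm_br_scl g by (simp add: mult.commute)
  finally show ?case by (rule scl_eqD) (use q2_neq C_nz in simp)
qed

end

section \<open>Quadratic relations between adjacent nodes\<close>

context scalar_algebra
begin

text \<open>When \<open>h * K\<close> is moved to the far right, all terms in which h itself
  survives cancel, because x and y have the \<open>K\<close>-weights p^2 and p^{-1}. The brackets x'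
  and y' are what is left. The roles are x = E_i, y = E_j, \<open>h * K\<close> a first mode of a
  current of i.\<close>

lemma serre_bracket:
  fixes K h x y x' y' :: 'r
  assumes Kx: "K * x = p\<^sup>2 *s (x * K)" and Ky: "K * y = inverse p *s (y * K)" and p: "p \<noteq> 0"
    and hx: "comm_br h x = x'" and hy: "comm_br h y = y'"
    and S: "y * (x * (h * K) + h * K * x) + (x * (h * K) + h * K * x) * y =
        (p + inverse p) *s (x * y * (h * K) + h * K * y * x)"
  shows "((p + inverse p) *s (x * y') + p *s (x' * y) - (p\<^sup>2 + 1) *s (y' * x) - y * x') * K = 0"
proof -
  have hx': "h * x = x * h + x'" and hy': "h * y = y * h + y'"
    using hx hy by (auto simp: comm_br_def)
  have Kx2: "K * (x * z) = p\<^sup>2 *s (x * (K * z))" and Ky2: "K * (y * z) = inverse p *s (y * (K * z))"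
    and hx2: "h * (x * z) = x * (h * z) + x' * z" and hy2: "h * (y * z) = y * (h * z) + y' * z" for z
    by (simp_all add: mult.assoc [symmetric] Kx Ky hx' hy' distrib_right)
  have c1: "p * (inverse p * (p * p)) = p * p" and c2: "inverse p * (inverse p * (p * p)) = 1"
    using p by (simp_all add: field_simps)
  from S have "0 = y * (x * (h * K) + h * K * x) + (x * (h * K) + h * K * x) * y -
        (p + inverse p) *s (x * y * (h * K) + h * K * y * x)" by simp
  also have "\<dots> = ((p + inverse p) *s (x * y') + p *s (x' * y) - (p\<^sup>2 + 1) *s (y' * x) - y * x') * K"
    using p by (simp add: mult.assoc distrib_left distrib_right left_diff_distrib right_diff_distrib
        Kx Ky Kx2 Ky2 hx' hy' hx2 hy2 scl_distribs power2_eq_square c1 c2)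
  finally show ?thesis by simp
qed

end

context loop_relations
begin


lemma \<psi>0_cancel:
  assumes "X * \<psi> i 0 = 0" "X * e = X" shows "X = 0"
  by (metis assms \<psi>0_\<phi>0 mult.assoc mult_zero_left)

lemma \<phi>0_cancel:
  assumes "X * \<phi> i 0 = 0" "X * e = X" shows "X = 0"
  by (metis assms \<phi>0_\<psi>0 mult.assoc mult_zero_left)

text \<open>The derivation given by the bracket with F_{i,b} replaces each of the two factors
  E_{i,m} in (R6) in turn by X, and kills E_j since i and j differ.\<close>

lemma serre_bracket_F:
  assumes ij: "a i j = - 1" and b: "comm_br (E i m) (F i b) = c *s X" and c: "c \<noteq> 0"
  shows "E j n * (E i m * X + X * E i m) + (E i m * X + X * E i m) * E j n =
        (q + inverse q) *s (E i m * E j n * X + X * E j n * E i m)"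
proof -
  have neq: "j \<noteq> i" using ij a_diag by auto
  have "comm_br (E j n * E i m * E i m + E i m * E i m * E j n) (F i b) =
      comm_br ((q + inverse q) *s (E i m * E j n * E i m)) (F i b)"
    by (simp add: E_serre [OF ij])
  hence "c *s (E j n * (E i m * X + X * E i m) + (E i m * X + X * E i m) * E j n) =
      c *s ((q + inverse q) *s (E i m * E j n * X + X * E j n * E i m))"
    using comm_E_F [of j n i b] neq
    by (simp add: comm_br_simps comm_br_scl b scl_distribs distrib_left distrib_right mult.assoc
        mult.commute [of c] add_ac)
  thus ?thesis by (rule scl_eqD) (rule c)
qed

text \<open>The Serre relation holds for every m, and its bracket with F_i involves n only through
  the bracket of \<open>H i\<close> with E_{j,n}. So m is free, and n is restricted as in
  \<open>H_E_le\<close>.\<close>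

lemma RE_adj_le:
  assumes ij: "a i j = - 1" and n: "n \<le> 0"
  shows "RE i j m n = 0"
proof -
  define g1 where "g1 = inverse C * (inverse q - q)"
  define g2 where "g2 = inverse C * (q powi 2 - q powi (- 2))"
  have g2: "g2 \<noteq> 0" using C_nz q2_neq by (simp add: g2_def)
  have hx: "comm_br (H i) (E i m) = g2 *s E i (m + 1)"
    using H_E [OF XP_XM_diag(1), of i m] by (simp add: a_diag g2_def)
  have hy: "comm_br (H i) (E j n) = g1 *s E j (n + 1)"
    using H_E_le [OF ij n] ij by (simp add: g1_def power_int_minus)
  have "((q + inverse q) *s (E i m * (g1 *s E j (n + 1))) + q *s ((g2 *s E i (m + 1)) * E j n)
      - (q\<^sup>2 + 1) *s ((g1 *s E j (n + 1)) * E i m) - E j n * (g2 *s E i (m + 1))) * \<psi> i 0 = 0"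
  proof (rule serre_bracket [OF _ _ q_nz hx hy])
    show "\<psi> i 0 * E i m = q\<^sup>2 *s (E i m * \<psi> i 0)" using \<psi>0_E [of i i m] by (simp add: a_diag)
    show "\<psi> i 0 * E j n = inverse q *s (E j n * \<psi> i 0)"
      using \<psi>0_E [of i j n] by (simp add: ij power_int_minus)
    \<comment> \<open>b = 1 - m puts the commutator into total mode 1, where \<open>\<phi>\<close>
      vanishes and \<open>\<psi>\<close> is \<open>H i * \<psi> i 0\<close>.\<close>
    have "comm_br (E i m) (F i (1 - m)) = (inverse (q - inverse q) * C powi m) *s (H i * \<psi> i 0)"
      by (simp add: comm_E_F EFbr_def \<phi>_pos \<psi>1_eq)
    from serre_bracket_F [OF ij this]
    show "E j n * (E i m * (H i * \<psi> i 0) + H i * \<psi> i 0 * E i m) +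
        (E i m * (H i * \<psi> i 0) + H i * \<psi> i 0 * E i m) * E j n =
        (q + inverse q) *s (E i m * E j n * (H i * \<psi> i 0) + H i * \<psi> i 0 * E j n * E i m)"
      using inverse_q_neq C_nz by simp
  qed
  hence "(q + inverse q) *s (E i m * (g1 *s E j (n + 1))) + q *s ((g2 *s E i (m + 1)) * E j n)
      - (q\<^sup>2 + 1) *s ((g1 *s E j (n + 1)) * E i m) - E j n * (g2 *s E i (m + 1)) = 0" (is "?B = 0")
    by (rule \<psi>0_cancel) (simp add: E_e mult.assoc left_diff_distrib distrib_right)
  moreover have "?B = (q * g2) *s RE i j m n"
  proof -
    \<comment> \<open>The shift factors of E_j and E_i are related by [2] g1 = - g2; with this the
      four brackets become the four terms of \<open>RE\<close>.\<close>
    have k: "(q + inverse q) * g1 = - g2" "(q\<^sup>2 + 1) * g1 = - (q * g2)"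
      and k': "q * g2 * inverse q = g2"
      using q_nz C_nz by (simp_all add: g1_def g2_def power_int_minus field_simps power2_eq_square)
    show ?thesis
      unfolding RE_def ij by (simp add: power_int_minus scl_add_right scl_diff_right k k')
  qed
  ultimately show ?thesis using scl_eq_0D [of "q * g2"] q_nz g2 by simp
qed

text \<open>The mirror image of \<open>RE_adj_le\<close> with \<open>H'\<close> and
  \<open>\<phi> i 0\<close>, whence inverse q in place of q. As \<open>H'\<close> lowers modes, the
  Serre relation is taken at m + 1 and n + 1; b = - m - 2 then gives the total mode -1, where only
  \<open>\<phi>\<close> contributes.\<close>

lemma RE_adj_ge:
  assumes ij: "a i j = - 1" and n: "n \<ge> 0"
  shows "RE i j m n = 0"
proof -
  define g1 where "g1 = q - inverse q"
  define g2 where "g2 = - (q powi 2 - q powi (- 2))"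
  have g2: "g2 \<noteq> 0" using q2_neq by (simp add: g2_def)
  have hx: "comm_br (H' i) (E i (m + 1)) = g2 *s E i m"
    using H'_E [OF XP_XM_diag(2), of i m] by (simp add: a_diag g2_def)
  have hy: "comm_br (H' i) (E j (n + 1)) = g1 *s E j n"
    using H'_E_ge [OF ij, of "n + 1"] n ij by (simp add: g1_def power_int_minus)
  have "((inverse q + inverse (inverse q)) *s (E i (m + 1) * (g1 *s E j n))
      + inverse q *s ((g2 *s E i m) * E j (n + 1))
      - ((inverse q)\<^sup>2 + 1) *s ((g1 *s E j n) * E i (m + 1)) - E j (n + 1) * (g2 *s E i m)) * \<phi> i 0 = 0"
  proof (rule serre_bracket [OF _ _ _ hx hy])
    show "inverse q \<noteq> 0" using q_nz by simp
    show "\<phi> i 0 * E i (m + 1) = (inverse q)\<^sup>2 *s (E i (m + 1) * \<phi> i 0)"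
      using \<phi>0_E [of i i "m + 1"] by (simp add: a_diag power_int_minus power_inverse)
    show "\<phi> i 0 * E j (n + 1) = inverse (inverse q) *s (E j (n + 1) * \<phi> i 0)"
      using \<phi>0_E [of i j "n + 1"] by (simp add: ij power_int_minus)
    have "comm_br (E i (m + 1)) (F i (- m - 2)) =
        (- (inverse (q - inverse q) * C powi (- m - 2))) *s (H' i * \<phi> i 0)"
      by (simp add: comm_E_F EFbr_def \<psi>_neg \<phi>1_eq)
    from serre_bracket_F [OF ij this, of "n + 1"]
    show "E j (n + 1) * (E i (m + 1) * (H' i * \<phi> i 0) + H' i * \<phi> i 0 * E i (m + 1)) +
        (E i (m + 1) * (H' i * \<phi> i 0) + H' i * \<phi> i 0 * E i (m + 1)) * E j (n + 1) =
        (inverse q + inverse (inverse q)) *s (E i (m + 1) * E j (n + 1) * (H' i * \<phi> i 0) +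
           H' i * \<phi> i 0 * E j (n + 1) * E i (m + 1))"
      using inverse_q_neq C_nz by (simp add: add.commute)
  qed
  hence "(inverse q + inverse (inverse q)) *s (E i (m + 1) * (g1 *s E j n))
      + inverse q *s ((g2 *s E i m) * E j (n + 1))
      - ((inverse q)\<^sup>2 + 1) *s ((g1 *s E j n) * E i (m + 1)) - E j (n + 1) * (g2 *s E i m) = 0"
    (is "?B = 0")
    by (rule \<phi>0_cancel) (simp add: E_e mult.assoc left_diff_distrib distrib_right)
  moreover have "?B = (- g2) *s RE i j m n"
  proof -
    have "(inverse q + inverse (inverse q)) * g1 = - g2" "((inverse q)\<^sup>2 + 1) * g1 = - (inverse q * g2)"
      using q_nz by (simp_all add: g1_def g2_def power_int_minus field_simps power2_eq_square)
    thus ?thesis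
      unfolding RE_def ij
      by (simp add: power_int_minus scl_add_right scl_diff_right mult.commute [of g2])
  qed
  ultimately show ?thesis using scl_eq_0D [of "- g2"] g2 by simp
qed

lemma RE_neq: "i \<noteq> j \<Longrightarrow> RE i j m n = 0"
  using a_off [of i j] RE_0 RE_adj_le RE_adj_ge by (metis linear)

lemma XP_eq_0: "XP i j k n = 0" and XM_eq_0: "XM i j k n = 0"
  using XP_XM_diag [of i k n] XP_XM_neq [of i j, OF _ RE_neq] by (cases "i = j"; simp)+

lemma H_E_all: "comm_br (H i) (E j n) = (inverse C * (q powi a i j - q powi (- a i j))) *s E j (n + 1)"
  by (rule H_E [OF XP_eq_0])

section \<open>Quadratic and Serre relations in all modes\<close>

lemma H_E_diag:
  obtains g where "g \<noteq> 0" "\<And>n. comm_br (H i) (E i n) = g *s E i (n + 1)"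
proof
  show "inverse C * (q powi 2 - q powi (- 2)) \<noteq> 0" using C_nz q2_neq by simp
  show "comm_br (H i) (E i n) = (inverse C * (q powi 2 - q powi (- 2))) *s E i (n + 1)" for n
    using H_E_all [of i i] by (simp add: a_diag)
qed

text \<open>Induction on the distance of m and n. The step taken at distance d - 1 expresses
  distance d through distance d - 2; at distance 1 symmetry makes both summands equal, and 2 is
  invertible. The last argument t is a further mode which the bracket may shift as well, so that
  vanishing is assumed for all t at once.\<close>

lemma symmetric_vanishing:
  fixes f :: "int \<Rightarrow> int \<Rightarrow> int \<Rightarrow> 'r"
  assumes sym: "\<And>m n. f m n = f n m" and diag: "\<And>n. f n n = (\<lambda>_. 0)"
    and step: "\<And>m n t. f m n = (\<lambda>_. 0) \<Longrightarrow> f (m + 1) n t + f m (n + 1) t = 0"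
  shows "f m n t = 0"
proof -
  have pos: "f (n + int d) n = (\<lambda>_. 0)" for d n
  proof (induction d arbitrary: n rule: less_induct)
    case (less d)
    consider "d = 0" | "d = 1" | d' where "d = Suc (Suc d')"
      by (metis One_nat_def not0_implies_Suc)
    thus ?case
    proof cases
      case 1
      thus ?thesis by (simp add: diag)
    next
      case 2
      have "f (n + 1) n t = 0" for t
        using step [OF diag [of n], of t] unfolding sym [of n "n + 1"] by (rule double_eq_0D)
      thus ?thesis unfolding 2 by (simp add: fun_eq_iff)
    next
      case 3
      have "f (n + int (Suc d')) n = (\<lambda>_. 0)" by (rule less.IH) (simp add: 3)
      from step [OF this] have 1: "f (n + int (Suc d') + 1) n t + f (n + int (Suc d')) (n + 1) t = 0" for t .
      have "f (n + 1 + int d') (n + 1) = (\<lambda>_. 0)" by (rule less.IH) (simp add: 3)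
      hence "f (n + int (Suc d')) (n + 1) t = 0" for t by (simp add: add_ac)
      with 1 have "f (n + int (Suc d') + 1) n t = 0" for t by simp
      moreover have "n + int d = n + int (Suc d') + 1" by (simp add: 3)
      ultimately show ?thesis by metis
    qed
  qed
  show ?thesis
  proof (cases "m \<ge> n")
    case True
    with pos [of n "nat (m - n)"] show ?thesis by simp
  next
    case False
    with pos [of m "nat (n - m)"] have "f n m = (\<lambda>_. 0)" by simp
    thus ?thesis by (simp add: sym [of m n])
  qed
qed


text \<open>(R4) is the diagonal m = n, and the bracket with \<open>H i\<close> raises either of the
  two modes with the same factor.\<close>

lemma RE_diag: "RE i i m n = 0"
proof (rule symmetric_vanishing [where f = "\<lambda>m n t. RE i i m n"])
  show "(\<lambda>t. RE i i m n) = (\<lambda>t. RE i i n m)" for m n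
    by (simp add: RE_def algebra_simps)
  show "(\<lambda>t. RE i i n n) = (\<lambda>t. 0)" for n
    using E_E [of i "n + 1"] by (simp add: RE_def a_diag)
  show "RE i i (m + 1) n + RE i i m (n + 1) = 0"
    if "(\<lambda>t. RE i i m n) = (\<lambda>t. 0)" for m n and t :: int
  proof -
    obtain g where g: "g \<noteq> 0" and HE: "\<And>n. comm_br (H i) (E i n) = g *s E i (n + 1)"
      by (rule H_E_diag [of i]) blast
    have "0 = comm_br (H i) (RE i i m n)" using that by (simp add: comm_br_def fun_eq_iff)
    also have "\<dots> = g *s (RE i i (m + 1) n + RE i i m (n + 1))"
      unfolding RE_def comm_br_simps comm_br_scl HE
      by (simp add: scl_add_right scl_diff_right algebra_simps)
    finally have "g *s (RE i i (m + 1) n + RE i i m (n + 1)) = 0" by simp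
    with g show ?thesis by (rule scl_eq_0D)
  qed
qed

lemma RE_eq_0: "RE i j m n = 0"
  using RE_neq RE_diag by metis

text \<open>The polarisation of (R6) in the two modes of E_i, that is, the coefficient form of
  (D8).\<close>

definition SE :: "'i \<Rightarrow> 'i \<Rightarrow> int \<Rightarrow> int \<Rightarrow> int \<Rightarrow> 'r" where
  "SE i j m n t = (E j t * E i m * E i n + E j t * E i n * E i m)
     - (q + inverse q) *s (E i m * E j t * E i n + E i n * E j t * E i m)
     + (E i m * E i n * E j t + E i n * E i m * E j t)"

lemma SE_eq_0:
  assumes ij: "a i j = - 1"
  shows "SE i j m n t = 0"
proof (rule symmetric_vanishing [where f = "SE i j"])
  show "SE i j m n = SE i j n m" for m n
    by (simp add: SE_def fun_eq_iff add.commute)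
  show "SE i j n n = (\<lambda>_. 0)" for n
  proof
    fix t
    have "SE i j n n t = (E j t * E i n * E i n + E i n * E i n * E j t)
       - (q + inverse q) *s (E i n * E j t * E i n) +
      ((E j t * E i n * E i n + E i n * E i n * E j t) - (q + inverse q) *s (E i n * E j t * E i n))"
      by (simp add: SE_def scl_add_right)
    also have "\<dots> = 0" by (simp add: E_serre [OF ij])
    finally show "SE i j n n t = 0" .
  qed
  show "SE i j (m + 1) n t + SE i j m (n + 1) t = 0" if z: "SE i j m n = (\<lambda>_. 0)" for m n t
  proof -
    obtain g where g: "g \<noteq> 0" and HE: "\<And>n. comm_br (H i) (E i n) = g *s E i (n + 1)"
      by (rule H_E_diag [of i]) blast
    obtain g' where HE': "\<And>n. comm_br (H i) (E j n) = g' *s E j (n + 1)"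
      using H_E_all [of i j] by blast
    define c where "c = q + inverse q"
    have "0 = comm_br (H i) (SE i j m n t)" using z by (simp add: comm_br_def)
    \<comment> \<open>The bracket also raises the mode t of E_j; that contribution vanishes because
      the assumption holds for every t.\<close>
    also have "\<dots> = g *s (SE i j (m + 1) n t + SE i j m (n + 1) t) + g' *s SE i j m n (t + 1)"
      unfolding SE_def comm_br_simps comm_br_scl HE HE' c_def [symmetric]
      by (simp add: scl_add_right scl_diff_right algebra_simps)
    finally have "g *s (SE i j (m + 1) n t + SE i j m (n + 1) t) = 0" using z by simp
    with g show ?thesis by (rule scl_eq_0D)
  qed
qed

end

section \<open>Commutativity of the Cartan currents\<close>

lemma sum_triangle_swap:
  fixes f :: "nat \<Rightarrow> nat \<Rightarrow> 'b::comm_monoid_add"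
  shows "(\<Sum>l\<le>k. \<Sum>m\<le>k - l. f l m) = (\<Sum>t\<le>k. \<Sum>l\<le>t. f l (t - l))"
    and "(\<Sum>m\<le>k. \<Sum>l\<le>k - m. f l m) = (\<Sum>t\<le>k. \<Sum>l\<le>t. f l (t - l))"
proof -
  have 1: "(\<Sum>l\<le>k. \<Sum>m\<le>k - l. g l m) = (\<Sum>t\<le>k. \<Sum>l\<le>t. g l (t - l))"
    for g :: "nat \<Rightarrow> nat \<Rightarrow> 'b"
  proof -
    have "(\<Sum>l\<le>k. \<Sum>m\<le>k - l. g l m) = (\<Sum>(l, m)\<in>{(l, m). l + m \<le> k}. g l m)"
      by (subst sum.Sigma) (auto intro!: sum.cong)
    thus ?thesis by (simp add: sum.triangle_reindex_eq)
  qed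
  show "(\<Sum>l\<le>k. \<Sum>m\<le>k - l. f l m) = (\<Sum>t\<le>k. \<Sum>l\<le>t. f l (t - l))" by (rule 1)
  have "(\<Sum>m\<le>k. \<Sum>l\<le>k - m. f l m) = (\<Sum>t\<le>k. \<Sum>m\<le>t. f (t - m) m)" by (rule 1)
  also have "\<dots> = (\<Sum>t\<le>k. \<Sum>l\<le>t. f l (t - l))"
  proof (rule sum.cong [OF refl])
    fix t
    show "(\<Sum>m\<le>t. f (t - m) m) = (\<Sum>l\<le>t. f l (t - l))"
      by (rule sum.reindex_bij_witness [of _ "\<lambda>l. t - l" "\<lambda>l. t - l"]) auto
  qed
  finally show "(\<Sum>m\<le>k. \<Sum>l\<le>k - m. f l m) = (\<Sum>t\<le>k. \<Sum>l\<le>t. f l (t - l))" .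
qed

text \<open>The coefficients of \<open>(b - y x) / (1 - b y x)\<close>.\<close>

fun mobius_coeff :: "'f::field \<Rightarrow> 'f \<Rightarrow> nat \<Rightarrow> 'f" where
  "mobius_coeff y b 0 = b"
| "mobius_coeff y b (Suc l) = y * (b * mobius_coeff y b l - (if l = 0 then 1 else 0))"

lemma mobius_coeff_scale:
  "y \<noteq> 0 \<Longrightarrow> y ^ l * mobius_coeff (inverse y) b l = mobius_coeff 1 b l"
  by (induction l) (simp_all add: field_simps)

lemma mobius_coeff_fps:
  "(1 - fps_const b * fps_X) * Abs_fps (mobius_coeff 1 b) = fps_const b - fps_X"
proof (rule fps_ext)
  fix n
  show "fps_nth ((1 - fps_const b * fps_X) * Abs_fps (mobius_coeff 1 b)) n = fps_nth (fps_const b - fps_X) n"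
    by (cases n) (simp_all add: left_diff_distrib mult.assoc)
qed

text \<open>(b - x)(1/b - x) = (1 - b x)(1 - x/b). This is the cancellation between the exchange
  factor of a current with E_j and that with F_j.\<close>

lemma mobius_coeff_inverse:
  assumes "(b :: 'f::field) \<noteq> 0"
  shows "(\<Sum>l\<le>t. mobius_coeff 1 b l * mobius_coeff 1 (inverse b) (t - l)) = (if t = 0 then 1 else 0)"
proof -
  define b' where "b' = inverse b"
  have bb: "fps_const b * fps_const b' = 1" using assms by (simp add: b'_def)
  let ?X = "fps_X :: 'f fps"
  let ?G = "\<lambda>b. Abs_fps (mobius_coeff 1 b) :: 'f fps"
  have "((1 - fps_const b * ?X) * (1 - fps_const b' * ?X)) * (?G b * ?G b') =
      (fps_const b - ?X) * (fps_const b' - ?X)"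
    by (simp add: mobius_coeff_fps [symmetric] mult_ac)
  also have "\<dots> = ((1 - fps_const b * ?X) * (1 - fps_const b' * ?X)) * 1"
    using bb by (simp add: algebra_simps)
  finally have "?G b * ?G b' = 1"
  proof (rule mult_left_cancel [THEN iffD1, rotated])
    have "fps_nth ((1 - fps_const b * ?X) * (1 - fps_const b' * ?X)) 0 = 1" by simp
    thus "(1 - fps_const b * ?X) * (1 - fps_const b' * ?X) \<noteq> 0" by force
  qed
  hence "fps_nth (?G b * ?G b') t = fps_nth 1 t" by simp
  thus ?thesis by (simp add: fps_mult_nth b'_def atLeast0AtMost)
qed

context loop_relations
begin

lemma \<psi>_F_rel:
  "\<psi> i k * F j (n + 1) - q powi a i j *s (\<psi> i (k + 1) * F j n) -
     q powi a i j *s (F j (n + 1) * \<psi> i k) + F j n * \<psi> i (k + 1) = 0"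
  using loop_relations.XM_eq_0 [OF swap, of i j "- k - 1" "- n - 1"]
  unfolding loop_relations.XM_def [OF swap] by (simp add: add.commute)

lemma \<phi>_F_rel:
  "inverse C *s (\<phi> i k * F j (n + 1)) - q powi a i j *s (\<phi> i (k + 1) * F j n) -
     (q powi a i j * inverse C) *s (F j (n + 1) * \<phi> i k) + F j n * \<phi> i (k + 1) = 0"
  using loop_relations.XP_eq_0 [OF swap, of i j "- k - 1" "- n - 1"]
  unfolding loop_relations.XP_def [OF swap] by (simp add: add.commute)

text \<open>Solving \<open>XP_eq_0\<close> for the higher mode of \<open>\<psi>\<close> moves one
  mode at a time from \<open>\<psi>\<close> to E_j. The recursion for the coefficients is that of
  the rational exchange factor with b = q^a and y = 1/C.\<close>

lemma \<psi>_E_series: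
  "\<psi> i (int k) * E j n =
    (\<Sum>l\<le>k. mobius_coeff (inverse C) (q powi a i j) l *s (E j (n + int l) * \<psi> i (int (k - l))))"
proof (induction k arbitrary: n)
  case 0
  show ?case by (simp add: \<psi>0_E)
next
  case (Suc k)
  let ?b = "q powi a i j" and ?g = "mobius_coeff (inverse C) (q powi a i j)"
  have CC: "C * (inverse C * x) = x" for x using C_nz by simp
  have "C *s (\<psi> i (1 + int k) * E j n) =
      C *s (?b *s (E j n * \<psi> i (1 + int k)) +
        inverse C *s (?b *s (\<psi> i (int k) * E j (n + 1)) - E j (n + 1) * \<psi> i (int k)))"
    using XP_eq_0 [of i j "int k" n]
    by (simp add: XP_def scl_add_right scl_diff_right algebra_simps CC right_inverse [OF C_nz])
  hence "\<psi> i (int (Suc k)) * E j n = ?b *s (E j n * \<psi> i (int (Suc k))) +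
        inverse C *s (?b *s (\<psi> i (int k) * E j (n + 1)) - E j (n + 1) * \<psi> i (int k))"
    using C_nz scl_eqD by (metis of_nat_Suc)
  also have "?b *s (\<psi> i (int k) * E j (n + 1)) - E j (n + 1) * \<psi> i (int k) =
      (\<Sum>l\<le>k. (?b * ?g l - (if l = 0 then 1 else 0)) *s (E j (n + int (Suc l)) * \<psi> i (int (k - l))))"
  proof -
    have "(\<Sum>l\<le>k. (?b * ?g l - (if l = 0 then 1 else 0)) *s (E j (n + int (Suc l)) * \<psi> i (int (k - l)))) =
      (\<Sum>l\<le>k. (?b * ?g l) *s (E j (n + 1 + int l) * \<psi> i (int (k - l)))) -
      (\<Sum>l\<le>k. if l = 0 then E j (n + 1) * \<psi> i (int k) else 0)"
      unfolding sum_subtractf [symmetric]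
      by (intro sum.cong refl) (auto simp: scl_diff_left add_ac)
    thus ?thesis by (simp add: Suc scl_sum_right)
  qed
  finally show ?case
    by (simp add: scl_sum_right sum.atMost_Suc_shift del: sum.atMost_Suc)
qed

lemma \<psi>_F_series:
  "\<psi> i (int k) * F j n =
    (\<Sum>l\<le>k. mobius_coeff 1 (inverse (q powi a i j)) l *s (F j (n + int l) * \<psi> i (int (k - l))))"
proof (induction k arbitrary: n)
  case 0
  show ?case by (simp add: \<psi>0_F power_int_minus)
next
  case (Suc k)
  let ?b = "inverse (q powi a i j)" and ?g = "mobius_coeff 1 (inverse (q powi a i j))"
  have b: "q powi a i j \<noteq> 0" using q_nz by simp
  have "q powi a i j *s (\<psi> i (1 + int k) * F j n) = q powi a i j *s (?b *s (F j n * \<psi> i (1 + int k)) +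
        (?b *s (\<psi> i (int k) * F j (n + 1)) - F j (n + 1) * \<psi> i (int k)))"
    using \<psi>_F_rel [of i "int k" j n] b
    by (simp add: scl_add_right scl_diff_right algebra_simps)
  hence "\<psi> i (int (Suc k)) * F j n = ?b *s (F j n * \<psi> i (int (Suc k))) +
        (?b *s (\<psi> i (int k) * F j (n + 1)) - F j (n + 1) * \<psi> i (int k))"
    using b scl_eqD by (metis of_nat_Suc)
  also have "?b *s (\<psi> i (int k) * F j (n + 1)) - F j (n + 1) * \<psi> i (int k) =
      (\<Sum>l\<le>k. (?b * ?g l - (if l = 0 then 1 else 0)) *s (F j (n + int (Suc l)) * \<psi> i (int (k - l))))"
  proof -
    have "(\<Sum>l\<le>k. (?b * ?g l - (if l = 0 then 1 else 0)) *s (F j (n + int (Suc l)) * \<psi> i (int (k - l)))) =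
      (\<Sum>l\<le>k. (?b * ?g l) *s (F j (n + 1 + int l) * \<psi> i (int (k - l)))) -
      (\<Sum>l\<le>k. if l = 0 then F j (n + 1) * \<psi> i (int k) else 0)"
      unfolding sum_subtractf [symmetric]
      by (intro sum.cong refl) (auto simp: scl_diff_left add_ac)
    thus ?thesis by (simp add: Suc scl_sum_right)
  qed
  finally show ?case
    by (simp add: sum.atMost_Suc_shift del: sum.atMost_Suc)
qed

text \<open>For L > 0 no \<open>\<phi>\<close> interferes, and \<psi>_{j,L} is a multiple of the
  commutator of E_{j,0} and F_{j,L}. Moving \<psi>_{i,k} through it produces the commutators of
  E_{j,l} with F_{j,L+t-l}, which depend on l only through C^l. With this power absorbed by
  \<open>mobius_coeff_scale\<close>, the sum over l is the coefficient of degree t in the product of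
  two inverse series, so only t = 0 survives.\<close>

lemma \<psi>_comm_pos:
  assumes "L > 0"
  shows "\<psi> i (int k) * \<psi> j (int L) = \<psi> j (int L) * \<psi> i (int k)"
proof -
  let ?g = "mobius_coeff (inverse C) (q powi a i j)"
  let ?g' = "mobius_coeff 1 (inverse (q powi a i j))"
  let ?d = "inverse (q - inverse q)"
  have b: "q powi a i j \<noteq> 0" using q_nz by simp
  have EF: "comm_br (E j (int l)) (F j (int L + int m)) = (?d * C ^ l) *s \<psi> j (int (L + (l + m)))" for l m
    using assms by (simp add: comm_E_F EFbr_def \<phi>_pos add_ac)
  have "\<psi> i (int k) * (E j 0 * F j (int L)) = \<psi> i (int k) * E j 0 * F j (int L)"
    by (simp add: mult.assoc)
  also have "\<dots> = (\<Sum>l\<le>k. \<Sum>m\<le>k - l. (?g l * ?g' m) *s (E j (int l) * F j (int L + int m) * \<psi> i (int (k - (l + m)))))"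
    by (simp add: \<psi>_E_series sum_distrib_right sum_distrib_left mult.assoc \<psi>_F_series scl_sum_right
        del: of_nat_diff)
  also have "\<dots> = (\<Sum>t\<le>k. \<Sum>l\<le>t. (?g l * ?g' (t - l)) *s (E j (int l) * F j (int L + int (t - l)) * \<psi> i (int (k - t))))"
    by (subst sum_triangle_swap) (auto intro!: sum.cong)
  finally have 1: "\<psi> i (int k) * (E j 0 * F j (int L)) = \<dots>" .
  have "\<psi> i (int k) * (F j (int L) * E j 0) = \<psi> i (int k) * F j (int L) * E j 0"
    by (simp add: mult.assoc)
  also have "\<dots> = (\<Sum>m\<le>k. \<Sum>l\<le>k - m. (?g l * ?g' m) *s (F j (int L + int m) * E j (int l) * \<psi> i (int (k - (l + m)))))"
    by (simp add: \<psi>_E_series sum_distrib_right sum_distrib_left mult.assoc \<psi>_F_series scl_sum_right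
        mult.commute add.commute del: of_nat_diff)
  also have "\<dots> = (\<Sum>t\<le>k. \<Sum>l\<le>t. (?g l * ?g' (t - l)) *s (F j (int L + int (t - l)) * E j (int l) * \<psi> i (int (k - t))))"
    by (subst sum_triangle_swap(2)) (auto intro!: sum.cong)
  finally have 2: "\<psi> i (int k) * (F j (int L) * E j 0) = \<dots>" .
  have "\<psi> i (int k) * comm_br (E j 0) (F j (int L)) =
     (\<Sum>t\<le>k. \<Sum>l\<le>t. (?g l * ?g' (t - l)) *s (comm_br (E j (int l)) (F j (int L + int (t - l))) * \<psi> i (int (k - t))))"
    unfolding comm_br_def right_diff_distrib 1 2
    by (simp add: sum_subtractf [symmetric] scl_diff_right [symmetric] left_diff_distrib)
  also have "\<dots> = (\<Sum>t\<le>k. \<Sum>l\<le>t. (?d * (mobius_coeff 1 (q powi a i j) l * ?g' (t - l))) *s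
      (\<psi> j (int (L + t)) * \<psi> i (int (k - t))))"
  proof (intro sum.cong refl)
    fix t l :: nat assume "l \<in> {..t}"
    have "?g l * ?g' (t - l) * (?d * C ^ l) = ?d * (C ^ l * ?g l * ?g' (t - l))" by (simp add: mult_ac)
    also have "C ^ l * ?g l = mobius_coeff 1 (q powi a i j) l"
      by (rule mobius_coeff_scale) (rule C_nz)
    finally have coef: "?g l * ?g' (t - l) * (?d * C ^ l) =
        ?d * (mobius_coeff 1 (q powi a i j) l * ?g' (t - l))" by (simp only: mult.assoc)
    show "(?g l * ?g' (t - l)) *s (comm_br (E j (int l)) (F j (int L + int (t - l))) * \<psi> i (int (k - t))) =
       (?d * (mobius_coeff 1 (q powi a i j) l * ?g' (t - l))) *s (\<psi> j (int (L + t)) * \<psi> i (int (k - t)))"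
      unfolding EF scl_mult_left scl_scl coef using \<open>l \<in> {..t}\<close> by simp
  qed
  also have "\<dots> = (\<Sum>t\<le>k. (?d * (if t = 0 then 1 else 0)) *s (\<psi> j (int (L + t)) * \<psi> i (int (k - t))))"
    by (simp only: scl_sum_left [symmetric] sum_distrib_left [symmetric] mobius_coeff_inverse [OF b])
  also have "\<dots> = (\<Sum>t\<le>k. if t = 0 then ?d *s (\<psi> j (int L) * \<psi> i (int k)) else 0)"
    by (intro sum.cong) auto
  also have "\<dots> = ?d *s (\<psi> j (int L) * \<psi> i (int k))" by simp
  finally have "?d *s (\<psi> i (int k) * \<psi> j (int L)) = ?d *s (\<psi> j (int L) * \<psi> i (int k))"
    using EF [of 0 0] by simp
  thus ?thesis by (rule scl_eqD) (use inverse_q_neq in simp)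
qed

lemma \<psi>_comm: "\<psi> i m * \<psi> j n = \<psi> j n * \<psi> i m"
proof (cases "m < 0 \<or> n < 0")
  case True
  thus ?thesis by (auto simp: \<psi>_neg)
next
  case False
  show ?thesis
  proof (cases "n = 0")
    case True
    thus ?thesis by (simp add: \<psi>0_\<psi>)
  next
    case n: False
    thus ?thesis using False \<psi>_comm_pos [of "nat n" i "nat m" j] by simp
  qed
qed

lemma \<phi>_comm: "\<phi> i m * \<phi> j n = \<phi> j n * \<phi> i m"
  using loop_relations.\<psi>_comm [OF swap, of i "- m" j "- n"] by simp

lemma RF_eq_0:
  "F i m * F j (n + 1) - q powi a i j *s (F i (m + 1) * F j n) -
     q powi a i j *s (F j (n + 1) * F i m) + F j n * F i (m + 1) = 0"
  using loop_relations.RE_eq_0 [OF swap, of i j "- m - 1" "- n - 1"]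
  unfolding loop_relations.RE_def [OF swap] by (simp add: add.commute)

lemma SF_eq_0:
  assumes "a i j = - 1"
  shows "(F j t * F i m * F i n + F j t * F i n * F i m)
     - (q + inverse q) *s (F i m * F j t * F i n + F i n * F j t * F i m)
     + (F i m * F i n * F j t + F i n * F i m * F j t) = 0"
  using loop_relations.SE_eq_0 [OF swap assms, of "- m" "- n" "- t"]
  unfolding loop_relations.SE_def [OF swap] by (simp add: add.commute)

end

section \<open>Exponentials of noncommuting series\<close>

lemma fps_commute:
  fixes f g :: "'r::ring_1 fps"
  assumes "\<And>m n. fps_nth f m * fps_nth g n = fps_nth g n * fps_nth f m"
  shows "f * g = g * f"
proof (rule fps_ext)
  fix n
  show "fps_nth (f * g) n = fps_nth (g * f) n"
    unfolding fps_mult_nth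
    by (rule sum.reindex_bij_witness [of _ "\<lambda>i. n - i" "\<lambda>i. n - i"]) (auto simp: assms)
qed

lemma compositions_empty: "n < k \<Longrightarrow> compositions k n = {}"
proof -
  have "length \<nu> \<le> sum_list \<nu>" if "0 \<notin> set \<nu>" for \<nu> :: "nat list"
    using that
  proof (induction \<nu>)
    case (Cons a \<nu>)
    thus ?case by (cases a) auto
  qed simp
  thus "n < k \<Longrightarrow> compositions k n = {}" by (fastforce simp: compositions_def)
qed

text \<open>Splitting off the first part of a composition is splitting off the first factor of the
  power. The order of the factors is kept throughout, so the coefficients may be
  noncommuting.\<close>

lemma fps_power_compositions:
  fixes X :: "nat \<Rightarrow> 'r::ring_1"
  shows "fps_nth (Abs_fps (\<lambda>m. if m = 0 then 0 else X m) ^ k) n =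
    (\<Sum>\<nu>\<in>compositions k n. prod_list (map X \<nu>))"
proof (induction k arbitrary: n)
  case 0
  show ?case by (simp add: compositions_0)
next
  case (Suc k)
  have "(\<Sum>\<nu>\<in>compositions (Suc k) n. prod_list (map X \<nu>)) =
      (\<Sum>(m, \<nu>)\<in>Sigma {0<..n} (\<lambda>m. compositions k (n - m)). X m * prod_list (map X \<nu>))"
  proof (rule sum.reindex_bij_witness [of _ "\<lambda>(m, \<nu>). m # \<nu>" "\<lambda>\<nu>. (hd \<nu>, tl \<nu>)"])
    fix \<nu> assume \<nu>: "\<nu> \<in> compositions (Suc k) n"
    then obtain m \<nu>' where m: "\<nu> = m # \<nu>'" by (cases \<nu>) (auto simp: compositions_def)
    with \<nu> have "m > 0" "m \<le> n" "\<nu>' \<in> compositions k (n - m)" by (auto simp: compositions_def)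
    thus "(hd \<nu>, tl \<nu>) \<in> Sigma {0<..n} (\<lambda>m. compositions k (n - m))"
      "(case (hd \<nu>, tl \<nu>) of (m, \<nu>) \<Rightarrow> m # \<nu>) = \<nu>"
      "(case (hd \<nu>, tl \<nu>) of (m, \<nu>) \<Rightarrow> X m * prod_list (map X \<nu>)) = prod_list (map X \<nu>)"
      by (simp_all add: m)
  next
    fix b assume "b \<in> Sigma {0<..n} (\<lambda>m. compositions k (n - m))"
    then obtain m \<nu> where b: "b = (m, \<nu>)" "m > 0" "m \<le> n" "\<nu> \<in> compositions k (n - m)" by auto
    thus "(hd (case b of (m, \<nu>) \<Rightarrow> m # \<nu>), tl (case b of (m, \<nu>) \<Rightarrow> m # \<nu>)) = b"
      "(case b of (m, \<nu>) \<Rightarrow> m # \<nu>) \<in> compositions (Suc k) n"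
      by (simp_all add: compositions_def)
  qed
  also have "\<dots> = (\<Sum>m\<in>{0<..n}. X m * (\<Sum>\<nu>\<in>compositions k (n - m). prod_list (map X \<nu>)))"
    by (subst sum.Sigma [symmetric]) (auto simp: finite_compositions sum_distrib_left)
  also have "\<dots> = (\<Sum>m=0..n. (if m = 0 then 0 else X m) * (\<Sum>\<nu>\<in>compositions k (n - m). prod_list (map X \<nu>)))"
    by (rule sum.mono_neutral_cong_left) auto
  finally show ?case by (simp add: fps_mult_nth Suc)
qed

lemma fps_deriv_power_commute:
  fixes A :: "'r::ring_1 fps"
  assumes "A * fps_deriv A = fps_deriv A * A"
  shows "fps_deriv (A ^ Suc k) = of_nat (Suc k) * (fps_deriv A * A ^ k)"
proof (induction k)
  case (Suc k)
  have "A * (of_nat (Suc k) * (fps_deriv A * A ^ k)) = of_nat (Suc k) * (fps_deriv A * A ^ Suc k)"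
    by (metis (no_types, lifting) assms mult.assoc mult_of_nat_commute power_Suc)
  thus ?case
    using Suc by (simp only: power_Suc [of A "Suc k"] fps_deriv_mult) (simp add: algebra_simps)
qed simp

section \<open>The exponential through its differential equation\<close>

context scalar_algebra
begin

text \<open>The counterpart of \<open>exp_coeff\<close> in a ring, with the same sum over
  compositions. In degree 0 it is the unit 1 of the ring, whereas \<open>exp_coeff\<close> gives the
  idempotents, that is, \<open>e\<close>.\<close>

definition pexp :: "(nat \<Rightarrow> 'r) \<Rightarrow> nat \<Rightarrow> 'r" where
  "pexp X n = (\<Sum>k=0..n. inverse (of_nat (fact k)) *s (\<Sum>\<nu>\<in>compositions k n. prod_list (map X \<nu>)))"

lemma pexp_0: "pexp X 0 = 1"
  by (simp add: pexp_def compositions_0)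

lemma pexp_bound:
  assumes "n \<le> N"
  shows "pexp X n = (\<Sum>k=0..N. inverse (of_nat (fact k)) *s
      fps_nth (Abs_fps (\<lambda>m. if m = 0 then 0 else X m) ^ k) n)"
  unfolding pexp_def fps_power_compositions
  by (rule sum.mono_neutral_left) (use assms in \<open>auto simp: compositions_empty\<close>)

text \<open>Since the coefficients commute, the derivative of A^k / k! is A' A^{k-1} / (k-1)!. This
  equation, together with \<open>fps_ode_unique\<close>, replaces manipulations of multiple series
  in what follows.\<close>

lemma pexp_deriv:
  assumes comm: "\<And>m n. X m * X n = X n * X m"
  defines "A \<equiv> Abs_fps (\<lambda>m. if m = 0 then 0 else X m)"
  shows "fps_deriv (Abs_fps (pexp X)) = fps_deriv A * Abs_fps (pexp X)"
proof (rule fps_ext)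
  fix n
  have "A * fps_deriv A = fps_deriv A * A"
    by (rule fps_commute) (simp add: A_def of_nat_mult_eq_scl comm del: of_nat_Suc)
  note dA = fps_deriv_power_commute [OF this]
  have step: "of_nat (Suc n) *s inverse (of_nat (fact (Suc k))) *s fps_nth (A ^ Suc k) (Suc n) =
      inverse (of_nat (fact k)) *s fps_nth (fps_deriv A * A ^ k) n" for k
  proof -
    have "of_nat (Suc n) *s fps_nth (A ^ Suc k) (Suc n) = fps_nth (fps_deriv (A ^ Suc k)) n"
      by (simp add: of_nat_mult_eq_scl del: power_Suc of_nat_Suc)
    also have "\<dots> = of_nat (Suc k) *s fps_nth (fps_deriv A * A ^ k) n"
      unfolding dA by (simp add: fps_of_nat [symmetric] of_nat_mult_eq_scl del: of_nat_Suc)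
    finally have "of_nat (Suc n) *s fps_nth (A ^ Suc k) (Suc n) =
        of_nat (Suc k) *s fps_nth (fps_deriv A * A ^ k) n" .
    hence "inverse (of_nat (fact (Suc k))) *s of_nat (Suc n) *s fps_nth (A ^ Suc k) (Suc n) =
        inverse (of_nat (fact (Suc k))) *s of_nat (Suc k) *s fps_nth (fps_deriv A * A ^ k) n"
      by simp
    moreover have "inverse (of_nat (fact (Suc k))) * of_nat (Suc k) = (inverse (of_nat (fact k)) :: 'f)"
    proof -
      have "(of_nat (fact (Suc k)) :: 'f) = of_nat (Suc k) * of_nat (fact k)"
        by (simp only: fact_Suc of_nat_mult of_nat_id)
      thus ?thesis by (simp add: field_simps del: of_nat_Suc fact_Suc of_nat_fact)
    qed
    ultimately show ?thesis by (simp add: mult.commute del: power_Suc of_nat_Suc fact_Suc)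
  qed
  have "fps_nth (fps_deriv (Abs_fps (pexp X))) n = of_nat (Suc n) *s pexp X (Suc n)"
    by (simp add: of_nat_mult_eq_scl del: of_nat_Suc)
  also have "pexp X (Suc n) = (\<Sum>k=0..Suc n. inverse (of_nat (fact k)) *s fps_nth (A ^ k) (Suc n))"
    unfolding A_def by (rule pexp_bound) simp
  also have "\<dots> = (\<Sum>k=0..n. inverse (of_nat (fact (Suc k))) *s fps_nth (A ^ Suc k) (Suc n))"
    by (subst sum.atLeast0_atMost_Suc_shift) (simp add: A_def del: fact_Suc power_Suc of_nat_fact of_nat_Suc)
  also have "of_nat (Suc n) *s \<dots> = (\<Sum>k=0..n. inverse (of_nat (fact k)) *s fps_nth (fps_deriv A * A ^ k) n)"
    unfolding scl_sum_right step ..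
  also have "\<dots> = (\<Sum>k=0..n. \<Sum>i=0..n. fps_nth (fps_deriv A) i * (inverse (of_nat (fact k)) *s fps_nth (A ^ k) (n - i)))"
    by (simp add: fps_mult_nth scl_sum_right)
  also have "\<dots> = (\<Sum>i=0..n. fps_nth (fps_deriv A) i * pexp X (n - i))"
    by (subst sum.swap) (simp add: pexp_bound [of _ n] A_def sum_distrib_left)
  also have "\<dots> = fps_nth (fps_deriv A * Abs_fps (pexp X)) n"
    by (simp add: fps_mult_nth)
  finally show "fps_nth (fps_deriv (Abs_fps (pexp X))) n = fps_nth (fps_deriv A * Abs_fps (pexp X)) n" .
qed

lemma fps_ode_unique:
  fixes V W D :: "'r fps"
  assumes "fps_deriv V = D * V" "fps_deriv W = D * W" "fps_nth V 0 = fps_nth W 0"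
  shows "V = W"
proof (rule fps_ext)
  fix n
  show "fps_nth V n = fps_nth W n"
  proof (induction n rule: less_induct)
    case (less n)
    show ?case
    proof (cases n)
      case (Suc m)
      have "fps_nth (D * V) m = fps_nth (D * W) m"
        unfolding fps_mult_nth using less Suc by (intro sum.cong refl) simp
      hence "fps_nth (fps_deriv V) m = fps_nth (fps_deriv W) m"
        using assms by simp
      hence "of_nat (Suc m) *s fps_nth V (Suc m) = of_nat (Suc m) *s fps_nth W (Suc m)"
        by (simp add: of_nat_mult_eq_scl del: of_nat_Suc)
      thus ?thesis unfolding Suc by (rule scl_eqD) (simp del: of_nat_Suc)
    qed (simp add: assms)
  qed
qed

lemma commute_prod_list:
  "(\<And>m. m \<in> set \<nu> \<Longrightarrow> y * X m = X m * y) \<Longrightarrow> y * prod_list (map X \<nu>) = prod_list (map X \<nu>) * (y :: 'r)"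
proof (induction \<nu>)
  case (Cons m \<nu>)
  have "y * (X m * prod_list (map X \<nu>)) = X m * (y * prod_list (map X \<nu>))"
    using Cons.prems [of m] by (simp add: mult.assoc [symmetric])
  also have "\<dots> = X m * prod_list (map X \<nu>) * y"
    using Cons by (simp add: mult.assoc)
  finally show ?case by simp
qed simp

lemma commute_pexp:
  "(\<And>m. y * X m = X m * y) \<Longrightarrow> y * pexp X n = pexp X n * (y :: 'r)"
  by (simp add: pexp_def sum_distrib_left sum_distrib_right commute_prod_list)

text \<open>Both sides solve the equation whose coefficient is the derivative of the sum of the two
  exponents, with constant term 1.\<close>

lemma pexp_add:
  assumes XX: "\<And>m n. X m * X n = X n * X m" and YY: "\<And>m n. Y m * Y n = Y n * Y m"
    and XY: "\<And>m n. X m * Y n = Y n * X m"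
  shows "Abs_fps (pexp X) * Abs_fps (pexp Y) = Abs_fps (pexp (\<lambda>m. X m + Y m))"
proof -
  let ?A = "\<lambda>X. Abs_fps (\<lambda>m. if m = 0 then 0 else X m) :: 'r fps"
  let ?D = "fps_deriv (?A (\<lambda>m. X m + Y m))"
  have "Abs_fps (pexp X) * fps_deriv (?A Y) = fps_deriv (?A Y) * Abs_fps (pexp X)"
    by (rule fps_commute) (simp add: of_nat_mult_eq_scl commute_pexp XY [symmetric] del: of_nat_Suc)
  hence "fps_deriv (Abs_fps (pexp X) * Abs_fps (pexp Y)) =
      (fps_deriv (?A Y) + fps_deriv (?A X)) * (Abs_fps (pexp X) * Abs_fps (pexp Y))"
    by (simp add: pexp_deriv [OF XX] pexp_deriv [OF YY] distrib_right mult.assoc [symmetric])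
  also have "?A Y + ?A X = ?A (\<lambda>m. X m + Y m)"
    by (rule fps_ext) simp
  hence "fps_deriv (?A Y) + fps_deriv (?A X) = ?D"
    by (simp only: fps_deriv_add [symmetric])
  finally have "fps_deriv (Abs_fps (pexp X) * Abs_fps (pexp Y)) = ?D * (Abs_fps (pexp X) * Abs_fps (pexp Y))" .
  moreover have "fps_deriv (Abs_fps (pexp (\<lambda>m. X m + Y m))) = ?D * Abs_fps (pexp (\<lambda>m. X m + Y m))"
    by (rule pexp_deriv) (simp add: distrib_left distrib_right XX YY XY add_ac)
  ultimately show ?thesis
    by (rule fps_ode_unique) (simp add: pexp_0)
qed

lemma pexp_scale: "pexp (\<lambda>m. c ^ m *s X m) n = c ^ n *s pexp X n"
proof -
  have "prod_list (map (\<lambda>m. c ^ m *s X m) \<nu>) = c ^ sum_list \<nu> *s prod_list (map X \<nu>)" for \<nu>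
    by (induction \<nu>) (simp_all add: power_add mult.commute)
  hence "(\<Sum>\<nu>\<in>compositions k n. prod_list (map (\<lambda>m. c ^ m *s X m) \<nu>)) =
      c ^ n *s (\<Sum>\<nu>\<in>compositions k n. prod_list (map X \<nu>))" for k
    unfolding scl_sum_right by (intro sum.cong refl) (simp add: compositions_def)
  thus ?thesis by (simp add: pexp_def scl_sum_right mult.commute)
qed

lemma pexp_split:
  assumes "n > 0"
  shows "pexp X n = X n + (\<Sum>k=2..n. inverse (of_nat (fact k)) *s (\<Sum>\<nu>\<in>compositions k n. prod_list (map X \<nu>)))"
proof -
  have "{0..n} = insert 0 (insert 1 {2..n})" using assms by auto
  thus ?thesis using assms compositions_1 [OF assms] by (simp add: pexp_def compositions_0)
qed

text \<open>The coefficient of degree n is s_n h_n plus products of h_m with m < n, so the h's can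
  be recovered one by one from the exponential. \<open>S\<close> is not assumed to contain 1; this
  allows the corner cut out by \<open>e\<close> as well as centralizers.\<close>

lemma pexp_log_closed:
  assumes S_add: "\<And>x y. S x \<Longrightarrow> S y \<Longrightarrow> S (x + y)" and S_mult: "\<And>x y. S x \<Longrightarrow> S y \<Longrightarrow> S (x * y)"
    and S_scl: "\<And>c x. S x \<Longrightarrow> S (c *s x)"
    and s: "\<And>n. n > 0 \<Longrightarrow> s n \<noteq> 0"
    and S_exp: "\<And>n. n > 0 \<Longrightarrow> S (pexp (\<lambda>m. s m *s h m) n)"
    and "n > 0"
  shows "S (h n)"
  using \<open>n > 0\<close>
proof (induction n rule: less_induct)
  case (less n)
  have S0: "S 0" using S_scl [OF S_exp [of 1], of 0] by simp
  have S_sum: "S (sum f A)" if "\<And>x. x \<in> A \<Longrightarrow> S (f x)" for f :: "'z \<Rightarrow> 'r" and A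
    using that by (induction A rule: infinite_finite_induct) (simp_all add: S0 S_add)
  have S_prod: "S (prod_list xs)" if "xs \<noteq> []" "\<And>x. x \<in> set xs \<Longrightarrow> S x" for xs
    using that
  proof (induction xs)
    case (Cons x xs)
    have x: "S x" by (rule Cons.prems) simp
    show ?case
    proof (cases "xs = []")
      case False
      have "S (prod_list xs)" by (rule Cons.IH [OF False]) (rule Cons.prems, simp)
      with x show ?thesis by (simp add: S_mult)
    qed (simp add: x)
  qed simp
  let ?X = "\<lambda>m. s m *s h m"
  let ?r = "\<Sum>k=2..n. inverse (of_nat (fact k)) *s (\<Sum>\<nu>\<in>compositions k n. prod_list (map ?X \<nu>))"
  have "S ?r"
  proof (intro S_sum S_scl S_prod)
    fix k \<nu> x assume k: "k \<in> {2..n}" and \<nu>: "\<nu> \<in> compositions k n"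
    thus "map ?X \<nu> \<noteq> []" by (auto simp: compositions_def)
    assume "x \<in> set (map ?X \<nu>)"
    then obtain m where "m \<in> set \<nu>" "x = ?X m" by auto
    with compositions_less [OF \<nu>, of m] k less.IH [of m] have "S (h m)" "x = ?X m" by simp_all
    thus "S x" by (simp only: S_scl)
  qed
  hence "S (pexp ?X n + (- 1) *s ?r)"
    using S_exp [OF less.prems] by (intro S_add S_scl)
  hence "S (s n *s h n)" by (simp add: pexp_split [OF less.prems])
  hence "S (inverse (s n) *s s n *s h n)" by (rule S_scl)
  thus "S (h n)" using s [OF less.prems] by simp
qed

end

text \<open>\<open>Q(z)\<close> and \<open>R(- z)\<close> are mutually inverse; their unit \<open>e\<close> need not be the unit of the ring.\<close>

locale series_pair = scalar_algebra scl
  for scl :: "'f::field_char_0 \<Rightarrow> 'r::ring_1 \<Rightarrow> 'r" (infixr "*s" 75) +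
  fixes e :: 'r and Q R :: "nat \<Rightarrow> 'r"
  assumes Q0: "Q 0 = e" and R0: "R 0 = e" and e_Q: "e * Q n = Q n" and Q_e: "Q n * e = Q n"
    and e_R: "e * R n = R n" and R_e: "R n * e = R n"
    and QR: "n > 0 \<Longrightarrow> (\<Sum>k=0..n. (- 1) ^ k *s (Q (n - k) * R k)) = 0"
    and RQ: "n > 0 \<Longrightarrow> (\<Sum>k=0..n. (- 1) ^ k *s (R k * Q (n - k))) = 0"
begin

definition QS :: "'r fps" where "QS = Abs_fps Q"
definition RS :: "'r fps" where "RS = Abs_fps (\<lambda>k. (- 1) ^ k *s R k)"

lemma QS_RS: "QS * RS = fps_const e" and RS_QS: "RS * QS = fps_const e"
proof -
  show "RS * QS = fps_const e"
  proof (rule fps_ext)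
    fix n show "fps_nth (RS * QS) n = fps_nth (fps_const e) n"
      using RQ [of n] e_R [of 0] by (cases "n = 0") (simp_all add: RS_def QS_def fps_mult_nth R0 Q0)
  qed
  show "QS * RS = fps_const e"
  proof (rule fps_ext)
    fix n
    have "(\<Sum>i=0..n. Q i * ((- 1) ^ (n - i) *s R (n - i))) = (\<Sum>k=0..n. (- 1) ^ k *s (Q (n - k) * R k))"
      by (rule sum.reindex_bij_witness [of _ "\<lambda>i. n - i" "\<lambda>i. n - i"]) auto
    thus "fps_nth (QS * RS) n = fps_nth (fps_const e) n"
      using QR [of n] e_R [of 0] by (cases "n = 0") (simp_all add: RS_def QS_def fps_mult_nth R0 Q0)
  qed
qed

lemma QS_e: "QS * fps_const e = QS"
  by (simp add: fps_eq_iff QS_def Q_e)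

text \<open>With c_m = q^m [m] these are the elements Q^{[1^n]}, and with c_m = q^{-m} [m] and P for
  Q they are P^{[1^n]}.\<close>

definition bracketed :: "(nat \<Rightarrow> 'f) \<Rightarrow> nat \<Rightarrow> 'r" where
  "bracketed c n = (\<Sum>m=0..n. ((- 1) ^ m * c m) *s (R (n - m) * Q m))"

lemma bracketed_series:
  "RS * Abs_fps (\<lambda>m. c m *s Q m) = Abs_fps (\<lambda>n. (- 1) ^ n *s bracketed c n)"
proof (rule fps_ext)
  fix n
  have *: "(- 1) ^ i = ((- 1) ^ n * (- 1) ^ (n - i) :: 'f)" if "i \<le> n" for i
  proof -
    from that obtain d where "n = i + d" using le_Suc_ex by blast
    thus ?thesis by (simp add: power_add mult.assoc flip: power_mult_distrib)
  qed
  have "(\<Sum>i=0..n. (- 1) ^ i *s R i * (c (n - i) *s Q (n - i))) =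
      (\<Sum>m=0..n. (- 1) ^ n *s ((- 1) ^ m * c m) *s (R (n - m) * Q m))"
    by (rule sum.reindex_bij_witness [of _ "\<lambda>i. n - i" "\<lambda>i. n - i"])
      (auto simp: mult.assoc [symmetric] * [symmetric], simp add: mult.commute)
  thus "fps_nth (RS * Abs_fps (\<lambda>m. c m *s Q m)) n = fps_nth (Abs_fps (\<lambda>n. (- 1) ^ n *s bracketed c n)) n"
    by (simp add: RS_def fps_mult_nth bracketed_def scl_sum_right)
qed

text \<open>Multiplying \<open>bracketed_series\<close> by Q(z) shows that c_n Q_n is a sum of
  products of some Q_i with a bracketed element of degree n - i. As c_0 = 0, the bracketed element
  of degree 0 vanishes, and only i < n occurs.\<close>

lemma Q_closed:
  assumes S_add: "\<And>x y. S x \<Longrightarrow> S y \<Longrightarrow> S (x + y)" and S_mult: "\<And>x y. S x \<Longrightarrow> S y \<Longrightarrow> S (x * y)"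
    and S_scl: "\<And>c x. S x \<Longrightarrow> S (c *s x)" and S_e: "S e"
    and c0: "c 0 = 0" and c: "\<And>n. n > 0 \<Longrightarrow> c n \<noteq> 0"
    and S_br: "\<And>n. n > 0 \<Longrightarrow> S (bracketed c n)"
  shows "S (Q n)"
proof (induction n rule: less_induct)
  case (less n)
  have S0: "S 0" using S_scl [OF S_e, of 0] by simp
  have S_sum: "S (sum f A)" if "\<And>x. x \<in> A \<Longrightarrow> S (f x)" for f :: "'z \<Rightarrow> 'r" and A
    using that by (induction A rule: infinite_finite_induct) (simp_all add: S0 S_add)
  show ?case
  proof (cases "n = 0")
    case False
    have br0: "bracketed c 0 = 0" by (simp add: bracketed_def c0)
    have "QS * Abs_fps (\<lambda>n. (- 1) ^ n *s bracketed c n) = fps_const e * Abs_fps (\<lambda>m. c m *s Q m)"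
      unfolding bracketed_series [symmetric] mult.assoc [symmetric] QS_RS ..
    also have "fps_const e * Abs_fps (\<lambda>m. c m *s Q m) = Abs_fps (\<lambda>m. c m *s Q m)"
      by (rule fps_ext) (simp add: e_Q)
    finally have "fps_nth (QS * Abs_fps (\<lambda>n. (- 1) ^ n *s bracketed c n)) n = c n *s Q n"
      by simp
    hence "(\<Sum>i=0..n. Q i * ((- 1) ^ (n - i) *s bracketed c (n - i))) = c n *s Q n"
      by (simp add: fps_mult_nth QS_def)
    moreover have "S (\<Sum>i=0..n. Q i * ((- 1) ^ (n - i) *s bracketed c (n - i)))"
    proof (rule S_sum)
      fix i assume "i \<in> {0..n}"
      thus "S (Q i * ((- 1) ^ (n - i) *s bracketed c (n - i)))"
        using less by (cases "i = n") (auto simp: br0 S0 intro!: S_scl S_mult S_br)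
    qed
    ultimately have "S (c n *s Q n)" by simp
    hence "S (inverse (c n) *s c n *s Q n)" by (rule S_scl)
    thus ?thesis using c False by simp
  qed (simp add: Q0 S_e)
qed

text \<open>For Q these data are s_m = 1/[m], p = q, c_m = q^m [m] and t = \<kappa> = q - 1/q; for
  P, q is replaced by 1/q everywhere except in [m], which changes the sign of t and
  \<kappa>.\<close>

context
  fixes h :: "nat \<Rightarrow> 'r" and s c :: "nat \<Rightarrow> 'f" and t p \<kappa> :: 'f
  assumes h_comm: "\<And>m n. h m * h n = h n * h m"
    and Q_exp: "\<And>n. n > 0 \<Longrightarrow> Q n = pexp (\<lambda>m. s m *s h m) n"
    and tps: "\<And>m. m > 0 \<Longrightarrow> t * p ^ m + s m = p ^ (2 * m) * s m"
    and \<kappa>: "\<And>m. \<kappa> * c m = p ^ (2 * m) - 1"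
begin

text \<open>By the assumption on t, p and s, passing from z to p^2 z in the exponent of Q(z) adds t
  h_m (p z)^m in degree m. So the exponential of t times the series of the h's, taken at p z, is
  Q(z)^{-1} Q(p^2 z). The exponentials are multiplied in the ring with unit 1 and cut down to the
  corner by the factor \<open>e\<close>.\<close>

lemma exp_product:
  "QS * Abs_fps (\<lambda>n. p ^ n *s (e * pexp (\<lambda>m. t *s h m) n)) = Abs_fps (\<lambda>n. p ^ (2 * n) *s Q n)"
proof -
  let ?Q = "Abs_fps (pexp (\<lambda>m. s m *s h m))"
  let ?U = "Abs_fps (pexp (\<lambda>m. p ^ m *s t *s h m))"
  have pexp_cong: "pexp X n = pexp Y n" if "\<And>m. m > 0 \<Longrightarrow> X m = Y m" for X Y :: "nat \<Rightarrow> 'r" and n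
  proof -
    have eq: "map X \<nu> = map Y \<nu>" if "\<nu> \<in> compositions k n" for \<nu> k
      using that \<open>\<And>m. m > 0 \<Longrightarrow> X m = Y m\<close> by (auto simp: compositions_def intro!: map_cong)
        (metis gr0I)
    have "(\<Sum>\<nu>\<in>compositions k n. prod_list (map X \<nu>)) = (\<Sum>\<nu>\<in>compositions k n. prod_list (map Y \<nu>))" for k
      by (rule sum.cong) (simp_all only: eq)
    thus ?thesis by (simp only: pexp_def)
  qed
  have Q1: "fps_const e * ?Q = QS"
  proof (rule fps_ext)
    fix n show "fps_nth (fps_const e * ?Q) n = fps_nth QS n"
      by (cases "n = 0") (simp_all add: QS_def pexp_0 Q0 Q_exp [symmetric] e_Q)
  qed
  have "?Q * ?U = Abs_fps (pexp (\<lambda>m. s m *s h m + p ^ m *s t *s h m))"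
    by (rule pexp_add) (simp_all add: h_comm mult.commute)
  also have "\<dots> = Abs_fps (pexp (\<lambda>m. (p ^ 2) ^ m *s s m *s h m))"
  proof (intro arg_cong [of _ _ Abs_fps] ext pexp_cong)
    fix m :: nat assume "m > 0"
    hence "s m + p ^ m * t = (p ^ 2) ^ m * s m"
      using tps [of m] unfolding power_mult [symmetric] by (simp add: add.commute mult.commute)
    thus "s m *s h m + p ^ m *s t *s h m = (p ^ 2) ^ m *s s m *s h m"
      by (simp only: scl_scl scl_add_left [symmetric])
  qed
  also have "\<dots> = Abs_fps (\<lambda>n. (p ^ 2) ^ n *s pexp (\<lambda>m. s m *s h m) n)"
    by (rule fps_ext) (simp only: pexp_scale fps_nth_Abs_fps)
  finally have "?Q * ?U = Abs_fps (\<lambda>n. (p ^ 2) ^ n *s pexp (\<lambda>m. s m *s h m) n)" .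
  hence "fps_const e * (?Q * ?U) = fps_const e * Abs_fps (\<lambda>n. (p ^ 2) ^ n *s pexp (\<lambda>m. s m *s h m) n)"
    by simp
  moreover have "fps_const e * Abs_fps (\<lambda>n. (p ^ 2) ^ n *s pexp (\<lambda>m. s m *s h m) n) =
      Abs_fps (\<lambda>n. p ^ (2 * n) *s Q n)"
  proof (rule fps_ext)
    fix n
    have "e * pexp (\<lambda>m. s m *s h m) n = Q n"
      by (cases "n = 0") (simp_all add: pexp_0 Q0 Q_exp [symmetric] e_Q)
    thus "fps_nth (fps_const e * Abs_fps (\<lambda>n. (p ^ 2) ^ n *s pexp (\<lambda>m. s m *s h m) n)) n =
      fps_nth (Abs_fps (\<lambda>n. p ^ (2 * n) *s Q n)) n"
      by (simp add: power_mult)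
  qed
  ultimately have "QS * ?U = Abs_fps (\<lambda>n. p ^ (2 * n) *s Q n)"
    by (simp add: Q1 mult.assoc [symmetric])
  moreover have "QS * ?U = QS * (fps_const e * ?U)"
    by (simp add: mult.assoc [symmetric] QS_e)
  moreover have "fps_const e * ?U = Abs_fps (\<lambda>n. p ^ n *s (e * pexp (\<lambda>m. t *s h m) n))"
    by (rule fps_ext) (simp add: pexp_scale del: scl_scl)
  ultimately show ?thesis by simp
qed

lemma exp_series:
  "Abs_fps (\<lambda>n. p ^ n *s (e * pexp (\<lambda>m. t *s h m) n)) = RS * Abs_fps (\<lambda>n. p ^ (2 * n) *s Q n)"
proof -
  have "e * e = e" using e_Q [of 0] by (simp add: Q0)
  hence "Abs_fps (\<lambda>n. p ^ n *s (e * pexp (\<lambda>m. t *s h m) n)) =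
      RS * QS * Abs_fps (\<lambda>n. p ^ n *s (e * pexp (\<lambda>m. t *s h m) n))"
    unfolding RS_QS by (simp add: fps_eq_iff mult.assoc [symmetric])
  thus ?thesis by (simp add: mult.assoc exp_product)
qed

text \<open>Q(p^2 z) is Q(z) plus \<kappa> times the series of the c_m Q_m. Multiplied by Q(z)^{-1}
  the first summand contributes in degree 0 only, which is why n > 0 is assumed.\<close>

lemma exp_bracketed:
  assumes "n > 0"
  shows "p ^ n *s (e * pexp (\<lambda>m. t *s h m) n) = ((- 1) ^ n * \<kappa>) *s bracketed c n"
proof -
  have "Abs_fps (\<lambda>n. p ^ (2 * n) *s Q n) = QS + Abs_fps (\<lambda>m. (\<kappa> * c m) *s Q m)"
    by (simp add: fps_eq_iff QS_def \<kappa> scl_diff_left)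
  hence "Abs_fps (\<lambda>n. p ^ n *s (e * pexp (\<lambda>m. t *s h m) n)) =
      fps_const e + RS * Abs_fps (\<lambda>m. (\<kappa> * c m) *s Q m)"
    by (simp add: exp_series distrib_left RS_QS)
  hence "p ^ n *s (e * pexp (\<lambda>m. t *s h m) n) = (- 1) ^ n *s bracketed (\<lambda>m. \<kappa> * c m) n"
    using assms by (simp add: bracketed_series fps_eq_iff)
  also have "bracketed (\<lambda>m. \<kappa> * c m) n = \<kappa> *s bracketed c n"
    by (simp add: bracketed_def scl_sum_right mult_ac)
  finally show ?thesis by simp
qed

end

end

section \<open>Exchange relations between series\<close>

locale corner_algebra = scalar_algebra scl
  for scl :: "'f::field_char_0 \<Rightarrow> 'r::ring_1 \<Rightarrow> 'r" (infixr "*s" 75) +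
  fixes e :: 'r
  assumes e_e: "e * e = e"
begin

definition corner :: "'r fps \<Rightarrow> bool" where
  "corner x \<longleftrightarrow> (\<forall>n. e * fps_nth x n = fps_nth x n \<and> fps_nth x n * e = fps_nth x n)"

lemma corner_mult: "corner x \<Longrightarrow> corner y \<Longrightarrow> corner (x * y)"
  unfolding corner_def
  by (simp add: fps_mult_nth sum_distrib_left sum_distrib_right mult.assoc)
    (simp add: mult.assoc [symmetric])

lemma corner_scale: "corner x \<Longrightarrow> corner (Abs_fps (\<lambda>n. c n *s fps_nth x n))"
  by (simp add: corner_def)

text \<open>\<open>x(u) y(z) = f(uz) y(z) x(u)\<close>.\<close>

definition exch :: "'r fps \<Rightarrow> 'r fps \<Rightarrow> 'f fps \<Rightarrow> bool" where
  "exch x y f \<longleftrightarrow> (\<forall>m n. fps_nth x n * fps_nth y m =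
     (\<Sum>k\<in>{0..min m n}. fps_nth f k *s (fps_nth y (m - k) * fps_nth x (n - k))))"

text \<open>Series in z whose coefficients are series in u: the outer index is the power of z, the
  inner one that of u. In this ring x(u) y(z) is an honest product.\<close>

definition in_u :: "'r fps \<Rightarrow> 'r fps fps" where "in_u x = fps_const x"
definition in_z :: "'r fps \<Rightarrow> 'r fps fps" where "in_z y = Abs_fps (\<lambda>m. fps_const (fps_nth y m))"
definition in_uz :: "'f fps \<Rightarrow> 'r fps fps" where
  "in_uz f = Abs_fps (\<lambda>k. Abs_fps (\<lambda>l. if l = k then fps_nth f k *s e else 0))"

lemma fps_const_sum: "fps_const (sum f A) = (\<Sum>a\<in>A. fps_const (f a))"
  by (induction A rule: infinite_finite_induct) (simp_all flip: fps_const_add)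

lemma in_u_mult: "in_u (x * y) = in_u x * in_u y"
  by (simp add: in_u_def)

lemma in_z_mult: "in_z (x * y) = in_z x * in_z y"
  by (rule fps_ext) (simp add: in_z_def fps_mult_nth fps_const_sum)

lemma fps_nth_sum: "fps_nth (sum f A) n = (\<Sum>a\<in>A. fps_nth (f a) n)"
  by (induction A rule: infinite_finite_induct) simp_all

lemma in_uz_mult_nth:
  "fps_nth (fps_nth (in_uz f * X) m) n =
    (\<Sum>k\<in>{0..min m n}. fps_nth f k *s (e * fps_nth (fps_nth X (m - k)) (n - k)))"
proof -
  have "fps_nth (fps_nth (in_uz f * X) m) n =
     (\<Sum>k=0..m. \<Sum>l=0..n. if l = k then fps_nth f k *s (e * fps_nth (fps_nth X (m - k)) (n - k)) else 0)"
    unfolding fps_mult_nth [of "in_uz f"] fps_nth_sum fps_mult_nth [of "fps_nth (in_uz f) _"]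
    by (intro sum.cong refl) (auto simp: in_uz_def)
  also have "\<dots> = (\<Sum>k=0..m. if k \<le> n then fps_nth f k *s (e * fps_nth (fps_nth X (m - k)) (n - k)) else 0)"
    by (intro sum.cong refl) (simp add: sum.delta)
  also have "\<dots> = (\<Sum>k\<in>{0..min m n}. fps_nth f k *s (e * fps_nth (fps_nth X (m - k)) (n - k)))"
    by (rule sum.mono_neutral_cong_right) auto
  finally show ?thesis .
qed

lemma mult_in_uz_nth:
  "fps_nth (fps_nth (X * in_uz f) m) n =
    (\<Sum>k\<in>{0..min m n}. fps_nth f k *s (fps_nth (fps_nth X (m - k)) (n - k) * e))"
proof -
  have "fps_nth (fps_nth (X * in_uz f) m) n =
     (\<Sum>k=0..m. \<Sum>l=0..n. fps_nth (fps_nth X k) l *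
        (if n - l = m - k then fps_nth f (m - k) *s e else 0))"
    unfolding fps_mult_nth [of X] fps_nth_sum fps_mult_nth [of "fps_nth X _"]
    by (intro sum.cong refl) (auto simp: in_uz_def)
  also have "\<dots> = (\<Sum>k=0..m. \<Sum>l=0..n. fps_nth (fps_nth X (m - k)) (n - l) *
        (if l = k then fps_nth f k *s e else 0))"
  proof -
    have "(\<Sum>k=0..m. \<Sum>l=0..n. fps_nth (fps_nth X k) l * (if n - l = m - k then fps_nth f (m - k) *s e else 0)) =
        (\<Sum>k=0..m. \<Sum>l=0..n. fps_nth (fps_nth X (m - k)) l * (if n - l = k then fps_nth f k *s e else 0))"
      by (rule sum.reindex_bij_witness [of _ "\<lambda>k. m - k" "\<lambda>k. m - k"]) auto
    also have "\<dots> = (\<Sum>k=0..m. \<Sum>l=0..n. fps_nth (fps_nth X (m - k)) (n - l) * (if l = k then fps_nth f k *s e else 0))"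
      by (rule sum.cong [OF refl], rule sum.reindex_bij_witness [of _ "\<lambda>k. n - k" "\<lambda>k. n - k"]) auto
    finally show ?thesis .
  qed
  also have "\<dots> = (\<Sum>k=0..m. \<Sum>l=0..n. if l = k then fps_nth f k *s (fps_nth (fps_nth X (m - k)) (n - k) * e) else 0)"
    by (intro sum.cong refl) auto
  also have "\<dots> = (\<Sum>k=0..m. if k \<le> n then fps_nth f k *s (fps_nth (fps_nth X (m - k)) (n - k) * e) else 0)"
    by (intro sum.cong refl) (simp add: sum.delta)
  also have "\<dots> = (\<Sum>k\<in>{0..min m n}. fps_nth f k *s (fps_nth (fps_nth X (m - k)) (n - k) * e))"
    by (rule sum.mono_neutral_cong_right) auto
  finally show ?thesis .
qed

lemma in_z_in_u_nth: "fps_nth (fps_nth (in_z y * in_u x) m) n = fps_nth y m * fps_nth x n"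
  by (simp add: in_z_def in_u_def)

lemma in_u_in_z_nth: "fps_nth (fps_nth (in_u x * in_z y) m) n = fps_nth x n * fps_nth y m"
  by (simp add: in_z_def in_u_def)

lemma corner_e: "corner y \<Longrightarrow> e * (fps_nth y m * z) = fps_nth y m * z"
  by (simp add: corner_def mult.assoc [symmetric])

lemma in_uz_nth: "fps_nth (fps_nth (in_uz f) m) n = (if n = m then fps_nth f m *s e else 0)"
  by (simp add: in_uz_def)

text \<open>In the ring of double series the exchange relation is a product identity, with a factor
  f(uz) \<open>e\<close> that commutes with everything from the corner. Hence exchange factors
  multiply for products and invert for inverses.\<close>

lemma exch_iff:
  assumes "corner x" "corner y"
  shows "exch x y f \<longleftrightarrow> in_u x * in_z y = in_uz f * (in_z y * in_u x)"
  by (simp add: exch_def fps_eq_iff in_u_in_z_nth in_uz_mult_nth in_z_in_u_nth corner_e assms)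

lemma in_uz_commute:
  assumes "\<And>m n. e * fps_nth (fps_nth X m) n = fps_nth (fps_nth X m) n"
    "\<And>m n. fps_nth (fps_nth X m) n * e = fps_nth (fps_nth X m) n"
  shows "in_uz f * X = X * in_uz f"
  by (intro fps_ext) (simp add: mult_in_uz_nth in_uz_mult_nth assms)

lemma in_uz_in_u: "corner x \<Longrightarrow> in_uz f * in_u x = in_u x * in_uz f"
  and in_uz_in_z: "corner x \<Longrightarrow> in_uz f * in_z x = in_z x * in_uz f"
  by (rule in_uz_commute; simp add: in_u_def in_z_def corner_def)+

lemma in_uz_mult: "in_uz f * in_uz g = in_uz (f * g)"
proof (intro fps_ext)
  fix m n
  have "(\<Sum>k\<in>{0..min m n}. fps_nth f k *s (e * (if n - k = m - k then fps_nth g (m - k) *s e else 0))) =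
      (if n = m then (\<Sum>k\<in>{0..m}. fps_nth f k * fps_nth g (m - k)) *s e else 0)"
    by (auto simp: e_e scl_sum_left intro!: sum.cong sum.neutral)
  thus "fps_nth (fps_nth (in_uz f * in_uz g) m) n = fps_nth (fps_nth (in_uz (f * g)) m) n"
    by (simp add: in_uz_mult_nth in_uz_nth fps_mult_nth [of f g])
qed

lemma in_uz_1: "corner x \<Longrightarrow> in_uz 1 * in_u x = in_u x" "corner x \<Longrightarrow> in_uz 1 * in_z x = in_z x"
proof -
  have 1: "in_uz 1 = fps_const (fps_const e)"
    by (intro fps_ext) (auto simp: in_uz_def)
  show "corner x \<Longrightarrow> in_uz 1 * in_u x = in_u x" "corner x \<Longrightarrow> in_uz 1 * in_z x = in_z x"
    by (simp_all add: 1 in_u_def in_z_def fps_eq_iff corner_def)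
qed

lemma exch_mult_left:
  assumes x: "corner x" "corner x'" and y: "corner y" and 1: "exch x y f" and 2: "exch x' y g"
  shows "exch (x * x') y (f * g)"
proof -
  have "in_u x * in_u x' * in_z y = in_u x * (in_uz g * in_z y * in_u x')"
    using 2 by (simp add: exch_iff x y mult.assoc)
  also have "\<dots> = in_uz g * (in_u x * in_z y) * in_u x'"
    using x by (simp add: in_uz_in_u mult.assoc [symmetric])
  also have "\<dots> = in_uz g * in_uz f * (in_z y * (in_u x * in_u x'))"
    using 1 by (simp add: exch_iff x y mult.assoc)
  finally show ?thesis
    by (simp add: exch_iff x y corner_mult in_u_mult in_uz_mult mult.commute)
qed

lemma exch_mult_right:
  assumes x: "corner x" and y: "corner y" "corner y'" and 1: "exch x y f" and 2: "exch x y' g"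
  shows "exch x (y * y') (f * g)"
proof -
  have "in_u x * (in_z y * in_z y') = in_uz f * in_z y * (in_u x * in_z y')"
    using 1 by (simp add: exch_iff x y mult.assoc [symmetric])
  also have "\<dots> = in_uz f * (in_z y * in_uz g) * (in_z y' * in_u x)"
    using 2 by (simp add: exch_iff x y mult.assoc)
  also have "in_z y * in_uz g = in_uz g * in_z y"
    using y by (simp add: in_uz_in_z)
  finally show ?thesis
    by (simp add: exch_iff x y corner_mult in_z_mult in_uz_mult [symmetric] mult.assoc)
qed

lemma in_u_inverse: "x * x' = fps_const e \<Longrightarrow> corner y \<Longrightarrow> in_u x * (in_u x' * in_z y) = in_z y"
  and in_u_inverse': "x * x' = fps_const e \<Longrightarrow> corner y \<Longrightarrow> in_z y * (in_u x * in_u x') = in_z y"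
  and in_z_inverse: "x * x' = fps_const e \<Longrightarrow> corner y \<Longrightarrow> in_z x * (in_z x' * in_u y) = in_u y"
  and in_z_inverse': "x * x' = fps_const e \<Longrightarrow> corner y \<Longrightarrow> in_u y * (in_z x * in_z x') = in_u y"
proof -
  have e: "in_u (fps_const e) = fps_const (fps_const e)" "in_z (fps_const e) = fps_const (fps_const e)"
    by (auto simp: in_u_def in_z_def fps_eq_iff)
  show "x * x' = fps_const e \<Longrightarrow> corner y \<Longrightarrow> in_u x * (in_u x' * in_z y) = in_z y"
    "x * x' = fps_const e \<Longrightarrow> corner y \<Longrightarrow> in_z y * (in_u x * in_u x') = in_z y"
    "x * x' = fps_const e \<Longrightarrow> corner y \<Longrightarrow> in_z x * (in_z x' * in_u y) = in_u y"
    "x * x' = fps_const e \<Longrightarrow> corner y \<Longrightarrow> in_u y * (in_z x * in_z x') = in_u y"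
    unfolding mult.assoc [symmetric] in_u_mult [symmetric] in_z_mult [symmetric]
    unfolding mult.assoc in_u_mult [symmetric] in_z_mult [symmetric]
    by (simp_all add: e, simp_all add: in_u_def in_z_def fps_eq_iff corner_def)
qed

lemma exch_inverse_left:
  assumes x: "corner x" "corner x'" and y: "corner y" and ex: "exch x y f"
    and inv: "x * x' = fps_const e" "x' * x = fps_const e" and fg: "f * g = 1"
  shows "exch x' y g"
proof -
  have "in_z y * in_u x' = in_u x' * (in_u x * in_z y) * in_u x'"
    by (simp add: in_u_inverse inv y)
  also have "in_u x * in_z y = in_uz f * (in_z y * in_u x)"
    using ex by (simp add: exch_iff x y)
  also have "in_u x' * (in_uz f * (in_z y * in_u x)) * in_u x' =
      in_uz f * in_u x' * (in_z y * (in_u x * in_u x'))"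
    using x by (simp add: in_uz_in_u mult.assoc [symmetric])
  also have "\<dots> = in_uz f * in_u x' * in_z y"
    by (simp add: in_u_inverse' inv y)
  finally have "in_uz g * (in_z y * in_u x') = in_uz (g * f) * in_u x' * in_z y"
    by (simp add: in_uz_mult [symmetric] mult.assoc)
  thus ?thesis using fg by (simp add: exch_iff x y mult.commute in_uz_1)
qed

lemma exch_inverse_right:
  assumes x: "corner x" and y: "corner y" "corner y'" and ex: "exch x y f"
    and inv: "y * y' = fps_const e" "y' * y = fps_const e" and fg: "f * g = 1"
  shows "exch x y' g"
proof -
  have "in_z y' * in_u x = in_z y' * (in_u x * (in_z y * in_z y'))"
    by (simp add: in_z_inverse' inv x)
  also have "\<dots> = in_z y' * (in_u x * in_z y) * in_z y'"
    by (simp add: mult.assoc)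
  also have "in_u x * in_z y = in_uz f * (in_z y * in_u x)"
    using ex by (simp add: exch_iff x y)
  also have "in_z y' * (in_uz f * (in_z y * in_u x)) * in_z y' =
      in_uz f * (in_z y' * (in_z y * in_u x)) * in_z y'"
    by (metis (no_types) in_uz_in_z [OF y(2)] mult.assoc)
  also have "\<dots> = in_uz f * in_u x * in_z y'"
    by (simp add: in_z_inverse inv x)
  finally have "in_uz g * (in_z y' * in_u x) = in_uz (g * f) * in_u x * in_z y'"
    by (simp add: in_uz_mult [symmetric] mult.assoc)
  thus ?thesis using fg by (simp add: exch_iff x y mult.commute in_uz_1)
qed

text \<open>(R2) brings Q to the right of P, whereas (D3) brings the current of the P's to the right
  of that of the Q's. Reversing the order inverts the factor.\<close>

lemma exch_swap:
  assumes x: "corner x" and y: "corner y" and ex: "exch x y f" and fg: "f * g = 1"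
  shows "fps_nth y m * fps_nth x n =
     (\<Sum>k\<in>{0..min m n}. fps_nth g k *s (fps_nth x (n - k) * fps_nth y (m - k)))"
proof -
  have "in_uz g * (in_u x * in_z y) = in_uz (g * f) * (in_z y * in_u x)"
    using ex by (simp add: exch_iff x y in_uz_mult [symmetric] mult.assoc)
  hence "in_z y * in_u x = in_uz g * (in_u x * in_z y)"
    using fg in_uz_1(2) [OF y] by (simp add: mult.commute mult.assoc [symmetric])
  hence "fps_nth (fps_nth (in_z y * in_u x) m) n = fps_nth (fps_nth (in_uz g * (in_u x * in_z y)) m) n"
    by simp
  thus ?thesis
    by (simp add: in_z_in_u_nth in_uz_mult_nth in_u_in_z_nth corner_e x)
qed

lemma exch_scale:
  assumes "exch x y f"
  shows "exch (Abs_fps (\<lambda>n. b ^ n *s fps_nth x n)) (Abs_fps (\<lambda>n. c ^ n *s fps_nth y n))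
     (Abs_fps (\<lambda>n. (b * c) ^ n * fps_nth f n))"
  unfolding exch_def
proof (intro allI)
  fix m n
  have "(b ^ n * c ^ m) *s (fps_nth x n * fps_nth y m) =
      (\<Sum>k\<in>{0..min m n}. (b ^ n * c ^ m * fps_nth f k) *s (fps_nth y (m - k) * fps_nth x (n - k)))"
    using assms by (simp add: exch_def scl_sum_right)
  also have "\<dots> = (\<Sum>k\<in>{0..min m n}. ((b * c) ^ k * fps_nth f k * (c ^ (m - k) * b ^ (n - k))) *s
      (fps_nth y (m - k) * fps_nth x (n - k)))"
  proof (intro sum.cong refl)
    fix k assume "k \<in> {0..min m n}"
    hence "b ^ n = b ^ k * b ^ (n - k)" "c ^ m = c ^ k * c ^ (m - k)"
      by (simp_all flip: power_add)
    hence "b ^ n * c ^ m * fps_nth f k = (b * c) ^ k * fps_nth f k * (c ^ (m - k) * b ^ (n - k))"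
      by (simp add: power_mult_distrib)
    thus "(b ^ n * c ^ m * fps_nth f k) *s (fps_nth y (m - k) * fps_nth x (n - k)) =
       ((b * c) ^ k * fps_nth f k * (c ^ (m - k) * b ^ (n - k))) *s
         (fps_nth y (m - k) * fps_nth x (n - k))" by (simp only:)
  qed
  finally show "fps_nth (Abs_fps (\<lambda>n. b ^ n *s fps_nth x n)) n *
      fps_nth (Abs_fps (\<lambda>n. c ^ n *s fps_nth y n)) m =
      (\<Sum>k\<in>{0..min m n}. fps_nth (Abs_fps (\<lambda>n. (b * c) ^ n * fps_nth f n)) k *s
        (fps_nth (Abs_fps (\<lambda>n. c ^ n *s fps_nth y n)) (m - k) *
         fps_nth (Abs_fps (\<lambda>n. b ^ n *s fps_nth x n)) (n - k)))"
    by (simp add: mult_ac)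
qed

end

section \<open>The structure function of (D3)\<close>

definition geom_factor :: "'f::field \<Rightarrow> 'f fps" where
  "geom_factor t = 1 - fps_const t * fps_X"

lemma geom_factor_mult_nth:
  "fps_nth (f * geom_factor t) n = fps_nth f n - (if n = 0 then 0 else t * fps_nth f (n - 1))"
  by (cases n) (simp_all add: geom_factor_def right_diff_distrib mult.assoc [symmetric] mult.commute [of f])

section \<open>Generating series of symmetric and exterior powers\<close>

lemma finite_msets_of_size:
  assumes "finite B"
  shows "finite {M. set_mset M \<subseteq> B \<and> size M = n}"
proof (rule finite_subset)
  show "{M. set_mset M \<subseteq> B \<and> size M = n} \<subseteq> mset ` {xs. set xs \<subseteq> B \<and> length xs = n}"
  proof
    fix M assume M: "M \<in> {M. set_mset M \<subseteq> B \<and> size M = n}"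
    obtain xs where "mset xs = M" using ex_mset by blast
    with M show "M \<in> mset ` {xs. set xs \<subseteq> B \<and> length xs = n}" by (intro image_eqI [of _ _ xs]) auto
  qed
qed (use assms in \<open>simp add: finite_lists_length_eq\<close>)

text \<open>The generating function of the complete symmetric functions. A nonempty multiset on
  \<open>insert b B\<close> either avoids b or arises from a smaller one by adding b; multiplication
  by 1 - w(b) x removes the second kind.\<close>

lemma sym_series:
  fixes w :: "'b \<Rightarrow> 'f::field"
  assumes "finite B"
  shows "Abs_fps (\<lambda>n. \<Sum>M\<in>{M. set_mset M \<subseteq> B \<and> size M = n}. \<Prod>b\<in>#M. w b) * (\<Prod>b\<in>B. geom_factor (w b)) = 1"
  using assms
proof (induction B)
  case empty
  have "{M. set_mset M \<subseteq> {} \<and> size M = n} = (if n = 0 then {{#} :: 'b multiset} else {})" for n :: nat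
    by auto
  hence "(\<Sum>M\<in>{M. set_mset M \<subseteq> {} \<and> size M = n}. \<Prod>b\<in>#M. w b) = (if n = 0 then 1 else 0)" for n
    by (simp only:) simp
  thus ?case by (simp only: fps_eq_iff prod.empty mult_1_right) simp
next
  case (insert b B)
  let ?S = "\<lambda>B n. {M. set_mset M \<subseteq> B \<and> size M = n}"
  let ?H = "\<lambda>B. Abs_fps (\<lambda>n. \<Sum>M\<in>?S B n. \<Prod>b\<in>#M. w b)"
  have "?H (insert b B) * geom_factor (w b) = ?H B"
  proof (rule fps_ext)
    fix n
    show "fps_nth (?H (insert b B) * geom_factor (w b)) n = fps_nth (?H B) n"
    proof (cases n)
      case 0
      have "?S B 0 = {{#}}" for B :: "'b set" by auto
      with 0 show ?thesis by (simp add: geom_factor_mult_nth) (simp add: geom_factor_def)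
    next
      case (Suc m)
      have "?S (insert b B) (Suc m) = ?S B (Suc m) \<union> add_mset b ` ?S (insert b B) m" (is "?L = ?R1 \<union> ?R2")
      proof
        show "?L \<subseteq> ?R1 \<union> ?R2"
        proof
          fix M assume M: "M \<in> ?L"
          show "M \<in> ?R1 \<union> ?R2"
          proof (cases "b \<in># M")
            case True
            then obtain M' where "M = add_mset b M'" by (metis mset_add)
            with M show ?thesis by auto
          next
            case False
            with M show ?thesis by auto
          qed
        qed
      qed auto
      moreover have "?R1 \<inter> ?R2 = {}" using insert.hyps by auto
      ultimately have "(\<Sum>M\<in>?L. \<Prod>b\<in>#M. w b) = (\<Sum>M\<in>?R1. \<Prod>b\<in>#M. w b) + (\<Sum>M\<in>?R2. \<Prod>b\<in>#M. w b)"
        using insert.hyps by (simp add: sum.union_disjoint finite_msets_of_size)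
      also have "(\<Sum>M\<in>?R2. \<Prod>b\<in>#M. w b) = w b * (\<Sum>M\<in>?S (insert b B) m. \<Prod>b\<in>#M. w b)"
        by (subst sum.reindex) (auto simp: inj_on_def sum_distrib_left)
      finally show ?thesis using Suc by (simp add: geom_factor_mult_nth)
    qed
  qed
  thus ?case using insert by (simp add: mult.assoc [symmetric])
qed

text \<open>The generating function of the elementary symmetric functions: the subsets with and
  without b correspond to the two terms of 1 - w(b) x.\<close>

lemma ext_series:
  fixes w :: "'b \<Rightarrow> 'f::field"
  assumes "finite B"
  shows "Abs_fps (\<lambda>n. (- 1) ^ n * (\<Sum>S\<in>{S. S \<subseteq> B \<and> card S = n}. \<Prod>b\<in>S. w b)) = (\<Prod>b\<in>B. geom_factor (w b))"
  using assms
proof (induction B)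
  case empty
  have "{S. S \<subseteq> {} \<and> card S = n} = (if n = 0 then {{} :: 'b set} else {})" for n :: nat
    by auto
  hence "(\<Sum>S\<in>{S. S \<subseteq> {} \<and> card S = n}. \<Prod>b\<in>S. w b) = (if n = 0 then 1 else 0)" for n
    by (simp only:) simp
  thus ?case by (simp only: fps_eq_iff prod.empty mult_1_right) simp
next
  case (insert b B)
  let ?S = "\<lambda>B n. {S. S \<subseteq> B \<and> card S = n}"
  let ?H = "\<lambda>B. Abs_fps (\<lambda>n. (- 1) ^ n * (\<Sum>S\<in>?S B n. \<Prod>b\<in>S. w b))"
  have "?H (insert b B) = ?H B * geom_factor (w b)"
  proof (rule fps_ext)
    fix n
    show "fps_nth (?H (insert b B)) n = fps_nth (?H B * geom_factor (w b)) n"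
    proof (cases n)
      case 0
      have "?S B' 0 = {{}}" if "finite B'" for B' :: "'b set"
        using that by (auto dest: finite_subset)
      with 0 insert.hyps show ?thesis by (simp add: geom_factor_mult_nth) (simp add: geom_factor_def)
    next
      case (Suc m)
      have fin: "finite S" if "S \<subseteq> B" for S using that insert.hyps finite_subset by blast
      have "?S (insert b B) (Suc m) = ?S B (Suc m) \<union> insert b ` ?S B m" (is "?L = ?R1 \<union> ?R2")
      proof
        show "?L \<subseteq> ?R1 \<union> ?R2"
        proof
          fix S assume S: "S \<in> ?L"
          show "S \<in> ?R1 \<union> ?R2"
          proof (cases "b \<in> S")
            case True
            with S have "S = insert b (S - {b})" "S - {b} \<in> ?S B m" by auto
            thus ?thesis by blast
          next
            case False
            with S show ?thesis by auto
          qed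
        qed
        show "?R1 \<union> ?R2 \<subseteq> ?L"
          using insert.hyps fin by (auto simp: card_insert_if)
      qed
      moreover have "?R1 \<inter> ?R2 = {}" using insert.hyps by auto
      ultimately have "(\<Sum>S\<in>?L. \<Prod>b\<in>S. w b) = (\<Sum>S\<in>?R1. \<Prod>b\<in>S. w b) + (\<Sum>S\<in>?R2. \<Prod>b\<in>S. w b)"
        using insert.hyps by (simp add: sum.union_disjoint)
      also have "(\<Sum>S\<in>?R2. \<Prod>b\<in>S. w b) = (\<Sum>S\<in>?S B m. \<Prod>b\<in>insert b S. w b)"
        using insert.hyps by (subst sum.reindex) (auto simp: inj_on_def)
      also have "\<dots> = (\<Sum>S\<in>?S B m. w b * (\<Prod>b\<in>S. w b))"
        using insert.hyps fin by (intro sum.cong refl prod.insert) auto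
      also have "\<dots> = w b * (\<Sum>S\<in>?S B m. \<Prod>b\<in>S. w b)"
        by (simp add: sum_distrib_left)
      finally show ?thesis using Suc by (simp add: geom_factor_mult_nth distrib_left mult.left_commute)
    qed
  qed
  thus ?case using insert by (simp add: mult.commute)
qed

section \<open>Graded dimensions of [c] and [2][c]\<close>

lemma prod_graded_basis:
  "(\<Prod>b\<in>graded_basis f. g (fst b)) = (\<Prod>d\<in>Poly_Mapping.keys f. g d ^ Poly_Mapping.lookup f d)"
proof -
  have "graded_basis f = Sigma (Poly_Mapping.keys f) (\<lambda>d. {..<Poly_Mapping.lookup f d})"
    by (auto simp: graded_basis_def in_keys_iff)
  moreover have "(\<Prod>d\<in>Poly_Mapping.keys f. \<Prod>k<Poly_Mapping.lookup f d. g d) =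
      (\<Prod>(d, k)\<in>Sigma (Poly_Mapping.keys f) (\<lambda>d. {..<Poly_Mapping.lookup f d}). g d)"
    by (rule prod.Sigma) auto
  ultimately show ?thesis by (simp add: split_def)
qed

lemma finite_graded_basis: "finite (graded_basis f)"
proof -
  have "graded_basis f = Sigma (Poly_Mapping.keys f) (\<lambda>d. {..<Poly_Mapping.lookup f d})"
    by (auto simp: graded_basis_def in_keys_iff)
  thus ?thesis by simp
qed

lemma prod_graded_basis_add:
  "(\<Prod>b\<in>graded_basis (f + g). h (fst b)) =
     (\<Prod>b\<in>graded_basis f. h (fst b)) * (\<Prod>b\<in>graded_basis g. h (fst b))"
proof -
  let ?S = "Poly_Mapping.keys f \<union> Poly_Mapping.keys g"
  have *: "(\<Prod>b\<in>graded_basis f'. h (fst b)) = (\<Prod>d\<in>?S. h d ^ Poly_Mapping.lookup f' d)"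
    if "Poly_Mapping.keys f' \<subseteq> ?S" for f'
    unfolding prod_graded_basis
    by (rule prod.mono_neutral_left) (use that in \<open>auto simp: in_keys_iff\<close>)
  show ?thesis
    using keys_add [of f g] by (simp add: * lookup_add power_add prod.distrib)
qed

lemma prod_graded_basis_sum:
  "(\<Prod>b\<in>graded_basis (\<Sum>k<n. f k). h (fst b)) = (\<Prod>k<n. \<Prod>b\<in>graded_basis (f k). h (fst b))"
  for n :: nat
proof (induction n)
  case 0
  show ?case by (simp add: prod_graded_basis)
next
  case (Suc n)
  thus ?case by (simp add: prod_graded_basis_add)
qed

lemma prod_graded_basis_single:
  "(\<Prod>b\<in>graded_basis (Poly_Mapping.single d 1). h (fst b)) = h d"
  by (simp add: prod_graded_basis)

text \<open>\<open>\<Prod>\<^sub>k\<^sub><\<^sub>c (1 - q\<^sup>j\<^sup>-\<^sup>2\<^sup>k x)\<close>\<close>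

definition string_prod :: "nat \<Rightarrow> int \<Rightarrow> 'k::field_char_0 poly fract fps" where
  "string_prod c j = (\<Prod>k<c. geom_factor (qq powi (j - 2 * int k)))"

text \<open>Both sides are the product over the string with c + 1 factors, seen once as the shorter
  string extended at its lower end and once as extended at its upper end.\<close>

lemma string_prod_shift:
  "string_prod c (j + 2) * geom_factor (qq powi (j + 2 - 2 * int c)) =
     geom_factor (qq powi (j + 2)) * (string_prod c j :: 'k::field_char_0 poly fract fps)"
proof -
  have "string_prod c (j + 2) * geom_factor (qq powi (j + 2 - 2 * int c)) =
      (\<Prod>k<Suc c. geom_factor (qq powi (j + 2 - 2 * int k)) :: 'k poly fract fps)"
    by (simp add: string_prod_def)
  also have "\<dots> = geom_factor (qq powi (j + 2)) * string_prod c j"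
    by (subst prod.lessThan_Suc_shift) (simp add: string_prod_def algebra_simps)
  finally show ?thesis .
qed

lemma string_prod_nth_0: "fps_nth (string_prod c j) 0 = 1"
  unfolding string_prod_def by (induction c) (simp_all add: geom_factor_def)

lemma string_prod_shift':
  assumes "j' = j + 2" "l = j + 2 - 2 * int c"
  shows "string_prod c j' * geom_factor (qq powi l) =
     geom_factor (qq powi j') * (string_prod c j :: 'k::field_char_0 poly fract fps)"
  unfolding assms by (rule string_prod_shift)

lemma qq_nonzero: "(qq :: 'k::field_char_0 poly fract) \<noteq> 0"
  by (simp add: qq_def qhalf_nonzero)

lemma qq_powi_sum: "qq powi (\<Sum>b\<in>A. f b) = (\<Prod>b\<in>A. qq powi f b :: 'k::field_char_0 poly fract)"
  by (induction A rule: infinite_finite_induct) (simp_all add: power_int_add qq_nonzero)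

lemma qq_powi_sum_mset: "qq powi (\<Sum>b\<in>#M. f b) = (\<Prod>b\<in>#M. qq powi f b :: 'k::field_char_0 poly fract)"
  by (induction M) (simp_all add: power_int_add qq_nonzero)

lemma prod_basis_laurent_qint:
  "(\<Prod>b\<in>graded_basis (laurent_qint c). geom_factor (qq powi fst b)) =
     (string_prod c (int c - 1) :: 'k::field_char_0 poly fract fps)"
  using prod_graded_basis_sum [where h = "\<lambda>d. geom_factor (qq powi d) :: 'k poly fract fps"]
  by (simp add: laurent_qint_def prod_graded_basis_single
      [where h = "\<lambda>d. geom_factor (qq powi d) :: 'k poly fract fps", simplified] string_prod_def)

text \<open>[2][c] is the sum of q [c] and q^{-1} [c], two strings with highest degrees c and c -
  2.\<close>

lemma prod_basis_two_laurent_qint: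
  "(\<Prod>b\<in>graded_basis (laurent_qint 2 * laurent_qint c). geom_factor (qq powi fst b)) =
     (string_prod c (int c) * string_prod c (int c - 2) :: 'k::field_char_0 poly fract fps)"
proof -
  let ?h = "\<lambda>d. geom_factor (qq powi d) :: 'k poly fract fps"
  have 2: "laurent_qint 2 = Poly_Mapping.single 1 1 + Poly_Mapping.single (- 1) 1"
    by (simp add: laurent_qint_def numeral_2_eq_2)
  have "laurent_qint 2 * laurent_qint c =
      (\<Sum>k<c. Poly_Mapping.single (int c - 2 * int k) 1) + (\<Sum>k<c. Poly_Mapping.single (int c - 2 - 2 * int k) 1)"
    unfolding 2 by (simp add: laurent_qint_def distrib_right sum_distrib_left mult_single sum.distrib algebra_simps)
  thus ?thesis
    by (simp add: prod_graded_basis_add [where h = ?h] prod_graded_basis_sum [where h = ?h]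
        prod_graded_basis_single [where h = ?h, simplified] string_prod_def)
qed

text \<open>The exchange factor of Q(u) with P(z) in row shape. The column series are, up to the
  sign of the variable, the inverses of the row series, so their exchange factors come from this one
  by inversion.\<close>

definition heis_series :: "nat \<Rightarrow> int \<Rightarrow> 'k::field_char_0 poly fract fps" where
  "heis_series c a = Abs_fps (heis_coeff c True a)"

lemma heis_series_2:
  "heis_series c 2 * (string_prod c (int c) * string_prod c (int c - 2)) = (1 :: 'k::field_char_0 poly fract fps)"
proof -
  let ?B = "graded_basis (laurent_qint 2 * laurent_qint c)"
  have "heis_series c 2 = Abs_fps (\<lambda>n. \<Sum>M\<in>{M. set_mset M \<subseteq> ?B \<and> size M = n}.
      \<Prod>b\<in>#M. qq powi fst b :: 'k poly fract)"
    by (simp add: fps_eq_iff heis_series_def heis_coeff_def sym_gdim_def qq_powi_sum_mset)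
  thus ?thesis
    using sym_series [OF finite_graded_basis, where w = "\<lambda>b. qq powi fst b :: 'k poly fract"]
    by (simp only: prod_basis_two_laurent_qint [symmetric])
qed

lemma heis_series_minus_1:
  "heis_series c (- 1) = (string_prod c (int c - 1) :: 'k::field_char_0 poly fract fps)"
proof -
  have "heis_series c (- 1) = Abs_fps (\<lambda>n. (- 1) ^ n *
      (\<Sum>S\<in>{S. S \<subseteq> graded_basis (laurent_qint c) \<and> card S = n}. \<Prod>b\<in>S. qq powi fst b :: 'k poly fract))"
    by (simp add: fps_eq_iff heis_series_def heis_coeff_def ext_gdim_def qq_powi_sum)
  thus ?thesis
    using ext_series [OF finite_graded_basis, where w = "\<lambda>b. qq powi fst b :: 'k poly fract"]
    by (simp only: prod_basis_laurent_qint [symmetric])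
qed

lemma heis_series_0: "heis_series c 0 = 1"
  by (simp add: heis_series_def heis_coeff_def fps_eq_iff)

lemma string_prod_scale:
  "Abs_fps (\<lambda>n. (qq powi i) ^ n * fps_nth (string_prod c j) n) =
     (string_prod c (j + i) :: 'k::field_char_0 poly fract fps)"
proof -
  have "Abs_fps (\<lambda>n. (qq powi i) ^ n * fps_nth (string_prod c j) n) =
      (string_prod c j oo (fps_const (qq powi i) * fps_X) :: 'k poly fract fps)"
    by (rule fps_compose_linear [symmetric])
  also have "\<dots> = (\<Prod>k<c. geom_factor (qq powi (j - 2 * int k)) oo (fps_const (qq powi i) * fps_X))"
    unfolding string_prod_def by (rule fps_compose_prod_distrib) simp
  also have "\<dots> = string_prod c (j + i)"
    unfolding string_prod_def
  proof (intro prod.cong refl)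
    fix k
    show "geom_factor (qq powi (j - 2 * int k)) oo (fps_const (qq powi i) * fps_X) =
        (geom_factor (qq powi (j + i - 2 * int k)) :: 'k poly fract fps)"
      by (simp add: geom_factor_def fps_compose_sub_distrib fps_compose_mult_distrib mult.assoc [symmetric]
          fps_const_mult [symmetric] del: fps_const_mult)
        (simp add: power_int_add [symmetric] qq_nonzero algebra_simps)
  qed
  finally show ?thesis .
qed

text \<open>X - s = - s (1 - X/s). The two constants s in the numerator are inverse to each other,
  and so are those in the denominator, so the prefactors cancel.\<close>

lemma d3_series_mult:
  "d3_series c a * (geom_factor (qq powi (- a - int c)) * geom_factor (qq powi (a + int c))) =
     (geom_factor (qq powi (a - int c)) * geom_factor (qq powi (int c - a)) :: 'k::field_char_0 poly fract fps)"
proof -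
  let ?X = "fps_X :: 'k poly fract fps"
  let ?t = "qq powi (int c - a) :: 'k poly fract" and ?u = "qq powi (a + int c) :: 'k poly fract"
  have X: "?X - fps_const t = fps_const (- t) * geom_factor (inverse t)" if "t \<noteq> 0" for t
    using that by (simp add: geom_factor_def right_diff_distrib mult.assoc [symmetric]
        flip: fps_const_neg)
  have e: "qq powi (- a) * qq powi int c = ?t" "qq powi a * qq powi (- int c) = inverse ?t"
    "qq powi a * qq powi int c = ?u" "qq powi (- a) * qq powi (- int c) = inverse ?u"
    unfolding power_int_minus [symmetric]
    by (subst power_int_add [symmetric]; simp add: qq_nonzero algebra_simps)+
  have nz: "?t \<noteq> 0" "?u \<noteq> 0" "inverse ?t \<noteq> 0" "inverse ?u \<noteq> 0" by (simp_all add: qq_nonzero)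
  have "d3_series c a = (geom_factor (inverse ?t) * geom_factor ?t) / (geom_factor (inverse ?u) * geom_factor ?u)"
  proof -
    have "(?X - fps_const t) * (?X - fps_const (inverse t)) = geom_factor (inverse t) * geom_factor t"
      if "t \<noteq> 0" for t
    proof -
      have "fps_const (- t) * fps_const (- inverse t) = (1 :: 'k poly fract fps)"
        using that by simp
      thus ?thesis using X [of t] X [of "inverse t"] that
        by (simp add: mult_ac del: fps_const_mult fps_const_neg)
    qed
    thus ?thesis unfolding d3_series_def e using nz by simp
  qed
  moreover have "fps_nth (geom_factor (inverse ?u) * geom_factor ?u) 0 \<noteq> 0"
    by (simp add: geom_factor_def)
  hence "x / (geom_factor (inverse ?u) * geom_factor ?u) * (geom_factor (inverse ?u) * geom_factor ?u) = x" for x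
    by (simp add: fps_divide_unit inverse_mult_eq_1 mult.assoc)
  ultimately have "d3_series c a * (geom_factor (inverse ?u) * geom_factor ?u) = geom_factor (inverse ?t) * geom_factor ?t"
    by simp
  moreover have "inverse ?u = qq powi (- a - int c)" "inverse ?t = qq powi (a - int c)"
    by (simp_all add: power_int_minus [symmetric] algebra_simps)
  ultimately show ?thesis by simp
qed

section \<open>The structure function and the exchange factors of (R2)\<close>

lemma geom_factor_nz: "geom_factor t \<noteq> 0"
proof -
  have "fps_nth (geom_factor t) 0 \<noteq> 0" by (simp add: geom_factor_def)
  thus ?thesis by force
qed

definition qscale :: "int \<Rightarrow> 'k::field_char_0 poly fract fps \<Rightarrow> 'k poly fract fps" where
  "qscale i f = Abs_fps (\<lambda>n. (qq powi i) ^ n * fps_nth f n)"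

lemma qscale_mult: "qscale i (f * g) = qscale i f * qscale i g"
  unfolding qscale_def fps_compose_linear [symmetric] by (rule fps_compose_mult_distrib) simp

lemma qscale_1: "qscale i 1 = 1"
  by (simp add: qscale_def fps_eq_iff)

lemma qscale_string_prod: "qscale i (string_prod c j) = string_prod c (j + i)"
  by (simp add: qscale_def string_prod_scale)

text \<open>Each current is a quotient of two Q's or P's whose arguments differ by q^2, so
  exchanging two currents involves four factors: g(x) twice, and its inverse f at q^2 x and at
  q^{-2} x. In terms of \<open>string_prod\<close> the shifted products agree with the unshifted
  ones up to end factors, and these end factors form the numerator and the denominator of
  \<open>d3_series\<close>.\<close>

lemma d3_series_heis:
  assumes a: "a = 2 \<or> a = - 1 \<or> a = 0"
  obtains f where "heis_series c a * f = (1 :: 'k::field_char_0 poly fract fps)"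
    "heis_series c a * qscale 2 f * qscale (- 2) f * heis_series c a * d3_series c a = 1"
  using a
proof (elim disjE)
  let ?G = "\<lambda>j. geom_factor (qq powi j) :: 'k poly fract fps"
  let ?T = "string_prod c :: int \<Rightarrow> 'k poly fract fps"
  let ?c = "int c"
  {
    assume "a = 2"
    let ?f = "?T ?c * ?T (?c - 2)"
    have f: "qscale 2 ?f = ?T (?c + 2) * ?T ?c" "qscale (- 2) ?f = ?T (?c - 2) * ?T (?c - 4)"
      by (simp_all add: qscale_mult qscale_string_prod)
    have "(d3_series c 2 * (?G (- 2 - ?c) * ?G (2 + ?c))) * (?T (?c + 2) * ?T ?c * ?T (?c - 2) * ?T (?c - 4)) =
        (?T (?c + 2) * ?G (2 - ?c)) * (?G (?c - 2) * ?T (?c - 4)) * (?T ?c * ?T (?c - 2))"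
      unfolding d3_series_mult by (simp add: mult_ac)
    also have "\<dots> = (?G (?c + 2) * ?T ?c) * (?T (?c - 2) * ?G (- 2 - ?c)) * (?T ?c * ?T (?c - 2))"
      using string_prod_shift' [of "?c + 2" ?c "2 - ?c" c, where 'k = 'k]
        string_prod_shift' [of "?c - 2" "?c - 4" "- 2 - ?c" c, where 'k = 'k] by simp
    finally have "(?G (- 2 - ?c) * ?G (2 + ?c)) * (d3_series c 2 * (qscale 2 ?f * qscale (- 2) ?f)) =
       (?G (- 2 - ?c) * ?G (2 + ?c)) * (?f * ?f)"
      unfolding f by (simp add: mult_ac add.commute)
    hence d: "d3_series c 2 * (qscale 2 ?f * qscale (- 2) ?f) = ?f * ?f"
      by (simp add: geom_factor_nz)
    show ?thesis
    proof (rule that [of ?f])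
      show 1: "heis_series c a * ?f = 1" using heis_series_2 [of c] \<open>a = 2\<close> by simp
      have "heis_series c a * qscale 2 ?f * qscale (- 2) ?f * heis_series c a * d3_series c a =
          heis_series c a * heis_series c a * (d3_series c 2 * (qscale 2 ?f * qscale (- 2) ?f))"
        using \<open>a = 2\<close> by (simp only: mult_ac)
      also have "\<dots> = (heis_series c a * ?f) * (heis_series c a * ?f)"
        unfolding d by (simp only: mult_ac)
      finally show "heis_series c a * qscale 2 ?f * qscale (- 2) ?f * heis_series c a * d3_series c a = 1"
        unfolding 1 by simp
    qed
  next
    assume "a = - 1"
    let ?f = "inverse (?T (?c - 1))"
    have "fps_nth (?T (?c - 1)) 0 = 1"
      by (rule string_prod_nth_0)
    hence f1: "?T (?c - 1) * ?f = 1"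
      using inverse_mult_eq_1 [of "?T (?c - 1)"] by (simp add: mult.commute)
    have f2: "?T (?c + 1) * qscale 2 ?f = 1" and f3: "?T (?c - 3) * qscale (- 2) ?f = 1"
      using arg_cong [OF f1, of "qscale 2"] arg_cong [OF f1, of "qscale (- 2)"]
      by (simp_all add: qscale_mult qscale_1 qscale_string_prod add.commute)
    have "(d3_series c (- 1) * (?G (1 - ?c) * ?G (?c - 1))) * (?T (?c - 1) * ?T (?c - 1)) =
        (?G (?c + 1) * ?T (?c - 1)) * (?T (?c - 1) * ?G (- 1 - ?c))"
      using d3_series_mult [of c "- 1", where 'k = 'k] by (simp add: mult_ac add.commute)
    also have "\<dots> = (?T (?c + 1) * ?G (1 - ?c)) * (?G (?c - 1) * ?T (?c - 3))"
      using string_prod_shift' [of "?c + 1" "?c - 1" "1 - ?c" c, where 'k = 'k]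
        string_prod_shift' [of "?c - 1" "?c - 3" "- 1 - ?c" c, where 'k = 'k] by simp
    finally have "(?G (1 - ?c) * ?G (?c - 1)) * (d3_series c (- 1) * (?T (?c - 1) * ?T (?c - 1))) =
       (?G (1 - ?c) * ?G (?c - 1)) * (?T (?c + 1) * ?T (?c - 3))"
      by (simp only: mult_ac)
    hence d: "d3_series c (- 1) * (?T (?c - 1) * ?T (?c - 1)) = ?T (?c + 1) * ?T (?c - 3)"
      by (simp add: geom_factor_nz)
    show ?thesis
    proof (rule that [of ?f])
      show "heis_series c a * ?f = 1" using f1 \<open>a = - 1\<close> by (simp add: heis_series_minus_1)
      have "heis_series c a * qscale 2 ?f * qscale (- 2) ?f * heis_series c a * d3_series c a =
          (d3_series c (- 1) * (?T (?c - 1) * ?T (?c - 1))) * (qscale 2 ?f * qscale (- 2) ?f)"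
        using \<open>a = - 1\<close> by (simp only: heis_series_minus_1 mult_ac)
      also have "\<dots> = (?T (?c + 1) * qscale 2 ?f) * (?T (?c - 3) * qscale (- 2) ?f)"
        unfolding d by (simp only: mult_ac)
      finally show "heis_series c a * qscale 2 ?f * qscale (- 2) ?f * heis_series c a * d3_series c a = 1"
        unfolding f2 f3 by simp
    qed
  next
    assume "a = 0"
    have "d3_series c 0 * (?G (- ?c) * ?G ?c) = 1 * (?G (- ?c) * ?G ?c)"
      using d3_series_mult [of c 0, where 'k = 'k] by (simp add: mult_ac)
    hence d: "d3_series c 0 = (1 :: 'k poly fract fps)"
      by (subst (asm) mult_right_cancel) (simp add: geom_factor_nz)
    show ?thesis
      by (rule that [of 1]) (simp_all add: \<open>a = 0\<close> heis_series_0 qscale_1 d)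
  }
qed

section \<open>Integrable representations\<close>

lemma qint_0 [simp]: "qint 0 = 0"
  by (simp add: qint_def)

lemma qint_minus: "qint (- n) = - (qint n :: 'k::field_char_0 poly fract)"
  by (simp add: qint_def minus_divide_left)

lemma qint_neq_0: "n \<noteq> 0 \<Longrightarrow> (qint n :: 'k::field_char_0 poly fract) \<noteq> 0"
  using qint_nonzero [of "nat n", where 'k = 'k] qint_nonzero [of "nat (- n)", where 'k = 'k] qint_minus [of n, where 'k = 'k]
  by (cases "n > 0") auto

lemma qq_neq_0: "(qq :: 'k::field_char_0 poly fract) \<noteq> 0"
  by (simp add: qq_def qhalf_nonzero)

lemma qq_diff_neq_0: "(qq :: 'k::field_char_0 poly fract) - inverse qq \<noteq> 0"
proof
  assume "(qq :: 'k poly fract) - inverse qq = 0"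
  hence "qint 1 = (0 :: 'k poly fract)" by (simp add: qint_def)
  with qint_neq_0 [of 1, where 'k = 'k] show False by simp
qed

lemma qint_1 [simp]: "qint 1 = (1 :: 'k::field_char_0 poly fract)"
  using qq_diff_neq_0 [where 'k = 'k] by (simp add: qint_def power_int_minus)

text \<open>The induction step for the commutator of E with a power of F: [k - 2a] is what the a-th
  lowered vector contributes. For a = 1 it is the product rule for [2][k].\<close>

lemma qint_add_mult:
  "qint (a + 1) * qint (k - a) = qint a * qint (k - a + 1) + (qint (k - 2 * a) :: 'k::field_char_0 poly fract)"
proof -
  let ?q = "qq :: 'k poly fract"
  define A K where "A = ?q powi a" and "K = ?q powi k"
  have nz: "A \<noteq> 0" "K \<noteq> 0" "?q \<noteq> 0" by (simp_all add: A_def K_def qq_neq_0)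
  have d: "?q - inverse ?q \<noteq> 0" by (rule qq_diff_neq_0)
  have e: "qint (a + 1) = (A * ?q - inverse (A * ?q)) / (?q - inverse ?q)"
    "qint (k - a) = (K / A - A / K) / (?q - inverse ?q)"
    "qint a = (A - inverse A) / (?q - inverse ?q)"
    "qint (k - a + 1) = (K / A * ?q - A / (K * ?q)) / (?q - inverse ?q)"
    "qint (k - 2 * a) = (K / A ^ 2 - A ^ 2 / K) / (?q - inverse ?q)"
    unfolding qint_def A_def K_def
    by (simp_all add: power_int_add power_int_diff power_int_minus qq_neq_0 power_int_mult
        power2_eq_square field_simps power_int_minus_left)
  have "(A * ?q - inverse (A * ?q)) * (K / A - A / K) =
      (A - inverse A) * (K / A * ?q - A / (K * ?q)) + (K / A ^ 2 - A ^ 2 / K) * (?q - inverse ?q)"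
    using nz by (simp add: field_simps power2_eq_square)
  moreover have "u1 / D * (u2 / D) = u3 / D * (u4 / D) + u5 / D"
    if "D \<noteq> 0" "u1 * u2 = u3 * u4 + u5 * D" for D u1 u2 u3 u4 u5 :: "'k poly fract"
    using that by (simp add: field_simps)
  ultimately show ?thesis unfolding e using d by blast
qed

lemma qint_2_mult: "qint 2 * qint k = qint (k - 1) + (qint (k + 1) :: 'k::field_char_0 poly fract)"
  using qint_add_mult [of 1 "k + 1", where 'k = 'k] by (simp add: add.commute)

text \<open>One string of weight spaces for a quantum sl2: \<open>W n\<close> has the weight k0 +
  2n. The operators depend on the position n because every generator of the algebra carries its
  weight. \<open>bounded\<close> is what integrability says about a string.\<close>

locale sl2_string = vector_space scale
  for scale :: "'k::field_char_0 poly fract \<Rightarrow> 'v::ab_group_add \<Rightarrow> 'v" +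
  fixes W :: "int \<Rightarrow> 'v set" and E F :: "int \<Rightarrow> 'v \<Rightarrow> 'v" and k0 :: int
  assumes W: "subspace (W n)"
    and E_W: "x \<in> W n \<Longrightarrow> E n x \<in> W (n + 1)" and F_W: "x \<in> W n \<Longrightarrow> F n x \<in> W (n - 1)"
    and E_lin: "Vector_Spaces.linear scale scale (E n)" and F_lin: "Vector_Spaces.linear scale scale (F n)"
    and E_F: "x \<in> W n \<Longrightarrow> E (n - 1) (F n x) - F (n + 1) (E n x) = scale (qint (k0 + 2 * n)) x"
    and bounded: "\<exists>n0. \<forall>n. \<bar>n\<bar> \<ge> n0 \<longrightarrow> W n = {0}"
begin

lemma E_linear:
  "E n (x + y) = E n x + E n y" "E n (x - y) = E n x - E n y" "E n (scale c x) = scale c (E n x)" "E n 0 = 0"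
proof -
  interpret l: Vector_Spaces.linear scale scale "E n" by (fact E_lin)
  show "E n (x + y) = E n x + E n y" "E n (x - y) = E n x - E n y"
    "E n (scale c x) = scale c (E n x)" "E n 0 = 0"
    by (fact l.add, fact l.diff, fact l.scale, fact l.zero)
qed

lemma F_linear:
  "F n (x + y) = F n x + F n y" "F n (x - y) = F n x - F n y" "F n (scale c x) = scale c (F n x)" "F n 0 = 0"
proof -
  interpret l: Vector_Spaces.linear scale scale "F n" by (fact F_lin)
  show "F n (x + y) = F n x + F n y" "F n (x - y) = F n x - F n y"
    "F n (scale c x) = scale c (F n x)" "F n 0 = 0"
    by (fact l.add, fact l.diff, fact l.scale, fact l.zero)
qed

text \<open>The string read upside down, which transfers statements on lowering operators to raising
  ones.\<close>

lemma flip: "sl2_string scale (\<lambda>n. W (- n)) (\<lambda>n. F (- n)) (\<lambda>n. E (- n)) (- k0)"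
proof (intro sl2_string.intro sl2_string_axioms.intro vector_space_axioms)
  show "subspace (W (- n))" "Vector_Spaces.linear scale scale (F (- n))"
    "Vector_Spaces.linear scale scale (E (- n))" for n
    by (fact W, fact F_lin, fact E_lin)
  show "x \<in> W (- n) \<Longrightarrow> F (- n) x \<in> W (- (n + 1))" "x \<in> W (- n) \<Longrightarrow> E (- n) x \<in> W (- (n - 1))" for x n
    using F_W [of x "- n"] E_W [of x "- n"] by simp_all
  show "F (- (n - 1)) (E (- n) x) - E (- (n + 1)) (F (- n) x) = scale (qint (- k0 + 2 * n)) x"
    if "x \<in> W (- n)" for x n
  proof -
    have "F (- n + 1) (E (- n) x) - E (- n - 1) (F (- n) x) = - scale (qint (k0 + 2 * (- n))) x"
      using E_F [OF that] by (metis minus_diff_eq)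
    also have "\<dots> = scale (qint (- k0 + 2 * n)) x"
      using qint_minus [of "k0 + 2 * (- n)", where 'k = 'k] by simp
    finally show ?thesis by simp
  qed
  from bounded obtain n0 where "\<forall>n. \<bar>n\<bar> \<ge> n0 \<longrightarrow> W n = {0}" by blast
  thus "\<exists>n0. \<forall>n. \<bar>n\<bar> \<ge> n0 \<longrightarrow> W (- n) = {0}" by (intro exI [of _ n0]) simp
qed

section \<open>Powers of the raising and lowering operators\<close>

fun Fp :: "nat \<Rightarrow> int \<Rightarrow> 'v \<Rightarrow> 'v" where
  "Fp 0 n x = x"
| "Fp (Suc a) n x = F (n - int a) (Fp a n x)"

fun Ep :: "nat \<Rightarrow> int \<Rightarrow> 'v \<Rightarrow> 'v" where
  "Ep 0 n x = x"
| "Ep (Suc a) n x = E (n + int a) (Ep a n x)"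

lemma Ep_Suc: "Ep (Suc a) n x = Ep a (n + 1) (E n x)"
  by (induction a) (simp_all add: algebra_simps)

lemma Fp_W: "x \<in> W n \<Longrightarrow> Fp a n x \<in> W (n - int a)"
  using F_W by (induction a) (simp_all, metis diff_diff_eq add.commute)

lemma Ep_W: "x \<in> W n \<Longrightarrow> Ep a n x \<in> W (n + int a)"
  using E_W by (induction a) (simp_all, metis add.assoc add.commute)

lemma Fp_linear: "Fp a n (x + y) = Fp a n x + Fp a n y" "Fp a n (scale c x) = scale c (Fp a n x)" "Fp a n 0 = 0"
  by (induction a) (simp_all add: F_linear)

lemma Ep_linear: "Ep a n (x - y) = Ep a n x - Ep a n y" "Ep a n (scale c x) = scale c (Ep a n x)" "Ep a n 0 = 0"
  by (induction a) (simp_all add: E_linear)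

lemma E_Fp:
  assumes x: "x \<in> W n"
  shows "E (n - int (Suc a)) (Fp (Suc a) n x) = Fp (Suc a) (n + 1) (E n x) +
     scale (qint (int (Suc a)) * qint (k0 + 2 * n - int a)) (Fp a n x)"
proof (induction a)
  case 0
  show ?case using E_F [OF x] by (simp add: algebra_simps)
next
  case (Suc a)
  let ?y = "Fp (Suc a) n x" and ?k = "k0 + 2 * n"
  have "E (n - int (Suc (Suc a))) (F (n - int (Suc a)) ?y) =
      F (n - int (Suc a) + 1) (E (n - int (Suc a)) ?y) + scale (qint (k0 + 2 * (n - int (Suc a)))) ?y"
    using E_F [OF Fp_W [OF x, of "Suc a"]] by (simp add: algebra_simps del: Fp.simps)
  also have "E (n - int (Suc a)) ?y = Fp (Suc a) (n + 1) (E n x) +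
     scale (qint (int (Suc a)) * qint (?k - int a)) (Fp a n x)" by (rule Suc)
  also have "F (n - int (Suc a) + 1) \<dots> = Fp (Suc (Suc a)) (n + 1) (E n x) +
     scale (qint (int (Suc a)) * qint (?k - int a)) ?y"
    by (simp add: F_linear algebra_simps)
  also have "\<dots> + scale (qint (k0 + 2 * (n - int (Suc a)))) ?y = Fp (Suc (Suc a)) (n + 1) (E n x) +
      scale (qint (int (Suc a)) * qint (?k - int a) + qint (k0 + 2 * (n - int (Suc a)))) ?y"
    by (simp add: scale_left_distrib add.assoc del: Fp.simps)
  also have "qint (int (Suc a)) * qint (?k - int a) + qint (k0 + 2 * (n - int (Suc a))) =
      (qint (int (Suc (Suc a))) * qint (?k - int (Suc a)) :: 'k poly fract)"
    using qint_add_mult [of "int (Suc a)" ?k, where 'k = 'k] by (simp add: algebra_simps)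
  finally show ?case by simp
qed

text \<open>Induction from the top of the string and, within it, on a. Let k be the weight of x. If
  F^{a+1} x = 0, then F applied to \<open>E_Fp\<close> gives F^{a+2} E x = 0, hence E x = 0 by the
  outer induction. \<open>E_Fp\<close> now reads [a+1][k-a] F^a x = 0, where k - a > 0 makes the
  factor nonzero.\<close>

lemma F_inj:
  assumes "x \<in> W n" "int a \<le> k0 + 2 * n" "Fp a n x = 0"
  shows "x = 0"
proof -
  from bounded obtain n0 where n0: "\<And>n. \<bar>n\<bar> \<ge> n0 \<Longrightarrow> W n = {0}" by blast
  show ?thesis using assms
  proof (induction "nat (n0 - n)" arbitrary: n x a rule: less_induct)
    case less
    show ?case
    proof (cases "n \<ge> n0")
      case True
      with n0 [of n] less.prems show ?thesis by auto
    next
      case False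
      show ?thesis using less.prems
      proof (induction a)
        case (Suc a)
        have 0: "Fp (Suc a) (n + 1) (E n x) + scale (qint (int (Suc a)) * qint (k0 + 2 * n - int a)) (Fp a n x) = 0"
          using E_Fp [OF Suc.prems(1), of a] Suc.prems(3) by (simp only: E_linear)
        have "F (n - int a) (Fp (Suc a) (n + 1) (E n x)) + scale (qint (int (Suc a)) * qint (k0 + 2 * n - int a)) (Fp (Suc a) n x) = 0"
          using arg_cong [OF 0, of "F (n - int a)"] by (simp only: F_linear Fp.simps)
        hence "Fp (Suc (Suc a)) (n + 1) (E n x) = 0"
          using Suc.prems(3) by (simp add: algebra_simps)
        hence "E n x = 0"
          by (intro less.hyps [of "n + 1" "E n x" "Suc (Suc a)"]) (use False E_W Suc.prems in auto)
        with 0 have "scale (qint (int (Suc a)) * qint (k0 + 2 * n - int a)) (Fp a n x) = 0"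
          by (simp only: Fp_linear add_0)
        moreover have "qint (int (Suc a)) * qint (k0 + 2 * n - int a) \<noteq> (0 :: 'k poly fract)"
          using Suc.prems(2) by (simp add: qint_neq_0)
        ultimately have "Fp a n x = 0" by (simp only: scale_eq_0_iff) blast
        with Suc show ?case by simp
      qed simp
    qed
  qed
qed


lemma E_inj:
  assumes "x \<in> W n" "int a \<le> - (k0 + 2 * n)" "Ep a n x = 0"
  shows "x = 0"
proof -
  have "sl2_string.Fp (\<lambda>n. E (- n)) a m x = Ep a (- m) x" for m
    by (induction a) (simp_all add: sl2_string.Fp.simps [OF flip] algebra_simps)
  thus ?thesis using sl2_string.F_inj [OF flip, of x "- n" a] assms by simp
qed

text \<open>Induction on the order of nilpotency of E at u. With M = N + 1 the vector z0 = E^M u is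
  annihilated by E. If E^M F^M z0 is a nonzero multiple of z0, subtracting a multiple of F^M z0 from
  u lowers the order; otherwise the weight of u is so low that E^{M+1} is injective on it, and u =
  0.\<close>

lemma decompose:
  assumes "u \<in> W n" "Ep (Suc N) n u = 0"
  shows "\<exists>z\<in>W n. \<exists>x\<in>W (n + 1). E n z = 0 \<and> u = z + F (n + 1) x"
  using assms
proof (induction N arbitrary: u)
  case 0
  thus ?case using subspace_0 [OF W] by (intro bexI [of _ u] bexI [of _ 0]) (auto simp: F_linear)
next
  case (Suc N)
  let ?M = "Suc N" let ?z0 = "Ep ?M n u" let ?k = "k0 + 2 * (n + int ?M)"
  have z0: "?z0 \<in> W (n + int ?M)" by (rule Ep_W) (rule Suc.prems)
  have E0: "E (n + int ?M) ?z0 = 0" using Suc.prems(2) by simp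
  show ?case
  proof (cases "k0 + 2 * n + int ?M + 1 > 0")
    \<comment> \<open>The factors of E^M F^M on z0 are [b+1][k-b] with b < M, where k is the weight
      of z0; the least value of k - b is the number assumed positive here.\<close>
    case True
    have EF: "b \<le> ?M \<Longrightarrow> \<exists>c. c \<noteq> 0 \<and> Ep b (n + int ?M - int b) (Fp b (n + int ?M) ?z0) = scale c ?z0" for b
    proof (induction b)
      case (Suc b)
      then obtain c where c: "c \<noteq> 0" "Ep b (n + int ?M - int b) (Fp b (n + int ?M) ?z0) = scale c ?z0" by auto
      let ?d = "qint (int (Suc b)) * qint (?k - int b) :: 'k poly fract"
      have "Ep (Suc b) (n + int ?M - int (Suc b)) (Fp (Suc b) (n + int ?M) ?z0) =
          Ep b (n + int ?M - int b) (E (n + int ?M - int (Suc b)) (Fp (Suc b) (n + int ?M) ?z0))"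
        unfolding Ep_Suc by (simp add: algebra_simps)
      also have "E (n + int ?M - int (Suc b)) (Fp (Suc b) (n + int ?M) ?z0) = scale ?d (Fp b (n + int ?M) ?z0)"
        unfolding E_Fp [OF z0] E0 by (simp only: Fp_linear add_0)
      also have "Ep b (n + int ?M - int b) \<dots> = scale (?d * c) ?z0"
        by (simp only: Ep_linear c scale_scale)
      finally show ?case using c True Suc.prems by (intro exI [of _ "?d * c"]) (simp add: qint_neq_0)
    qed (auto intro: exI [of _ 1])
    from EF [of ?M] obtain c where c: "c \<noteq> 0" "Ep ?M n (Fp ?M (n + int ?M) ?z0) = scale c ?z0" by auto
    \<comment> \<open>One power of F fewer than in the vector to be subtracted, so that this vector
      is F y.\<close>
    define y where "y = scale (inverse c) (Fp N (n + int ?M) ?z0)"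
    have y: "y \<in> W (n + 1)"
      unfolding y_def using Fp_W [OF z0, of N] by (intro subspace_scale [OF W]) simp
    have Fy: "F (n + 1) y = scale (inverse c) (Fp ?M (n + int ?M) ?z0)"
      by (simp add: y_def F_linear algebra_simps)
    let ?u = "u - F (n + 1) y"
    have "?u \<in> W n" using Suc.prems F_W [OF y] by (intro subspace_diff [OF W]) auto
    moreover have "Ep ?M n ?u = 0"
      unfolding Fy Ep_linear c(2) using c(1) by (simp del: Ep.simps)
    ultimately obtain z x where "z \<in> W n" "x \<in> W (n + 1)" "E n z = 0" "?u = z + F (n + 1) x"
      using Suc.IH [of ?u] by blast
    thus ?thesis using y
      by (intro bexI [of _ z] bexI [of _ "x + y"]) (auto simp: F_linear algebra_simps subspace_add [OF W])
  next
    case False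
    hence "u = 0" by (intro E_inj [OF Suc.prems(1) _ Suc.prems(2)]) simp
    thus ?thesis using subspace_0 [OF W] by (intro bexI [of _ 0]) (auto simp: F_linear E_linear)
  qed
qed

lemma Ep_nilpotent:
  assumes "u \<in> W n" shows "\<exists>N. Ep (Suc N) n u = 0"
proof -
  from bounded obtain n0 where n0: "\<And>n. \<bar>n\<bar> \<ge> n0 \<Longrightarrow> W n = {0}" by blast
  have "Ep (Suc (nat (n0 - n))) n u \<in> W (n + int (Suc (nat (n0 - n))))" by (rule Ep_W) (rule assms)
  also have "\<dots> \<subseteq> {0}" using n0 [of "n + int (Suc (nat (n0 - n)))"] by (simp del: of_nat_Suc)
  finally show ?thesis by blast
qed

end

text \<open>On \<open>ker E\<close> in weight \<open>k\<close> the power \<open>F\<^sup>k\<^sup>+\<^sup>1\<close> vanishes, and it is injective in weight \<open>k + 3\<close>, the weight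
  of the values of \<open>S\<close>; the weight space is the sum of \<open>ker E\<close> and the image of \<open>F\<close>.\<close>

lemma sl2_string_intertwiner:
  assumes "sl2_string scale W E F k0" and "sl2_string scale W' E' F' (k0 - 1)"
    and S_W: "\<And>n x. x \<in> W n \<Longrightarrow> S n x \<in> W' (n + 2)"
    and S_add: "\<And>n x y. x \<in> W n \<Longrightarrow> y \<in> W n \<Longrightarrow> S n (x + y) = S n x + S n y"
    and S_F: "\<And>n x. x \<in> W n \<Longrightarrow> F' (n + 2) (S n x) = S (n - 1) (F n x)"
    and u: "u \<in> W n"
  shows "S n u = 0"
proof -
  interpret W: sl2_string scale W E F k0 by fact
  interpret W': sl2_string scale W' E' F' "k0 - 1" by fact
  from W.bounded obtain n0 where n0: "\<And>n. \<bar>n\<bar> \<ge> n0 \<Longrightarrow> W n = {0}" by blast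
  have S0: "S n 0 = 0" for n
    using S_add [of 0 n 0] W.subspace_0 [OF W.W] by simp
  have S_Fp: "W'.Fp a (n + 2) (S n x) = S (n - int a) (W.Fp a n x)" if "x \<in> W n" for a n x
  proof (induction a)
    case (Suc a)
    thus ?case using S_F [OF W.Fp_W [OF that, of a]] by (simp add: algebra_simps)
  qed simp
  show ?thesis using u
  proof (induction "nat (n0 - n)" arbitrary: n u rule: less_induct)
    case less
    show ?case
    proof (cases "n \<ge> n0")
      case True
      with n0 [of n] less.prems show ?thesis by (auto simp: S0)
    next
      case False
      obtain z x where z: "z \<in> W n" "E n z = 0" and x: "x \<in> W (n + 1)" and u: "u = z + F (n + 1) x"
        using W.decompose [OF less.prems] W.Ep_nilpotent [OF less.prems] by metis
      have "S (n + 1) x = 0" using False x by (intro less.hyps) auto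
      hence "S n (F (n + 1) x) = 0" using S_F [OF x] by (simp add: W'.F_linear)
      moreover have "S n z = 0"
      proof (cases "k0 + 2 * n \<ge> 0")
        case False
        hence "z = 0" using z by (intro W.E_inj [of z n 1]) simp_all
        thus ?thesis by (simp add: S0)
      next
        case True
        define a where "a = nat (k0 + 2 * n)"
        have a: "int a = k0 + 2 * n" using True by (simp add: a_def)
        \<comment> \<open>With a equal to the weight of z the coefficient in \<open>E_Fp\<close>
          contains [0]. The vector F^{a+1} z has the negative weight - a - 2, where E is injective,
          so it vanishes.\<close>
        have "E (n - int (Suc a)) (W.Fp (Suc a) n z) = 0"
          unfolding W.E_Fp [OF z(1)] z(2) a by (simp only: W.Fp_linear diff_self qint_0 mult_zero_right W.scale_zero_left add_0)
        hence "W.Fp (Suc a) n z = 0"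
          using a by (intro W.E_inj [OF W.Fp_W [OF z(1)], of 1]) (simp_all del: W.Fp.simps)
        hence "W'.Fp (Suc a) (n + 2) (S n z) = 0"
          by (simp only: S_Fp [OF z(1)] S0)
        thus ?thesis using a by (intro W'.F_inj [OF S_W [OF z(1)], of "Suc a"]) simp_all
      qed
      ultimately show ?thesis
        using S_add [OF z(1), of "F (n + 1) x"] W.F_W [OF x] u by simp
    qed
  qed
qed

section \<open>The Serre operator as an intertwiner\<close>

lemma wt_scale_simps [simp]:
  "wt_scale 0 \<alpha> = 0" "lam + wt_scale (n + 1) \<alpha> = lam + wt_scale n \<alpha> + \<alpha>"
  "lam + wt_scale (n - 1) \<alpha> = lam + wt_scale n \<alpha> - \<alpha>"
  "lam + wt_scale (n + 2) \<alpha> = lam + wt_scale n \<alpha> + \<alpha> + \<alpha>"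
  by (auto simp: wt_scale_def prod_eq_iff fun_eq_iff zero_prod_def plus_prod_def algebra_simps)

text \<open>X and Y raise and lower along the \<alpha>-string, \<kappa> is the sl2-weight, and y
  changes it by -1. The left hand side S of the Serre relation maps the string through lam to that
  through lam + \<beta>, whose weights start one lower, and moves up by two places since X occurs
  twice. This is the situation of \<open>sl2_string_intertwiner\<close>. X may be taken from the E's
  or from the F's.\<close>

lemma weighted_serre:
  fixes scale :: "'k::field_char_0 poly fract \<Rightarrow> 'v::ab_group_add \<Rightarrow> 'v"
    and V :: "'i weight \<Rightarrow> 'v set" and X Y y :: "'i weight \<Rightarrow> 'v \<Rightarrow> 'v" and \<kappa> :: "'i weight \<Rightarrow> int"
  assumes vs: "vector_space scale" and V: "\<And>lam. module.subspace scale (V lam)"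
    and lin: "\<And>lam. Vector_Spaces.linear scale scale (X lam)" "\<And>lam. Vector_Spaces.linear scale scale (Y lam)"
      "\<And>lam. Vector_Spaces.linear scale scale (y lam)"
    and X: "\<And>lam v. v \<in> V lam \<Longrightarrow> X lam v \<in> V (lam + \<alpha>)"
    and Y: "\<And>lam v. v \<in> V lam \<Longrightarrow> Y lam v \<in> V (lam - \<alpha>)"
    and y: "\<And>lam v. v \<in> V lam \<Longrightarrow> y lam v \<in> V (lam + \<beta>)"
    and XY: "\<And>lam v. v \<in> V lam \<Longrightarrow>
      X (lam - \<alpha>) (Y lam v) - Y (lam + \<alpha>) (X lam v) = scale (qint (\<kappa> lam)) v"
    and yY: "\<And>lam v. v \<in> V lam \<Longrightarrow> Y (lam + \<beta>) (y lam v) = y (lam - \<alpha>) (Y lam v)"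
    and \<kappa>: "\<And>lam. \<kappa> (lam + \<alpha>) = \<kappa> lam + 2" "\<And>lam. \<kappa> (lam + \<beta>) = \<kappa> lam - 1"
    and bounded: "\<And>lam. \<exists>n0. \<forall>n. \<bar>n\<bar> \<ge> n0 \<longrightarrow> V (lam + wt_scale n \<alpha>) = {0}"
    and v: "v \<in> V lam"
  shows "y (lam + \<alpha> + \<alpha>) (X (lam + \<alpha>) (X lam v)) + X (lam + \<beta> + \<alpha>) (X (lam + \<beta>) (y lam v)) -
      scale (qint 2) (X (lam + \<alpha> + \<beta>) (y (lam + \<alpha>) (X lam v))) = 0"
proof -
  interpret vector_space scale by fact
  have lin_simps: "X \<mu> (u + w) = X \<mu> u + X \<mu> w" "X \<mu> (u - w) = X \<mu> u - X \<mu> w" "X \<mu> (scale c u) = scale c (X \<mu> u)"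
    "Y \<mu> (u + w) = Y \<mu> u + Y \<mu> w" "Y \<mu> (u - w) = Y \<mu> u - Y \<mu> w" "Y \<mu> (scale c u) = scale c (Y \<mu> u)"
    "y \<mu> (u + w) = y \<mu> u + y \<mu> w" "y \<mu> (u - w) = y \<mu> u - y \<mu> w" "y \<mu> (scale c u) = scale c (y \<mu> u)" for \<mu> u w c
  proof -
    interpret X: Vector_Spaces.linear scale scale "X \<mu>" by fact
    interpret Y: Vector_Spaces.linear scale scale "Y \<mu>" by fact
    interpret y: Vector_Spaces.linear scale scale "y \<mu>" by fact
    show "X \<mu> (u + w) = X \<mu> u + X \<mu> w" "X \<mu> (u - w) = X \<mu> u - X \<mu> w" "X \<mu> (scale c u) = scale c (X \<mu> u)"
      "Y \<mu> (u + w) = Y \<mu> u + Y \<mu> w" "Y \<mu> (u - w) = Y \<mu> u - Y \<mu> w" "Y \<mu> (scale c u) = scale c (Y \<mu> u)"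
      "y \<mu> (u + w) = y \<mu> u + y \<mu> w" "y \<mu> (u - w) = y \<mu> u - y \<mu> w" "y \<mu> (scale c u) = scale c (y \<mu> u)"
      by (fact X.add X.diff X.scale Y.add Y.diff Y.scale y.add y.diff y.scale)+
  qed
  have \<kappa>_scale: "\<kappa> (\<mu> + wt_scale n \<alpha>) = \<kappa> \<mu> + 2 * n" for \<mu> n
  proof (induction n rule: int_induct [where k = 0])
    case (step2 n)
    have "\<kappa> (\<mu> + wt_scale n \<alpha>) = \<kappa> (\<mu> + wt_scale (n - 1) \<alpha> + \<alpha>)" by simp
    hence "\<kappa> (\<mu> + wt_scale (n - 1) \<alpha>) = \<kappa> (\<mu> + wt_scale n \<alpha>) - 2" unfolding \<kappa> by linarith
    thus ?case unfolding step2(2) by (simp only: right_diff_distrib)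
  qed (simp_all add: \<kappa>)
  have string: "sl2_string scale (\<lambda>n. V (\<mu> + wt_scale n \<alpha>)) (\<lambda>n. X (\<mu> + wt_scale n \<alpha>))
      (\<lambda>n. Y (\<mu> + wt_scale n \<alpha>)) (\<kappa> \<mu>)" for \<mu>
  proof (intro sl2_string.intro sl2_string_axioms.intro vs V lin bounded)
    fix x n assume x: "x \<in> V (\<mu> + wt_scale n \<alpha>)"
    show "X (\<mu> + wt_scale n \<alpha>) x \<in> V (\<mu> + wt_scale (n + 1) \<alpha>)"
      "Y (\<mu> + wt_scale n \<alpha>) x \<in> V (\<mu> + wt_scale (n - 1) \<alpha>)"
      using X [OF x] Y [OF x] by simp_all
    show "X (\<mu> + wt_scale (n - 1) \<alpha>) (Y (\<mu> + wt_scale n \<alpha>) x) -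
        Y (\<mu> + wt_scale (n + 1) \<alpha>) (X (\<mu> + wt_scale n \<alpha>) x) = scale (qint (\<kappa> \<mu> + 2 * n)) x"
      using XY [OF x] by (simp add: \<kappa>_scale)
  qed
  define S where "S \<mu> v = y (\<mu> + \<alpha> + \<alpha>) (X (\<mu> + \<alpha>) (X \<mu> v)) + X (\<mu> + \<beta> + \<alpha>) (X (\<mu> + \<beta>) (y \<mu> v)) -
      scale (qint 2) (X (\<mu> + \<alpha> + \<beta>) (y (\<mu> + \<alpha>) (X \<mu> v)))" for \<mu> v
  \<comment> \<open>Y passes y freely and leaves a quantum integer at each X it passes. With k the
    weight of u, the terms in y X u cancel by [k] + [k+2] = [2][k+1], those in X y u by [k-1] +
    [k+1] = [2][k].\<close>
  have S_Y: "Y (\<mu> + \<beta> + \<alpha> + \<alpha>) (S \<mu> u) = S (\<mu> - \<alpha>) (Y \<mu> u)" if u: "u \<in> V \<mu>" for \<mu> u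
  proof -
    let ?k = "\<kappa> \<mu>" let ?u = "Y \<mu> u"
    have YX: "Y \<nu> (X \<mu> u) = X \<xi> (Y \<mu> u) - scale (qint k) u"
      if "u \<in> V \<mu>" "\<nu> = \<mu> + \<alpha>" "\<xi> = \<mu> - \<alpha>" "k = \<kappa> \<mu>" for \<nu> \<xi> \<mu> u k
    proof -
      have "a - b = c \<Longrightarrow> b = a - c" for a b c :: 'v by auto
      from this [OF XY [OF that(1)]] show ?thesis unfolding that(2-4) .
    qed
    have Yy: "Y \<nu> (y \<mu> u) = y \<xi> (Y \<mu> u)"
      if "u \<in> V \<mu>" "\<nu> = \<mu> + \<beta>" "\<xi> = \<mu> - \<alpha>" for \<nu> \<xi> \<mu> u
      using yY [OF that(1)] that(2-3) by simp
    have Xu: "X \<mu> u \<in> V (\<mu> + \<alpha>)" by (rule X) (rule u)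
    have XXu: "X (\<mu> + \<alpha>) (X \<mu> u) \<in> V (\<mu> + \<alpha> + \<alpha>)" by (rule X) (rule Xu)
    have yu: "y \<mu> u \<in> V (\<mu> + \<beta>)" by (rule y) (rule u)
    have Xyu: "X (\<mu> + \<beta>) (y \<mu> u) \<in> V (\<mu> + \<beta> + \<alpha>)" by (rule X) (rule yu)
    have yXu: "y (\<mu> + \<alpha>) (X \<mu> u) \<in> V (\<mu> + \<alpha> + \<beta>)" by (rule y) (rule Xu)
    have 1: "Y (\<mu> + \<alpha>) (X \<mu> u) = X (\<mu> - \<alpha>) ?u - scale (qint ?k) u"
      by (rule YX [OF u]) simp_all
    have "Y (\<mu> + \<alpha> + \<alpha>) (X (\<mu> + \<alpha>) (X \<mu> u)) = X \<mu> (Y (\<mu> + \<alpha>) (X \<mu> u)) - scale (qint (?k + 2)) (X \<mu> u)"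
      by (rule YX [OF Xu]) (simp_all add: \<kappa>)
    also have "\<dots> = X \<mu> (X (\<mu> - \<alpha>) ?u) - scale (qint ?k) (X \<mu> u) - scale (qint (?k + 2)) (X \<mu> u)"
      unfolding 1 by (simp add: lin_simps)
    finally have 2: "Y (\<mu> + \<alpha> + \<alpha>) (X (\<mu> + \<alpha>) (X \<mu> u)) = \<dots>" .
    have "Y (\<mu> + \<beta> + \<alpha> + \<alpha>) (y (\<mu> + \<alpha> + \<alpha>) (X (\<mu> + \<alpha>) (X \<mu> u))) =
        y (\<mu> + \<alpha>) (Y (\<mu> + \<alpha> + \<alpha>) (X (\<mu> + \<alpha>) (X \<mu> u)))"
      by (rule Yy [OF XXu]) (simp_all add: add_ac)
    hence t1: "Y (\<mu> + \<beta> + \<alpha> + \<alpha>) (y (\<mu> + \<alpha> + \<alpha>) (X (\<mu> + \<alpha>) (X \<mu> u))) =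
        y (\<mu> + \<alpha>) (X \<mu> (X (\<mu> - \<alpha>) ?u)) -
        (scale (qint ?k) (y (\<mu> + \<alpha>) (X \<mu> u)) + scale (qint (?k + 2)) (y (\<mu> + \<alpha>) (X \<mu> u)))"
      by (simp add: 2 lin_simps)
    have 3: "Y (\<mu> + \<beta>) (y \<mu> u) = y (\<mu> - \<alpha>) ?u" by (rule Yy [OF u]) simp_all
    have "Y (\<mu> + \<beta> + \<alpha>) (X (\<mu> + \<beta>) (y \<mu> u)) = X (\<mu> + \<beta> - \<alpha>) (Y (\<mu> + \<beta>) (y \<mu> u)) - scale (qint (?k - 1)) (y \<mu> u)"
      by (rule YX [OF yu]) (simp_all add: \<kappa>)
    hence 4: "Y (\<mu> + \<beta> + \<alpha>) (X (\<mu> + \<beta>) (y \<mu> u)) = X (\<mu> + \<beta> - \<alpha>) (y (\<mu> - \<alpha>) ?u) - scale (qint (?k - 1)) (y \<mu> u)"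
      by (simp only: 3)
    have "Y (\<mu> + \<beta> + \<alpha> + \<alpha>) (X (\<mu> + \<beta> + \<alpha>) (X (\<mu> + \<beta>) (y \<mu> u))) =
        X (\<mu> + \<beta>) (Y (\<mu> + \<beta> + \<alpha>) (X (\<mu> + \<beta>) (y \<mu> u))) - scale (qint (?k + 1)) (X (\<mu> + \<beta>) (y \<mu> u))"
      by (rule YX [OF Xyu]) (simp_all add: \<kappa>)
    hence t2: "Y (\<mu> + \<beta> + \<alpha> + \<alpha>) (X (\<mu> + \<beta> + \<alpha>) (X (\<mu> + \<beta>) (y \<mu> u))) =
        X (\<mu> + \<beta>) (X (\<mu> + \<beta> - \<alpha>) (y (\<mu> - \<alpha>) ?u)) -
        (scale (qint (?k - 1)) (X (\<mu> + \<beta>) (y \<mu> u)) + scale (qint (?k + 1)) (X (\<mu> + \<beta>) (y \<mu> u)))"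
      by (simp add: 4 lin_simps)
    have "Y (\<mu> + \<alpha> + \<beta>) (y (\<mu> + \<alpha>) (X \<mu> u)) = y \<mu> (Y (\<mu> + \<alpha>) (X \<mu> u))"
      by (rule Yy [OF Xu]) simp_all
    hence 5: "Y (\<mu> + \<alpha> + \<beta>) (y (\<mu> + \<alpha>) (X \<mu> u)) = y \<mu> (X (\<mu> - \<alpha>) ?u) - scale (qint ?k) (y \<mu> u)"
      by (simp add: 1 lin_simps)
    have "Y (\<mu> + \<beta> + \<alpha> + \<alpha>) (X (\<mu> + \<alpha> + \<beta>) (y (\<mu> + \<alpha>) (X \<mu> u))) =
        X (\<mu> + \<beta>) (Y (\<mu> + \<alpha> + \<beta>) (y (\<mu> + \<alpha>) (X \<mu> u))) - scale (qint (?k + 1)) (y (\<mu> + \<alpha>) (X \<mu> u))"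
    proof (rule YX [OF yXu])
      show "?k + 1 = \<kappa> (\<mu> + \<alpha> + \<beta>)" by (simp add: \<kappa>)
    qed (simp_all add: add_ac)
    hence t3: "Y (\<mu> + \<beta> + \<alpha> + \<alpha>) (X (\<mu> + \<alpha> + \<beta>) (y (\<mu> + \<alpha>) (X \<mu> u))) =
        X (\<mu> + \<beta>) (y \<mu> (X (\<mu> - \<alpha>) ?u)) - scale (qint ?k) (X (\<mu> + \<beta>) (y \<mu> u)) -
        scale (qint (?k + 1)) (y (\<mu> + \<alpha>) (X \<mu> u))"
      by (simp add: 5 lin_simps)
    have q: "scale (qint 2) (scale (qint ?k) w) = scale (qint (?k - 1)) w + scale (qint (?k + 1)) w"
      "scale (qint 2) (scale (qint (?k + 1)) w) = scale (qint ?k) w + scale (qint (?k + 2)) w" for w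
      using qint_2_mult [of ?k, where 'k = 'k] qint_2_mult [of "?k + 1", where 'k = 'k]
      by (simp_all add: scale_left_distrib [symmetric] add.commute)
    have "Y (\<mu> + \<beta> + \<alpha> + \<alpha>) (S \<mu> u) = y (\<mu> + \<alpha>) (X \<mu> (X (\<mu> - \<alpha>) ?u)) +
        X (\<mu> + \<beta>) (X (\<mu> + \<beta> - \<alpha>) (y (\<mu> - \<alpha>) ?u)) - scale (qint 2) (X (\<mu> + \<beta>) (y \<mu> (X (\<mu> - \<alpha>) ?u)))"
      unfolding S_def lin_simps t1 t2 t3 by (simp add: scale_right_diff_distrib q del: scale_scale)
    also have "\<dots> = S (\<mu> - \<alpha>) ?u"
      unfolding S_def by (simp add: algebra_simps)
    finally show ?thesis .
  qed
  have "S (lam + wt_scale 0 \<alpha>) v = 0"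
  proof (rule sl2_string_intertwiner [OF string [of lam], where W' = "\<lambda>n. V (lam + \<beta> + wt_scale n \<alpha>)"
        and E' = "\<lambda>n. X (lam + \<beta> + wt_scale n \<alpha>)" and F' = "\<lambda>n. Y (lam + \<beta> + wt_scale n \<alpha>)"
        and S = "\<lambda>n. S (lam + wt_scale n \<alpha>)"])
    show "sl2_string scale (\<lambda>n. V (lam + \<beta> + wt_scale n \<alpha>)) (\<lambda>n. X (lam + \<beta> + wt_scale n \<alpha>))
        (\<lambda>n. Y (lam + \<beta> + wt_scale n \<alpha>)) (\<kappa> lam - 1)"
      using string [of "lam + \<beta>"] by (simp add: \<kappa>)
    fix n x assume x: "x \<in> V (lam + wt_scale n \<alpha>)"
    let ?\<mu> = "lam + wt_scale n \<alpha>"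
    have 1: "y (?\<mu> + \<alpha> + \<alpha>) (X (?\<mu> + \<alpha>) (X ?\<mu> x)) \<in> V (?\<mu> + \<alpha> + \<alpha> + \<beta>)"
      by (intro y X x)
    have 2: "X (?\<mu> + \<beta> + \<alpha>) (X (?\<mu> + \<beta>) (y ?\<mu> x)) \<in> V (?\<mu> + \<beta> + \<alpha> + \<alpha>)"
      by (intro y X x)
    have 3: "X (?\<mu> + \<alpha> + \<beta>) (y (?\<mu> + \<alpha>) (X ?\<mu> x)) \<in> V (?\<mu> + \<alpha> + \<beta> + \<alpha>)"
      by (intro y X x)
    have e: "lam + \<beta> + wt_scale (n + 2) \<alpha> = ?\<mu> + \<beta> + \<alpha> + \<alpha>" "?\<mu> + \<alpha> + \<alpha> + \<beta> = ?\<mu> + \<beta> + \<alpha> + \<alpha>"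
      "?\<mu> + \<alpha> + \<beta> + \<alpha> = ?\<mu> + \<beta> + \<alpha> + \<alpha>"
      unfolding wt_scale_simps by (simp_all only: add_ac)
    show "S ?\<mu> x \<in> V (lam + \<beta> + wt_scale (n + 2) \<alpha>)"
      unfolding S_def e(1) using 1 2 3 unfolding e
      by (intro subspace_diff [OF V] subspace_add [OF V] subspace_scale [OF V])
    show "Y (lam + \<beta> + wt_scale (n + 2) \<alpha>) (S ?\<mu> x) = S (lam + wt_scale (n - 1) \<alpha>) (Y ?\<mu> x)"
      unfolding e(1) S_Y [OF x] by simp
    fix x' show "S ?\<mu> (x + x') = S ?\<mu> x + S ?\<mu> x'"
      by (simp add: S_def lin_simps scale_right_distrib)
  qed (use v in simp)
  thus ?thesis by (simp add: S_def)
qed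

section \<open>The action of the free algebra on a representation\<close>

lemma alg_act_add:
  assumes "vector_space scale"
  shows "alg_act scale \<rho> (x + y) v = alg_act scale \<rho> x v + alg_act scale \<rho> y v"
proof -
  interpret vector_space scale by fact
  let ?S = "Poly_Mapping.keys x \<union> Poly_Mapping.keys y"
  have *: "alg_act scale \<rho> z v = (\<Sum>w\<in>?S. scale (Poly_Mapping.lookup z w) (foldr \<rho> (letters w) v))"
    if "Poly_Mapping.keys z \<subseteq> ?S" for z
    unfolding alg_act_def
    by (rule sum.mono_neutral_left) (use that in \<open>auto simp: in_keys_iff\<close>)
  show ?thesis
    using keys_add [of x y] by (simp add: * lookup_add scale_left_distrib sum.distrib)
qed

lemma alg_act_single:
  assumes "vector_space scale"
  shows "alg_act scale \<rho> (Poly_Mapping.single w a) v = scale a (foldr \<rho> (letters w) v)"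
proof -
  interpret vector_space scale by fact
  show ?thesis by (simp add: alg_act_def)
qed

lemma alg_act_diff:
  assumes "vector_space scale"
  shows "alg_act scale \<rho> (x - y) v = alg_act scale \<rho> x v - alg_act scale \<rho> y v"
  using alg_act_add [OF assms, of \<rho> "x - y" y v] by simp


lemma gen_mult: "gen g * gen h = Poly_Mapping.single (Word [g, h]) 1"
  by (simp add: gen_def mult_single plus_word_def)

lemma gen_mult3: "gen f * Poly_Mapping.single (Word [g, h]) 1 = Poly_Mapping.single (Word [f, g, h]) 1"
  by (simp add: gen_def mult_single plus_word_def)

lemma smul_single: "a *\<^sub>q Poly_Mapping.single w b = Poly_Mapping.single w (a * b)"
  by (simp add: smul_def mult_single zero_word_def plus_word_def)

lemma pair_simple_add: "pair_simple (lam + \<mu>) i = pair_simple lam i + pair_simple \<mu> i"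
  "pair_simple (lam - \<mu>) i = pair_simple lam i - pair_simple \<mu> i"
  "pair_simple (- \<mu>) i = - pair_simple \<mu> i"
  by (simp_all add: pair_simple_def)

lemma pair_simple_basic: "pair_simple (simple_root adj j) i = cartan adj j i" "pair_simple (delta_wt n) i = 0"
  by (simp_all add: pair_simple_def simple_root_def delta_wt_def)

lemma cartan_sym: "simply_laced_finite_type adj \<Longrightarrow> cartan adj i j = cartan adj j i"
  by (auto simp: cartan_def simply_laced_finite_type_def)

lemma hop_at_simps:
  "(opE adj c i r)\<one>\<^bsub>lam\<^esub> = gen (EG i r lam)" "(opF adj c i r)\<one>\<^bsub>lam\<^esub> = gen (FG i r lam)"
  "(opP c i s n)\<one>\<^bsub>lam\<^esub> = gen (PG i s n lam)" "(opQ c i s n)\<one>\<^bsub>lam\<^esub> = gen (QG i s n lam)"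
  "(x \<odot> y)\<one>\<^bsub>lam\<^esub> = x\<one>\<^bsub>lam + hop_wt y\<^esub> * y\<one>\<^bsub>lam\<^esub>"
  by (simp_all add: opE_def opF_def opP_def opQ_def hop_mult_def)

lemma hop_wt_simps:
  "hop_wt (opE adj c i r) = simple_root adj i + delta_wt (r * int c)"
  "hop_wt (opF adj c i r) = - simple_root adj i + delta_wt (r * int c)"
  "hop_wt (opP c i s n) = delta_wt (- int n * int c)" "hop_wt (opQ c i s n) = delta_wt (int n * int c)"
  "hop_wt (x \<odot> y) = hop_wt x + hop_wt y"
  by (simp_all add: opE_def opF_def opP_def opQ_def hop_mult_def)

lemma delta_wt_add: "delta_wt m + delta_wt n = delta_wt (m + n)" and delta_wt_minus: "- delta_wt n = delta_wt (- n)"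
  and delta_wt_0: "delta_wt 0 = 0"
  by (auto simp: delta_wt_def prod_eq_iff fun_eq_iff zero_prod_def plus_prod_def)

text \<open>The sl2-triple used for E_{i,m} consists of E_{i,m} and F_{i,-m}, with \<alpha> =
  \<alpha>_i + m c \<delta> and weight <lambda,i> + m c by (R3). For the F's the roles are
  interchanged: \<alpha> = - \<alpha>_i + m c \<delta>, which is again a real root, and the weight
  is - <lambda,i> + m c.\<close>

lemma integrable_rel6:
  fixes adj :: "'i::finite \<Rightarrow> 'i \<Rightarrow> bool" and scale :: "'k::field_char_0 poly fract \<Rightarrow> 'v::ab_group_add \<Rightarrow> 'v"
  assumes adj: "simply_laced_finite_type adj" and rep: "weight_representation scale V \<rho>"
    and int: "integrable adj V" and rels: "rels_hold_on scale \<rho> (rels0_5 adj c)"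
  shows "rels_hold_on scale \<rho> (rel6 adj c)"
proof -
  have vs: "vector_space scale" and lin: "\<And>g. Vector_Spaces.linear scale scale (\<rho> g)"
    and V: "\<And>lam. module.subspace scale (V lam)"
    and decomp: "\<And>v. \<exists>!f. (\<forall>lam. f lam \<in> V lam) \<and> finite {lam. f lam \<noteq> 0} \<and> v = (\<Sum>lam | f lam \<noteq> 0. f lam)"
    and idem: "\<And>lam \<mu> v. v \<in> V \<mu> \<Longrightarrow> \<rho> (Idem lam) v = (if lam = \<mu> then v else 0)"
    using rep unfolding weight_representation_def by blast+
  interpret vector_space scale by (rule vs)
  have act: "alg_act scale \<rho> x v = 0" if "x \<in> rels0_5 adj c" for x v
    using rels that by (simp add: rels_hold_on_def)
  note act_simps = alg_act_diff [OF vs] alg_act_add [OF vs] gen_mult gen_mult3 smul_single alg_act_single [OF vs]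
    hop_at_simps
  have idem_V: "\<rho> (Idem \<mu>) v \<in> V \<mu>" for \<mu> v
  proof -
    interpret l: Vector_Spaces.linear scale scale "\<rho> (Idem \<mu>)" by (rule lin)
    obtain f where f: "\<And>lam. f lam \<in> V lam" "finite {lam. f lam \<noteq> 0}" "v = (\<Sum>lam | f lam \<noteq> 0. f lam)"
      using decomp [of v] by auto
    have "\<rho> (Idem \<mu>) v = (\<Sum>lam | f lam \<noteq> 0. \<rho> (Idem \<mu>) (f lam))"
      unfolding f(3) by (rule l.sum)
    also have "\<dots> \<in> V \<mu>"
      using f(1) by (intro subspace_sum [OF V]) (auto simp: idem [OF f(1)] subspace_0 [OF V])
    finally show ?thesis .
  qed
  have wt: "\<rho> (Idem (lam + hop_wt T)) (\<rho> g v) = \<rho> g v" "\<rho> g (\<rho> (Idem lam) v) = \<rho> g v"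
    if T: "weight_rels T \<subseteq> rels0_5 adj c" and g: "T\<one>\<^bsub>lam\<^esub> = (gen g :: ('i, 'k) free_alg)" for T g lam v
  proof -
    have "idem (lam + hop_wt T) * T\<one>\<^bsub>lam\<^esub> - T\<one>\<^bsub>lam\<^esub> \<in> weight_rels T"
      "T\<one>\<^bsub>lam\<^esub> * idem lam - T\<one>\<^bsub>lam\<^esub> \<in> weight_rels T"
      unfolding weight_rels_def by blast+
    hence "alg_act scale \<rho> (idem (lam + hop_wt T) * T\<one>\<^bsub>lam\<^esub> - T\<one>\<^bsub>lam\<^esub>) v = 0"
      "alg_act scale \<rho> (T\<one>\<^bsub>lam\<^esub> * idem lam - T\<one>\<^bsub>lam\<^esub>) v = 0"
      using act T by blast+
    thus "\<rho> (Idem (lam + hop_wt T)) (\<rho> g v) = \<rho> g v" "\<rho> g (\<rho> (Idem lam) v) = \<rho> g v"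
      unfolding g by (simp_all add: act_simps, simp_all add: gen_def act_simps)
  qed
  have wE: "weight_rels (opE adj c i r :: ('i, 'k) hop) \<subseteq> rels0_5 adj c"
    and wF: "weight_rels (opF adj c i r :: ('i, 'k) hop) \<subseteq> rels0_5 adj c" for i r
    by (auto simp: rels0_5_def rel1_def)
  have E_V: "\<rho> (EG i r lam) v \<in> V (lam + (simple_root adj i + delta_wt (r * int c)))" for i r lam v
    using idem_V [of "lam + hop_wt (opE adj c i r :: ('i, 'k) hop)"] wt(1) [OF wE hop_at_simps(1), of lam i r v]
    by (metis hop_wt_simps(1))
  have F_V: "\<rho> (FG i r lam) v \<in> V (lam + (- simple_root adj i + delta_wt (r * int c)))" for i r lam v
    using idem_V [of "lam + hop_wt (opF adj c i r :: ('i, 'k) hop)"] wt(1) [OF wF hop_at_simps(2), of lam i r v]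
    by (metis hop_wt_simps(2))
  have E_idem: "\<rho> (EG i r lam) (\<rho> (Idem lam) v) = \<rho> (EG i r lam) v"
    and F_idem: "\<rho> (FG i r lam) (\<rho> (Idem lam) v) = \<rho> (FG i r lam) v" for i r lam v
    by (rule wt(2) [OF wE hop_at_simps(1)], rule wt(2) [OF wF hop_at_simps(2)])
  have EF: "\<rho> (EG i m (lam + (- simple_root adj i + delta_wt (- m * int c)))) (\<rho> (FG i (- m) lam) v) -
      \<rho> (FG i (- m) (lam + (simple_root adj i + delta_wt (m * int c)))) (\<rho> (EG i m lam) v) =
      scale (qint (pair_simple lam i + m * int c)) v" if v: "v \<in> V lam" for i m lam v
  proof -
    have "(opE adj c i m \<odot> opF adj c i (- m))\<one>\<^bsub>lam\<^esub> - (opF adj c i (- m) \<odot> opE adj c i m)\<one>\<^bsub>lam\<^esub> -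
        qint (pair_simple lam i + m * int c) *\<^sub>q idem lam \<in> (rels0_5 adj c :: ('i, 'k) free_alg set)"
      unfolding rels0_5_def rel3_def by (rule UnI1, rule UnI1, rule UnI2, rule UnI1, rule CollectI,
        rule exI [of _ i], rule exI [of _ m], rule exI [of _ "- m"], rule exI [of _ lam]) simp
    from act [OF this, of v] show ?thesis
      using idem [OF v, of lam]
      by (simp add: act_simps hop_wt_simps) (simp add: gen_def smul_single alg_act_single [OF vs])
  qed
  have EF_neq: "\<rho> (EG i m (lam + (- simple_root adj j + delta_wt (n * int c)))) (\<rho> (FG j n lam) v) =
      \<rho> (FG j n (lam + (simple_root adj i + delta_wt (m * int c)))) (\<rho> (EG i m lam) v)"
    if ij: "i \<noteq> j" for i j m n lam v
  proof -
    have "(opE adj c i m \<odot> opF adj c j n)\<one>\<^bsub>lam\<^esub> - (opF adj c j n \<odot> opE adj c i m)\<one>\<^bsub>lam\<^esub>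
        \<in> (rels0_5 adj c :: ('i, 'k) free_alg set)"
      using ij unfolding rels0_5_def rel3_def by blast
    from act [OF this, of v] show ?thesis
      by (simp add: act_simps hop_wt_simps)
  qed
  have root: "simple_root adj i \<in> finite_root adj" "- simple_root adj i \<in> finite_root adj" for i
  proof -
    show 1: "simple_root adj i \<in> finite_root adj" by (rule finite_root.simple)
    \<comment> \<open>The reflection of a simple root in itself, where the pairing is 2.\<close>
    have "- simple_root adj i = simple_root adj i - wt_scale (pair_simple (simple_root adj i) i) (simple_root adj i)"
    proof -
      have p: "pair_simple (simple_root adj i) i = 2" by (simp add: pair_simple_basic cartan_def)
      show ?thesis unfolding p by (auto simp: wt_scale_def simple_root_def prod_eq_iff fun_eq_iff)
    qed
    thus "- simple_root adj i \<in> finite_root adj" using finite_root.reflect [OF 1, of i] by simp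
  qed
  have bounded: "\<exists>n0. \<forall>n. \<bar>n\<bar> \<ge> n0 \<longrightarrow> V (lam + wt_scale n (\<beta> + delta_wt m)) = {0}"
    if "\<beta> \<in> finite_root adj" for \<beta> m lam
    using int that unfolding integrable_def real_root_def by blast
  have serre: "alg_act scale \<rho> ((T j n \<odot> T i m \<odot> T i m)\<one>\<^bsub>lam\<^esub> + (T i m \<odot> T i m \<odot> T j n)\<one>\<^bsub>lam\<^esub> -
        qint 2 *\<^sub>q (T i m \<odot> T j n \<odot> T i m)\<one>\<^bsub>lam\<^esub> :: ('i, 'k) free_alg) v = 0"
    if T: "T \<in> {opE adj c, opF adj c}" and ij: "cartan adj i j = - 1" for T i j m n lam v
  proof -
    have neq: "i \<noteq> j" using ij by (auto simp: cartan_def)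
    have ji: "cartan adj j i = - 1" using ij cartan_sym [OF adj] by metis
    \<comment> \<open>The rightmost generators absorb the idempotent, so the relation has to be
      checked only on the component of v of weight lam.\<close>
    let ?v = "\<rho> (Idem lam) v"
    have dm: "lam - (simple_root adj i + delta_wt (m * int c)) = lam + (- simple_root adj i + delta_wt (- m * int c))"
      "lam - (- simple_root adj i + delta_wt (m * int c)) = lam + (simple_root adj i + delta_wt (- m * int c))" for lam :: "'i weight"
      by (simp_all add: delta_wt_minus [symmetric])
    consider "T = opE adj c" | "T = opF adj c" using T by blast
    thus ?thesis
    proof cases
      assume "T = opE adj c"
      let ?\<alpha> = "simple_root adj i + delta_wt (m * int c)" and ?\<beta> = "simple_root adj j + delta_wt (n * int c)"
      have "\<rho> (EG j n (lam + ?\<alpha> + ?\<alpha>)) (\<rho> (EG i m (lam + ?\<alpha>)) (\<rho> (EG i m lam) ?v)) +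
         \<rho> (EG i m (lam + ?\<beta> + ?\<alpha>)) (\<rho> (EG i m (lam + ?\<beta>)) (\<rho> (EG j n lam) ?v)) -
         scale (qint 2) (\<rho> (EG i m (lam + ?\<alpha> + ?\<beta>)) (\<rho> (EG j n (lam + ?\<alpha>)) (\<rho> (EG i m lam) ?v))) = 0"
      proof (rule weighted_serre [where X = "\<lambda>lam. \<rho> (EG i m lam)" and Y = "\<lambda>lam. \<rho> (FG i (- m) lam)"
            and y = "\<lambda>lam. \<rho> (EG j n lam)" and \<kappa> = "\<lambda>lam. pair_simple lam i + m * int c", OF vs V lin lin lin])
        fix lam v assume v: "v \<in> V lam"
        show "\<rho> (FG i (- m) lam) v \<in> V (lam - ?\<alpha>)" unfolding dm using F_V [of i "- m"] by simp
        show "\<rho> (EG i m (lam - ?\<alpha>)) (\<rho> (FG i (- m) lam) v) - \<rho> (FG i (- m) (lam + ?\<alpha>)) (\<rho> (EG i m lam) v) =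
            scale (qint (pair_simple lam i + m * int c)) v" unfolding dm by (rule EF [OF v])
        show "\<rho> (FG i (- m) (lam + ?\<beta>)) (\<rho> (EG j n lam) v) = \<rho> (EG j n (lam - ?\<alpha>)) (\<rho> (FG i (- m) lam) v)"
          unfolding dm using EF_neq [of j i n lam "- m" v] neq by simp
      qed (simp_all add: E_V idem_V bounded root pair_simple_add pair_simple_basic ji cartan_def [of adj i i])
      thus ?thesis unfolding \<open>T = opE adj c\<close>
        by (simp add: act_simps hop_wt_simps E_idem add_ac)
    next
      assume "T = opF adj c"
      let ?\<alpha> = "- simple_root adj i + delta_wt (m * int c)" and ?\<beta> = "- simple_root adj j + delta_wt (n * int c)"
      have "\<rho> (FG j n (lam + ?\<alpha> + ?\<alpha>)) (\<rho> (FG i m (lam + ?\<alpha>)) (\<rho> (FG i m lam) ?v)) +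
         \<rho> (FG i m (lam + ?\<beta> + ?\<alpha>)) (\<rho> (FG i m (lam + ?\<beta>)) (\<rho> (FG j n lam) ?v)) -
         scale (qint 2) (\<rho> (FG i m (lam + ?\<alpha> + ?\<beta>)) (\<rho> (FG j n (lam + ?\<alpha>)) (\<rho> (FG i m lam) ?v))) = 0"
      proof (rule weighted_serre [where X = "\<lambda>lam. \<rho> (FG i m lam)" and Y = "\<lambda>lam. \<rho> (EG i (- m) lam)"
            and y = "\<lambda>lam. \<rho> (FG j n lam)" and \<kappa> = "\<lambda>lam. - pair_simple lam i + m * int c", OF vs V lin lin lin])
        fix lam v assume v: "v \<in> V lam"
        show "\<rho> (EG i (- m) lam) v \<in> V (lam - ?\<alpha>)" unfolding dm using E_V [of i "- m"] by simp
        have "qint (- pair_simple lam i + m * int c) = - (qint (pair_simple lam i + - m * int c) :: 'k poly fract)"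
          using qint_minus [of "pair_simple lam i + - m * int c", where 'k = 'k] by simp
        hence k: "scale (qint (- pair_simple lam i + m * int c)) v = - scale (qint (pair_simple lam i + - m * int c)) v"
          by (simp only: scale_minus_left)
        have "\<rho> (EG i (- m) (lam + ?\<alpha>)) (\<rho> (FG i m lam) v) -
            \<rho> (FG i m (lam + (simple_root adj i + delta_wt (- m * int c)))) (\<rho> (EG i (- m) lam) v) =
            scale (qint (pair_simple lam i + - m * int c)) v"
          using EF [OF v, of i "- m"] by simp
        thus "\<rho> (FG i m (lam - ?\<alpha>)) (\<rho> (EG i (- m) lam) v) - \<rho> (EG i (- m) (lam + ?\<alpha>)) (\<rho> (FG i m lam) v) =
            scale (qint (- pair_simple lam i + m * int c)) v"
          unfolding dm k by (metis minus_diff_eq)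
        show "\<rho> (EG i (- m) (lam + ?\<beta>)) (\<rho> (FG j n lam) v) = \<rho> (FG j n (lam - ?\<alpha>)) (\<rho> (EG i (- m) lam) v)"
          unfolding dm using EF_neq [of i j "- m" lam n v] neq by simp
      qed (simp_all add: F_V [simplified] idem_V bounded [OF root(2), simplified] pair_simple_add pair_simple_basic ji cartan_def [of adj i i])
      thus ?thesis unfolding \<open>T = opF adj c\<close>
        by (simp add: act_simps hop_wt_simps F_idem add_ac)
    qed
  qed
  thus ?thesis unfolding rels_hold_on_def rel6_def by blast
qed

section \<open>The ring of operators on weight families\<close>

lemma smul_add_right: "a *\<^sub>q (x + y) = a *\<^sub>q x + a *\<^sub>q y"
  and smul_add_left: "(a + b) *\<^sub>q x = a *\<^sub>q x + b *\<^sub>q x"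
  and smul_diff_right: "a *\<^sub>q (x - y) = a *\<^sub>q x - a *\<^sub>q y"
  and smul_mult_left: "(a *\<^sub>q x) * y = a *\<^sub>q (x * y)"
  for x y :: "('i, 'k::field_char_0) free_alg"
  by (simp_all add: smul_def distrib_left distrib_right right_diff_distrib mult.assoc single_add)

lemma smul_mult_right: "x * (a *\<^sub>q y) = a *\<^sub>q (x * y)"
  for x y :: "('i, 'k::field_char_0) free_alg"
proof -
  have "x * Poly_Mapping.single 0 a = Poly_Mapping.single 0 a * x"
  proof (induction x rule: Poly_Mapping.update_induct)
    case const
    show ?case by simp
  next
    case (update f w b)
    have "Poly_Mapping.update w b f = f + Poly_Mapping.single w b"
      using update.hyps by (intro poly_mapping_eqI) (auto simp: lookup_update lookup_add lookup_single in_keys_iff when_def)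
    thus ?case using update.IH by (simp add: distrib_left distrib_right mult_single mult.commute)
  qed
  thus ?thesis by (simp add: smul_def mult.assoc [symmetric])
qed

interpretation free_alg: vector_space "smul :: 'k::field_char_0 poly fract \<Rightarrow> ('i, 'k) free_alg \<Rightarrow> _"
  by standard (simp_all add: smul_add_right smul_add_left smul_smul smul_one)

lemma two_sided_ideal_smul: "x \<in> two_sided_ideal S \<Longrightarrow> a *\<^sub>q x \<in> two_sided_ideal S"
  by (simp add: smul_def two_sided_ideal.left)

lemma two_sided_ideal_subspace: "free_alg.subspace (two_sided_ideal S)"
  by (rule free_alg.subspaceI)
    (auto intro: two_sided_ideal.zero two_sided_ideal.add two_sided_ideal_smul)

text \<open>A linear choice of representatives modulo the ideal. The ideal depends on
  \<open>adj\<close> and \<open>c\<close>, so elements of the quotient are represented inside the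
  free algebra instead of forming a type. Compatibility with products takes the form of
  \<open>reduction_mult\<close>.\<close>

definition is_reduction ::
    "('i, 'k::field_char_0) free_alg set \<Rightarrow> (('i, 'k) free_alg \<Rightarrow> ('i, 'k) free_alg) \<Rightarrow> bool" where
  "is_reduction S \<pi> \<longleftrightarrow> (\<forall>x y. \<pi> (x + y) = \<pi> x + \<pi> y) \<and> (\<forall>a x. \<pi> (a *\<^sub>q x) = a *\<^sub>q \<pi> x) \<and>
     (\<forall>x. \<pi> x = 0 \<longleftrightarrow> x \<in> two_sided_ideal S) \<and> (\<forall>x. x - \<pi> x \<in> two_sided_ideal S)"

text \<open>A projection along the ideal: a basis of the ideal is extended to a basis of the free
  algebra, and the basis vectors from the ideal are sent to 0.\<close>

lemma is_reduction_exists: "\<exists>\<pi>. is_reduction S (\<pi> :: ('i, 'k::field_char_0) free_alg \<Rightarrow> _)"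
proof -
  let ?I = "two_sided_ideal S :: ('i, 'k) free_alg set"
  interpret vector_space_pair "smul :: 'k poly fract \<Rightarrow> ('i, 'k) free_alg \<Rightarrow> _" smul ..
  obtain B where B: "B \<subseteq> ?I" "free_alg.independent B" "?I \<subseteq> free_alg.span B"
    using free_alg.maximal_independent_subset by blast
  have span: "free_alg.span B = ?I"
    using B free_alg.span_minimal [OF B(1) two_sided_ideal_subspace] by blast
  let ?B = "free_alg.extend_basis B"
  obtain g where g: "Vector_Spaces.linear smul smul g" "\<forall>x\<in>?B. g x = (if x \<in> B then 0 else x)"
    using linear_independent_extend [OF free_alg.independent_extend_basis [OF B(2)],
        of "\<lambda>x. if x \<in> B then 0 else x"] by blast
  interpret g: Vector_Spaces.linear "smul :: 'k poly fract \<Rightarrow> ('i, 'k) free_alg \<Rightarrow> _" smul g by (rule g(1))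
  have diff: "x - g x \<in> ?I" for x
  proof -
    have "x \<in> free_alg.span ?B" using free_alg.span_extend_basis [OF B(2)] by simp
    thus ?thesis
    proof (induction rule: free_alg.span_induct_alt)
      case base
      show ?case by (simp add: g.zero two_sided_ideal.zero)
    next
      case (step c x y)
      have "x - g x \<in> ?I" using g(2) step(1) B(1) by (auto simp: two_sided_ideal.zero)
      hence "c *\<^sub>q (x - g x) + (y - g y) \<in> ?I"
        using step by (intro two_sided_ideal.add two_sided_ideal_smul)
      thus ?case by (simp add: g.add g.scale smul_diff_right algebra_simps)
    qed
  qed
  have "g x = 0" if "x \<in> ?I" for x
  proof -
    have "x \<in> free_alg.span B" using that span by simp
    thus ?thesis
    proof (induction rule: free_alg.span_induct_alt)
      case (step c x y)
      moreover have "x \<in> ?B" using free_alg.extend_basis_superset [OF B(2)] step(1) by blast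
      ultimately show ?case using g(2) by (simp add: g.add g.scale)
    qed (simp add: g.zero)
  qed
  with diff have "g x = 0 \<longleftrightarrow> x \<in> ?I" for x by (metis diff_zero)
  with diff have "is_reduction S g" by (simp add: is_reduction_def g.add g.scale)
  thus ?thesis by blast
qed

definition reduction :: "('i, 'k::field_char_0) free_alg set \<Rightarrow> ('i, 'k) free_alg \<Rightarrow> ('i, 'k) free_alg" where
  "reduction S = (SOME \<pi>. is_reduction S \<pi>)"

lemma is_reduction: "is_reduction S (reduction S)"
  unfolding reduction_def by (rule someI_ex [OF is_reduction_exists])

lemma reduction_add: "reduction S (x + y) = reduction S x + reduction S y"
  and reduction_smul: "reduction S (a *\<^sub>q x) = a *\<^sub>q reduction S x"
  and reduction_eq_0: "reduction S x = 0 \<longleftrightarrow> x \<in> two_sided_ideal S"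
  and reduction_diff_mem: "x - reduction S x \<in> two_sided_ideal S"
  using is_reduction [of S] by (auto simp: is_reduction_def)

lemma reduction_diff: "reduction S (x - y) = reduction S x - reduction S y"
  using reduction_add [of S "x - y" y] by simp

lemma reduction_mult: "reduction S (x * reduction S y) = reduction S (x * y)"
proof -
  have "x * (y - reduction S y) \<in> two_sided_ideal S"
    by (rule two_sided_ideal.left) (rule reduction_diff_mem)
  hence "reduction S (x * (y - reduction S y)) = 0" by (simp add: reduction_eq_0)
  thus ?thesis by (simp add: right_diff_distrib reduction_diff)
qed

text \<open>The linear operators on families of elements of the free algebra indexed by weights.  Homogeneous
  operators of the quotient algebra act on such families, which makes identities between them, without
  idempotents, identities in a ring.\<close>

type_synonym ('i, 'k) wfam = "'i weight \<Rightarrow> ('i, 'k) free_alg"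

definition wfam_linear :: "(('i, 'k::field_char_0) wfam \<Rightarrow> ('i, 'k) wfam) \<Rightarrow> bool" where
  "wfam_linear f \<longleftrightarrow> (\<forall>u v. f (u + v) = f u + f v) \<and> (\<forall>a u. f (\<lambda>w. a *\<^sub>q u w) = (\<lambda>w. a *\<^sub>q f u w))"

typedef (overloaded) ('i, 'k) wop = "{f :: ('i, 'k::field_char_0) wfam \<Rightarrow> ('i, 'k) wfam. wfam_linear f}"
  by (rule exI [of _ "\<lambda>v. v"]) (simp add: wfam_linear_def)

lemma wfam_linear_Rep: "wfam_linear (Rep_wop x)"
  using Rep_wop [of x] by simp

lemma Rep_Abs_wop: "wfam_linear f \<Longrightarrow> Rep_wop (Abs_wop f) = f"
  by (simp add: Abs_wop_inverse)

lemma wop_eqI: "(\<And>v. Rep_wop x v = Rep_wop y v) \<Longrightarrow> x = y"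
  by (simp add: Rep_wop_inject [symmetric] fun_eq_iff)

lemma Rep_wop_linear:
  "Rep_wop x (u + v) = Rep_wop x u + Rep_wop x v" "Rep_wop x (\<lambda>w. a *\<^sub>q u w) = (\<lambda>w. a *\<^sub>q Rep_wop x u w)"
  using wfam_linear_Rep [of x] by (auto simp: wfam_linear_def)

instantiation wop :: (type, field_char_0) ring_1
begin

definition "zero_wop = Abs_wop (\<lambda>v. 0)"
definition "one_wop = Abs_wop (\<lambda>v. v)"
definition "plus_wop x y = Abs_wop (\<lambda>v. Rep_wop x v + Rep_wop y v)"
definition "uminus_wop x = Abs_wop (\<lambda>v. - Rep_wop x v)"
definition "minus_wop x y = Abs_wop (\<lambda>v. Rep_wop x v - Rep_wop y v)"
definition "times_wop x y = Abs_wop (\<lambda>v. Rep_wop x (Rep_wop y v))"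

lemma Rep_wop_simps:
  "Rep_wop 0 v = 0" "Rep_wop 1 v = v" "Rep_wop (x + y) v = Rep_wop x v + Rep_wop y v"
  "Rep_wop (- x) v = - Rep_wop x v" "Rep_wop (x - y) v = Rep_wop x v - Rep_wop y v"
  "Rep_wop (x * y) v = Rep_wop x (Rep_wop y v)"
proof -
  have z: "a *\<^sub>q 0 = 0" "a *\<^sub>q (- x) = - (a *\<^sub>q x)" for a and x :: "('a, 'b) free_alg"
    by (simp_all add: smul_def)
  show "Rep_wop 0 v = 0" unfolding zero_wop_def
    by (subst Rep_Abs_wop) (auto simp: wfam_linear_def z zero_fun_def)
  show "Rep_wop 1 v = v" unfolding one_wop_def
    by (subst Rep_Abs_wop) (auto simp: wfam_linear_def)
  show "Rep_wop (x + y) v = Rep_wop x v + Rep_wop y v" unfolding plus_wop_def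
    by (subst Rep_Abs_wop) (auto simp: wfam_linear_def Rep_wop_linear smul_add_right fun_eq_iff algebra_simps)
  show "Rep_wop (- x) v = - Rep_wop x v" unfolding uminus_wop_def
    by (subst Rep_Abs_wop) (auto simp: wfam_linear_def Rep_wop_linear z fun_eq_iff)
  show "Rep_wop (x - y) v = Rep_wop x v - Rep_wop y v" unfolding minus_wop_def
    by (subst Rep_Abs_wop) (auto simp: wfam_linear_def Rep_wop_linear smul_diff_right fun_eq_iff algebra_simps)
  show "Rep_wop (x * y) v = Rep_wop x (Rep_wop y v)" unfolding times_wop_def
    by (subst Rep_Abs_wop) (auto simp: wfam_linear_def Rep_wop_linear)
qed

instance
proof
  show "(0 :: ('a, 'b) wop) \<noteq> 1"
  proof
    assume "(0 :: ('a, 'b) wop) = 1"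
    hence "Rep_wop (0 :: ('a, 'b) wop) (\<lambda>_. 1) = Rep_wop 1 (\<lambda>_. 1)" by simp
    thus False by (simp add: Rep_wop_simps fun_eq_iff)
  qed
qed (rule wop_eqI; simp add: Rep_wop_simps Rep_wop_linear algebra_simps)+

end

definition wop_scale :: "'k::field_char_0 poly fract \<Rightarrow> ('i, 'k) wop \<Rightarrow> ('i, 'k) wop" where
  "wop_scale a x = Abs_wop (\<lambda>v w. a *\<^sub>q Rep_wop x v w)"

lemma Rep_wop_scale: "Rep_wop (wop_scale a x) v = (\<lambda>w. a *\<^sub>q Rep_wop x v w)"
  unfolding wop_scale_def
  by (subst Rep_Abs_wop) (auto simp: wfam_linear_def Rep_wop_linear smul_add_right smul_smul mult.commute fun_eq_iff)

text \<open>The scalars of \<open>scalar_algebra\<close> must have characteristic 0, since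
  exponentials divide by factorials.\<close>

instance fract :: ("{idom, ring_char_0}") field_char_0
proof
  show "inj (of_nat :: nat \<Rightarrow> 'a fract)"
  proof (rule injI)
    fix m n assume "(of_nat m :: 'a fract) = of_nat n"
    hence "Fract (of_nat m) 1 = (Fract (of_nat n) 1 :: 'a fract)" by (simp add: Fract_of_nat_eq)
    thus "m = n" by (simp add: eq_fract)
  qed
qed

interpretation wop: scalar_algebra "wop_scale :: 'k::field_char_0 poly fract \<Rightarrow> ('i, 'k) wop \<Rightarrow> _"
proof
  show "wop_scale c (x + y) = wop_scale c x + wop_scale c y" "wop_scale (c + d) x = wop_scale c x + wop_scale d x"
    "wop_scale c (wop_scale d x) = wop_scale (c * d) x" "wop_scale 1 x = x"
    "wop_scale c x * y = wop_scale c (x * y)" "x * wop_scale c y = wop_scale c (x * y)"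
    for c d and x y :: "('i, 'k) wop"
    by (rule wop_eqI; simp add: Rep_wop_scale Rep_wop_simps Rep_wop_linear smul_add_right smul_add_left
        smul_smul smul_one fun_eq_iff)+
qed

text \<open>Left multiplication, moving the entry of the family at lam to lam + wt x. Composition
  then follows the product of homogeneous operators, and the reduction makes the result depend only
  on the classes of the elements x1_lam.\<close>

definition act :: "('i, 'k::field_char_0) free_alg set \<Rightarrow> ('i, 'k) hop \<Rightarrow> ('i, 'k) wop" where
  "act S x = Abs_wop (\<lambda>v \<mu>. reduction S (x\<one>\<^bsub>\<mu> - hop_wt x\<^esub> * v (\<mu> - hop_wt x)))"

lemma Rep_act: "Rep_wop (act S x) v \<mu> = reduction S (x\<one>\<^bsub>\<mu> - hop_wt x\<^esub> * v (\<mu> - hop_wt x))"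
  unfolding act_def
  by (subst Rep_Abs_wop)
    (auto simp: wfam_linear_def fun_eq_iff distrib_left reduction_add reduction_smul smul_mult_right)

text \<open>The action is faithful: the constant family 1 returns every x1_lam modulo the ideal.
  Through this equivalence an identity of operators becomes an identity in A for every
  weight.\<close>

lemma act_eq_iff:
  assumes "hop_wt x = hop_wt y"
  shows "act S x = act S y \<longleftrightarrow> (\<forall>lam. x\<one>\<^bsub>lam\<^esub> - y\<one>\<^bsub>lam\<^esub> \<in> two_sided_ideal S)"
proof
  assume eq: "act S x = act S y"
  show "\<forall>lam. x\<one>\<^bsub>lam\<^esub> - y\<one>\<^bsub>lam\<^esub> \<in> two_sided_ideal S"
  proof
    fix lam
    have "Rep_wop (act S x) (\<lambda>_. 1) (lam + hop_wt x) = Rep_wop (act S y) (\<lambda>_. 1) (lam + hop_wt x)"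
      by (simp add: eq)
    hence "reduction S (x\<one>\<^bsub>lam\<^esub> - y\<one>\<^bsub>lam\<^esub>) = 0"
      using assms by (simp add: Rep_act reduction_diff)
    thus "x\<one>\<^bsub>lam\<^esub> - y\<one>\<^bsub>lam\<^esub> \<in> two_sided_ideal S" by (simp add: reduction_eq_0)
  qed
next
  assume mem: "\<forall>lam. x\<one>\<^bsub>lam\<^esub> - y\<one>\<^bsub>lam\<^esub> \<in> two_sided_ideal S"
  show "act S x = act S y"
  proof (intro wop_eqI ext)
    fix v \<mu>
    let ?l = "\<mu> - hop_wt x"
    have "(x\<one>\<^bsub>?l\<^esub> - y\<one>\<^bsub>?l\<^esub>) * v ?l \<in> two_sided_ideal S"
      by (rule two_sided_ideal.right) (use mem in blast)
    hence "reduction S ((x\<one>\<^bsub>?l\<^esub> - y\<one>\<^bsub>?l\<^esub>) * v ?l) = 0" by (simp add: reduction_eq_0)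
    thus "Rep_wop (act S x) v \<mu> = Rep_wop (act S y) v \<mu>"
      using assms by (simp add: Rep_act left_diff_distrib reduction_diff)
  qed
qed

lemma act_mult: "act S (x \<odot> y) = act S x * act S y"
proof (intro wop_eqI ext)
  fix v \<mu>
  show "Rep_wop (act S (x \<odot> y)) v \<mu> = Rep_wop (act S x * act S y) v \<mu>"
    by (simp add: Rep_wop_simps Rep_act hop_wt_simps hop_at_simps reduction_mult mult.assoc diff_diff_eq [symmetric])
qed

lemma act_scale: "act S (hop_scale a x) = wop_scale a (act S x)"
  by (intro wop_eqI ext) (simp add: Rep_wop_scale Rep_act hop_scale_def smul_mult_left reduction_smul)

lemma act_add: "act S (Hop w (\<lambda>lam. f lam + g lam)) = act S (Hop w f) + act S (Hop w g)"
  by (intro wop_eqI ext) (simp add: Rep_wop_simps Rep_act distrib_right reduction_add)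

lemma act_diff: "act S (Hop w (\<lambda>lam. f lam - g lam)) = act S (Hop w f) - act S (Hop w g)"
  by (intro wop_eqI ext) (simp add: Rep_wop_simps Rep_act left_diff_distrib reduction_diff)

lemma act_smul: "act S (Hop w (\<lambda>lam. a *\<^sub>q f lam)) = wop_scale a (act S (Hop w f))"
  using act_scale [of S a "Hop w f"] by (simp add: hop_scale_def)

lemma act_zero: "act S (Hop w (\<lambda>lam. 0)) = 0"
  using act_diff [of S w "\<lambda>_. 0" "\<lambda>_. 0"] by simp

lemma act_sum: "act S (Hop w (\<lambda>lam. \<Sum>k\<in>A. f k lam)) = (\<Sum>k\<in>A. act S (Hop w (f k)))"
  by (induction A rule: infinite_finite_induct) (simp_all add: act_zero act_add)

lemma Hop_collapse: "hop_wt x = w \<Longrightarrow> Hop w (hop_at x) = x"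
  by (cases x) simp

lemma act_eqI:
  assumes "hop_wt x = hop_wt y" "\<And>lam. x\<one>\<^bsub>lam\<^esub> - y\<one>\<^bsub>lam\<^esub> \<in> S"
  shows "act S x = act S y"
  using assms by (simp add: act_eq_iff two_sided_ideal.base)

text \<open>The operator that multiplies by a scalar depending on the weight, such as q^h. It is not
  a single element of A, but it is an operator on families; with k = 1 it is
  \<open>e\<close>.\<close>

definition wt_fun :: "('i, 'k::field_char_0) free_alg set \<Rightarrow> ('i weight \<Rightarrow> 'k poly fract) \<Rightarrow> ('i, 'k) wop" where
  "wt_fun S k = act S (Hop 0 (\<lambda>lam. k lam *\<^sub>q idem lam))"

lemma wt_fun_left:
  assumes "weight_rels x \<subseteq> two_sided_ideal S"
  shows "wt_fun S k * act S x = act S (Hop (hop_wt x) (\<lambda>lam. k (lam + hop_wt x) *\<^sub>q x\<one>\<^bsub>lam\<^esub>))"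
proof -
  have "k (lam + hop_wt x) *\<^sub>q (idem (lam + hop_wt x) * x\<one>\<^bsub>lam\<^esub> - x\<one>\<^bsub>lam\<^esub>) \<in> two_sided_ideal S" for lam
    by (intro two_sided_ideal_smul) (use assms in \<open>unfold weight_rels_def, blast\<close>)
  thus ?thesis
    unfolding wt_fun_def act_mult [symmetric]
    by (subst act_eq_iff) (simp_all add: hop_wt_simps hop_at_simps smul_mult_left smul_diff_right)
qed

lemma wt_fun_right:
  assumes "weight_rels x \<subseteq> two_sided_ideal S"
  shows "act S x * wt_fun S k = act S (Hop (hop_wt x) (\<lambda>lam. k lam *\<^sub>q x\<one>\<^bsub>lam\<^esub>))"
proof -
  have "k lam *\<^sub>q (x\<one>\<^bsub>lam\<^esub> * idem lam - x\<one>\<^bsub>lam\<^esub>) \<in> two_sided_ideal S" for lam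
    by (intro two_sided_ideal_smul) (use assms in \<open>unfold weight_rels_def, blast\<close>)
  thus ?thesis
    unfolding wt_fun_def act_mult [symmetric]
    by (subst act_eq_iff) (simp_all add: hop_wt_simps hop_at_simps smul_mult_right smul_diff_right)
qed

lemma wt_fun_mult:
  assumes "\<And>lam. idem lam * idem lam - idem lam \<in> S"
  shows "wt_fun S k * wt_fun S l = wt_fun S (\<lambda>lam. k lam * l lam)"
proof -
  have "(k lam * l lam) *\<^sub>q (idem lam * idem lam - idem lam) \<in> two_sided_ideal S" for lam
    by (intro two_sided_ideal_smul two_sided_ideal.base assms)
  thus ?thesis
    unfolding wt_fun_def act_mult [symmetric]
    by (subst act_eq_iff) (simp_all add: hop_wt_simps hop_at_simps smul_mult_left smul_mult_right
        smul_smul smul_diff_right mult.commute)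
qed

section \<open>The loop relations in the algebra\<close>

locale quantum_affine =
  fixes adj :: "'i::finite \<Rightarrow> 'i \<Rightarrow> bool" and c :: nat and S :: "('i, 'k::field_char_0) free_alg set"
  assumes finite_type: "simply_laced_finite_type adj" and S: "S = rels0_5 adj c \<union> rel6 adj c"
begin

section \<open>The generators as operators\<close>

notation wop_scale (infixr "*s" 75)

abbreviation q :: "'k poly fract" where "q \<equiv> qq"
abbreviation a :: "'i \<Rightarrow> 'i \<Rightarrow> int" where "a \<equiv> cartan adj"

definition e :: "('i, 'k) wop" where "e = act S (Hop 0 idem)"
definition E :: "'i \<Rightarrow> int \<Rightarrow> ('i, 'k) wop" where "E i n = act S (opE adj c i n)"
definition F :: "'i \<Rightarrow> int \<Rightarrow> ('i, 'k) wop" where "F i n = act S (opF adj c i n)"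
definition P :: "shape \<Rightarrow> 'i \<Rightarrow> nat \<Rightarrow> ('i, 'k) wop" where "P s i n = act S (opP c i s n)"
definition Q :: "shape \<Rightarrow> 'i \<Rightarrow> nat \<Rightarrow> ('i, 'k) wop" where "Q s i n = act S (opQ c i s n)"
definition Pb :: "'i \<Rightarrow> nat \<Rightarrow> ('i, 'k) wop" where "Pb i n = act S (opPbr c i n)"
definition Qb :: "'i \<Rightarrow> nat \<Rightarrow> ('i, 'k) wop" where "Qb i n = act S (opQbr c i n)"
definition K :: "'i \<Rightarrow> ('i, 'k) wop" where "K i = wt_fun S (\<lambda>lam. q powi pair_simple lam i)"
definition K' :: "'i \<Rightarrow> ('i, 'k) wop" where "K' i = wt_fun S (\<lambda>lam. q powi (- pair_simple lam i))"

text \<open>The factor q - 1/q turns (R3) into the common form \<open>EF_rel\<close>, whose zeroth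
  modes come from the two exponentials in a quantum integer. The sign of \<open>\<phi>\<close>
  compensates that \<open>\<phi>\<close> is subtracted there.\<close>

definition \<psi> :: "'i \<Rightarrow> int \<Rightarrow> ('i, 'k) wop" where
  "\<psi> i n = (if n < 0 then 0 else if n = 0 then K i else (q - inverse q) *s (Qb i (nat n) * K i))"
definition \<phi> :: "'i \<Rightarrow> int \<Rightarrow> ('i, 'k) wop" where
  "\<phi> i n = (if n > 0 then 0 else if n = 0 then K' i else (- (q - inverse q)) *s (Pb i (nat (- n)) * K' i))"

lemma in_S: "x \<in> rel0 c \<Longrightarrow> x \<in> S" "x \<in> rel1 adj c \<Longrightarrow> x \<in> S" "x \<in> rel2 adj c \<Longrightarrow> x \<in> S"
  "x \<in> rel3 adj c \<Longrightarrow> x \<in> S" "x \<in> rel4 adj c \<Longrightarrow> x \<in> S" "x \<in> rel5 adj c \<Longrightarrow> x \<in> S"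
  "x \<in> rel6 adj c \<Longrightarrow> x \<in> S"
  by (auto simp: S rels0_5_def)

lemma S_subset: "S \<subseteq> two_sided_ideal S"
  by (auto intro: two_sided_ideal.base)

lemma weight_rels_basic:
  "weight_rels (opE adj c i r) \<subseteq> two_sided_ideal S" "weight_rels (opF adj c i r) \<subseteq> two_sided_ideal S"
  "weight_rels (opP c i s n) \<subseteq> two_sided_ideal S" "weight_rels (opQ c i s n) \<subseteq> two_sided_ideal S"
proof -
  have "weight_rels (opE adj c i r) \<subseteq> S" "weight_rels (opF adj c i r) \<subseteq> S"
    "weight_rels (opP c i s n) \<subseteq> S" "weight_rels (opQ c i s n) \<subseteq> S"
    by (auto simp: S rels0_5_def rel1_def rel2_def)
  thus "weight_rels (opE adj c i r) \<subseteq> two_sided_ideal S" "weight_rels (opF adj c i r) \<subseteq> two_sided_ideal S"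
    "weight_rels (opP c i s n) \<subseteq> two_sided_ideal S" "weight_rels (opQ c i s n) \<subseteq> two_sided_ideal S"
    using S_subset by blast+
qed

lemma act_Hop: "hop_wt x = w \<Longrightarrow> act S (Hop w (\<lambda>lam. x\<one>\<^bsub>lam\<^esub>)) = act S x"
  by (metis Hop_collapse)

lemma e_eq: "e = wt_fun S (\<lambda>_. 1)"
  by (simp add: e_def wt_fun_def smul_one)

lemma unit_act:
  assumes "weight_rels x \<subseteq> two_sided_ideal S"
  shows "e * act S x = act S x" "act S x * e = act S x"
  using wt_fun_left [OF assms, of "\<lambda>_. 1"] wt_fun_right [OF assms, of "\<lambda>_. 1"]
  by (simp_all add: e_eq smul_one act_Hop)

text \<open>The converse of \<open>unit_act\<close>, for composite operators such as the bracketed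
  P's and Q's, whose weight relations have to be derived.\<close>

lemma weight_rels_unit:
  assumes "e * act S x = act S x" "act S x * e = act S x"
  shows "weight_rels x \<subseteq> two_sided_ideal S"
proof -
  have "act S (Hop 0 idem \<odot> x) = act S x" "act S (x \<odot> Hop 0 idem) = act S x"
    using assms by (simp_all add: act_mult e_def)
  thus ?thesis
    by (subst (asm) (1 2) act_eq_iff) (auto simp: hop_wt_simps hop_at_simps weight_rels_def)
qed

lemma idem_rel: "idem lam * idem lam - idem lam \<in> S"
proof (rule in_S(2))
  show "idem lam * idem lam - idem lam \<in> rel1 adj c"
    unfolding rel1_def by (rule UnI1, rule UnI1, rule CollectI, rule exI [of _ lam], rule exI [of _ lam]) simp
qed

lemma wt_fun_mult_S: "wt_fun S k * wt_fun S l = wt_fun S (\<lambda>lam. k lam * l lam)"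
  by (rule wt_fun_mult) (rule idem_rel)

lemma e_e: "e * e = e" and e_wt_fun: "e * wt_fun S k = wt_fun S k" and wt_fun_e: "wt_fun S k * e = wt_fun S k"
  by (simp_all add: e_eq wt_fun_mult_S)

lemma K_K': "K i * K' i = e" "K' i * K i = e"
  by (simp_all add: K_def K'_def wt_fun_mult_S e_eq power_int_minus qq_nonzero)

lemma K_comm: "K i * K j = K j * K i" "K i * K' j = K' j * K i" "K' i * K' j = K' j * K' i"
  by (simp_all add: K_def K'_def wt_fun_mult_S mult.commute)

lemma e_K: "e * K i = K i" "K i * e = K i" "e * K' i = K' i" "K' i * e = K' i"
  by (simp_all add: K_def K'_def e_wt_fun wt_fun_e)

lemma K_act:
  assumes "weight_rels x \<subseteq> two_sided_ideal S"
  shows "K i * act S x = q powi pair_simple (hop_wt x) i *s (act S x * K i)"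
    "K' i * act S x = q powi (- pair_simple (hop_wt x) i) *s (act S x * K' i)"
  unfolding K_def K'_def wt_fun_left [OF assms] wt_fun_right [OF assms] act_smul [symmetric]
  by (simp_all add: pair_simple_add power_int_add power_int_diff power_int_minus qq_nonzero smul_smul mult.commute
      field_simps)

lemma unit_basic:
  "e * E i n = E i n" "E i n * e = E i n" "e * F i n = F i n" "F i n * e = F i n"
  "e * P s i m = P s i m" "P s i m * e = P s i m" "e * Q s i m = Q s i m" "Q s i m * e = Q s i m"
  unfolding E_def F_def P_def Q_def by (simp_all add: unit_act weight_rels_basic)

lemma K_PQ: "K i * P s j n = P s j n * K i" "K' i * P s j n = P s j n * K' i"
  "K i * Q s j n = Q s j n * K i" "K' i * Q s j n = Q s j n * K' i"
  unfolding P_def Q_def by (simp_all add: K_act weight_rels_basic hop_wt_simps pair_simple_basic)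

section \<open>The relations as operator identities\<close>

lemma Qb_eq: "Qb i n = (\<Sum>m=0..n. ((- 1) ^ m * (q ^ m * qint (int m))) *s (Q Col i (n - m) * Q Row i m))"
proof -
  have "Qb i n = (\<Sum>m=0..n. ((- q) ^ m * qint (int m)) *s
      act S (Hop (delta_wt (int n * int c)) (\<lambda>lam. (opQ c i Col (n - m) \<odot> opQ c i Row m)\<one>\<^bsub>lam\<^esub>)))"
    unfolding Qb_def opQbr_def act_sum act_smul ..
  also have "\<dots> = (\<Sum>m=0..n. ((- 1) ^ m * (q ^ m * qint (int m))) *s (Q Col i (n - m) * Q Row i m))"
  proof (intro sum.cong refl)
    fix m assume m: "m \<in> {0..n}"
    have "act S (Hop (delta_wt (int n * int c)) (\<lambda>lam. (opQ c i Col (n - m) \<odot> opQ c i Row m)\<one>\<^bsub>lam\<^esub>)) =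
        Q Col i (n - m) * Q Row i m"
      unfolding Q_def act_mult [symmetric]
      by (rule act_Hop) (use m in \<open>simp add: hop_wt_simps delta_wt_add of_nat_diff algebra_simps\<close>)
    moreover have "(- q) ^ m * qint (int m) = (- 1) ^ m * (q ^ m * qint (int m))"
      by (simp add: power_minus [of q])
    ultimately show "((- q) ^ m * qint (int m)) *s
        act S (Hop (delta_wt (int n * int c)) (\<lambda>lam. (opQ c i Col (n - m) \<odot> opQ c i Row m)\<one>\<^bsub>lam\<^esub>)) =
        ((- 1) ^ m * (q ^ m * qint (int m))) *s (Q Col i (n - m) * Q Row i m)" by (simp only:)
  qed
  finally show ?thesis .
qed

lemma Pb_eq: "Pb i n = (\<Sum>m=0..n. ((- 1) ^ m * (inverse q ^ m * qint (int m))) *s (P Col i (n - m) * P Row i m))"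
proof -
  have "Pb i n = (\<Sum>m=0..n. ((- q) powi (- int m) * qint (int m)) *s
      act S (Hop (delta_wt (- int n * int c)) (\<lambda>lam. (opP c i Col (n - m) \<odot> opP c i Row m)\<one>\<^bsub>lam\<^esub>)))"
    unfolding Pb_def opPbr_def act_sum act_smul ..
  also have "\<dots> = (\<Sum>m=0..n. ((- 1) ^ m * (inverse q ^ m * qint (int m))) *s (P Col i (n - m) * P Row i m))"
  proof (intro sum.cong refl)
    fix m assume m: "m \<in> {0..n}"
    have "act S (Hop (delta_wt (- int n * int c)) (\<lambda>lam. (opP c i Col (n - m) \<odot> opP c i Row m)\<one>\<^bsub>lam\<^esub>)) =
        P Col i (n - m) * P Row i m"
      unfolding P_def act_mult [symmetric]
      by (rule act_Hop) (use m in \<open>simp add: hop_wt_simps delta_wt_add of_nat_diff algebra_simps\<close>)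
    moreover have "(- q) powi (- int m) * qint (int m) = (- 1) ^ m * (inverse q ^ m * qint (int m))"
      by (cases "even m") (simp_all add: power_int_minus power_inverse)
    ultimately show "((- q) powi (- int m) * qint (int m)) *s
        act S (Hop (delta_wt (- int n * int c)) (\<lambda>lam. (opP c i Col (n - m) \<odot> opP c i Row m)\<one>\<^bsub>lam\<^esub>)) =
        ((- 1) ^ m * (inverse q ^ m * qint (int m))) *s (P Col i (n - m) * P Row i m)" by (simp only:)
  qed
  finally show ?thesis .
qed

lemma PQ_0: "P s i 0 = e" "Q s i 0 = e"
proof -
  have "(opP c i s 0)\<one>\<^bsub>lam\<^esub> - idem lam \<in> S" "(opQ c i s 0)\<one>\<^bsub>lam\<^esub> - idem lam \<in> S" for lam
    by (rule in_S(1), unfold rel0_def, blast)+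
  thus "P s i 0 = e" "Q s i 0 = e"
    unfolding P_def Q_def e_def by (auto intro!: act_eqI simp: hop_wt_simps delta_wt_0)
qed

lemma PQ_inverse:
  assumes "n > 0"
  shows "(\<Sum>k=0..n. (- 1) ^ k *s (P Row i (n - k) * P Col i k)) = 0"
    "(\<Sum>k=0..n. (- 1) ^ k *s (P Col i k * P Row i (n - k))) = 0"
    "(\<Sum>k=0..n. (- 1) ^ k *s (Q Row i (n - k) * Q Col i k)) = 0"
    "(\<Sum>k=0..n. (- 1) ^ k *s (Q Col i k * Q Row i (n - k))) = 0"
proof -
  have *: "(\<Sum>k=0..n. (- 1) ^ k *s act S (f k)) = 0"
    if "\<And>k. k \<le> n \<Longrightarrow> hop_wt (f k) = w"
      and "\<And>lam. (\<Sum>k=0..n. ((- 1) ^ k) *\<^sub>q (f k)\<one>\<^bsub>lam\<^esub>) \<in> S" for f w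
  proof -
    have "act S (Hop w (\<lambda>lam. \<Sum>k=0..n. ((- 1) ^ k) *\<^sub>q (f k)\<one>\<^bsub>lam\<^esub>)) = act S (Hop w (\<lambda>_. 0))"
      by (rule act_eqI) (use that in simp_all)
    moreover have "act S (Hop w (\<lambda>lam. \<Sum>k=0..n. ((- 1) ^ k) *\<^sub>q (f k)\<one>\<^bsub>lam\<^esub>)) =
        (\<Sum>k=0..n. (- 1) ^ k *s act S (f k))"
      unfolding act_sum act_smul by (intro sum.cong refl) (simp add: act_Hop that(1))
    ultimately show ?thesis by (simp add: act_zero)
  qed
  have wt: "hop_wt (T i Row (n - k) \<odot> T i Col k) = hop_wt (T i Row n)"
    "hop_wt (T i Col k \<odot> T i Row (n - k)) = hop_wt (T i Row n)"
    if "T \<in> {opP c, opQ c}" "k \<le> n" for k and T :: "'i \<Rightarrow> shape \<Rightarrow> nat \<Rightarrow> ('i, 'k) hop"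
    using that by (auto simp: hop_wt_simps delta_wt_add of_nat_diff algebra_simps)
  have rel: "(\<Sum>k=0..n. ((- 1) ^ k) *\<^sub>q (T i Row (n - k) \<odot> T i Col k)\<one>\<^bsub>lam\<^esub>) \<in> S"
    "(\<Sum>k=0..n. ((- 1) ^ k) *\<^sub>q (T i Col k \<odot> T i Row (n - k))\<one>\<^bsub>lam\<^esub>) \<in> S"
    if "T \<in> {opP c, opQ c}" for T :: "'i \<Rightarrow> shape \<Rightarrow> nat \<Rightarrow> ('i, 'k) hop" and lam
  proof -
    have "n \<ge> 1" using assms by simp
    thus "(\<Sum>k=0..n. ((- 1) ^ k) *\<^sub>q (T i Row (n - k) \<odot> T i Col k)\<one>\<^bsub>lam\<^esub>) \<in> S"
      "(\<Sum>k=0..n. ((- 1) ^ k) *\<^sub>q (T i Col k \<odot> T i Row (n - k))\<one>\<^bsub>lam\<^esub>) \<in> S"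
      using that by - (rule in_S(1), unfold rel0_def, blast)+
  qed
  have T: "opP c \<in> {opP c, opQ c}" "opQ c \<in> {opP c, opQ c}" by auto
  show "(\<Sum>k=0..n. (- 1) ^ k *s (P Row i (n - k) * P Col i k)) = 0"
    "(\<Sum>k=0..n. (- 1) ^ k *s (P Col i k * P Row i (n - k))) = 0"
    "(\<Sum>k=0..n. (- 1) ^ k *s (Q Row i (n - k) * Q Col i k)) = 0"
    "(\<Sum>k=0..n. (- 1) ^ k *s (Q Col i k * Q Row i (n - k))) = 0"
    unfolding P_def Q_def act_mult [symmetric]
    by (rule * [OF wt(1) [OF T(1)] rel(1) [OF T(1)]], assumption)
      (rule * [OF wt(2) [OF T(1)] rel(2) [OF T(1)]], assumption,
       rule * [OF wt(1) [OF T(2)] rel(1) [OF T(2)]], assumption,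
       rule * [OF wt(2) [OF T(2)] rel(2) [OF T(2)]], assumption)
qed

lemma Q_P: "Q s j n * P t i m =
    (\<Sum>k=0..min m n. heis_coeff c (s = t) (a i j) k *s (P t i (m - k) * Q s j (n - k)))"
proof -
  let ?w = "hop_wt (opQ c j s n \<odot> opP c i t m :: ('i, 'k) hop)"
  have "act S (opQ c j s n \<odot> opP c i t m) = act S (Hop ?w (\<lambda>lam. \<Sum>k=0..min m n.
      heis_coeff c (s = t) (a i j) k *\<^sub>q (opP c i t (m - k) \<odot> opQ c j s (n - k))\<one>\<^bsub>lam\<^esub>))"
  proof (rule act_eqI)
    fix lam
    show "(opQ c j s n \<odot> opP c i t m)\<one>\<^bsub>lam\<^esub> - (Hop ?w (\<lambda>lam. \<Sum>k=0..min m n.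
      heis_coeff c (s = t) (a i j) k *\<^sub>q (opP c i t (m - k) \<odot> opQ c j s (n - k))\<one>\<^bsub>lam\<^esub>))\<one>\<^bsub>lam\<^esub> \<in> S"
      by (rule in_S(3), unfold rel2_def homog.sel, blast)
  qed simp
  also have "\<dots> = (\<Sum>k=0..min m n. heis_coeff c (s = t) (a i j) k *s (P t i (m - k) * Q s j (n - k)))"
    unfolding act_sum act_smul P_def Q_def act_mult [symmetric]
  proof (intro sum.cong refl)
    fix k assume "k \<in> {0..min m n}"
    thus "heis_coeff c (s = t) (a i j) k *s
        act S (Hop ?w (\<lambda>lam. (opP c i t (m - k) \<odot> opQ c j s (n - k))\<one>\<^bsub>lam\<^esub>)) =
      heis_coeff c (s = t) (a i j) k *s act S (opP c i t (m - k) \<odot> opQ c j s (n - k))"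
      by (subst act_Hop) (auto simp: hop_wt_simps delta_wt_add of_nat_diff algebra_simps)
  qed
  finally show ?thesis by (simp add: act_mult Q_def P_def)
qed

lemma QbPb_unit: "e * Qb i n = Qb i n" "Qb i n * e = Qb i n" "e * Pb i n = Pb i n" "Pb i n * e = Pb i n"
proof -
  have "e * (Q s i m * x) = Q s i m * x" "e * (P s i m * x) = P s i m * x" for s m x
    by (simp_all add: mult.assoc [symmetric] unit_basic)
  thus "e * Qb i n = Qb i n" "Qb i n * e = Qb i n" "e * Pb i n = Pb i n" "Pb i n * e = Pb i n"
    unfolding Qb_eq Pb_eq by (simp_all add: sum_distrib_left sum_distrib_right mult.assoc unit_basic)
qed

lemma K_QbPb: "K i * Qb j n = Qb j n * K i" "K' i * Qb j n = Qb j n * K' i"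
  "K i * Pb j n = Pb j n * K i" "K' i * Pb j n = Pb j n * K' i"
proof -
  have *: "K i * (Q s j m * x) = Q s j m * (K i * x)" "K i * (P s j m * x) = P s j m * (K i * x)"
    "K' i * (Q s j m * x) = Q s j m * (K' i * x)" "K' i * (P s j m * x) = P s j m * (K' i * x)" for s m x
    by (simp_all add: mult.assoc [symmetric] K_PQ)
  show "K i * Qb j n = Qb j n * K i" "K' i * Qb j n = Qb j n * K' i"
    "K i * Pb j n = Pb j n * K i" "K' i * Pb j n = Pb j n * K' i"
    unfolding Qb_eq Pb_eq by (simp_all add: sum_distrib_left sum_distrib_right mult.assoc K_PQ *)
qed

lemma Q_pair: "series_pair wop_scale e (Q Row i) (Q Col i)"
  and P_pair: "series_pair wop_scale e (P Row i) (P Col i)"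
  by (unfold_locales; simp add: PQ_0 unit_basic PQ_inverse)+

lemma Qb_bracketed: "Qb i n = series_pair.bracketed wop_scale (Q Row i) (Q Col i) (\<lambda>m. q ^ m * qint (int m)) n"
  by (simp add: Qb_eq series_pair.bracketed_def [OF Q_pair])

lemma Pb_bracketed: "Pb i n = series_pair.bracketed wop_scale (P Row i) (P Col i) (\<lambda>m. inverse q ^ m * qint (int m)) n"
  by (simp add: Pb_eq series_pair.bracketed_def [OF P_pair])

lemma Qb_1: "Qb i 1 = (- q) *s Q Row i 1" and Pb_1: "Pb i 1 = (- inverse q) *s P Row i 1"
  by (simp_all add: Qb_eq Pb_eq PQ_0 unit_basic)

lemma act_commutator:
  assumes "hop_wt x + hop_wt y = w" "\<And>lam. (x \<odot> y)\<one>\<^bsub>lam\<^esub> - (y \<odot> x)\<one>\<^bsub>lam\<^esub> - f lam \<in> S"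
  shows "act S x * act S y - act S y * act S x = act S (Hop w f)"
proof -
  have "act S (Hop w (\<lambda>lam. (x \<odot> y)\<one>\<^bsub>lam\<^esub> - (y \<odot> x)\<one>\<^bsub>lam\<^esub>)) = act S (Hop w f)"
    by (rule act_eqI) (use assms(2) in simp_all)
  moreover have "act S (Hop w (\<lambda>lam. (x \<odot> y)\<one>\<^bsub>lam\<^esub>)) = act S x * act S y"
    "act S (Hop w (\<lambda>lam. (y \<odot> x)\<one>\<^bsub>lam\<^esub>)) = act S y * act S x"
    using assms(1) by (simp_all add: act_Hop hop_wt_simps add.commute act_mult)
  ultimately show ?thesis by (simp add: act_diff)
qed

lemma EF_rel:
  "E i m * F i n - F i n * E i m =
     inverse (q - inverse q) *s ((q ^ c) powi m *s \<psi> i (m + n) - (q ^ c) powi n *s \<phi> i (m + n))"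
proof -
  have qc: "(q ^ c) powi z = q powi (z * int c)" for z
    by (simp add: power_int_mult power_int_power mult.commute)
  have d: "q - inverse q \<noteq> 0" by (rule qq_diff_neq_0)
  let ?w = "delta_wt ((m + n) * int c)"
  define f :: "'i weight \<Rightarrow> ('i, 'k) free_alg" where "f lam = (if m + n > 0 then
           (qq powi (m * int c) * qq powi pair_simple lam i) *\<^sub>q (opQbr c i (nat (m + n)))\<one>\<^bsub>lam\<^esub>
         else if m + n < 0 then
           (qq powi (n * int c) * qq powi (- pair_simple lam i)) *\<^sub>q (opPbr c i (nat (- m - n)))\<one>\<^bsub>lam\<^esub>
         else qint (pair_simple lam i + m * int c) *\<^sub>q idem lam)" for lam
  have "E i m * F i n - F i n * E i m = act S (Hop ?w f)"
    unfolding E_def F_def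
  proof (rule act_commutator)
    show "hop_wt (opE adj c i m) + hop_wt (opF adj c i n) = ?w"
      by (simp add: hop_wt_simps delta_wt_add [symmetric] distrib_right)
    fix lam
    show "(opE adj c i m \<odot> opF adj c i n)\<one>\<^bsub>lam\<^esub> - (opF adj c i n \<odot> opE adj c i m)\<one>\<^bsub>lam\<^esub> - f lam \<in> S"
      by (rule in_S(4), unfold rel3_def f_def) blast
  qed
  also have "act S (Hop ?w f) = inverse (q - inverse q) *s ((q ^ c) powi m *s \<psi> i (m + n) - (q ^ c) powi n *s \<phi> i (m + n))"
  \<comment> \<open>In total mode 0 the two exponentials of the quantum integer give
    \<open>K i\<close> and \<open>K' i\<close>; in all other modes one of the two currents vanishes
    and (R3) has a single term.\<close>
  proof (cases "m + n = 0")
    case True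
    have "f lam = inverse (q - inverse q) *\<^sub>q (q powi (m * int c) *\<^sub>q q powi pair_simple lam i *\<^sub>q idem lam -
        q powi (n * int c) *\<^sub>q q powi (- pair_simple lam i) *\<^sub>q idem lam)" for lam
    proof -
      have n: "n = - m" using True by simp
      have "qint (pair_simple lam i + m * int c) = inverse (q - inverse q) *
          (q powi (m * int c) * q powi pair_simple lam i - q powi (n * int c) * q powi (- pair_simple lam i))"
        by (simp add: qint_def n power_int_add power_int_diff qq_nonzero power_int_minus divide_inverse mult.commute)
      thus ?thesis using True
        by (simp add: f_def smul_smul smul_diff_right [symmetric] free_alg.scale_left_diff_distrib [symmetric])
    qed
    hence "f = (\<lambda>lam. inverse (q - inverse q) *\<^sub>q (q powi (m * int c) *\<^sub>q q powi pair_simple lam i *\<^sub>q idem lam -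
        q powi (n * int c) *\<^sub>q q powi (- pair_simple lam i) *\<^sub>q idem lam))"
      by (rule ext)
    moreover have w: "?w = 0" using True by (simp add: delta_wt_0)
    ultimately have "act S (Hop ?w f) = inverse (q - inverse q) *s
        (q powi (m * int c) *s K i - q powi (n * int c) *s K' i)"
      unfolding w by (simp only: act_smul act_diff K_def K'_def wt_fun_def)
    thus ?thesis using True by (simp add: \<psi>_def \<phi>_def qc)
  next
    case False
    show ?thesis
    proof (cases "m + n > 0")
      case True
      let ?X = "opQbr c i (nat (m + n)) :: ('i, 'k) hop"
      have w: "?w = hop_wt ?X" using True by (simp add: opQbr_def)
      have f: "f = (\<lambda>lam. q powi (m * int c) *\<^sub>q q powi pair_simple lam i *\<^sub>q ?X\<one>\<^bsub>lam\<^esub>)"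
        using True by (auto simp: f_def smul_smul)
      have "act S (Hop (hop_wt ?X) (\<lambda>lam. q powi pair_simple lam i *\<^sub>q ?X\<one>\<^bsub>lam\<^esub>)) = Qb i (nat (m + n)) * K i"
        unfolding Qb_def K_def
        by (rule wt_fun_right [symmetric], rule weight_rels_unit) (use QbPb_unit in \<open>simp_all add: Qb_def\<close>)
      hence 1: "act S (Hop ?w f) = q powi (m * int c) *s (Qb i (nat (m + n)) * K i)"
        unfolding w f act_smul by simp
      have 2: "\<phi> i (m + n) = 0" "\<psi> i (m + n) = (q - inverse q) *s (Qb i (nat (m + n)) * K i)"
        using True by (simp_all add: \<psi>_def \<phi>_def)
      have 3: "inverse (q - inverse q) * (z * (q - inverse q)) = z" for z
        using d by (simp add: field_simps)
      show ?thesis unfolding 1 2 qc by (simp add: 3)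
    next
      case F: False
      with False have neg: "m + n < 0" by simp
      let ?X = "opPbr c i (nat (- m - n)) :: ('i, 'k) hop"
      have w: "?w = hop_wt ?X" using neg by (simp add: opPbr_def algebra_simps)
      have f: "f = (\<lambda>lam. q powi (n * int c) *\<^sub>q q powi (- pair_simple lam i) *\<^sub>q ?X\<one>\<^bsub>lam\<^esub>)"
        using neg by (auto simp: f_def smul_smul)
      have "act S (Hop (hop_wt ?X) (\<lambda>lam. q powi (- pair_simple lam i) *\<^sub>q ?X\<one>\<^bsub>lam\<^esub>)) = Pb i (nat (- m - n)) * K' i"
        unfolding Pb_def K'_def
        by (rule wt_fun_right [symmetric], rule weight_rels_unit) (use QbPb_unit in \<open>simp_all add: Pb_def\<close>)
      hence 1: "act S (Hop ?w f) = q powi (n * int c) *s (Pb i (nat (- m - n)) * K' i)"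
        unfolding w f act_smul by simp
      have 2: "\<psi> i (m + n) = 0" "\<phi> i (m + n) = (- (q - inverse q)) *s (Pb i (nat (- m - n)) * K' i)"
        using neg by (simp_all add: \<psi>_def \<phi>_def)
      have 3: "inverse (q - inverse q) * (z * (q - inverse q)) = z" for z
        using d by (simp add: field_simps)
      have 4: "inverse (q - inverse q) * (z * (inverse q - q)) = - z" for z
        using 3 [of "- z"] by (simp add: algebra_simps)
      show ?thesis unfolding 1 2 qc by (simp add: 4)
    qed
  qed
  finally show ?thesis .
qed

end

lemma heis_coeff_0: "heis_coeff c True b 0 = 1"
proof -
  have "{M. set_mset M \<subseteq> B \<and> size M = 0} = {{#}}" for B :: "(int \<times> nat) set" by auto
  moreover have "{T. T \<subseteq> B \<and> card T = 0} = {{}}" if "finite B" for B :: "(int \<times> nat) set"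
    using that by (auto dest: finite_subset)
  ultimately show ?thesis
    by (simp add: heis_coeff_def sym_gdim_def ext_gdim_def finite_graded_basis)
qed

context quantum_affine
begin

lemma \<psi>_pos: "n > 0 \<Longrightarrow> \<psi> i (int n) = (q - inverse q) *s (Qb i n * K i)"
  and \<phi>_neg: "n > 0 \<Longrightarrow> \<phi> i (- int n) = (- (q - inverse q)) *s (Pb i n * K' i)"
  by (simp_all add: \<psi>_def \<phi>_def)

lemma E_E_rel: "E i n * E i (n - 1) = q ^ 2 *s (E i (n - 1) * E i n)"
  and F_F_rel: "F i (n - 1) * F i n = q ^ 2 *s (F i n * F i (n - 1))"
proof -
  have "act S (opE adj c i n \<odot> opE adj c i (n - 1)) = act S (hop_scale (q ^ 2) (opE adj c i (n - 1) \<odot> opE adj c i n))"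
  proof (rule act_eqI)
    fix lam
    show "(opE adj c i n \<odot> opE adj c i (n - 1))\<one>\<^bsub>lam\<^esub> - (hop_scale (q ^ 2) (opE adj c i (n - 1) \<odot> opE adj c i n))\<one>\<^bsub>lam\<^esub> \<in> S"
      by (rule in_S(5), unfold rel4_def hop_scale_def homog.sel, blast)
  qed (simp add: hop_scale_def hop_wt_simps)
  thus "E i n * E i (n - 1) = q ^ 2 *s (E i (n - 1) * E i n)"
    by (simp only: act_mult act_scale E_def)
  have "act S (opF adj c i (n - 1) \<odot> opF adj c i n) = act S (hop_scale (q ^ 2) (opF adj c i n \<odot> opF adj c i (n - 1)))"
  proof (rule act_eqI)
    fix lam
    show "(opF adj c i (n - 1) \<odot> opF adj c i n)\<one>\<^bsub>lam\<^esub> - (hop_scale (q ^ 2) (opF adj c i n \<odot> opF adj c i (n - 1)))\<one>\<^bsub>lam\<^esub> \<in> S"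
      by (rule in_S(5), unfold rel4_def hop_scale_def homog.sel, blast)
  qed (simp add: hop_scale_def hop_wt_simps)
  thus "F i (n - 1) * F i n = q ^ 2 *s (F i n * F i (n - 1))"
    by (simp only: act_mult act_scale F_def)
qed

lemma act_vanish: "(\<And>lam. f lam \<in> S) \<Longrightarrow> act S (Hop w f) = 0"
  using act_eqI [of "Hop w f" "Hop w (\<lambda>_. 0)" S] by (simp add: act_zero)

lemma E_F_neq_rel: "i \<noteq> j \<Longrightarrow> E i m * F j n = F j n * E i m"
proof -
  assume ij: "i \<noteq> j"
  let ?w = "simple_root adj i + delta_wt (m * int c) + (- simple_root adj j + delta_wt (n * int c))"
  have "act S (Hop ?w (\<lambda>lam. (opE adj c i m \<odot> opF adj c j n)\<one>\<^bsub>lam\<^esub> - (opF adj c j n \<odot> opE adj c i m)\<one>\<^bsub>lam\<^esub>)) = 0"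
    by (rule act_vanish, rule in_S(4), unfold rel3_def) (use ij in blast)
  thus ?thesis
    by (simp only: act_diff) (simp add: act_Hop hop_wt_simps act_mult E_def F_def add_ac)
qed

lemma T_T_0_rel:
  assumes "a i j = 0"
  shows "E i m * E j n = E j n * E i m" "F i m * F j n = F j n * F i m"
proof -
  have *: "act S (T i m \<odot> T j n) = act S (T j n \<odot> T i m)" if T: "T \<in> {opE adj c, opF adj c}" for T
  proof (rule act_eqI)
    show "hop_wt (T i m \<odot> T j n) = hop_wt (T j n \<odot> T i m)" by (simp add: hop_wt_simps add.commute)
    fix lam
    show "(T i m \<odot> T j n)\<one>\<^bsub>lam\<^esub> - (T j n \<odot> T i m)\<one>\<^bsub>lam\<^esub> \<in> S"
      by (rule in_S(6), unfold rel5_def) (use T assms in blast)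
  qed
  show "E i m * E j n = E j n * E i m" "F i m * F j n = F j n * F i m"
    using * [of "opE adj c"] * [of "opF adj c"] by (simp_all add: act_mult E_def F_def)
qed

lemma E_E_adj_rel:
  assumes ij: "a i j = - 1"
  shows "E i 1 * E j 0 + E j 1 * E i 0 = inverse q *s (E j 0 * E i 1 + E i 0 * E j 1)"
    "F i (- 1) * F j 0 + F j (- 1) * F i 0 = inverse q *s (F j 0 * F i (- 1) + F i 0 * F j (- 1))"
proof -
  let ?w = "simple_root adj i + simple_root adj j + delta_wt (int c)"
  have "act S (Hop ?w (\<lambda>lam. (opE adj c i 1 \<odot> opE adj c j 0)\<one>\<^bsub>lam\<^esub> + (opE adj c j 1 \<odot> opE adj c i 0)\<one>\<^bsub>lam\<^esub> -
        inverse q *\<^sub>q ((opE adj c j 0 \<odot> opE adj c i 1)\<one>\<^bsub>lam\<^esub> + (opE adj c i 0 \<odot> opE adj c j 1)\<one>\<^bsub>lam\<^esub>))) = 0"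
    by (rule act_vanish, rule in_S(6), unfold rel5_def) (use ij in blast)
  thus "E i 1 * E j 0 + E j 1 * E i 0 = inverse q *s (E j 0 * E i 1 + E i 0 * E j 1)"
    by (simp only: act_diff act_add act_smul) (simp add: act_Hop hop_wt_simps delta_wt_0 act_mult E_def add_ac)
  let ?w = "- simple_root adj i - simple_root adj j - delta_wt (int c)"
  have "act S (Hop ?w (\<lambda>lam. (opF adj c i (- 1) \<odot> opF adj c j 0)\<one>\<^bsub>lam\<^esub> + (opF adj c j (- 1) \<odot> opF adj c i 0)\<one>\<^bsub>lam\<^esub> -
        inverse q *\<^sub>q ((opF adj c j 0 \<odot> opF adj c i (- 1))\<one>\<^bsub>lam\<^esub> + (opF adj c i 0 \<odot> opF adj c j (- 1))\<one>\<^bsub>lam\<^esub>))) = 0"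
    by (rule act_vanish, rule in_S(6), unfold rel5_def) (use ij in blast)
  thus "F i (- 1) * F j 0 + F j (- 1) * F i 0 = inverse q *s (F j 0 * F i (- 1) + F i 0 * F j (- 1))"
    by (simp only: act_diff act_add act_smul)
      (simp add: act_Hop hop_wt_simps delta_wt_0 delta_wt_minus [symmetric] act_mult F_def algebra_simps)
qed

lemma qint_2: "qint 2 = q + inverse q"
proof -
  have "(q - inverse q) * (q + inverse q) = q powi 2 - q powi (- 2)"
    by (simp add: power_int_minus algebra_simps power2_eq_square)
  thus ?thesis using qq_diff_neq_0 [where 'k = 'k] by (simp add: qint_def field_simps)
qed

lemma serre_rel:
  assumes ij: "a i j = - 1"
  shows "E j n * E i m * E i m + E i m * E i m * E j n = (q + inverse q) *s (E i m * E j n * E i m)"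
    "F j n * F i m * F i m + F i m * F i m * F j n = (q + inverse q) *s (F i m * F j n * F i m)"
proof -
  let ?w = "simple_root adj i + delta_wt (m * int c) + (simple_root adj i + delta_wt (m * int c)) +
      (simple_root adj j + delta_wt (n * int c))"
  have "act S (Hop ?w (\<lambda>lam. (opE adj c j n \<odot> opE adj c i m \<odot> opE adj c i m)\<one>\<^bsub>lam\<^esub> +
      (opE adj c i m \<odot> opE adj c i m \<odot> opE adj c j n)\<one>\<^bsub>lam\<^esub> -
      qint 2 *\<^sub>q (opE adj c i m \<odot> opE adj c j n \<odot> opE adj c i m)\<one>\<^bsub>lam\<^esub>)) = 0"
    by (rule act_vanish, rule in_S(7), unfold rel6_def) (use ij in blast)
  thus "E j n * E i m * E i m + E i m * E i m * E j n = (q + inverse q) *s (E i m * E j n * E i m)"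
    unfolding act_diff act_add act_smul qint_2
    by (subst (asm) (1 2 3) act_Hop) (simp_all add: hop_wt_simps act_mult E_def add_ac mult.assoc)
  let ?w = "- simple_root adj i + delta_wt (m * int c) + (- simple_root adj i + delta_wt (m * int c)) +
      (- simple_root adj j + delta_wt (n * int c))"
  have "act S (Hop ?w (\<lambda>lam. (opF adj c j n \<odot> opF adj c i m \<odot> opF adj c i m)\<one>\<^bsub>lam\<^esub> +
      (opF adj c i m \<odot> opF adj c i m \<odot> opF adj c j n)\<one>\<^bsub>lam\<^esub> -
      qint 2 *\<^sub>q (opF adj c i m \<odot> opF adj c j n \<odot> opF adj c i m)\<one>\<^bsub>lam\<^esub>)) = 0"
    by (rule act_vanish, rule in_S(7), unfold rel6_def) (use ij in blast)
  thus "F j n * F i m * F i m + F i m * F i m * F j n = (q + inverse q) *s (F i m * F j n * F i m)"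
    unfolding act_diff act_add act_smul qint_2
    by (subst (asm) (1 2 3) act_Hop) (simp_all add: hop_wt_simps act_mult F_def add_ac mult.assoc)
qed

text \<open>(R2) in degrees 1 and 1: the term k = 0 is P_1 Q_1 and the term k = 1 is a multiple of
  \<open>e\<close>. The factors K cancel against their inverses.\<close>

lemma heis_rel: "\<exists>x. comm_br (\<psi> i 1 * \<phi> i 0) (\<phi> j (- 1) * \<psi> j 0) = x *s e"
proof -
  have "\<psi> i 1 * \<phi> i 0 = ((q - inverse q) * (- q)) *s Q Row i 1"
    using \<psi>_pos [of 1 i] by (simp add: Qb_1 [simplified] \<phi>_def mult.assoc K_K' unit_basic)
  moreover have "\<phi> j (- 1) * \<psi> j 0 = (- (q - inverse q) * (- inverse q)) *s P Row j 1"
    using \<phi>_neg [of 1 j] by (simp add: Pb_1 [simplified] \<psi>_def mult.assoc K_K' unit_basic)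
  moreover have "comm_br (Q Row i 1) (P Row j 1) = heis_coeff c True (a j i) 1 *s e"
  proof -
    have "heis_coeff c True (a j i) 0 = (1 :: 'k poly fract)"
      by (rule heis_coeff_0)
    thus ?thesis using Q_P [of Row i 1 Row j 1] by (simp add: comm_br_def PQ_0 e_e)
  qed
  ultimately show ?thesis
    by (simp only: wop.comm_br_scl wop.scl_scl) (rule exI, rule refl)
qed


lemma \<psi>\<phi>_unit: "e * \<psi> i n = \<psi> i n" "\<psi> i n * e = \<psi> i n" "e * \<phi> i n = \<phi> i n" "\<phi> i n * e = \<phi> i n"
proof -
  have "e * (Qb i m * x) = Qb i m * x" "e * (Pb i m * x) = Pb i m * x" for m x
    by (simp_all add: mult.assoc [symmetric] QbPb_unit)
  thus "e * \<psi> i n = \<psi> i n" "\<psi> i n * e = \<psi> i n" "e * \<phi> i n = \<phi> i n" "\<phi> i n * e = \<phi> i n"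
    by (simp_all add: \<psi>_def \<phi>_def e_K mult.assoc)
qed

lemma K_\<psi>\<phi>: "K i * \<psi> j n = \<psi> j n * K i" "K i * \<phi> j n = \<phi> j n * K i"
  "K' i * \<psi> j n = \<psi> j n * K' i" "K' i * \<phi> j n = \<phi> j n * K' i"
proof -
  have *: "K i * (Qb j m * x) = Qb j m * (K i * x)" "K i * (Pb j m * x) = Pb j m * (K i * x)"
    "K' i * (Qb j m * x) = Qb j m * (K' i * x)" "K' i * (Pb j m * x) = Pb j m * (K' i * x)" for m x
    by (simp_all add: mult.assoc [symmetric] K_QbPb)
  show "K i * \<psi> j n = \<psi> j n * K i" "K i * \<phi> j n = \<phi> j n * K i"
    "K' i * \<psi> j n = \<psi> j n * K' i" "K' i * \<phi> j n = \<phi> j n * K' i"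
    by (simp_all add: \<psi>_def \<phi>_def mult.assoc * K_comm [of i j] K_comm(3) [of i j] K_comm(2) [of j i])
qed

lemma a_sym: "a i j = a j i"
  by (rule cartan_sym) (rule finite_type)

lemma q_nroot: "n > 0 \<Longrightarrow> q ^ n \<noteq> 1"
  using qhalf_power_neq_1 [of "2 * n", where 'k = 'k] by (simp add: qq_def power_mult)

sublocale L: loop_relations wop_scale q "q ^ c" a e E F \<psi> \<phi>
proof (intro loop_relations.intro loop_relations_axioms.intro wop.scalar_algebra_axioms)
  show "q \<noteq> 0" "q ^ c \<noteq> 0" by (simp_all add: qq_nonzero)
  show "q ^ n \<noteq> 1" if "n > 0" for n :: nat using that by (rule q_nroot)
  show "a i i = 2" for i by (simp add: cartan_def)
  show "i \<noteq> j \<Longrightarrow> a i j = 0 \<or> a i j = - 1" for i j by (simp add: cartan_def)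
  show "a i j = a j i" for i j by (rule a_sym)
  show "\<psi> i n = 0" if "n < 0" for i n using that by (simp add: \<psi>_def)
  show "\<phi> i n = 0" if "n > 0" for i n using that by (simp add: \<phi>_def)
  show "\<psi> i 0 * \<phi> i 0 = e" "\<phi> i 0 * \<psi> i 0 = e" for i by (simp_all add: \<psi>_def \<phi>_def K_K')
  show "\<psi> i 0 * E j n = q powi a i j *s (E j n * \<psi> i 0)" for i j n
    using K_act(1) [OF weight_rels_basic(1), of i j n] a_sym [of i j]
    by (simp add: \<psi>_def E_def hop_wt_simps pair_simple_add pair_simple_basic)
  show "\<psi> i 0 * F j n = q powi - a i j *s (F j n * \<psi> i 0)" for i j n
    using K_act(1) [OF weight_rels_basic(2), of i j n] a_sym [of i j]
    by (simp add: \<psi>_def F_def hop_wt_simps pair_simple_add pair_simple_basic)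
  show "\<psi> i 0 * \<psi> j n = \<psi> j n * \<psi> i 0" "\<psi> i 0 * \<phi> j n = \<phi> j n * \<psi> i 0" for i j n
    using K_\<psi>\<phi> [of i j n] by (simp_all add: \<psi>_def [of i 0])
qed (fact unit_basic \<psi>\<phi>_unit EF_rel E_F_neq_rel E_E_rel F_F_rel E_E_adj_rel T_T_0_rel serre_rel heis_rel)+

section \<open>Commutativity of the P's and of the Q's\<close>

lemma hop_prod_act:
  "xs \<noteq> [] \<Longrightarrow> act S (hop_prod xs) = prod_list (map (act S) xs)"
  "hop_wt (hop_prod xs) = sum_list (map hop_wt xs)"
  by (induction xs rule: hop_prod.induct) (simp_all add: act_mult hop_wt_simps)

text \<open>The empty composition gives the family of all idempotents, so degree 0 yields
  \<open>e\<close> instead of the 1 of \<open>pexp\<close>.\<close>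

lemma act_exp_coeff:
  assumes wt: "\<And>m. hop_wt (X m) = delta_wt (z * int m)"
  shows "act S (Hop (delta_wt (z * int n)) (\<lambda>lam. exp_coeff X n lam)) =
    (if n = 0 then e else wop.pexp (\<lambda>m. act S (X m)) n)"
proof (cases "n = 0")
  case True
  thus ?thesis by (simp add: exp_coeff_0 delta_wt_0 e_def)
next
  case False
  have w: "hop_wt (hop_prod (map X \<nu>)) = delta_wt (z * int (sum_list \<nu>))" for \<nu>
    by (induction \<nu>) (simp_all add: hop_prod_act(2) wt delta_wt_0 delta_wt_add distrib_left)
  have "act S (Hop (delta_wt (z * int n)) (\<lambda>lam. (hop_prod (map X \<nu>))\<one>\<^bsub>lam\<^esub>)) = prod_list (map (\<lambda>m. act S (X m)) \<nu>)"
    if \<nu>: "\<nu> \<in> compositions k n" for k \<nu>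
  proof -
    have "map X \<nu> \<noteq> []" "sum_list \<nu> = n" using \<nu> False by (auto simp: compositions_def)
    thus ?thesis using w [of \<nu>] by (simp add: act_Hop hop_prod_act(1) comp_def)
  qed
  hence "(\<Sum>\<nu>\<in>compositions k n. act S (Hop (delta_wt (z * int n)) (\<lambda>lam. (hop_prod (map X \<nu>))\<one>\<^bsub>lam\<^esub>))) =
      (\<Sum>\<nu>\<in>compositions k n. prod_list (map (\<lambda>m. act S (X m)) \<nu>))" for k
    by (intro sum.cong refl)
  thus ?thesis using False
    by (simp only: exp_coeff_def act_sum act_smul wop.pexp_def if_False)
qed

text \<open>The commutativity of the current modes, with the invertible factors K and K' removed. In
  degree 0 the bracketed elements are zero because [0] = 0.\<close>

lemma QbPb_comm: "Qb i m * Qb j n = Qb j n * Qb i m" "Pb i m * Pb j n = Pb j n * Pb i m"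
proof -
  have d: "q - inverse q \<noteq> 0" by (rule qq_diff_neq_0)
  have Qb: "Qb i n = inverse (q - inverse q) *s (\<psi> i (int n) * K' i)" if "n > 0" for i n
    unfolding \<psi>_pos [OF that] using d by (simp add: mult.assoc K_K' QbPb_unit)
  have Pb: "Pb i n = (- inverse (q - inverse q)) *s (\<phi> i (- int n) * K i)" if "n > 0" for i n
    unfolding \<phi>_neg [OF that]
    by (simp only: wop.scl_mult_left wop.scl_scl minus_mult_minus left_inverse [OF d] wop.scl_one mult.assoc K_K' QbPb_unit)
  have 0: "Qb i 0 = 0" "Pb i 0 = 0" for i by (simp_all add: Qb_eq Pb_eq)
  have comm: "(x * k) * (y * l) = (y * l) * (x * k)"
    if "x * y = y * x" "k * y = y * k" "l * x = x * l" "k * l = l * k" for x y k l :: "('i, 'k) wop"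
  proof -
    have "(x * k) * (y * l) = x * (k * y) * l" by (simp add: mult.assoc)
    also have "\<dots> = x * y * (k * l)" unfolding that(2) by (simp add: mult.assoc)
    also have "\<dots> = y * (x * l) * k" unfolding that(1,4) by (simp add: mult.assoc)
    also have "\<dots> = (y * l) * (x * k)" unfolding that(3) [symmetric] by (simp add: mult.assoc)
    finally show ?thesis .
  qed
  have "(\<psi> i m * K' i) * (\<psi> j n * K' j) = (\<psi> j n * K' j) * (\<psi> i m * K' i)" for i j m n
    by (rule comm) (fact L.\<psi>_comm K_\<psi>\<phi> K_comm)+
  thus "Qb i m * Qb j n = Qb j n * Qb i m"
    by (cases "m = 0"; cases "n = 0") (simp_all add: 0 Qb mult.commute)
  have "(\<phi> i m * K i) * (\<phi> j n * K j) = (\<phi> j n * K j) * (\<phi> i m * K i)" for i j m n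
    by (rule comm) (fact L.\<phi>_comm K_\<psi>\<phi> K_comm)+
  thus "Pb i m * Pb j n = Pb j n * Pb i m"
    by (cases "m = 0"; cases "n = 0") (simp_all add: 0 Pb mult.commute)
qed

lemma centralizer_closed:
  fixes y :: "('i, 'k) wop"
  shows "x * y = y * x \<Longrightarrow> x' * y = y * x' \<Longrightarrow> (x + x') * y = y * (x + x')"
    "x * y = y * x \<Longrightarrow> x' * y = y * x' \<Longrightarrow> (x * x') * y = y * (x * x')"
    "x * y = y * x \<Longrightarrow> (b *s x) * y = y * (b *s x)"
proof -
  show "(x * x') * y = y * (x * x')" if "x * y = y * x" "x' * y = y * x'"
  proof -
    have "(x * x') * y = x * (y * x')" using that(2) by (simp add: mult.assoc)
    thus ?thesis using that(1) by (simp add: mult.assoc [symmetric])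
  qed
qed (simp_all add: distrib_left distrib_right)

lemma qint_coeff_neq_0: "n > 0 \<Longrightarrow> q ^ n * qint (int n) \<noteq> 0" "n > 0 \<Longrightarrow> inverse q ^ n * qint (int n) \<noteq> 0"
  by (simp_all add: qq_nonzero qint_nonzero)

text \<open>\<open>Q_closed\<close> applied to the centralizer of y: the Q's lie in the algebra
  generated by \<open>e\<close> and the bracketed Q's.\<close>

lemma Q_centralizer:
  assumes "\<And>n. n > 0 \<Longrightarrow> Qb i n * y = y * Qb i n" "e * y = y * e"
  shows "Q Row i n * y = y * Q Row i n"
  by (rule series_pair.Q_closed [OF Q_pair, where S = "\<lambda>x. x * y = y * x" and c = "\<lambda>m. q ^ m * qint (int m)"])
    (use assms centralizer_closed qint_coeff_neq_0 in \<open>simp_all add: Qb_bracketed\<close>)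

lemma P_centralizer:
  assumes "\<And>n. n > 0 \<Longrightarrow> Pb i n * y = y * Pb i n" "e * y = y * e"
  shows "P Row i n * y = y * P Row i n"
  by (rule series_pair.Q_closed [OF P_pair, where S = "\<lambda>x. x * y = y * x" and c = "\<lambda>m. inverse q ^ m * qint (int m)"])
    (use assms centralizer_closed qint_coeff_neq_0 in \<open>simp_all add: Pb_bracketed\<close>)

lemma Q_comm: "Q Row i m * Q Row j n = Q Row j n * Q Row i m"
proof (rule Q_centralizer)
  \<comment> \<open>The centralizer argument is applied once to each of the two factors.\<close>
  show "Qb i m * Q Row j n = Q Row j n * Qb i m" for m
    by (rule Q_centralizer [symmetric]) (simp_all add: QbPb_comm(1) [of j _ i m] QbPb_unit)
qed (simp add: unit_basic)

lemma P_comm: "P Row i m * P Row j n = P Row j n * P Row i m"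
proof (rule P_centralizer)
  show "Pb i m * P Row j n = P Row j n * Pb i m" for m
    by (rule P_centralizer [symmetric]) (simp_all add: QbPb_comm(2) [of j _ i m] QbPb_unit)
qed (simp add: unit_basic)

end

section \<open>The Cartan currents\<close>

locale drinfeld_generators = quantum_affine adj c S
  for adj :: "'i::finite \<Rightarrow> 'i \<Rightarrow> bool" and c and S :: "('i, 'k::field_char_0) free_alg set" +
  fixes h :: "('i, 'k) hfam"
  assumes h: "is_drinfeld_h adj c h"
begin

definition hh :: "'i \<Rightarrow> int \<Rightarrow> ('i, 'k) wop" where "hh i m = act S (oph c h i m)"

lemma eq_A_iff: "eq_A adj c x y \<longleftrightarrow> x - y \<in> two_sided_ideal S"
  by (simp add: eq_A_def S)

lemma Q_exp: "n > 0 \<Longrightarrow> Q Row i n = wop.pexp (\<lambda>m. inverse (qint (int m)) *s hh i (int m)) n"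
  and P_exp: "n > 0 \<Longrightarrow> P Row i n = wop.pexp (\<lambda>m. inverse (qint (int m)) *s hh i (- int m)) n"
proof -
  assume n: "n > 0"
  let ?X = "\<lambda>m. hop_scale (inverse (qint (int m))) (oph c h i (int m))"
  let ?Y = "\<lambda>m. hop_scale (inverse (qint (int m))) (oph c h i (- int m))"
  have "act S (opQ c i Row n) = act S (Hop (delta_wt (int c * int n)) (\<lambda>lam. exp_coeff ?X n lam))"
    using h by (subst act_eq_iff) (auto simp: is_drinfeld_h_def eq_A_iff hop_wt_simps mult.commute)
  also have "\<dots> = wop.pexp (\<lambda>m. act S (?X m)) n"
    using n act_exp_coeff [of ?X "int c" n] by (simp add: hop_scale_def oph_def mult.commute)
  finally show "Q Row i n = wop.pexp (\<lambda>m. inverse (qint (int m)) *s hh i (int m)) n"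
    by (simp add: Q_def act_scale hh_def)
  have "act S (opP c i Row n) = act S (Hop (delta_wt (- int c * int n)) (\<lambda>lam. exp_coeff ?Y n lam))"
    using h by (subst act_eq_iff) (auto simp: is_drinfeld_h_def eq_A_iff hop_wt_simps mult.commute)
  also have "\<dots> = wop.pexp (\<lambda>m. act S (?Y m)) n"
    using n act_exp_coeff [of ?Y "- int c" n] by (simp add: hop_scale_def oph_def mult.commute)
  finally show "P Row i n = wop.pexp (\<lambda>m. inverse (qint (int m)) *s hh i (- int m)) n"
    by (simp add: P_def act_scale hh_def)
qed

text \<open>The transfer of properties from the Q's and P's to the h's, used for the corner of
  \<open>e\<close> and for centralizers.\<close>

lemma hh_closed:
  assumes "\<And>x y. T x \<Longrightarrow> T y \<Longrightarrow> T (x + y)" "\<And>x y. T x \<Longrightarrow> T y \<Longrightarrow> T (x * y)"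
    "\<And>b x. T x \<Longrightarrow> T (b *s x)"
  shows "(\<And>n. n > 0 \<Longrightarrow> T (Q Row i n)) \<Longrightarrow> m > 0 \<Longrightarrow> T (hh i (int m))"
    "(\<And>n. n > 0 \<Longrightarrow> T (P Row i n)) \<Longrightarrow> m > 0 \<Longrightarrow> T (hh i (- int m))"
proof -
  have s: "inverse (qint (int n)) \<noteq> (0 :: 'k poly fract)" if "n > 0" for n
    using that by (simp add: qint_nonzero)
  show "T (hh i (int m))" if "\<And>n. n > 0 \<Longrightarrow> T (Q Row i n)" "m > 0"
    by (rule wop.pexp_log_closed [where S = T and s = "\<lambda>m. inverse (qint (int m))" and h = "\<lambda>m. hh i (int m)"])
      (use assms s that Q_exp in auto)
  show "T (hh i (- int m))" if "\<And>n. n > 0 \<Longrightarrow> T (P Row i n)" "m > 0"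
    by (rule wop.pexp_log_closed [where S = T and s = "\<lambda>m. inverse (qint (int m))" and h = "\<lambda>m. hh i (- int m)"])
      (use assms s that P_exp in auto)
qed

text \<open>The equations defining the h's say nothing about idempotents on either side of them;
  this is inherited from Q and P. They do not constrain \<open>h i 0\<close>, hence the assumption
  on r.\<close>

lemma e_hh:
  assumes "r \<noteq> 0" shows "e * hh i r = hh i r" "hh i r * e = hh i r"
proof -
  let ?T = "\<lambda>x. e * x = x \<and> x * e = x"
  have T: "?T x \<Longrightarrow> ?T y \<Longrightarrow> ?T (x + y)" "?T x \<Longrightarrow> ?T y \<Longrightarrow> ?T (x * y)" "?T x \<Longrightarrow> ?T (b *s x)" for x y b
    by (simp_all add: distrib_left distrib_right mult.assoc) (simp add: mult.assoc [symmetric])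
  have "?T (hh i r)"
  proof (cases "r > 0")
    case True
    have "?T (hh i (int (nat r)))"
      by (rule hh_closed(1) [where T = ?T]) (use T unit_basic True in auto)
    thus ?thesis using True by simp
  next
    case False
    have "?T (hh i (- int (nat (- r))))"
      by (rule hh_closed(2) [where T = ?T]) (use T unit_basic False assms in auto)
    thus ?thesis using False by simp
  qed
  thus "e * hh i r = hh i r" "hh i r * e = hh i r" by blast+
qed

lemma hh_comm:
  assumes "m > 0" "n > 0"
  shows "hh i (int m) * hh j (int n) = hh j (int n) * hh i (int m)"
    "hh i (- int m) * hh j (- int n) = hh j (- int n) * hh i (- int m)"
proof -
  have 1: "hh i (int m) * Q Row j k = Q Row j k * hh i (int m)" for i j k
    by (rule hh_closed(1) [where T = "\<lambda>x. x * Q Row j k = Q Row j k * x"])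
      (use centralizer_closed Q_comm assms in auto)
  show "hh i (int m) * hh j (int n) = hh j (int n) * hh i (int m)"
    by (rule hh_closed(1) [where T = "\<lambda>x. hh i (int m) * x = x * hh i (int m)"])
      (use centralizer_closed [symmetric] 1 assms in auto)
  have 2: "hh i (- int m) * P Row j k = P Row j k * hh i (- int m)" for i j k
    by (rule hh_closed(2) [where T = "\<lambda>x. x * P Row j k = P Row j k * x"])
      (use centralizer_closed P_comm assms in auto)
  show "hh i (- int m) * hh j (- int n) = hh j (- int n) * hh i (- int m)"
    by (rule hh_closed(2) [where T = "\<lambda>x. hh i (- int m) * x = x * hh i (- int m)"])
      (use centralizer_closed [symmetric] 2 assms in auto)
qed

section \<open>The exponentials of the h's\<close>

definition U :: "'i \<Rightarrow> nat \<Rightarrow> ('i, 'k) wop" where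
  "U i n = e * wop.pexp (\<lambda>m. (q - inverse q) *s (if m = 0 then 0 else hh i (int m))) n"
text \<open>\<open>U\<close> and \<open>U'\<close> are the coefficients of the currents \<psi>^+ and
  \<psi>^- without their weight factors. Compositions have positive parts only; the value 0 at m = 0
  makes the argument commute with itself for all indices although \<open>h i 0\<close> is arbitrary.
  The factor \<open>e\<close> corrects degree 0.\<close>

definition U' :: "'i \<Rightarrow> nat \<Rightarrow> ('i, 'k) wop" where
  "U' i n = e * wop.pexp (\<lambda>m. (- (q - inverse q)) *s (if m = 0 then 0 else hh i (- int m))) n"

lemma pexp_cong: "(\<And>m. m > 0 \<Longrightarrow> X m = Y m) \<Longrightarrow> wop.pexp X n = wop.pexp Y n"
proof -
  assume XY: "\<And>m. m > 0 \<Longrightarrow> X m = Y m"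
  have eq: "map X \<nu> = map Y \<nu>" if "\<nu> \<in> compositions k n" for \<nu> k
    using that XY by (auto simp: compositions_def intro!: map_cong) (metis gr0I)
  have "(\<Sum>\<nu>\<in>compositions k n. prod_list (map X \<nu>)) = (\<Sum>\<nu>\<in>compositions k n. prod_list (map Y \<nu>))" for k
    by (rule sum.cong) (simp_all only: eq)
  thus ?thesis by (simp only: wop.pexp_def)
qed

lemma qint_identities:
  assumes "m > 0"
  shows "(q - inverse q) * q ^ m + inverse (qint (int m)) = q ^ (2 * m) * inverse (qint (int m))"
    "- (q - inverse q) * inverse q ^ m + inverse (qint (int m)) = inverse q ^ (2 * m) * inverse (qint (int m))"
proof -
  let ?n = "qint (int m) :: 'k poly fract"
  have n: "?n \<noteq> 0" using assms by (rule qint_nonzero)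
  have qn: "q ^ m \<noteq> 0" by (simp add: qq_nonzero)
  have "(q - inverse q) * ?n = q ^ m - inverse (q ^ m)"
    using qq_diff_neq_0 [where 'k = 'k] by (simp add: qint_def power_int_minus)
  hence "(q - inverse q) * ?n * q ^ m = q ^ (2 * m) - 1"
    "(q - inverse q) * ?n * inverse q ^ m = 1 - inverse q ^ (2 * m)"
    using qn by (simp_all add: left_diff_distrib power_mult power2_eq_square power_inverse mult_2 power_add)
  note id = this
  have *: "d * x + inverse ?n = y * inverse ?n" if "d * ?n * x = y - 1" for d x y
  proof -
    have "y = d * ?n * x + 1" using that by simp
    thus ?thesis using n by (simp add: distrib_right)
  qed
  show "(q - inverse q) * q ^ m + inverse ?n = q ^ (2 * m) * inverse ?n"
    by (rule *) (rule id)
  show "- (q - inverse q) * inverse q ^ m + inverse ?n = inverse q ^ (2 * m) * inverse ?n"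
    by (rule *, simp only: mult_minus_left id) (rule minus_diff_eq)
qed

lemma qint_kappa:
  "(q - inverse q) * (q ^ m * qint (int m)) = q ^ (2 * m) - 1"
  "- (q - inverse q) * (inverse q ^ m * qint (int m)) = inverse q ^ (2 * m) - 1"
proof -
  have qn: "q ^ m \<noteq> 0" by (simp add: qq_nonzero)
  have 1: "(q - inverse q) * qint (int m) = q ^ m - inverse (q ^ m)"
    using qq_diff_neq_0 [where 'k = 'k] by (simp add: qint_def power_int_minus)
  have "(q - inverse q) * (q ^ m * qint (int m)) = q ^ m * ((q - inverse q) * qint (int m))"
    "- (q - inverse q) * (inverse q ^ m * qint (int m)) = - (inverse q ^ m * ((q - inverse q) * qint (int m)))"
    by (simp_all add: algebra_simps)
  thus "(q - inverse q) * (q ^ m * qint (int m)) = q ^ (2 * m) - 1"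
    "- (q - inverse q) * (inverse q ^ m * qint (int m)) = inverse q ^ (2 * m) - 1"
    unfolding 1 using qn by (simp_all add: right_diff_distrib power_mult power2_eq_square power_inverse mult_2 power_add)
qed

definition hp :: "'i \<Rightarrow> nat \<Rightarrow> ('i, 'k) wop" where "hp i m = (if m = 0 then 0 else hh i (int m))"
definition hm :: "'i \<Rightarrow> nat \<Rightarrow> ('i, 'k) wop" where "hm i m = (if m = 0 then 0 else hh i (- int m))"

lemma hphm_comm: "hp i m * hp i n = hp i n * hp i m" "hm i m * hm i n = hm i n * hm i m"
  using hh_comm [of m n i i] by (auto simp: hp_def hm_def)

lemma Q_exp': "n > 0 \<Longrightarrow> Q Row i n = wop.pexp (\<lambda>m. inverse (qint (int m)) *s hp i m) n"
  and P_exp': "n > 0 \<Longrightarrow> P Row i n = wop.pexp (\<lambda>m. inverse (qint (int m)) *s hm i m) n"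
  unfolding Q_exp P_exp by (rule pexp_cong, simp add: hp_def hm_def)+

lemma U_bracketed: "n > 0 \<Longrightarrow> q ^ n *s U i n = ((- 1) ^ n * (q - inverse q)) *s Qb i n"
  unfolding U_def Qb_bracketed hp_def [symmetric]
  by (rule series_pair.exp_bracketed [OF Q_pair, where s = "\<lambda>m. inverse (qint (int m))"])
    (use hphm_comm Q_exp' qint_identities qint_kappa in auto)

lemma U'_bracketed: "n > 0 \<Longrightarrow> inverse q ^ n *s U' i n = ((- 1) ^ n * (- (q - inverse q))) *s Pb i n"
  unfolding U'_def Pb_bracketed hm_def [symmetric]
  by (rule series_pair.exp_bracketed [OF P_pair, where s = "\<lambda>m. inverse (qint (int m))"])
    (use hphm_comm P_exp' qint_identities qint_kappa in auto)

lemma U_series: "Abs_fps (\<lambda>n. q ^ n *s U i n) =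
    series_pair.RS wop_scale (Q Col i) * Abs_fps (\<lambda>n. q ^ (2 * n) *s Q Row i n)"
  unfolding U_def hp_def [symmetric]
  by (rule series_pair.exp_series [OF Q_pair, where s = "\<lambda>m. inverse (qint (int m))"
        and c = "\<lambda>m. q ^ m * qint (int m)" and \<kappa> = "q - inverse q"])
    (use hphm_comm Q_exp' qint_identities qint_kappa in auto)

lemma U'_series: "Abs_fps (\<lambda>n. inverse q ^ n *s U' i n) =
    series_pair.RS wop_scale (P Col i) * Abs_fps (\<lambda>n. inverse q ^ (2 * n) *s P Row i n)"
  unfolding U'_def hm_def [symmetric]
  by (rule series_pair.exp_series [OF P_pair, where s = "\<lambda>m. inverse (qint (int m))"
        and c = "\<lambda>m. inverse q ^ m * qint (int m)" and \<kappa> = "- (q - inverse q)"])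
    (use hphm_comm P_exp' qint_identities qint_kappa in auto)

lemma U_0: "U i 0 = e" "U' i 0 = e"
  by (simp_all add: U_def U'_def wop.pexp_0)

text \<open>The modes in (R3) and those of Drinfeld's currents differ by powers of - q: the power of
  q is the rescaling of z in \<open>exp_product\<close>, and the sign is that of
  \<open>exp_bracketed\<close>.\<close>

lemma \<psi>_U: "U i n * K i = ((- q) powi (- int n)) *s \<psi> i (int n)"
  and \<phi>_U: "U' i n * K' i = ((- q) powi int n) *s \<phi> i (- int n)"
proof -
  have qn: "q ^ n \<noteq> 0" "inverse q ^ n \<noteq> 0" by (simp_all add: qq_nonzero)
  show "U i n * K i = ((- q) powi (- int n)) *s \<psi> i (int n)"
  proof (cases "n = 0")
    case False
    have "q ^ n *s (U i n * K i) = ((- 1) ^ n * (q - inverse q)) *s (Qb i n * K i)"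
      using U_bracketed [of n i] False by (metis wop.scl_mult_left gr0I)
    also have "\<dots> = (- 1) ^ n *s \<psi> i (int n)"
      using \<psi>_pos [of n i] False by simp
    also have "(- 1) ^ n = q ^ n * ((- q) powi (- int n))"
      using qn by (cases "even n") (simp_all add: power_int_minus)
    finally have "q ^ n *s (U i n * K i) = q ^ n *s ((- q) powi (- int n)) *s \<psi> i (int n)"
      by (simp only: wop.scl_scl)
    thus ?thesis using qn(1) by (rule wop.scl_eqD)
  qed (simp add: U_0 \<psi>_def e_K)
  show "U' i n * K' i = ((- q) powi int n) *s \<phi> i (- int n)"
  proof (cases "n = 0")
    case False
    have "inverse q ^ n *s (U' i n * K' i) = ((- 1) ^ n * (- (q - inverse q))) *s (Pb i n * K' i)"
      using U'_bracketed [of n i] False by (metis wop.scl_mult_left gr0I)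
    also have "\<dots> = (- 1) ^ n *s (- (q - inverse q)) *s (Pb i n * K' i)"
      by (simp only: wop.scl_scl)
    also have "\<dots> = (- 1) ^ n *s \<phi> i (- int n)"
      using \<phi>_neg [of n i] False by (simp only: gr0I)
    also have "(- 1) ^ n = inverse q ^ n * ((- q) powi int n)"
      using qn by (cases "even n") (simp_all add: power_inverse)
    finally have "inverse q ^ n *s (U' i n * K' i) = inverse q ^ n *s ((- q) powi int n) *s \<phi> i (- int n)"
      by (simp only: wop.scl_scl)
    thus ?thesis using qn(2) by (rule wop.scl_eqD)
  qed (simp add: U_0 \<phi>_def e_K)
qed

lemma act_exp_coeff_h:
  assumes s: "s = 1 \<or> s = - 1"
  shows "act S (Hop (delta_wt (s * int c * int n)) (\<lambda>lam. exp_coeff (\<lambda>m. hop_scale b (oph c h i (s * int m))) n lam)) =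
     e * wop.pexp (\<lambda>m. b *s (if m = 0 then 0 else hh i (s * int m))) n"
proof -
  let ?X = "\<lambda>m. hop_scale b (oph c h i (s * int m))"
  have 1: "act S (Hop (delta_wt (s * int c * int n)) (\<lambda>lam. exp_coeff ?X n lam)) =
     (if n = 0 then e else wop.pexp (\<lambda>m. act S (?X m)) n)"
    by (rule act_exp_coeff) (simp add: hop_scale_def oph_def mult_ac)
  show ?thesis
  proof (cases "n = 0")
    case True
    thus ?thesis using 1 by (simp add: wop.pexp_0)
  next
    case False
    have 2: "wop.pexp (\<lambda>m. act S (?X m)) n = wop.pexp (\<lambda>m. b *s (if m = 0 then 0 else hh i (s * int m))) n"
      by (rule pexp_cong) (simp add: act_scale hh_def)
    have "e * prod_list (map (\<lambda>m. b *s (if m = 0 then 0 else hh i (s * int m))) \<nu>) =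
        prod_list (map (\<lambda>m. b *s (if m = 0 then 0 else hh i (s * int m))) \<nu>)" if \<nu>: "\<nu> \<in> compositions k n" for k \<nu>
    proof -
      obtain m \<nu>' where "\<nu> = m # \<nu>'" using \<nu> False by (cases \<nu>) (auto simp: compositions_def)
      thus ?thesis using s e_hh [of "s * int m" i] by (auto simp: mult.assoc [symmetric])
    qed
    hence "e * (\<Sum>\<nu>\<in>compositions k n. prod_list (map (\<lambda>m. b *s (if m = 0 then 0 else hh i (s * int m))) \<nu>)) =
        (\<Sum>\<nu>\<in>compositions k n. prod_list (map (\<lambda>m. b *s (if m = 0 then 0 else hh i (s * int m))) \<nu>))" for k
      unfolding sum_distrib_left by (intro sum.cong refl)
    hence "e * wop.pexp (\<lambda>m. b *s (if m = 0 then 0 else hh i (s * int m))) n =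
        wop.pexp (\<lambda>m. b *s (if m = 0 then 0 else hh i (s * int m))) n"
      unfolding wop.pexp_def sum_distrib_left wop.scl_mult_right by (simp only:)
    thus ?thesis unfolding 1 2 using False by simp
  qed
qed

definition pps :: "int \<Rightarrow> 'i \<Rightarrow> int \<Rightarrow> ('i, 'k) wop" where
  "pps s i n = (if s = 1 then \<psi> i n else \<phi> i n)"

lemma act_cur_psi:
  assumes s: "s = 1 \<or> s = - 1"
  shows "act S (cur_psi c h s i n) = ((- q) powi n) *s pps s i (- n)"
proof (cases "s * n \<le> 0")
  case False
  thus ?thesis using s by (auto simp: cur_psi_def pps_def act_zero L.\<psi>_neg L.\<phi>_pos)
next
  case True
  define m where "m = nat (- (s * n))"
  have n: "n = - s * int m" using True s by (auto simp: m_def)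
  let ?f = "\<lambda>lam. exp_coeff (\<lambda>m. hop_scale (of_int s * (q - inverse q)) (oph c h i (s * int m))) m lam"
  have "cur_psi c h s i n = Hop (delta_wt (s * int c * int m)) (\<lambda>lam. q powi (s * pair_simple lam i) *\<^sub>q ?f lam)"
    using True s by (simp add: cur_psi_def m_def [symmetric]) (auto simp: n mult.commute)
  hence "act S (cur_psi c h s i n) = act S (Hop (delta_wt (s * int c * int m)) (\<lambda>lam. q powi (s * pair_simple lam i) *\<^sub>q ?f lam))"
    by simp
  also have "\<dots> = act S (Hop (delta_wt (s * int c * int m)) ?f) * wt_fun S (\<lambda>lam. q powi (s * pair_simple lam i))"
  proof -
    let ?X = "Hop (delta_wt (s * int c * int m)) ?f"
    have "weight_rels ?X \<subseteq> two_sided_ideal S"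
    proof (rule weight_rels_unit)
      show "e * act S ?X = act S ?X"
        unfolding act_exp_coeff_h [OF s] by (simp add: mult.assoc [symmetric] e_e)
      let ?p = "wop.pexp (\<lambda>m. (of_int s * (q - inverse q)) *s (if m = 0 then 0 else hh i (s * int m))) m"
      have p: "e * ?p = ?p * e"
        by (rule wop.commute_pexp) (use s in \<open>auto simp: e_hh\<close>)
      have "e * ?p * e = e * (?p * e)" by (rule mult.assoc)
      also have "\<dots> = e * e * ?p" unfolding p [symmetric] by (rule mult.assoc [symmetric])
      finally show "act S ?X * e = act S ?X"
        unfolding act_exp_coeff_h [OF s] by (simp only: e_e)
    qed
    from wt_fun_right [OF this, of "\<lambda>lam. q powi (s * pair_simple lam i)"] show ?thesis by simp
  qed
  also have "act S (Hop (delta_wt (s * int c * int m)) ?f) = (if s = 1 then U i m else U' i m)"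
    unfolding act_exp_coeff_h [OF s] using s by (auto simp: U_def U'_def cong: if_cong)
  also have "wt_fun S (\<lambda>lam. q powi (s * pair_simple lam i)) = (if s = 1 then K i else K' i)"
    using s by (auto simp: K_def K'_def)
  also have "(if s = 1 then U i m else U' i m) * (if s = 1 then K i else K' i) = ((- q) powi n) *s pps s i (- n)"
    using s by (auto simp: \<psi>_U \<phi>_U pps_def n)
  finally show ?thesis .
qed

end

section \<open>The Drinfeld relations\<close>

context scalar_algebra
begin

text \<open>A coefficient of a Drinfeld relation is a loop relation, with coefficients k1 to k4,
  multiplied by one common scalar g that collects the normalising powers.\<close>

lemma relation_scale:
  assumes "k1 *s x1 - k2 *s x2 - k3 *s x3 + k4 *s x4 = 0"
    and "l1 = g * k1" "l2 = g * k2" "l3 = g * k3" "l4 = g * k4"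
  shows "l1 *s x1 - l2 *s x2 = l3 *s x3 - l4 *s x4"
proof -
  have "g *s (k1 *s x1 - k2 *s x2 - k3 *s x3 + k4 *s x4) = 0" using assms(1) by simp
  thus ?thesis unfolding assms(2-5) by (simp add: scl_distribs algebra_simps)
qed

lemma scl_sum_three:
  "d *s (x - b *s y + z) + d *s (x' - b *s y' + z') = d *s ((x + x') - b *s (y + y') + (z + z'))"
proof -
  have "x - b *s y + z + (x' - b *s y' + z') = (x + x') - b *s (y + y') + (z + z')"
    unfolding scl_add_right by simp
  thus ?thesis by (simp only: scl_add_right [symmetric])
qed

lemma fps_scale_mult:
  "Abs_fps (\<lambda>n. c ^ n *s fps_nth (x * y) n) =
    Abs_fps (\<lambda>n. c ^ n *s fps_nth x n) * Abs_fps (\<lambda>n. c ^ n *s fps_nth y n)"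
proof (rule fps_ext)
  fix n
  have "c ^ n *s (\<Sum>i=0..n. fps_nth x i * fps_nth y (n - i)) =
      (\<Sum>i=0..n. (c ^ i *s fps_nth x i) * (c ^ (n - i) *s fps_nth y (n - i)))"
    unfolding scl_sum_right
  proof (intro sum.cong refl)
    fix i assume "i \<in> {0..n}"
    hence "c ^ n = c ^ i * c ^ (n - i)" by (simp flip: power_add)
    thus "c ^ n *s (fps_nth x i * fps_nth y (n - i)) = (c ^ i *s fps_nth x i) * (c ^ (n - i) *s fps_nth y (n - i))"
      by (simp add: mult.commute)
  qed
  thus "fps_nth (Abs_fps (\<lambda>n. c ^ n *s fps_nth (x * y) n)) n =
      fps_nth (Abs_fps (\<lambda>n. c ^ n *s fps_nth x n) * Abs_fps (\<lambda>n. c ^ n *s fps_nth y n)) n"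
    by (simp add: fps_mult_nth)
qed

end

context drinfeld_generators
begin


abbreviation C :: "'k poly fract" where "C \<equiv> q ^ c"
abbreviation r :: "'k poly fract" where "r \<equiv> qhalf ^ c"
text \<open>The normalisation -q^{1+c/2} of e_{i,r} and f_{i,r}; \<open>r\<close> is
  q^{c/2}.\<close>

definition t :: "'k poly fract" where "t = - (q * r)"

lemma r_t: "r \<noteq> 0" "t \<noteq> 0" "r * r = C" "t = - q * r"
  by (simp_all add: t_def qhalf_nonzero qq_nonzero qq_def power_mult_distrib [symmetric] power2_eq_square)

lemma act_cur_x:
  "act S (cur_x adj c 1 i n) = t powi n *s E i (- n)" "act S (cur_x adj c (- 1) i n) = t powi n *s F i (- n)"
  by (simp_all add: cur_x_def ope_def opf_def act_scale t_def E_def F_def)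

lemma cur_wt:
  "hop_wt (cur_x adj c 1 i n) = simple_root adj i + delta_wt (- n * int c)"
  "hop_wt (cur_x adj c (- 1) i n) = - simple_root adj i + delta_wt (- n * int c)"
  "hop_wt (cur_psi c h s i n) = 0 + delta_wt (- n * int c)"
  by (simp_all add: cur_x_def ope_def opf_def hop_scale_def hop_wt_simps cur_psi_def)

lemma eq_A_act: "act S (Hop w f) = act S (Hop w g) \<Longrightarrow> eq_A adj c (f lam) (g lam)"
  by (subst (asm) act_eq_iff) (simp_all add: eq_A_iff del: split_paired_All)

lemma eq_A_idem:
  assumes "e * act S x = act S x" "\<mu> = lam + hop_wt x"
  shows "eq_A adj c (x\<one>\<^bsub>lam\<^esub>) (idem \<mu> * x\<one>\<^bsub>lam\<^esub>)"
proof -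
  have "act S x = act S (Hop 0 idem \<odot> x)"
    using assms(1) by (simp add: act_mult e_def)
  thus ?thesis
    by (subst (asm) act_eq_iff) (simp_all add: hop_wt_simps hop_at_simps eq_A_iff assms(2) del: split_paired_All)
qed

section \<open>Relations read off coefficientwise: (D1), (D2) and (D4) to (D7)\<close>

lemma drinfeld1: "drinfeld1 adj c h"
  unfolding drinfeld1_def
proof (intro allI conjI impI eq_A_idem)
  fix i k lam
  show "e * act S (ope adj c i k) = act S (ope adj c i k)" "e * act S (opf adj c i k) = act S (opf adj c i k)"
    using unit_basic by (simp_all add: ope_def opf_def act_scale E_def F_def)
  show "e * act S (oph c h i k) = act S (oph c h i k)" if "k \<noteq> 0"
    using e_hh(1) [OF that, of i] by (simp add: hh_def)
qed (simp_all add: ope_def opf_def oph_def hop_scale_def hop_wt_simps add_ac)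

lemma pps_comm: "pps s i m * pps s j n = pps s j n * pps s i m"
  using L.\<psi>_comm [of i m j n] L.\<phi>_comm [of i m j n] by (simp add: pps_def)

lemma drinfeld2: "drinfeld2 adj c h"
  unfolding drinfeld2_def dist_eq_A_def prod_zw_def prod_wz_def
proof (intro allI ballI)
  fix i j lam s and m n :: int
  assume "s \<in> {1, - 1 :: int}"
  hence s: "s = 1 \<or> s = - 1" by simp
  show "eq_A adj c ((cur_psi c h s i m \<odot> cur_psi c h s j n)\<one>\<^bsub>lam\<^esub>) ((cur_psi c h s j n \<odot> cur_psi c h s i m)\<one>\<^bsub>lam\<^esub>)"
    by (rule eq_A_act [where w = "delta_wt (- m * int c) + delta_wt (- n * int c)"])
      (simp add: act_Hop hop_wt_simps cur_wt add.commute act_mult act_cur_psi [OF s] pps_comm mult.commute)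
qed

text \<open>All four terms in a coefficient of a linear exchange relation have the same weight, so
  it can be checked as one identity of operators.\<close>

lemma dist_eq_A_lin:
  assumes X: "\<And>n. hop_wt (X n) = x + delta_wt (- n * int c)" and Y: "\<And>n. hop_wt (Y n) = y + delta_wt (- n * int c)"
    and eq: "\<And>m n. \<alpha> *s (act S (X (m - 1)) * act S (Y n)) - \<beta> *s (act S (X m) * act S (Y (n - 1))) =
      \<alpha>' *s (act S (Y n) * act S (X (m - 1))) - \<beta>' *s (act S (Y (n - 1)) * act S (X m))"
  shows "dist_eq_A adj c (lin_mult \<alpha> \<beta> (prod_zw X Y lam)) (lin_mult \<alpha>' \<beta>' (prod_wz Y X lam))"
  unfolding dist_eq_A_def lin_mult_def prod_zw_def prod_wz_def
proof (intro allI)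
  fix m n
  have w: "hop_wt (X (m - 1)) + hop_wt (Y n) = x + y + delta_wt ((1 - m - n) * int c)"
    "hop_wt (X m) + hop_wt (Y (n - 1)) = x + y + delta_wt ((1 - m - n) * int c)"
    by (simp_all add: X Y delta_wt_add [symmetric] algebra_simps) (simp_all add: delta_wt_add algebra_simps)
  show "eq_A adj c
      (\<alpha> *\<^sub>q (X (m - 1) \<odot> Y n)\<one>\<^bsub>lam\<^esub> - \<beta> *\<^sub>q (X m \<odot> Y (n - 1))\<one>\<^bsub>lam\<^esub>)
      (\<alpha>' *\<^sub>q (Y n \<odot> X (m - 1))\<one>\<^bsub>lam\<^esub> - \<beta>' *\<^sub>q (Y (n - 1) \<odot> X m)\<one>\<^bsub>lam\<^esub>)"
    by (rule eq_A_act [where w = "x + y + delta_wt ((1 - m - n) * int c)"], unfold act_diff act_smul,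
        (subst act_Hop, simp add: hop_wt_simps w w [unfolded add.commute [of "hop_wt (X _)"]])+,
        unfold act_mult, rule eq)
qed

text \<open>The two products on either side of an exchange relation have modes that differ by moving
  1 from one current to the other; in the normalising powers this costs the ratio y of the two
  bases.\<close>

lemma powi_exchange:
  fixes x y z :: "'k poly fract"
  assumes "x \<noteq> 0" "z \<noteq> 0" "x = y * z"
  shows "x powi m * z powi (n - 1) = y * (x powi (m - 1) * z powi n)"
    "z powi (n - 1) * x powi m = y * (x powi (m - 1) * z powi n)"
proof -
  have "x powi m = x powi (m - 1) * x" "z powi n = z powi (n - 1) * z"
    using power_int_add [of x "m - 1" 1] power_int_add [of z "n - 1" 1] assms by simp_all
  hence "x powi m * z powi (n - 1) = x powi (m - 1) * (y * z) * z powi (n - 1)"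
    "y * (x powi (m - 1) * z powi n) = y * (x powi (m - 1) * (z powi (n - 1) * z))"
    by (simp_all only: assms(3) [symmetric])
  thus "x powi m * z powi (n - 1) = y * (x powi (m - 1) * z powi n)"
    "z powi (n - 1) * x powi m = y * (x powi (m - 1) * z powi n)"
    by (simp_all only: mult_ac)
qed

text \<open>(D6) and (D7) have one common form in the Cartan entry, which is 2 for i = j and -1 for
  adjacent nodes.\<close>

lemma drinfeld_xx:
  assumes "\<epsilon> \<in> {1, - 1 :: int}"
  shows "dist_eq_A adj c (lin_mult 1 (q powi (\<epsilon> * a i j)) (prod_zw (cur_x adj c \<epsilon> i) (cur_x adj c \<epsilon> j) lam))
     (lin_mult (q powi (\<epsilon> * a i j)) 1 (prod_wz (cur_x adj c \<epsilon> j) (cur_x adj c \<epsilon> i) lam))"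
proof -
  define G where "G m n = t powi (m - 1) * t powi n" for m n
  have G: "t powi (m - 1) * t powi n = G m n" "t powi n * t powi (m - 1) = G m n"
    "t powi m * t powi (n - 1) = G m n" "t powi (n - 1) * t powi m = G m n" for m n
    using powi_exchange [OF r_t(2,2), of 1 m n] by (simp_all add: G_def mult.commute)
  from assms consider "\<epsilon> = 1" | "\<epsilon> = - 1" by blast
  thus ?thesis
  proof cases
    case 1
    show ?thesis
      unfolding 1
    proof (rule dist_eq_A_lin, rule cur_wt, rule cur_wt, unfold act_cur_x wop.scl_mult_left wop.scl_mult_right wop.scl_scl)
      fix m n
      have "1 *s (E i (- (m - 1)) * E j (- n)) - q powi a i j *s (E i (- m) * E j (- (n - 1))) -
          q powi a i j *s (E j (- n) * E i (- (m - 1))) + 1 *s (E j (- (n - 1)) * E i (- m)) = 0"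
        using L.RE_eq_0 [of i j "- m" "- n"] by (simp add: L.RE_def add.commute)
      thus "(1 * (t powi n * t powi (m - 1))) *s (E i (- (m - 1)) * E j (- n)) -
          (q powi (1 * a i j) * (t powi (n - 1) * t powi m)) *s (E i (- m) * E j (- (n - 1))) =
          (q powi (1 * a i j) * (t powi (m - 1) * t powi n)) *s (E j (- n) * E i (- (m - 1))) -
          (1 * (t powi m * t powi (n - 1))) *s (E j (- (n - 1)) * E i (- m))"
        by (rule wop.relation_scale [where g = "G m n"]) (simp_all only: G [where m = m and n = n] mult_1 mult_1_right, simp_all only: mult.commute)
    qed
  next
    case 2
    show ?thesis
      unfolding 2
    proof (rule dist_eq_A_lin, rule cur_wt, rule cur_wt, unfold act_cur_x wop.scl_mult_left wop.scl_mult_right wop.scl_scl)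
      fix m n
      have "q powi a i j *s (F i (- (m - 1)) * F j (- n)) - 1 *s (F i (- m) * F j (- (n - 1))) -
          1 *s (F j (- n) * F i (- (m - 1))) + q powi a i j *s (F j (- (n - 1)) * F i (- m)) = 0"
        using L.RF_eq_0 [of i "- m" j "- n"] by (simp add: algebra_simps)
      thus "(1 * (t powi n * t powi (m - 1))) *s (F i (- (m - 1)) * F j (- n)) -
          (q powi (- 1 * a i j) * (t powi (n - 1) * t powi m)) *s (F i (- m) * F j (- (n - 1))) =
          (q powi (- 1 * a i j) * (t powi (m - 1) * t powi n)) *s (F j (- n) * F i (- (m - 1))) -
          (1 * (t powi m * t powi (n - 1))) *s (F j (- (n - 1)) * F i (- m))"
        \<comment> \<open>In the loop relation for F the powers of q stand at the other pair of
          terms; the factor q^{-a} moves them to where (D6) and (D7) have them.\<close>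
        by (rule wop.relation_scale [where g = "q powi (- a i j) * G m n"])
          (simp_all add: G [where m = m and n = n] power_int_minus qq_nonzero)
    qed
  qed
qed

lemma drinfeld6: "drinfeld6 adj c h"
  unfolding drinfeld6_def
proof (intro allI ballI)
  fix i lam \<epsilon> assume "\<epsilon> \<in> {1, - 1 :: int}"
  from drinfeld_xx [OF this, of i i lam]
  show "dist_eq_A adj c (lin_mult 1 (qq powi (2 * \<epsilon>)) (prod_zw (cur_x adj c \<epsilon> i) (cur_x adj c \<epsilon> i) lam :: ('i, 'k) dist2))
       (lin_mult (qq powi (2 * \<epsilon>)) 1 (prod_wz (cur_x adj c \<epsilon> i) (cur_x adj c \<epsilon> i) lam))"
    by (simp add: L.a_diag mult.commute)
qed

lemma drinfeld7: "drinfeld7 adj c h"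
  unfolding drinfeld7_def
proof (intro allI ballI impI)
  fix i j lam \<epsilon> assume "\<epsilon> \<in> {1, - 1 :: int}" "a i j = - 1"
  from drinfeld_xx [OF this(1), of i j lam] this(2)
  show "dist_eq_A adj c (lin_mult 1 (qq powi (- \<epsilon>)) (prod_zw (cur_x adj c \<epsilon> i) (cur_x adj c \<epsilon> j) lam :: ('i, 'k) dist2))
       (lin_mult (qq powi (- \<epsilon>)) 1 (prod_wz (cur_x adj c \<epsilon> j) (cur_x adj c \<epsilon> i) lam))"
    by simp
qed

lemma drinfeld4: "drinfeld4 adj c h"
  unfolding drinfeld4_def
proof (intro allI ballI)
  fix i j lam \<epsilon> s assume \<epsilon>: "\<epsilon> \<in> {1, - 1 :: int}" and s: "s \<in> {1, - 1 :: int}"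
  let ?A = "q powi a i j"
  have A: "?A \<noteq> 0" by (simp add: qq_nonzero)
  have r: "r \<noteq> 0" by (rule r_t)
  have rr: "r * (inverse r * x) = x" "r * inverse r = 1" for x using r by simp_all
  \<comment> \<open>The modes of \<psi> are scaled by powers of - q, those of E and F by powers of t
    = - q r. The ratio r = q^{c/2} is the origin of the half powers in (D4).\<close>
  have mq: "- q \<noteq> 0" "- q = inverse r * t" using r qq_nonzero [where 'k = 'k] by (simp_all add: r_t(4))
  define G where "G m n = inverse r * ((- q) powi (m - 1) * t powi n)" for m n
  have G: "(- q) powi (m - 1) * t powi n = r * G m n" "t powi n * (- q) powi (m - 1) = r * G m n"
    "(- q) powi m * t powi (n - 1) = G m n" "t powi (n - 1) * (- q) powi m = G m n" for m n
    using powi_exchange [OF mq(1) r_t(2) mq(2), of m n] r by (simp_all add: G_def mult.commute)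
  have qr: "qhalf powi int c = r" "qhalf powi (- int c) = inverse r" by (simp_all add: power_int_minus)
  note unf = act_cur_x act_cur_psi [OF disjI1 [OF refl]] act_cur_psi [OF disjI2 [OF refl]]
    wop.scl_mult_left wop.scl_mult_right wop.scl_scl
  consider "\<epsilon> = 1" "s = 1" | "\<epsilon> = 1" "s = - 1" | "\<epsilon> = - 1" "s = 1" | "\<epsilon> = - 1" "s = - 1"
    using \<epsilon> s by blast
  thus "dist_eq_A adj c
       (lin_mult (qhalf powi (\<epsilon> * s * int c)) (qq powi (\<epsilon> * cartan adj i j))
         (prod_zw (cur_psi c h s j) (cur_x adj c \<epsilon> i) lam))
       (lin_mult (qq powi (\<epsilon> * cartan adj i j) * qhalf powi (\<epsilon> * s * int c)) 1
         (prod_wz (cur_x adj c \<epsilon> i) (cur_psi c h s j) lam))"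
  proof cases
    case 1
    show ?thesis
      unfolding 1
    proof (rule dist_eq_A_lin, rule cur_wt, rule cur_wt, unfold unf)
      fix m n
      have rel: "C *s (pps 1 j (- (m - 1)) * E i (- n)) - ?A *s (pps 1 j (- m) * E i (- (n - 1))) -
          (?A * C) *s (E i (- n) * pps 1 j (- (m - 1))) + 1 *s (E i (- (n - 1)) * pps 1 j (- m)) = 0"
        using L.XP_eq_0 [of j i "- m" "- n"] by (simp add: L.XP_def add.commute pps_def a_sym [of j i])
      show "(qhalf powi (1 * 1 * int c) * (t powi n * (- q) powi (m - 1))) *s (pps 1 j (- (m - 1)) * E i (- n)) -
          (q powi (1 * a i j) * (t powi (n - 1) * (- q) powi m)) *s (pps 1 j (- m) * E i (- (n - 1))) =
          (q powi (1 * a i j) * qhalf powi (1 * 1 * int c) * ((- q) powi (m - 1) * t powi n)) *s (E i (- n) * pps 1 j (- (m - 1))) -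
          (1 * ((- q) powi m * t powi (n - 1))) *s (E i (- (n - 1)) * pps 1 j (- m))"
        by (rule wop.relation_scale [OF rel, where g = "G m n"])
          (use r in \<open>simp_all add: G qr r_t(3) [symmetric] mult_ac\<close>)
    qed
  next
    case 2
    show ?thesis
      unfolding 2
    proof (rule dist_eq_A_lin, rule cur_wt, rule cur_wt, unfold unf)
      fix m n
      have rel: "1 *s (pps (- 1) j (- (m - 1)) * E i (- n)) - ?A *s (pps (- 1) j (- m) * E i (- (n - 1))) -
          ?A *s (E i (- n) * pps (- 1) j (- (m - 1))) + 1 *s (E i (- (n - 1)) * pps (- 1) j (- m)) = 0"
        using L.XM_eq_0 [of j i "- m" "- n"] by (simp add: L.XM_def add.commute pps_def a_sym [of j i])
      show "(qhalf powi (1 * - 1 * int c) * (t powi n * (- q) powi (m - 1))) *s (pps (- 1) j (- (m - 1)) * E i (- n)) -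
          (q powi (1 * a i j) * (t powi (n - 1) * (- q) powi m)) *s (pps (- 1) j (- m) * E i (- (n - 1))) =
          (q powi (1 * a i j) * qhalf powi (1 * - 1 * int c) * ((- q) powi (m - 1) * t powi n)) *s (E i (- n) * pps (- 1) j (- (m - 1))) -
          (1 * ((- q) powi m * t powi (n - 1))) *s (E i (- (n - 1)) * pps (- 1) j (- m))"
        by (rule wop.relation_scale [OF rel, where g = "G m n"])
          (use r in \<open>simp_all add: G qr mult_ac\<close>)
    qed
  next
    case 3
    show ?thesis
      unfolding 3
    proof (rule dist_eq_A_lin, rule cur_wt, rule cur_wt, unfold unf)
      fix m n
      have rel: "?A *s (pps 1 j (- (m - 1)) * F i (- n)) - 1 *s (pps 1 j (- m) * F i (- (n - 1))) -
          1 *s (F i (- n) * pps 1 j (- (m - 1))) + ?A *s (F i (- (n - 1)) * pps 1 j (- m)) = 0"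
        using L.\<psi>_F_rel [of j "- m" i "- n"] by (simp add: pps_def a_sym [of j i] algebra_simps)
      show "(qhalf powi (- 1 * 1 * int c) * (t powi n * (- q) powi (m - 1))) *s (pps 1 j (- (m - 1)) * F i (- n)) -
          (q powi (- 1 * a i j) * (t powi (n - 1) * (- q) powi m)) *s (pps 1 j (- m) * F i (- (n - 1))) =
          (q powi (- 1 * a i j) * qhalf powi (- 1 * 1 * int c) * ((- q) powi (m - 1) * t powi n)) *s (F i (- n) * pps 1 j (- (m - 1))) -
          (1 * ((- q) powi m * t powi (n - 1))) *s (F i (- (n - 1)) * pps 1 j (- m))"
        by (rule wop.relation_scale [OF rel, where g = "inverse ?A * G m n"])
          (use r A in \<open>simp_all add: G qr power_int_minus mult_ac\<close>)
    qed
  next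
    case 4
    show ?thesis
      unfolding 4
    proof (rule dist_eq_A_lin, rule cur_wt, rule cur_wt, unfold unf)
      fix m n
      have rel: "?A *s (pps (- 1) j (- (m - 1)) * F i (- n)) - inverse C *s (pps (- 1) j (- m) * F i (- (n - 1))) -
          1 *s (F i (- n) * pps (- 1) j (- (m - 1))) + (?A * inverse C) *s (F i (- (n - 1)) * pps (- 1) j (- m)) = 0"
        using L.\<phi>_F_rel [of j "- m" i "- n"] by (simp add: pps_def a_sym [of j i] algebra_simps)
      show "(qhalf powi (- 1 * - 1 * int c) * (t powi n * (- q) powi (m - 1))) *s (pps (- 1) j (- (m - 1)) * F i (- n)) -
          (q powi (- 1 * a i j) * (t powi (n - 1) * (- q) powi m)) *s (pps (- 1) j (- m) * F i (- (n - 1))) =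
          (q powi (- 1 * a i j) * qhalf powi (- 1 * - 1 * int c) * ((- q) powi (m - 1) * t powi n)) *s (F i (- n) * pps (- 1) j (- (m - 1))) -
          (1 * ((- q) powi m * t powi (n - 1))) *s (F i (- (n - 1)) * pps (- 1) j (- m))"
        by (rule wop.relation_scale [OF rel, where g = "inverse ?A * C * G m n"])
          (use r A in \<open>simp_all add: G qr rr power_int_minus r_t(3) [symmetric] mult_ac\<close>)
    qed
  qed
qed

lemma drinfeld5: "drinfeld5 adj c h"
  unfolding drinfeld5_def dist_eq_A_def prod_zw_def prod_wz_def
proof (intro allI)
  fix i j lam and m n :: int
  let ?X = "cur_x adj c 1 i m :: ('i, 'k) hop" and ?Y = "cur_x adj c (- 1) j n :: ('i, 'k) hop"
  let ?w = "hop_wt ?X + hop_wt ?Y"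
  have lhs: "act S (Hop ?w (\<lambda>lam. (?X \<odot> ?Y)\<one>\<^bsub>lam\<^esub> - (?Y \<odot> ?X)\<one>\<^bsub>lam\<^esub>)) =
      t powi (m + n) *s (E i (- m) * F j (- n) - F j (- n) * E i (- m))"
    by (simp only: act_diff)
      (simp add: act_Hop hop_wt_simps act_mult act_cur_x add.commute mult.commute power_int_add r_t(2) wop.scl_diff_right)
  show "eq_A adj c ((?X \<odot> ?Y)\<one>\<^bsub>lam\<^esub> - (?Y \<odot> ?X)\<one>\<^bsub>lam\<^esub>)
       (if i = j then
          (1 / (qq - inverse qq)) *\<^sub>q
            (delta_wz (qq ^ c) (qhalf ^ c) (cur_psi c h 1 i) lam m n -
             delta_zw (qq ^ c) (qhalf ^ c) (cur_psi c h (- 1) i) lam m n)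
        else 0)"
  proof (cases "i = j")
    case False
    have "eq_A adj c ((?X \<odot> ?Y)\<one>\<^bsub>lam\<^esub> - (?Y \<odot> ?X)\<one>\<^bsub>lam\<^esub>) 0"
      by (rule eq_A_act [where w = ?w and g = "\<lambda>_. 0"], unfold lhs act_zero)
        (simp add: E_F_neq_rel [OF False])
    thus ?thesis using False by simp
  next
    case True
    have w: "hop_wt (cur_psi c h s i (m + n)) = ?w" for s
      by (simp add: cur_wt True delta_wt_add algebra_simps)
    \<comment> \<open>The power of - q comes from the modes of \<psi>, the power of r from the
      arguments q^{c/2} w and q^{c/2} z in (D5); together they make up the normalisation of e and
      f.\<close>
    have qr: "r powi (m + n) * (- q) powi (m + n) = t powi (m + n)"
      by (simp add: r_t(4) power_int_mult_distrib [symmetric] mult.commute)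
    have "eq_A adj c ((?X \<odot> ?Y)\<one>\<^bsub>lam\<^esub> - (?Y \<odot> ?X)\<one>\<^bsub>lam\<^esub>)
          ((1 / (qq - inverse qq)) *\<^sub>q
            (delta_wz (qq ^ c) (qhalf ^ c) (cur_psi c h 1 i) lam m n -
             delta_zw (qq ^ c) (qhalf ^ c) (cur_psi c h (- 1) i) lam m n))"
      unfolding delta_wz_def delta_zw_def
    proof (rule eq_A_act [where w = ?w], unfold lhs, unfold act_smul act_diff)
      have "E i (- m) * F j (- n) - F j (- n) * E i (- m) =
         inverse (q - inverse q) *s (C powi (- m) *s \<psi> i (- (m + n)) - C powi (- n) *s \<phi> i (- (m + n)))"
        using EF_rel [of i "- m" "- n"] True by simp
      thus "t powi (m + n) *s (E i (- m) * F j (- n) - F j (- n) * E i (- m)) =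
        (1 / (q - inverse q)) *s ((C powi (- m) * r powi (m + n)) *s act S (Hop ?w (hop_at (cur_psi c h 1 i (m + n)))) -
          (C powi (- n) * r powi (m + n)) *s act S (Hop ?w (hop_at (cur_psi c h (- 1) i (m + n)))))"
        unfolding act_Hop [OF w]
        by (simp add: act_Hop [OF w] act_cur_psi pps_def wop.scl_diff_right qr [symmetric] divide_inverse mult_ac)
    qed
    thus ?thesis using True by simp
  qed
qed


section \<open>The exchange of \<psi>^- and \<psi>^+, relation (D3)\<close>

sublocale Z: corner_algebra wop_scale e
  by unfold_locales (rule e_e)

lemma U_unit: "e * U j n = U j n" "U j n * e = U j n" "e * U' j n = U' j n" "U' j n * e = U' j n"
proof -
  have *: "e * (e * x) = e * x" "e * x * e = e * x" if "e * x = x * e" for x :: "('i, 'k) wop"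
  proof -
    show 1: "e * (e * x) = e * x" by (simp add: mult.assoc [symmetric] e_e)
    show "e * x * e = e * x" unfolding mult.assoc that [symmetric] by (rule 1)
  qed
  show "e * U j n = U j n" "U j n * e = U j n" "e * U' j n = U' j n" "U' j n * e = U' j n"
    unfolding U_def U'_def by (intro * wop.commute_pexp; simp add: e_hh)+
qed

lemma U_corner: "Z.corner (Abs_fps (U j))" "Z.corner (Abs_fps (U' j))"
  by (simp_all add: Z.corner_def U_unit)

lemma K_U: "K i * U' j n = U' j n * K i" "K' i * U j n = U j n * K' i"
proof -
  have "U j n = ((- q) powi (- int n)) *s (\<psi> j (int n) * K' j)"
    using arg_cong [OF \<psi>_U [of j n], of "\<lambda>x. x * K' j"] by (simp add: mult.assoc K_K' U_unit)
  thus "K' i * U j n = U j n * K' i"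
    using K_\<psi>\<phi>(3) [of i j "int n"] by (simp add: mult.assoc [symmetric]) (simp add: mult.assoc K_comm(3) [of i j])
  have "U' j n = ((- q) powi int n) *s (\<phi> j (- int n) * K j)"
    using arg_cong [OF \<phi>_U [of j n], of "\<lambda>x. x * K j"] by (simp add: mult.assoc K_K' U_unit)
  thus "K i * U' j n = U' j n * K i"
    using K_\<psi>\<phi>(2) [of i j "- int n"] by (simp add: mult.assoc [symmetric]) (simp add: mult.assoc K_comm(1) [of i j])
qed

lemma heis_exch: "Z.exch (Abs_fps (Q Row j)) (Abs_fps (P Row i)) (heis_series c (a i j))"
  by (simp add: Z.exch_def Q_P heis_series_def)

text \<open>After rescaling, U(u) = Q(u/q)^{-1} Q(q u) and U'(z) = P(q z)^{-1} P(z/q). The four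
  pairs of factors have the products of arguments uz, q^{-2} uz, q^2 uz and uz; the exchange factor
  is inverted when exactly one of the two members is an inverse.\<close>

lemma U_exch:
  assumes f: "heis_series c (a i j) * f = 1"
  shows "Z.exch (Abs_fps (U j)) (Abs_fps (U' i))
    (heis_series c (a i j) * qscale 2 f * qscale (- 2) f * heis_series c (a i j))"
proof -
  interpret Qp: series_pair wop_scale e "Q Row j" "Q Col j" by (rule Q_pair)
  interpret Pp: series_pair wop_scale e "P Row i" "P Col i" by (rule P_pair)
  let ?g = "heis_series c (a i j)"
  let ?S = "\<lambda>b x. Abs_fps (\<lambda>n. b ^ n *s fps_nth x n)"
  have corner: "Z.corner Qp.QS" "Z.corner Qp.RS" "Z.corner Pp.QS" "Z.corner Pp.RS"
    by (simp_all add: Z.corner_def Qp.QS_def Qp.RS_def Pp.QS_def Pp.RS_def unit_basic)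
  have S_corner: "Z.corner (?S b x)" if "Z.corner x" for b x
    using that by (rule Z.corner_scale)
  have 1: "Z.exch Qp.QS Pp.QS ?g" unfolding Qp.QS_def Pp.QS_def by (rule heis_exch)
  have 2: "Z.exch Qp.RS Pp.QS f"
    by (rule Z.exch_inverse_left [OF corner(1,2,3) 1 Qp.QS_RS Qp.RS_QS f])
  have 3: "Z.exch Qp.QS Pp.RS f"
    by (rule Z.exch_inverse_right [OF corner(1,3,4) 1 Pp.QS_RS Pp.RS_QS f])
  have 4: "Z.exch Qp.RS Pp.RS ?g"
    by (rule Z.exch_inverse_right [OF corner(2,3,4) 2 Pp.QS_RS Pp.RS_QS]) (use f in \<open>simp add: mult.commute\<close>)
  have q1: "inverse q ^ n * q ^ (2 * n) = q ^ n" "q ^ n * inverse q ^ (2 * n) = inverse q ^ n"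
    "inverse q ^ n * q ^ n = 1" "q ^ n * inverse q ^ n = 1" for n
    by (simp_all add: mult_2 power_add power_inverse qq_nonzero)
  have "Abs_fps (U j) = ?S (inverse q) (Abs_fps (\<lambda>n. q ^ n *s U j n))"
    by (simp add: fps_eq_iff q1)
  also have "\<dots> = ?S (inverse q) Qp.RS * ?S q Qp.QS"
    unfolding U_series wop.fps_scale_mult by (simp add: q1 Qp.QS_def)
  finally have x: "Abs_fps (U j) = ?S (inverse q) Qp.RS * ?S q Qp.QS" .
  have "Abs_fps (U' i) = ?S q (Abs_fps (\<lambda>n. inverse q ^ n *s U' i n))"
    by (simp add: fps_eq_iff q1)
  also have "\<dots> = ?S q Pp.RS * ?S (inverse q) Pp.QS"
    unfolding U'_series wop.fps_scale_mult by (simp add: q1 Pp.QS_def)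
  finally have y: "Abs_fps (U' i) = ?S q Pp.RS * ?S (inverse q) Pp.QS" .
  have s: "Abs_fps (\<lambda>n. (inverse q * q) ^ n * fps_nth ?g n) = ?g"
    "Abs_fps (\<lambda>n. (q * inverse q) ^ n * fps_nth ?g n) = ?g"
    "Abs_fps (\<lambda>n. (inverse q * inverse q) ^ n * fps_nth f n) = qscale (- 2) f"
    "Abs_fps (\<lambda>n. (q * q) ^ n * fps_nth f n) = qscale 2 f"
    by (simp_all add: fps_eq_iff qq_nonzero qscale_def power_int_minus power2_eq_square)
  have "Z.exch (Abs_fps (U j)) (Abs_fps (U' i)) ((?g * qscale (- 2) f) * (qscale 2 f * ?g))"
    unfolding x y
  proof (intro Z.exch_mult_left Z.exch_mult_right Z.corner_mult S_corner corner)
    show "Z.exch (?S (inverse q) Qp.RS) (?S q Pp.RS) ?g"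
      using Z.exch_scale [OF 4, of "inverse q" q] unfolding s .
    show "Z.exch (?S (inverse q) Qp.RS) (?S (inverse q) Pp.QS) (qscale (- 2) f)"
      using Z.exch_scale [OF 2, of "inverse q" "inverse q"] unfolding s .
    show "Z.exch (?S q Qp.QS) (?S q Pp.RS) (qscale 2 f)"
      using Z.exch_scale [OF 3, of q q] unfolding s .
    show "Z.exch (?S q Qp.QS) (?S (inverse q) Pp.QS) ?g"
      using Z.exch_scale [OF 1, of q "inverse q"] unfolding s .
  qed
  thus ?thesis by (simp add: mult_ac)
qed

text \<open>The weight operators K and K' commute with both series, so the exchange is that of
  \<open>U'\<close> and \<open>U\<close>. The normalising powers of - q depend only on n - m and are
  the same in all terms of the sum.\<close>

lemma \<phi>_\<psi>_exch:
  "\<phi> i (- int m) * \<psi> j (int n) = (\<Sum>k\<in>{0..min m n}. fps_nth (d3_series c (a i j)) k *s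
     (\<psi> j (int (n - k)) * \<phi> i (- int (m - k))))"
proof -
  have "a i j = 2 \<or> a i j = - 1 \<or> a i j = 0" by (simp add: cartan_def)
  then obtain f where f: "heis_series c (a i j) * f = (1 :: 'k poly fract fps)"
    "heis_series c (a i j) * qscale 2 f * qscale (- 2) f * heis_series c (a i j) * d3_series c (a i j) = 1"
    by (rule d3_series_heis)
  have pa: "(- q) powi m * (- q) powi n = (- q) powi (m + n)" for m n
    by (rule power_int_add [symmetric]) (simp add: qq_nonzero)
  have pow: "(- q) powi (- int m) * (- q) powi int m = 1" "(- q) powi int m * (- q) powi (- int m) = 1" for m
    by (simp_all only: pa) simp_all
  have \<psi>: "\<psi> j (int n) = (- q) powi int n *s (U j n * K j)" for n
    unfolding \<psi>_U wop.scl_scl pow wop.scl_one ..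
  have \<phi>: "\<phi> i (- int m) = (- q) powi (- int m) *s (U' i m * K' i)" for m
    unfolding \<phi>_U wop.scl_scl pow wop.scl_one ..
  have 1: "\<phi> i (- int m) * \<psi> j (int n) = ((- q) powi (- int m) * (- q) powi int n) *s (U' i m * U j n * (K j * K' i))" for m n
  proof -
    have "(U' i m * K' i) * (U j n * K j) = U' i m * (K' i * U j n) * K j" by (simp only: mult.assoc)
    also have "\<dots> = U' i m * U j n * (K j * K' i)" unfolding K_U K_comm(2) by (simp only: mult.assoc)
    finally show ?thesis unfolding \<psi> \<phi> by (simp add: mult.commute)
  qed
  have 2: "\<psi> j (int n) * \<phi> i (- int m) = ((- q) powi (- int m) * (- q) powi int n) *s (U j n * U' i m * (K j * K' i))" for m n
  proof -
    have "(U j n * K j) * (U' i m * K' i) = U j n * (K j * U' i m) * K' i" by (simp only: mult.assoc)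
    also have "\<dots> = U j n * U' i m * (K j * K' i)" unfolding K_U by (simp only: mult.assoc)
    finally show ?thesis unfolding \<psi> \<phi> by (simp add: mult.commute)
  qed
  have "U' i m * U j n = (\<Sum>k\<in>{0..min m n}. fps_nth (d3_series c (a i j)) k *s (U j (n - k) * U' i (m - k)))"
    using Z.exch_swap [OF U_corner U_exch [OF f(1)] f(2), of m n] by simp
  hence "\<phi> i (- int m) * \<psi> j (int n) = (\<Sum>k\<in>{0..min m n}. ((- q) powi (- int m) * (- q) powi int n) *s
      fps_nth (d3_series c (a i j)) k *s (U j (n - k) * U' i (m - k) * (K j * K' i)))"
    unfolding 1 by (simp only: sum_distrib_right wop.scl_mult_left wop.scl_sum_right)
  also have "\<dots> = (\<Sum>k\<in>{0..min m n}. fps_nth (d3_series c (a i j)) k *s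
     (\<psi> j (int (n - k)) * \<phi> i (- int (m - k))))"
  proof (intro sum.cong refl)
    fix k assume k: "k \<in> {0..min m n}"
    have "(- q) powi (- int m) * (- q) powi int n = (- q) powi (- int (m - k)) * (- q) powi int (n - k)"
      using k by (simp only: pa) (simp add: of_nat_diff)
    thus "((- q) powi (- int m) * (- q) powi int n) *s
        fps_nth (d3_series c (a i j)) k *s (U j (n - k) * U' i (m - k) * (K j * K' i)) =
      fps_nth (d3_series c (a i j)) k *s (\<psi> j (int (n - k)) * \<phi> i (- int (m - k)))"
      unfolding 2 by (simp only: wop.scl_scl mult.commute)
  qed
  finally show ?thesis .
qed

lemma drinfeld3: "drinfeld3 adj c h"
  unfolding drinfeld3_def dist_eq_A_def prod_zw_def prod_wz_def series_mult_def
proof (intro allI)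
  fix i j lam and m n :: int
  let ?A = "{k::nat. int k \<le> m}" and ?g = "fps_nth (d3_series c (a i j)) :: nat \<Rightarrow> 'k poly fract"
  let ?w = "delta_wt (- (m + n) * int c) :: 'i weight"
  have w: "hop_wt (cur_psi c h s i m') + hop_wt (cur_psi c h s' j n') = ?w" if "m' + n' = m + n" for i j s s' m' n'
    unfolding that [symmetric] by (simp add: cur_wt delta_wt_add algebra_simps)
  have pa: "(- q) powi m * (- q) powi n = (- q) powi (m + n)" for m n
    by (rule power_int_add [symmetric]) (simp add: qq_nonzero)
  have pow: "(- q) powi m' * (- q) powi n' = (- q) powi (m + n)" "(- q) powi n' * (- q) powi m' = (- q) powi (m + n)"
    if "m' + n' = m + n" for m' n'
    using that by (simp_all add: pa add.commute)
  have "\<phi> i (- m) * \<psi> j (- n) = (\<Sum>k\<in>?A. ?g k *s (\<psi> j (- n - int k) * \<phi> i (int k - m)))"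
  \<comment> \<open>Outside this range both sides vanish, because \<open>\<psi>\<close> has no
    negative and \<open>\<phi>\<close> no positive modes. Inside it the vanishing of
    \<open>\<psi>\<close> cuts the sum off at k = - n.\<close>
  proof (cases "m \<ge> 0 \<and> n \<le> 0")
    case True
    define m' n' where "m' = nat m" and "n' = nat (- n)"
    have mn: "m = int m'" "n = - int n'" using True by (auto simp: m'_def n'_def)
    have "?A = {0..m'}" by (auto simp: mn)
    hence "(\<Sum>k\<in>?A. ?g k *s (\<psi> j (- n - int k) * \<phi> i (int k - m))) =
        (\<Sum>k\<in>{0..m'}. ?g k *s (\<psi> j (int n' - int k) * \<phi> i (int k - int m')))"
      by (simp add: mn)
    also have "\<dots> = (\<Sum>k\<in>{0..min m' n'}. ?g k *s (\<psi> j (int (n' - k)) * \<phi> i (- int (m' - k))))"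
      by (rule sum.mono_neutral_cong_right) (auto simp: L.\<psi>_neg of_nat_diff)
    finally show ?thesis using \<phi>_\<psi>_exch [of i m' j n'] by (simp add: mn)
  next
    case False
    hence "\<phi> i (- m) * \<psi> j (- n) = 0" by (auto simp: L.\<psi>_neg L.\<phi>_pos)
    moreover have "(\<Sum>k\<in>?A. ?g k *s (\<psi> j (- n - int k) * \<phi> i (int k - m))) = 0"
      using False by (intro sum.neutral) (auto simp: L.\<psi>_neg)
    ultimately show ?thesis by simp
  qed
  hence main: "(- q) powi (m + n) *s (\<phi> i (- m) * \<psi> j (- n)) =
      (\<Sum>k\<in>?A. ?g k *s (- q) powi (m + n) *s (\<psi> j (- n - int k) * \<phi> i (int k - m)))"
    by (simp add: wop.scl_sum_right mult.commute)
  have psi: "act S (cur_psi c h 1 j n) = (- q) powi n *s \<psi> j (- n)"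
    "act S (cur_psi c h (- 1) j n) = (- q) powi n *s \<phi> j (- n)" for j n
    by (simp_all add: act_cur_psi pps_def)
  show "eq_A adj c ((cur_psi c h (- 1) i m \<odot> cur_psi c h 1 j n)\<one>\<^bsub>lam\<^esub>)
     (\<Sum>k\<in>?A. ?g k *\<^sub>q (cur_psi c h 1 j (n + int k) \<odot> cur_psi c h (- 1) i (m - int k))\<one>\<^bsub>lam\<^esub>)"
  proof (rule eq_A_act [where w = ?w], unfold act_sum act_smul)
    have 1: "act S (Hop ?w (hop_at (cur_psi c h (- 1) i m \<odot> cur_psi c h 1 j n))) =
        (- q) powi (m + n) *s (\<phi> i (- m) * \<psi> j (- n))"
      by (subst act_Hop) (simp_all only: hop_wt_simps w act_mult psi wop.scl_mult_left wop.scl_mult_right wop.scl_scl pow)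
    have 2: "act S (Hop ?w (hop_at (cur_psi c h 1 j (n + int k) \<odot> cur_psi c h (- 1) i (m - int k)))) =
        (- q) powi (m + n) *s (\<psi> j (- n - int k) * \<phi> i (int k - m))" for k
    proof -
      have "m - int k + (n + int k) = m + n" "n + int k + (m - int k) = m + n" by simp_all
      note 3 = w [OF this(2)] pow [OF this(1)] pow [OF this(2)]
      have neg: "- (m - int k) = int k - m" "- (n + int k) = - n - int k" by simp_all
      show ?thesis
        by (subst act_Hop, simp only: hop_wt_simps 3)
          (simp only: act_mult psi wop.scl_mult_left wop.scl_mult_right wop.scl_scl 3 neg)
    qed
    show "act S (Hop ?w (hop_at (cur_psi c h (- 1) i m \<odot> cur_psi c h 1 j n))) =
       (\<Sum>k\<in>?A. ?g k *s act S (Hop ?w (hop_at (cur_psi c h 1 j (n + int k) \<odot> cur_psi c h (- 1) i (m - int k)))))"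
      unfolding 1 2 by (rule main)
  qed
qed

section \<open>The quantum Serre relations (D8)\<close>

lemma qbinom_small:
  "qbinom (Suc 0) 0 = (1 :: 'k poly fract)" "qbinom (Suc 0) (Suc 0) = (1 :: 'k poly fract)"
  "qbinom 2 0 = (1 :: 'k poly fract)" "qbinom 2 (Suc 0) = (q + inverse q)" "qbinom 2 2 = (1 :: 'k poly fract)"
proof -
  have "qint 2 \<noteq> (0 :: 'k poly fract)" using qint_nonzero [of 2, where 'k = 'k] by simp
  moreover have "{1..2 :: nat} = {1, 2}" by auto
  ultimately show "qbinom (Suc 0) 0 = (1 :: 'k poly fract)" "qbinom (Suc 0) (Suc 0) = (1 :: 'k poly fract)"
    "qbinom 2 0 = (1 :: 'k poly fract)" "qbinom 2 (Suc 0) = (q + inverse q)" "qbinom 2 2 = (1 :: 'k poly fract)"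
    by (simp_all add: qbinom_def qfact_def qint_2 numeral_2_eq_2 [symmetric])
qed

lemma drinfeld8: "drinfeld8 adj c h"
  unfolding drinfeld8_def
proof (intro allI ballI impI)
  fix i j lam \<epsilon> u N and k :: "nat \<Rightarrow> int"
  assume \<epsilon>: "\<epsilon> \<in> {1, - 1 :: int}" and N: "a i j \<le> 0 \<and> N = nat (1 - a i j)"
  let ?x = "\<lambda>i n. cur_x adj c \<epsilon> i n :: ('i, 'k) hop"
  define T where "T = (if \<epsilon> = 1 then E else F)"
  have T: "act S (?x i n) = t powi n *s T i (- n)" for i n
    using \<epsilon> by (auto simp: T_def act_cur_x)
  have wt: "hop_wt (?x i n) = wt_scale \<epsilon> (simple_root adj i) + delta_wt (- n * int c)" for i n
    using \<epsilon> by (auto simp: cur_wt wt_scale_def simple_root_def zero_prod_def fun_eq_iff)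
  let ?L = "\<lambda>\<sigma> s. map (\<lambda>l. ?x i (k (\<sigma> l))) [1..<s + 1] @ [?x j u] @ map (\<lambda>l. ?x i (k (\<sigma> l))) [s + 1..<N + 1]"
  let ?w = "(\<Sum>l=1..N. hop_wt (?x i (k l))) + hop_wt (?x j u)"
  have w: "hop_wt (hop_prod (?L \<sigma> s)) = ?w" if "\<sigma> permutes {1..N}" "s \<le> N" for \<sigma> s
  proof -
    have "[1..<N + 1] = [1..<s + 1] @ [s + 1..<N + 1]"
      using that(2) by (metis Suc_eq_plus1 le_add2 add_le_mono1 upt_add_eq_append le_Suc_ex add.assoc add.commute)
    hence "(\<Sum>l\<leftarrow>[1..<s + 1]. hop_wt (?x i (k (\<sigma> l)))) + (\<Sum>l\<leftarrow>[s + 1..<N + 1]. hop_wt (?x i (k (\<sigma> l)))) =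
        (\<Sum>l\<leftarrow>[1..<N + 1]. hop_wt (?x i (k (\<sigma> l))))"
      by simp
    also have "\<dots> = (\<Sum>l=1..N. hop_wt (?x i (k (\<sigma> l))))"
      by (subst interv_sum_list_conv_sum_set_nat) (rule sum.cong, auto)
    also have "\<dots> = (\<Sum>l=1..N. hop_wt (?x i (k l)))"
      using that(1) by (rule sum.permute [symmetric, unfolded comp_def])
    finally show ?thesis
      unfolding hop_prod_act(2) by (simp add: comp_def add_ac)
  qed
  have L: "act S (Hop ?w (hop_at (hop_prod (?L \<sigma> s)))) = prod_list (map (act S) (?L \<sigma> s))"
    if "\<sigma> permutes {1..N}" "s \<le> N" for \<sigma> s
    unfolding act_Hop [OF w [OF that]] by (rule hop_prod_act(1)) simp
  have "act S (Hop ?w (\<lambda>lam. \<Sum>\<sigma>\<in>{\<sigma>. \<sigma> permutes {1..N}}. \<Sum>s=0..N.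
        ((- 1) ^ s * qbinom N s) *\<^sub>q (hop_prod (?L \<sigma> s))\<one>\<^bsub>lam\<^esub>)) =
      (\<Sum>\<sigma>\<in>{\<sigma>. \<sigma> permutes {1..N}}. \<Sum>s=0..N. ((- 1) ^ s * qbinom N s) *s prod_list (map (act S) (?L \<sigma> s)))"
    unfolding act_sum act_smul by (intro sum.cong refl) (simp only: L mem_Collect_eq atLeastAtMost_iff)
  also have "\<dots> = 0"
  proof (cases "a i j = 0")
    case True
    hence N1: "N = Suc 0" using N by simp
    have perms: "{\<sigma>. \<sigma> permutes {Suc 0..Suc 0}} = {id}" by auto
    have "T i m * T j n = T j n * T i m" for m n
      using T_T_0_rel [OF True] by (simp add: T_def)
    thus ?thesis by (simp add: N1 perms qbinom_small T mult.commute)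
  next
    case False
    hence ij: "a i j = - 1" and N2: "N = 2" using N by (auto simp: cartan_def split: if_splits)
    have perms: "{\<sigma>. \<sigma> permutes {1..2::nat}} = {id, transpose 1 2}"
      using permutes_doubleton_iff [of _ 1 "2 :: nat"] by (auto simp: atLeastAtMost_insertL [symmetric] numeral_2_eq_2)
    have neq: "id \<noteq> transpose 1 (2 :: nat)" by (metis id_apply transpose_apply_first numeral_eq_one_iff semiring_norm(85))
    have "(T j n * T i m * T i l + T j n * T i l * T i m) -
        (q + inverse q) *s (T i m * T j n * T i l + T i l * T j n * T i m) +
        (T i m * T i l * T j n + T i l * T i m * T j n) = 0" for m n l
      using L.SE_eq_0 [OF ij, of m l n] L.SF_eq_0 [OF ij, of n m l] by (simp add: T_def L.SE_def)
    note rel' = this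
    define b where "b = q + inverse q"
    note rel = rel' [folded b_def] and binom = qbinom_small [folded b_def]
    have upts: "[1..<0 + 1] = []" "[0 + 1..<2 + 1] = [1, 2]" "[1..<1 + 1] = [1]" "[1 + 1..<2 + 1] = [2]"
      "[1..<2 + 1] = [1, 2]" "[2 + 1..<2 + 1 :: nat] = []"
      by (simp_all add: upt_rec)
    have sum2: "(\<Sum>s=0..2. f s) = f 0 + f 1 + f 2" for f :: "nat \<Rightarrow> ('i, 'k) wop"
      by (simp add: numeral_2_eq_2)
    \<comment> \<open>The contribution of one ordering of the two modes of the i-current. The two
      permutations give both orderings, and their sum is the polarised Serre relation.\<close>
    define G where "G m n = (t powi m * t powi n * t powi u) *s (T j (- u) * T i (- m) * T i (- n) -
      b *s (T i (- m) * T j (- u) * T i (- n)) + T i (- m) * T i (- n) * T j (- u))" for m n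
    have "(\<Sum>s=0..N. ((- 1) ^ s * qbinom N s) *s prod_list (map (act S) (?L \<sigma> s))) = G (k (\<sigma> 1)) (k (\<sigma> 2))" for \<sigma>
      unfolding N2 sum2 upts
      by (simp add: binom T G_def mult.assoc wop.scl_distribs mult_ac)
    note inner = this
    have comm: "t powi k 2 * t powi k 1 = t powi k 1 * t powi k 2" by (rule mult.commute)
    have "(\<Sum>\<sigma>\<in>{\<sigma>. \<sigma> permutes {1..N}}. \<Sum>s=0..N. ((- 1) ^ s * qbinom N s) *s prod_list (map (act S) (?L \<sigma> s))) =
        G (k 1) (k 2) + G (k 2) (k 1)"
      unfolding inner unfolding N2 perms using neq by simp
    also have "\<dots> = (t powi k 1 * t powi k 2 * t powi u) *s
        ((T j (- u) * T i (- k 1) * T i (- k 2) + T j (- u) * T i (- k 2) * T i (- k 1)) -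
        b *s (T i (- k 1) * T j (- u) * T i (- k 2) + T i (- k 2) * T j (- u) * T i (- k 1)) +
        (T i (- k 1) * T i (- k 2) * T j (- u) + T i (- k 2) * T i (- k 1) * T j (- u)))"
      unfolding G_def comm by (rule wop.scl_sum_three)
    also have "\<dots> = 0" unfolding rel by (rule wop.scl_zero_right)
    finally show ?thesis .
  qed
  finally have "act S (Hop ?w (\<lambda>lam. \<Sum>\<sigma>\<in>{\<sigma>. \<sigma> permutes {1..N}}. \<Sum>s=0..N.
        ((- 1) ^ s * qbinom N s) *\<^sub>q (hop_prod (?L \<sigma> s))\<one>\<^bsub>lam\<^esub>)) = act S (Hop ?w (\<lambda>lam. 0))"
    by (simp only: act_zero)
  thus "eq_A adj c (\<Sum>\<sigma>\<in>{\<sigma>. \<sigma> permutes {1..N}}. \<Sum>s=0..N.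
        ((- 1) ^ s * qbinom N s) *\<^sub>q (hop_prod (?L \<sigma> s))\<one>\<^bsub>lam\<^esub>) (0 :: ('i, 'k) free_alg)"
    by (rule eq_A_act)
qed

end

theorem theorem2p1:
  fixes adj :: "'i::finite \<Rightarrow> 'i \<Rightarrow> bool" and c :: nat
  assumes "simply_laced_finite_type adj" and "c > 0"
  shows
    "(\<forall>h :: ('i, 'k::field_char_0) hfam. is_drinfeld_h adj c h \<longrightarrow>
        drinfeld1 adj c h \<and> drinfeld2 adj c h \<and> drinfeld3 adj c h \<and> drinfeld4 adj c h \<and>
        drinfeld5 adj c h \<and> drinfeld6 adj c h \<and> drinfeld7 adj c h \<and> drinfeld8 adj c h) \<and>
     (\<forall>(scale :: 'k poly fract \<Rightarrow> 'v::ab_group_add \<Rightarrow> 'v) V \<rho>.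
        weight_representation scale V \<rho> \<and> integrable adj V \<and>
        rels_hold_on scale \<rho> (rels0_5 adj c) \<longrightarrow>
        rels_hold_on scale \<rho> (rel6 adj c))"
proof (intro conjI allI impI)
  fix h :: "('i, 'k) hfam"
  assume "is_drinfeld_h adj c h"
  then interpret drinfeld_generators adj c "rels0_5 adj c \<union> rel6 adj c" h
    by unfold_locales (use assms in simp_all)
  show "drinfeld1 adj c h" "drinfeld2 adj c h" "drinfeld3 adj c h" "drinfeld4 adj c h"
    "drinfeld5 adj c h" "drinfeld6 adj c h" "drinfeld7 adj c h" "drinfeld8 adj c h"
    by (fact drinfeld1 drinfeld2 drinfeld3 drinfeld4 drinfeld5 drinfeld6 drinfeld7 drinfeld8)+
next
  fix scale :: "'k poly fract \<Rightarrow> 'v \<Rightarrow> 'v" and V \<rho>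
  assume "weight_representation scale V \<rho> \<and> integrable adj V \<and> rels_hold_on scale \<rho> (rels0_5 adj c)"
  thus "rels_hold_on scale \<rho> (rel6 adj c)"
    using integrable_rel6 [OF assms(1)] by blast
qed

end
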